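(* There is an absolute constant $C'_0>0$ (independent of $a$) such that the following holds for every $C'\geq C'_0$ and every $0<a<\tfrac12$. For $m\geq 1$ let $C(m)=\lceil C'\sqrt{m\log m}\,\rceil$ and $n=m+C(m)$, and let $\Phi=\Phi^{(m)}$ be the directed spatial permutation on $\mathbb{T}_{n,m}$ with parameter $a$. Then, as $m\to\infty$, the distribution of the cycle structure $\mathcal{X}(\Phi^{(m)})$ converges weakly to the Poisson--Dirichlet distribution $\mathsf{PD}(1)$.
   Context: Torus: $\mathbb{T}_{n,m}=(\mathbb{Z}/n\mathbb{Z})\times(\mathbb{Z}/m\mathbb{Z})$, with vertices $\boldsymbol{x}=(x_1,x_2)$; expressions in the first (second) coordinate are interpreted modulo $n$ (modulo $m$). Directed spatial permutation with parameter $a\in(0,\frac12)$: let $(\tilde\phi_{\boldsymbol{x}})_{\boldsymbol{x}\in\mathbb{T}_{n,m}}$ be IID with values in $\{-1,0,1\}$ and $\mathbb{P}[\tilde\phi_{\boldsymbol{x}}=1]=\mathbb{P}[\tilde\phi_{\boldsymbol{x}}=-1]=a$, $\mathbb{P}[\tilde\phi_{\boldsymbol{x}}=0]=1-2a$. Define $\tilde\Phi:\mathbb{T}_{n,m}\to\mathbb{T}_{n,m}$ by $\tilde\Phi(\boldsymbol{x})=(x_1+1,\,x_2+\tilde\phi_{\boldsymbol{x}}+1)$. Then $\Phi$ is the random bijection whose law is that of $\tilde\Phi$ conditioned on the event that $\tilde\Phi$ is a bijection. Cycle structure: for a bijection $\pi$ of a set of $N$ elements (here $N=nm$), $\mathcal{X}(\pi)=(L_1,L_2,\dots)$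 is the non-increasing list of the normalized cycle lengths $|\mathsf{C}|/N$, where $\mathsf{C}$ runs over the cycles (orbits) of $\pi$ and $|\mathsf{C}|$ is the number of elements of $\mathsf{C}$; if $\pi$ has exactly $k$ cycles then $L_j=0$ for $j>k$. $\mathsf{PD}(1)$: let $\Delta=\{(y_i)_{i\geq1}: y_i\geq0,\ \sum_i y_i=1,\ y_1\geq y_2\geq\cdots\}$. Let $(U_i)_{i\geq 1}$ be IID uniform on $[0,1]$, $x_1=U_1$ and $x_i=U_i(1-\sum_{j=1}^{i-1}x_j)$ for $i\ge2$. $\mathsf{PD}(1)$ is the law on $\Delta$ of the sequence obtained by rearranging $(x_i)_{i\geq1}$ in non-increasing order. Weak convergence is of probability measures on $\Delta$, with the topology induced by the sup norm (equivalently, coordinatewise convergence). *)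

theory Defs
  imports
    "HOL-Probability.Probability"
    "HOL-Combinatorics.Orbits"
begin

section \<open>Directed spatial permutations of the torus\<close>

text \<open>
  The torus is represented by the canonical residues, and maps of the torus to itself are
  extended by the identity to all integer pairs, so that a map is a bijection of the torus
  if and only if it permutes it in the sense of \<^const>\<open>permutes\<close>.
\<close>

definition torus :: "nat \<Rightarrow> nat \<Rightarrow> (int \<times> int) set" where
  "torus n m = {0..<int n} \<times> {0..<int m}"

definition step_pmf :: "real \<Rightarrow> int pmf" where
  "step_pmf a = pmf_of_list [(-1, a), (0, 1 - 2 * a), (1, a)]"

definition shift_map :: "nat \<Rightarrow> nat \<Rightarrow> (int \<times> int \<Rightarrow> int) \<Rightarrow> int \<times> int \<Rightarrow> int \<times> int" where
  "shift_map n m \<phi> x =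
     (if x \<in> torus n m
      then ((fst x + 1) mod int n, (snd x + \<phi> x + 1) mod int m)
      else x)"

definition random_map_pmf :: "real \<Rightarrow> nat \<Rightarrow> nat \<Rightarrow> (int \<times> int \<Rightarrow> int \<times> int) pmf" where
  "random_map_pmf a n m = map_pmf (shift_map n m) (Pi_pmf (torus n m) 0 (\<lambda>_. step_pmf a))"

definition directed_permutation_pmf :: "real \<Rightarrow> nat \<Rightarrow> nat \<Rightarrow> (int \<times> int \<Rightarrow> int \<times> int) pmf" where
  "directed_permutation_pmf a n m =
     cond_pmf (random_map_pmf a n m) {\<pi>. bij_betw \<pi> (torus n m) (torus n m)}"

lemma finite_torus [simp]: "finite (torus n m)"
  by (simp add: torus_def)

lemma pmf_step_pmf:
  assumes "0 < a" "a < 1/2"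
  shows "pmf (step_pmf a) 1 = a" "pmf (step_pmf a) (-1) = a" "pmf (step_pmf a) 0 = 1 - 2 * a"
proof -
  have "pmf_of_list_wf [(-1 :: int, a), (0, 1 - 2 * a), (1, a)]"
    using assms by (intro pmf_of_list_wfI) auto
  then show "pmf (step_pmf a) 1 = a" "pmf (step_pmf a) (-1) = a"
            "pmf (step_pmf a) 0 = 1 - 2 * a"
    by (simp_all add: step_pmf_def pmf_pmf_of_list)
qed

text \<open>The conditioning event has positive probability, as \<^const>\<open>cond_pmf\<close> requires.\<close>

lemma bijection_possible:
  assumes "0 < a" "a < 1/2"
  shows "set_pmf (random_map_pmf a n m) \<inter> {\<pi>. bij_betw \<pi> (torus n m) (torus n m)} \<noteq> {}"
proof -
  let ?\<pi> = "shift_map n m (\<lambda>_. 0)"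
  have "pmf (Pi_pmf (torus n m) 0 (\<lambda>_. step_pmf a)) (\<lambda>_. 0) > 0"
    using assms by (subst pmf_Pi') (auto intro!: prod_pos simp: pmf_step_pmf)
  then have "(\<lambda>_. 0) \<in> set_pmf (Pi_pmf (torus n m) 0 (\<lambda>_. step_pmf a))"
    by (simp add: set_pmf_iff)
  then have "?\<pi> \<in> set_pmf (random_map_pmf a n m)"
    by (auto simp: random_map_pmf_def)
  moreover have "bij_betw ?\<pi> (torus n m) (torus n m)"
  proof (rule bij_betwI[where g = "\<lambda>y. ((fst y - 1) mod int n, (snd y - 1) mod int m)"])
    show "?\<pi> \<in> torus n m \<rightarrow> torus n m"
      by (auto simp: shift_map_def torus_def)
    show "(\<lambda>y. ((fst y - 1) mod int n, (snd y - 1) mod int m)) \<in> torus n m \<rightarrow> torus n m"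
      by (auto simp: torus_def)
  qed (auto simp: shift_map_def torus_def mod_simps)
  ultimately show ?thesis by blast
qed


section \<open>Cycle structure\<close>

text \<open>
  For a permutation of a finite set, \<^term>\<open>orbit \<pi> x\<close> contains \<^term>\<open>x\<close>. The cycles form a set, but
  their lengths are collected in a multiset because different cycles may have equal length.
\<close>

definition cycle_structure :: "'a set \<Rightarrow> ('a \<Rightarrow> 'a) \<Rightarrow> nat \<Rightarrow> real" where
  "cycle_structure S \<pi> =
     (let ls = rev (sorted_list_of_multiset
                 (image_mset (\<lambda>C. real (card C) / real (card S)) (mset_set (orbit \<pi> ` S))))
      in (\<lambda>j. if j < length ls then ls ! j else 0))"


section \<open>The space of mass partitions and weak convergence\<close>

definition Delta :: "(nat \<Rightarrow> real) set" where
  "Delta = {y. (\<forall>i. 0 \<le> y i) \<and> y sums 1 \<and> decseq y}"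

lemma cycle_structure_in_Delta:
  assumes S: "finite S" "S \<noteq> {}" and \<pi>: "bij_betw \<pi> S S" "\<And>x. x \<notin> S \<Longrightarrow> \<pi> x = x"
  shows "cycle_structure S \<pi> \<in> Delta"
proof -
  have perm: "\<pi> permutes S" using \<pi> by (simp add: bij_imp_permutes)
  then have permn: "permutation \<pi>" using S(1) by (auto simp: permutation_permutes)
  define A where "A = image_mset (\<lambda>C. real (card C) / real (card S)) (mset_set (orbit \<pi> ` S))"
  define ls where "ls = rev (sorted_list_of_multiset A)"
  have cs: "cycle_structure S \<pi> = (\<lambda>j. if j < length ls then ls ! j else 0)"
    by (simp only: cycle_structure_def ls_def A_def Let_def)
  have ls_nonneg: "0 \<le> ls ! j" if "j < length ls" for j
  proof -
    have "ls ! j \<in> set ls" using that by simp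
    then show ?thesis by (auto simp: ls_def A_def S(1))
  qed
  have self: "x \<in> orbit \<pi> x" for x by (rule permutation_self_in_orbit[OF permn])
  have sub: "orbit \<pi> x \<subseteq> S" if "x \<in> S" for x
    using permutes_orbit_subset[OF perm that] .
  have un: "\<Union> (orbit \<pi> ` S) = S" using self sub by blast
  have dis: "C \<inter> D = {}" if "C \<in> orbit \<pi> ` S" "D \<in> orbit \<pi> ` S" "C \<noteq> D" for C D
  proof (rule ccontr)
    assume "C \<inter> D \<noteq> {}"
    then obtain z where "z \<in> C" "z \<in> D" by blast
    then have "C = orbit \<pi> z" "D = orbit \<pi> z"
      using that(1,2) by (auto dest: orbit_cyclic_eq3[OF cyclic_on_orbit'[OF permn]])
    with that(3) show False by simp
  qed
  have "card (\<Union> (orbit \<pi> ` S)) = sum card (orbit \<pi> ` S)"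
    using dis sub S(1) by (intro card_Union_disjoint)
      (auto simp: pairwise_def disjnt_def intro: finite_subset[OF sub])
  then have cards: "(\<Sum>C\<in>orbit \<pi> ` S. real (card C)) = real (card S)"
    by (simp add: un flip: of_nat_sum)
  have "sum_list ls = sum_mset A"
    by (simp add: ls_def flip: sum_mset_sum_list)
  also have "\<dots> = (\<Sum>C\<in>orbit \<pi> ` S. real (card C) / real (card S))"
    by (simp add: A_def sum_unfold_sum_mset)
  also have "\<dots> = 1"
    using S cards by (simp flip: sum_divide_distrib)
  finally have total: "sum_list ls = 1" .
  have "(\<lambda>j. if j < length ls then ls ! j else 0) sums
          (\<Sum>j<length ls. if j < length ls then ls ! j else 0)"
    by (rule sums_finite) auto
  also have "(\<Sum>j<length ls. if j < length ls then ls ! j else 0) = (\<Sum>j<length ls. ls ! j)"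
    by (rule sum.cong) auto
  also have "\<dots> = 1" using total by (simp add: sum_list_sum_nth atLeast0LessThan)
  finally have "cycle_structure S \<pi> sums 1" by (simp add: cs)
  moreover have "decseq (cycle_structure S \<pi>)"
  proof -
    have "sorted_wrt (\<ge>) ls"
      by (simp add: ls_def sorted_wrt_rev)
    then have "ls ! j \<le> ls ! i" if "i < j" "j < length ls" for i j
      using that by (auto simp: sorted_wrt_iff_nth_less)
    then have "cycle_structure S \<pi> j \<le> cycle_structure S \<pi> i" if "i \<le> j" for i j
      using that ls_nonneg by (cases "i = j") (auto simp: cs)
    then show ?thesis by (simp add: decseq_def)
  qed
  ultimately show ?thesis using ls_nonneg by (auto simp: Delta_def cs)
qed

text \<open>
  The library topology on \<^typ>\<open>nat \<Rightarrow> real\<close> is that of coordinatewise convergence. On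
  \<^term>\<open>Delta\<close> it coincides with the topology of the sup norm.
\<close>

lemma Delta_le:
  assumes "y \<in> Delta"
  shows "y i \<le> 1 / (real i + 1)"
proof -
  have y: "\<And>i. 0 \<le> y i" "y sums 1" "decseq y" using assms by (auto simp: Delta_def)
  have "(real i + 1) * y i = (\<Sum>j<Suc i. y i)" by simp
  also have "\<dots> \<le> (\<Sum>j<Suc i. y j)"
    using y(3) by (intro sum_mono) (auto simp: decseq_def)
  also have "\<dots> \<le> suminf y"
    using y by (intro sum_le_suminf) (auto simp: sums_iff)
  also have "\<dots> = 1" using y(2) by (simp add: sums_iff)
  finally show ?thesis by (simp add: field_simps)
qed

lemma Delta_diff_le:
  assumes "x \<in> Delta" "y \<in> Delta"
  shows "\<bar>x i - y i\<bar> \<le> 1 / (real i + 1)"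
  using Delta_le[OF assms(1), of i] Delta_le[OF assms(2), of i] assms
  by (auto simp: Delta_def abs_le_iff) (smt (verit))+

lemma bdd_above_Delta_diff:
  assumes "x \<in> Delta" "y \<in> Delta"
  shows "bdd_above (range (\<lambda>i. \<bar>x i - y i\<bar>))"
proof (rule bdd_aboveI2)
  fix i
  have "1 / (real i + 1) \<le> 1" by simp
  then show "\<bar>x i - y i\<bar> \<le> 1" using Delta_diff_le[OF assms, of i] by linarith
qed

lemma openin_Delta_iff_sup_norm:
  "openin (top_of_set Delta) U \<longleftrightarrow>
     U \<subseteq> Delta \<and> (\<forall>x\<in>U. \<exists>r>0. \<forall>y\<in>Delta. (SUP i. \<bar>x i - y i\<bar>) < r \<longrightarrow> y \<in> U)"
proof
  assume U: "openin (top_of_set Delta) U"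
  then obtain T where T: "open T" "U = Delta \<inter> T"
    by (auto simp: openin_open)
  show "U \<subseteq> Delta \<and> (\<forall>x\<in>U. \<exists>r>0. \<forall>y\<in>Delta. (SUP i. \<bar>x i - y i\<bar>) < r \<longrightarrow> y \<in> U)"
  proof (intro conjI ballI)
    show "U \<subseteq> Delta" using T by auto
    fix x assume x: "x \<in> U"
    with T obtain e where e: "e > 0" "\<And>y. dist y x < e \<Longrightarrow> y \<in> T"
      by (auto simp: open_dist)
    show "\<exists>r>0. \<forall>y\<in>Delta. (SUP i. \<bar>x i - y i\<bar>) < r \<longrightarrow> y \<in> U"
    proof (intro exI[of _ "e/4"] conjI ballI impI)
      show "e/4 > 0" using e by simp
      fix y assume y: "y \<in> Delta" and lt: "(SUP i. \<bar>x i - y i\<bar>) < e/4"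
      have xD: "x \<in> Delta" using x T by auto
      have co: "dist (y i) (x i) \<le> e/4" for i
      proof -
        have "\<bar>x i - y i\<bar> \<le> (SUP i. \<bar>x i - y i\<bar>)"
          by (intro cSUP_upper bdd_above_Delta_diff xD y) auto
        then show ?thesis using lt by (simp add: dist_real_def abs_minus_commute)
      qed
      obtain N :: nat where N: "(1/2::real) ^ N < e/4"
        using real_arch_pow_inv[of "e/4" "1/2"] e by auto
      have "Max {dist (y (from_nat n)) (x (from_nat n)) |n. n \<le> N} \<le> e/4"
        using co by (subst Max_le_iff) auto
      with dist_fun_le_dist_first_terms[of y x N] N e
      have "dist y x < e" by linarith
      then show "y \<in> U" using e T y by auto
    qed
  qed
next
  assume U: "U \<subseteq> Delta \<and>
    (\<forall>x\<in>U. \<exists>r>0. \<forall>y\<in>Delta. (SUP i. \<bar>x i - y i\<bar>) < r \<longrightarrow> y \<in> U)"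
  show "openin (top_of_set Delta) U"
  proof (subst openin_subopen, intro ballI)
    fix x assume x: "x \<in> U"
    then have xD: "x \<in> Delta" using U by auto
    from x U obtain r where r: "r > 0"
      "\<And>y. y \<in> Delta \<Longrightarrow> (SUP i. \<bar>x i - y i\<bar>) < r \<Longrightarrow> y \<in> U" by blast
    obtain N :: nat where N: "2 / r < real N" using reals_Archimedean2 by blast
    define V where "V = (\<Inter>i\<in>{..<N}. {y :: nat \<Rightarrow> real. \<bar>x i - y i\<bar> < r/2})"
    have "open V"
      unfolding V_def
      by (intro open_INT open_Collect_less continuous_intros ballI finite_lessThan) auto
    moreover have "Delta \<inter> V \<subseteq> U"
    proof
      fix y assume y: "y \<in> Delta \<inter> V"
      have "\<bar>x i - y i\<bar> \<le> r/2" for i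
      proof (cases "i < N")
        case True
        then show ?thesis using y by (auto simp: V_def less_imp_le)
      next
        case False
        then have "2 / r < real i + 1" using N by linarith
        then have "1 / (real i + 1) \<le> r/2" using r(1) by (simp add: field_simps)
        then show ?thesis using Delta_diff_le[of x y i] xD y by auto
      qed
      then have "(SUP i. \<bar>x i - y i\<bar>) \<le> r/2" by (intro cSUP_least) auto
      then have "(SUP i. \<bar>x i - y i\<bar>) < r" using r(1) by linarith
      then show "y \<in> U" using r(2) y by blast
    qed
    moreover have "x \<in> V" using r(1) by (simp add: V_def)
    ultimately show "\<exists>T. openin (top_of_set Delta) T \<and> x \<in> T \<and> T \<subseteq> U"
      using xD by (intro exI[of _ "Delta \<inter> V"]) (auto simp: openin_open)
  qed
qed

text \<open>
  Weak convergence of measures on \<^term>\<open>restrict_space borel S\<close>, tested against the bounded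
  functions that are continuous on the subspace \<^term>\<open>S\<close>.
\<close>

definition weak_conv_on ::
  "'a::topological_space set \<Rightarrow> (nat \<Rightarrow> 'a measure) \<Rightarrow> 'a measure \<Rightarrow> bool" where
  "weak_conv_on S M N \<longleftrightarrow>
     (\<forall>f :: 'a \<Rightarrow> real. continuous_on S f \<and> bounded (f ` S) \<longrightarrow>
        (\<lambda>k. integral\<^sup>L (M k) f) \<longlonglongrightarrow> integral\<^sup>L N f)"


section \<open>The Poisson--Dirichlet distribution\<close>

fun stick_breaking :: "(nat \<Rightarrow> real) \<Rightarrow> nat \<Rightarrow> real" where
  "stick_breaking u i = u i * (1 - (\<Sum>j<i. stick_breaking u j))"

declare stick_breaking.simps [simp del]

text \<open>
  A non-increasing rearrangement of an infinite sequence is unique if it exists. It exists for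
  almost every stick-breaking sequence, since all of its entries are then positive and sum to 1.
\<close>

definition decreasing_rearrangement :: "(nat \<Rightarrow> real) \<Rightarrow> nat \<Rightarrow> real" where
  "decreasing_rearrangement x = (THE y. decseq y \<and> (\<exists>\<sigma>. bij \<sigma> \<and> y = x \<circ> \<sigma>))"

definition PD1 :: "(nat \<Rightarrow> real) measure" where
  "PD1 = distr (\<Pi>\<^sub>M i\<in>UNIV. uniform_measure lborel {0..1}) (restrict_space borel Delta)
           (\<lambda>u. decreasing_rearrangement (stick_breaking u))"


section \<open>The law of the cycle structure of a directed spatial permutation\<close>

text \<open>
  For \<^prop>\<open>0 < n\<close> and \<^prop>\<open>0 < m\<close> the cycle structure lies in \<^term>\<open>Delta\<close>; the degenerate
  case of the empty torus does not affect limits as \<^term>\<open>m\<close> tends to infinity.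
\<close>

definition cycle_structure_law :: "real \<Rightarrow> nat \<Rightarrow> nat \<Rightarrow> (nat \<Rightarrow> real) measure" where
  "cycle_structure_law a n m =
     distr (measure_pmf (directed_permutation_pmf a n m)) (restrict_space borel Delta)
       (cycle_structure (torus n m))"

definition excess :: "real \<Rightarrow> nat \<Rightarrow> nat" where
  "excess C' m = nat \<lceil>C' * sqrt (real m * ln (real m))\<rceil>"

end

theory Submission
	imports Defs "HOL-Real_Asymp.Real_Asymp"
begin

text \<open>Restricted to a column, a bijection of this form either rotates the whole column, which is negligible,
	or exchanges the targets of some disjoint pairs of neighbours. In the latter case it is encoded by the set
	\<open>D\<close> of the lower sites of these pairs, which has no two adjacent elements and gets weight \<open>z ^ card D\<close>
	with \<open>z = (a / (1 - 2 * a))^2\<close>.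
	Follow the trajectories of \<open>k\<close> uniform points until they return to one of these points. Two of them come
	close often before that, since each turn around the torus advances the second coordinate by the excess.
	Toggling an element of \<open>D\<close> where they are adjacent exchanges their futures and multiplies the weight by
	\<open>z\<close> or \<open>1 / z\<close>. So the permutation induced on the \<open>k\<close> points is asymptotically invariant under
	transpositions, hence uniform. Its cycle structure approximates the full one with error of order
	\<open>1 / sqrt k\<close>, and the cycle structure of a uniform permutation tends to \<open>PD1\<close> by discrete stick breaking.\<close>

text \<open>The sites of a column are dependent, so a walker that reads some of them reweights the
  others. Sites at distance \<open>r\<close> from those already read behave as independent of them
  up to the factor \<open>mixf z r\<close>, which tends to 1 exponentially in \<open>r\<close>; for
  \<open>r\<close> a power of \<open>m\<close> the product of these factors over a whole run stays
  bounded, and such one-sided estimates suffice to control the walkers by potentials. This requires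
  fresh sites at every step, and here the excess is used: displacements over one turn have Gaussian
  tails at scale \<open>sqrt n\<close>, so an excess of \<open>200 * sqrt (m * ln m)\<close>
  outweighs them for all starting points at once, and trajectories cannot come back close to
  themselves before about \<open>n * m / (2 * C)\<close> steps. The excess is also large against
  \<open>sqrt m\<close>; therefore a function that is nearly constant along trajectories has nearly
  the same mean over the torus as over a window in one column, which brings two uniform points
  within \<open>m powr (3/5)\<close> of each other. A single toggle leaves a bias
  \<open>abs ((1 - z) / (1 + z))\<close>, so one encounter has to offer many of them.\<close>

abbreviation ri :: "int => real" where "ri == real_of_int"
abbreviation swp :: "'a => 'a => 'a => 'a" where "swp == Transposition.transpose"

lemma card_torus: "card (torus n m) = n * m"
	by (simp add: torus_def)

section \<open>Hard-core configurations on a path\<close>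

definition Ind :: "nat set => nat set set" where
	"Ind A = {S. S <= A & (ALL i:S. Suc i ~: S)}"

text \<open>The partition function of the hard-core model with fugacity \<open>z\<close>. The set
  \<open>A\<close> need not be an interval, because fixing the configuration on a window cuts a path
  into two.\<close>

definition hc_sum :: "real => nat set => real" where
	"hc_sum z A = (SUM S:Ind A. z ^ card S)"

definition nbr :: "nat set => nat set" where
	"nbr T = Suc ` T \<union> {i. Suc i \<in> T}"

lemma finite_Ind [simp]: "finite A ==> finite (Ind A)"
	unfolding Ind_def by (rule finite_subset[of _ "Pow A"]) auto

lemma Ind_finite: "finite A ==> S \<in> Ind A ==> finite S"
	unfolding Ind_def using finite_subset by blast

text \<open>Spatial Markov property: given the trace \<open>T\<close> on \<open>M\<close>, the other
  elements form an arbitrary independent subset of what is left after \<open>M\<close> and the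
  neighbours of \<open>T\<close> are deleted.\<close>

lemma hc_sum_split:
	assumes "finite A" "T \<in> Ind A" "T <= M"
	shows "(SUM S | S \<in> Ind A & S \<inter> M = T. z ^ card S) = z ^ card T * hc_sum z (A - M - nbr T)"
proof -
	have fT: "finite T" using assms Ind_finite by blast
	have "(SUM S | S \<in> Ind A & S \<inter> M = T. z ^ card S) = (SUM S:Ind (A - M - nbr T). z ^ card T * z ^ card S)"
	proof (rule sum.reindex_bij_witness[where i="%R. R \<union> T" and j="%S. S - T"])
		fix S assume S: "S \<in> {S. S \<in> Ind A & S \<inter> M = T}"
		show "(S - T) \<union> T = S" using S by auto
		show "S - T \<in> Ind (A - M - nbr T)" using S assms by (auto simp: Ind_def nbr_def)
		have "finite S" using S assms Ind_finite by blast
		moreover have "T <= S" using S by auto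
		ultimately have "card S = card T + card (S - T)"
			using fT by (metis card_Diff_subset card_mono le_add_diff_inverse)
		thus "z ^ card T * z ^ card (S - T) = z ^ card S" by (simp add: power_add)
	next
		fix R assume R: "R \<in> Ind (A - M - nbr T)"
		show "(R \<union> T) - T = R" using R assms by (auto simp: Ind_def)
		show "R \<union> T \<in> {S. S \<in> Ind A & S \<inter> M = T}" using R assms
			by (auto simp: Ind_def nbr_def)
	qed
	thus ?thesis by (simp add: hc_sum_def sum_distrib_left)
qed

text \<open>The strict inequality leaves at least one site between the two sets, so no edge joins
  them and independent sets of the union are pairs of independent sets.\<close>

lemma hc_sum_union:
	assumes "finite A" "finite B" "!!i j. i \<in> A ==> j \<in> B ==> Suc i < j"
	shows "hc_sum z (A \<union> B) = hc_sum z A * hc_sum z B"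
proof -
	have dis: "A \<inter> B = {}" using assms(3) by fastforce
	have 1: "ALL i:A. ALL j:B. Suc i ~= j & Suc j ~= i" using assms(3) by fastforce
	have "hc_sum z A * hc_sum z B = (SUM (S,R):Ind A \<times> Ind B. z ^ card S * z ^ card R)"
		by (simp add: hc_sum_def sum_product sum.cartesian_product)
	also have "... = (SUM S:Ind (A \<union> B). z ^ card S)"
	proof (rule sum.reindex_bij_witness[where i="%S. (S \<inter> A, S \<inter> B)" and j="%(S,R). S \<union> R"])
		fix p assume "p \<in> Ind A \<times> Ind B"
		then obtain S R where p: "p = (S,R)" "S \<in> Ind A" "R \<in> Ind B" by auto
		hence sub: "S <= A" "R <= B" by (auto simp: Ind_def)
		show "(((case p of (S, R) => S \<union> R) \<inter> A), ((case p of (S, R) => S \<union> R) \<inter> B)) = p"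
			using p sub dis by auto
		show "(case p of (S, R) => S \<union> R) \<in> Ind (A \<union> B)"
			unfolding Ind_def
		proof (intro CollectI conjI ballI)
			show "(case p of (S, R) => S \<union> R) <= A \<union> B" using p(1) sub by auto
			fix i assume i: "i \<in> (case p of (S, R) => S \<union> R)"
			have "Suc i ~: S" using i p assms(3)[of "Suc i" i] sub by (auto simp: Ind_def subset_iff)
			moreover have "Suc i ~: R" using i p assms(3)[of i "Suc i"] sub by (auto simp: Ind_def subset_iff)
			ultimately show "Suc i ~: (case p of (S, R) => S \<union> R)" using p(1) by simp
		qed
		have "card (S \<union> R) = card S + card R"
			by (rule card_Un_disjoint) (use p sub dis assms finite_subset in "blast+")
		thus "z ^ card (case p of (S, R) => S \<union> R) = (case p of (S, R) => z ^ card S * z ^ card R)"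
			using p by (simp add: power_add)
	next
		fix S assume "S \<in> Ind (A \<union> B)"
		thus "(case (S \<inter> A, S \<inter> B) of (S, R) => S \<union> R) = S" "(S \<inter> A, S \<inter> B) \<in> Ind A \<times> Ind B"
			by (auto simp: Ind_def)
	qed
	finally show ?thesis by (simp add: hc_sum_def)
qed

lemma hc_sum_shift: "hc_sum z {p..<p + g} = hc_sum z {0..<g}"
proof -
	have bij: "bij_betw ((`) (%i. i + p)) (Ind {0..<g}) (Ind {p..<p + g})"
	proof (rule bij_betwI[where g="(`) (%i. i - p)"])
		show "(`) (%i. i + p) \<in> Ind {0..<g} \<rightarrow> Ind {p..<p + g}"
			by (auto simp: Ind_def image_iff subset_iff)
		show "(`) (%i. i - p) \<in> Ind {p..<p + g} \<rightarrow> Ind {0..<g}"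
		proof
			fix S assume S: "S \<in> Ind {p..<p + g}"
			have "x = Suc y" if "x \<in> S" "y \<in> S" "x - p = Suc (y - p)" for x y
				using that S by (auto simp: Ind_def subset_iff)
			thus "(%i. i - p) ` S \<in> Ind {0..<g}" using S
				unfolding Ind_def by fastforce
		qed
	next
		fix S assume "S \<in> Ind {0..<g}"
		thus "(%i. i - p) ` (%i. i + p) ` S = S" by (auto simp: image_image)
	next
		fix S assume S: "S \<in> Ind {p..<p + g}"
		have "(%i. i + p) ` (%i. i - p) ` S = (%i. i) ` S"
			unfolding image_image by (rule image_cong) (use S in "auto simp: Ind_def")
		thus "(%i. i + p) ` (%i. i - p) ` S = S" by simp
	qed
	have "(SUM S:Ind {0..<g}. z ^ card ((%i. i + p) ` S)) = (SUM S:Ind {p..<p + g}. z ^ card S)"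
		by (rule sum.reindex_bij_betw[OF bij])
	moreover have "card ((%i. i + p) ` S) = card S" for S
		by (rule card_image) (simp add: inj_on_def)
	ultimately show ?thesis by (simp add: hc_sum_def)
qed

section \<open>Partition functions of intervals and their exponential growth\<close>

definition Zp :: "real => nat => real" where "Zp z g = hc_sum z {0..<g}"

lemma hc_sum_interval: "hc_sum z {p..<q} = Zp z (q - p)"
proof (cases "p <= q")
	case True
	thus ?thesis using hc_sum_shift[of z p "q - p"] by (simp add: Zp_def)
next
	case False
	hence "{p..<q} = {0..<q-p}" by auto
	thus ?thesis by (simp add: Zp_def)
qed

lemma Zp_0 [simp]: "Zp z 0 = 1"
proof -
	have "Ind {} = {{}}" by (auto simp: Ind_def)
	thus ?thesis by (simp add: Zp_def hc_sum_def)
qed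

text \<open>The two terms belong to an empty and to an occupied last site. For \<open>g = 0\<close>
  truncated subtraction gives the correct value \<open>1 + z\<close>.\<close>

lemma Zp_step:
	"Zp z (Suc g) = Zp z g + z * Zp z (g - 1)"
proof -
	let ?A = "{0..<Suc g}"
	have "Zp z (Suc g) = (SUM S:{S. S \<in> Ind ?A & S \<inter> {g} = {}} \<union> {S. S \<in> Ind ?A & S \<inter> {g} = {g}}. z ^ card S)"
		unfolding Zp_def hc_sum_def by (rule sum.cong) auto
	also have "... = (SUM S | S \<in> Ind ?A & S \<inter> {g} = {}. z ^ card S) + (SUM S | S \<in> Ind ?A & S \<inter> {g} = {g}. z ^ card S)"
		by (rule sum.union_disjoint) auto
	also have "(SUM S | S \<in> Ind ?A & S \<inter> {g} = {}. z ^ card S) = Zp z g"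
	proof -
		have e: "?A - {g} - nbr {} = {0..<g}" by (auto simp: nbr_def)
		show ?thesis by (subst hc_sum_split) (auto simp: Ind_def e hc_sum_interval)
	qed
	also have "(SUM S | S \<in> Ind ?A & S \<inter> {g} = {g}. z ^ card S) = z * Zp z (g - 1)"
	proof -
		have e: "?A - {g} - nbr {g} = {0..<g - 1}" by (auto simp: nbr_def)
		show ?thesis by (subst hc_sum_split) (auto simp: Ind_def e hc_sum_interval)
	qed
	finally show ?thesis .
qed

text \<open>The larger root of \<open>x\<^sup>2 = x + z\<close>, the characteristic equation of
  \<open>Zp_step\<close>. The other root is \<open>1 - lam z\<close>, and \<open>tht z\<close> is
  the absolute value of the ratio of the other root to this one.\<close>

definition lam :: "real => real" where "lam z = (1 + sqrt (1 + 4 * z)) / 2"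
definition tht :: "real => real" where "tht z = z / (lam z)\<^sup>2"

lemma lam_props:
	assumes "z > 0"
	shows "lam z > 1" "(lam z)\<^sup>2 = lam z + z"
proof -
	have "sqrt (1 + 4 * z) > 1" using assms by simp
	thus "lam z > 1" unfolding lam_def by simp
	have "(sqrt (1 + 4 * z))\<^sup>2 = 1 + 4 * z" using assms by simp
	thus "(lam z)\<^sup>2 = lam z + z" unfolding lam_def by (simp add: power2_eq_square algebra_simps)
qed

lemma tht_props:
	assumes "z > 0" shows "0 < tht z" "tht z < 1"
	using lam_props[OF assms] assms unfolding tht_def by auto

text \<open>A Binet formula: powers of both roots solve the recursion, and the values at 0 and 1 fix
  the coefficients. Multiplying by the difference of the roots keeps divisions out of the
  induction.\<close>

lemma Zp_closed:
	assumes "z > 0"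
	shows "Zp z g * (2 * lam z - 1) = lam z ^ (g + 2) - (1 - lam z) ^ (g + 2)"
proof (induction g rule: less_induct)
	case (less g)
	let ?l = "lam z"
	have l: "?l * ?l = ?l + z" using lam_props(2)[OF assms] by (simp add: power2_eq_square)
	have l': "(1 - ?l) * (1 - ?l) = (1 - ?l) + z" using l by (simp add: algebra_simps)
	consider "g = 0" | "g = 1" | g' where "g = Suc (Suc g')"
		by (metis One_nat_def not0_implies_Suc)
	thus ?case
	proof cases
		case 1 thus ?thesis by (simp add: power2_eq_square algebra_simps)
	next
		case 2
		have "Zp z 1 = 1 + z" using Zp_step[of z 0] by simp
		moreover have "?l ^ 3 - (1 - ?l) ^ 3 = (1 + z) * (2 * ?l - 1)"
			using l by algebra
		ultimately show ?thesis using 2 by (simp add: numeral_3_eq_3)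
	next
		case 3
		have "Zp z g * (2 * ?l - 1) = Zp z (Suc g') * (2 * ?l - 1) + z * (Zp z g' * (2 * ?l - 1))"
			using Zp_step[of z "Suc g'"] 3 by (simp add: algebra_simps)
		also have "... = ?l ^ (Suc g' + 2) - (1 - ?l) ^ (Suc g' + 2) + z * (?l ^ (g' + 2) - (1 - ?l) ^ (g' + 2))"
			using less[of g'] less[of "Suc g'"] 3 by simp
		also have "... = (?l + z) * ?l ^ (g' + 2) - ((1 - ?l) + z) * (1 - ?l) ^ (g' + 2)"
			by (simp add: algebra_simps)
		also have "... = ?l ^ (g + 2) - (1 - ?l) ^ (g + 2)"
			unfolding l[symmetric] l'[symmetric] 3 by (simp add: algebra_simps)
		finally show ?thesis .
	qed
qed

definition Zc :: "real => real" where "Zc z = (lam z)\<^sup>2 / (2 * lam z - 1)"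

lemma Zc_pos: "z > 0 ==> Zc z > 0"
	using lam_props[of z] by (simp add: Zc_def)

text \<open>The second root is smaller by the factor \<open>tht z\<close>, so the partition function
  is geometric up to a relative error \<open>tht z ^ r\<close>. The condition admits
  \<open>g = r - 2\<close>, the length that remains when both ends of a margin of \<open>r\<close>
  sites are blocked.\<close>

lemma Zp_bounds:
	assumes "z > 0" "r <= g + 2"
	shows "Zp z g <= Zc z * lam z ^ g * (1 + tht z ^ r)"
		and "Zc z * lam z ^ g * (1 - tht z ^ r) <= Zp z g"
proof -
	let ?l = "lam z" and ?t = "tht z"
	note lp = lam_props[OF assms(1)] and tp = tht_props[OF assms(1)]
	have "?l * (?l - 1) = z" using lp(2) by (simp add: power2_eq_square algebra_simps)
	hence "z / ?l = ?l - 1" using lp(1) by (simp add: field_simps)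
	hence tl: "1 - ?l = - (?t * ?l)" unfolding tht_def using lp(1)
		by (simp add: power2_eq_square)
	have "\<bar>(1 - ?l) ^ (g + 2)\<bar> = (?t * ?l) ^ (g + 2)"
		unfolding tl using tp lp by (subst power_abs) (simp add: abs_mult)
	also have "... = ?t ^ (g + 2) * ?l ^ (g + 2)" by (rule power_mult_distrib)
	also have "... <= ?t ^ r * ?l ^ (g + 2)"
		using tp lp assms by (intro mult_right_mono power_decreasing) auto
	finally have b: "\<bar>(1 - ?l) ^ (g + 2)\<bar> <= ?t ^ r * ?l ^ (g + 2)" .
	have e: "Zp z g = (?l ^ (g + 2) - (1 - ?l) ^ (g + 2)) / (2 * ?l - 1)"
		using Zp_closed[OF assms(1), of g] lp by (simp add: field_simps)
	have r1: "Zc z * ?l ^ g * (1 + ?t ^ r) = (?l ^ (g + 2) + ?t ^ r * ?l ^ (g + 2)) / (2 * ?l - 1)"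
		by (simp add: Zc_def power_add algebra_simps power2_eq_square add_divide_distrib)
	have r2: "Zc z * ?l ^ g * (1 - ?t ^ r) = (?l ^ (g + 2) - ?t ^ r * ?l ^ (g + 2)) / (2 * ?l - 1)"
		by (simp add: Zc_def power_add algebra_simps power2_eq_square diff_divide_distrib)
	show "Zp z g <= Zc z * lam z ^ g * (1 + tht z ^ r)"
		unfolding e r1 using b lp by (intro divide_right_mono) auto
	show "Zc z * lam z ^ g * (1 - tht z ^ r) <= Zp z g"
		unfolding e r2 using b lp by (intro divide_right_mono) auto
qed

section \<open>Influence of the boundary on a distant window\<close>

definition mixf :: "real => nat => real" where
	"mixf z r = ((1 + tht z ^ r) / (1 - tht z ^ r)) ^ 3"

definition hc_fix :: "real => nat => nat => nat set => nat set => real" where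
	"hc_fix z p q M T = (SUM S | S \<in> Ind {p..<q} & S \<inter> M = T. z ^ card S)"

text \<open>\<open>alp\<close> and \<open>alp'\<close> delete extreme sites that are blocked by
  occupied sites outside the path, \<open>bet\<close> and \<open>bet'\<close> account for those
  blocked by occupied ends of the window. What remains are two separate margins of \<open>r\<close>
  sites each, minus the blocked ones.\<close>

lemma hc_fix_eq:
	assumes "T \<in> Ind {r..<r+len}" "alp <= 1" "alp' <= 1" "r >= 2" "len > 0"
	defines "bet == of_bool (r \<in> T) :: nat" and "bet' == of_bool (r + len - 1 \<in> T) :: nat"
	shows "hc_fix z alp (2*r+len-alp') {r..<r+len} T
			= z ^ card T * (Zp z (r - bet - alp) * Zp z (r - bet' - alp'))"
proof -
	have b: "bet <= 1" "bet' <= 1" by (auto simp: bet_def bet'_def)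
	have T: "T <= {r..<r+len}" using assms by (auto simp: Ind_def)
	have "{r..<r+len} <= {alp..<2*r+len-alp'}" using assms by auto
	hence "T \<in> Ind {alp..<2*r+len-alp'}" using assms(1) unfolding Ind_def by blast
	hence 1: "hc_fix z alp (2*r+len-alp') {r..<r+len} T
		= z ^ card T * hc_sum z ({alp..<2*r+len-alp'} - {r..<r+len} - nbr T)"
		unfolding hc_fix_def by (intro hc_sum_split) (use T in auto)
	have ex: "i \<in> nbr T \<longleftrightarrow> (i < r & i = r - 1 & r \<in> T) | (i >= r + len & i = r + len & r + len - 1 \<in> T)"
		if "i ~: {r..<r+len}" for i
	proof -
		have "i \<in> nbr T \<longleftrightarrow> Suc i \<in> T | (i > 0 & i - 1 \<in> T)"
			by (auto simp: nbr_def image_iff) (metis Suc_pred)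
		moreover have "Suc i \<in> T \<longleftrightarrow> (i < r & i = r - 1 & r \<in> T)"
		proof
			assume "Suc i \<in> T"
			hence "r <= Suc i" "Suc i < r + len" using T by auto
			hence "Suc i = r" using that by auto
			thus "i < r & i = r - 1 & r \<in> T" using \<open>Suc i \<in> T\<close> by auto
		qed (use assms in auto)
		moreover have "(i > 0 & i - 1 \<in> T) \<longleftrightarrow> (i >= r + len & i = r + len & r + len - 1 \<in> T)"
		proof
			assume a: "i > 0 & i - 1 \<in> T"
			hence "r <= i - 1" "i - 1 < r + len" using T by auto
			hence "i = r + len" using that a by auto
			thus "i >= r + len & i = r + len & r + len - 1 \<in> T" using a by auto
		qed (use assms in auto)
		ultimately show ?thesis by blast
	qed
	have "{alp..<2*r+len-alp'} - {r..<r+len} - nbr T = {alp..<r - bet} \<union> {r+len+bet'..<2*r+len-alp'}"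
	proof (rule set_eqI)
		fix i
		show "i \<in> {alp..<2*r+len-alp'} - {r..<r+len} - nbr T \<longleftrightarrow> i \<in> {alp..<r - bet} \<union> {r+len+bet'..<2*r+len-alp'}"
		proof (cases "i \<in> {r..<r+len}")
			case True thus ?thesis by (auto simp: bet_def bet'_def)
		next
			case False
			thus ?thesis using ex[OF False] assms(2-5) by (auto simp: bet_def bet'_def)
		qed
	qed
	moreover have "hc_sum z ({alp..<r - bet} \<union> {r+len+bet'..<2*r+len-alp'}) = Zp z (r - bet - alp) * Zp z (r - bet' - alp')"
	proof -
		have "2*r+len-alp' - (r+len+bet') = r - bet' - alp'" by auto
		moreover have "hc_sum z ({alp..<r - bet} \<union> {r+len+bet'..<2*r+len-alp'})
				= hc_sum z {alp..<r - bet} * hc_sum z {r+len+bet'..<2*r+len-alp'}"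
			by (rule hc_sum_union) (use assms(5) in auto)
		ultimately show ?thesis by (simp add: hc_sum_interval)
	qed
	ultimately show ?thesis using 1 by simp
qed

text \<open>After \<open>hc_fix_eq\<close> either side is a product of three path partition
  functions, hence the cube in \<open>mixf\<close>, and the lengths of the three paths have the same
  sum on both sides. So the geometric parts cancel: the law of the window hardly depends on whether
  the boundary bits are \<open>alp\<close>, \<open>alp'\<close> or \<open>gam\<close>,
  \<open>gam'\<close>.\<close>

lemma hc_cross:
	assumes z: "z > 0" and T: "T \<in> Ind {r..<r+len}" and a: "alp <= 1" "alp' <= 1" "gam <= 1" "gam' <= 1"
		and r: "r >= 2" and l: "len > 0"
	defines "L == 2*r+len"
	shows "hc_fix z alp (L-alp') {r..<r+len} T * hc_sum z {gam..<L-gam'}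
			<= mixf z r * (hc_fix z gam (L-gam') {r..<r+len} T * hc_sum z {alp..<L-alp'})"
proof -
	define bet where "bet = (of_bool (r \<in> T) :: nat)"
	define bet' where "bet' = (of_bool (r + len - 1 \<in> T) :: nat)"
	have b: "bet <= 1" "bet' <= 1" by (auto simp: bet_def bet'_def)
	have f: "hc_fix z alp (L-alp') {r..<r+len} T = z ^ card T * (Zp z (r - bet - alp) * Zp z (r - bet' - alp'))"
				"hc_fix z gam (L-gam') {r..<r+len} T = z ^ card T * (Zp z (r - bet - gam) * Zp z (r - bet' - gam'))"
		unfolding L_def bet_def bet'_def by (intro hc_fix_eq; fact assms)+
	let ?l = "lam z" and ?A = "Zc z" and ?p = "1 + tht z ^ r" and ?q = "1 - tht z ^ r"
	note lp = lam_props[OF z] and tp = tht_props[OF z]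
	have "tht z ^ r < 1" using tp r by (intro power_Suc_less_one[of "tht z" "r - 1", simplified] | simp add: power_less_one_iff)+
	hence qp: "?q > 0" "?p > 0" using tp by (auto simp: add_pos_pos)
	have Zpos: "0 <= Zp z g" for g unfolding Zp_def hc_sum_def using z by (intro sum_nonneg) auto
	have Ap: "?A > 0" using Zc_pos[OF z] .
	have up: "Zp z g <= ?A * ?l ^ g * ?p" and lo: "?A * ?l ^ g * ?q <= Zp z g" if "g + 2 >= r" for g
		using Zp_bounds[OF z, of r g] that by auto
	have s: "hc_sum z {gam..<L-gam'} = Zp z (L - gam' - gam)" "hc_sum z {alp..<L-alp'} = Zp z (L - alp' - alp)"
		by (simp_all add: hc_sum_interval)
	have U: "Zp z (r - bet - alp) * Zp z (r - bet' - alp') * Zp z (L - gam' - gam)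
			<= (?A * ?l ^ (r - bet - alp) * ?p) * (?A * ?l ^ (r - bet' - alp') * ?p) * (?A * ?l ^ (L - gam' - gam) * ?p)"
		using a b r lp qp Ap by (intro mult_mono up Zpos mult_nonneg_nonneg) (auto simp: L_def)
	have V: "(?A * ?l ^ (r - bet - gam) * ?q) * (?A * ?l ^ (r - bet' - gam') * ?q) * (?A * ?l ^ (L - alp' - alp) * ?q)
			<= Zp z (r - bet - gam) * Zp z (r - bet' - gam') * Zp z (L - alp' - alp)"
		using a b r lp qp Ap by (intro mult_mono lo Zpos mult_nonneg_nonneg) (auto simp: L_def)
	\<comment> \<open>Each of the six bits is subtracted exactly once on either side;
	  \<open>r >= 2\<close> excludes truncation.\<close>
	have ex: "(r - bet - alp) + (r - bet' - alp') + (L - gam' - gam) = (r - bet - gam) + (r - bet' - gam') + (L - alp' - alp)"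
		using a b r by (auto simp: L_def)
	define e where "e = (r - bet - alp) + (r - bet' - alp') + (L - gam' - gam)"
	have "(?A * ?l ^ (r - bet - alp) * ?p) * (?A * ?l ^ (r - bet' - alp') * ?p) * (?A * ?l ^ (L - gam' - gam) * ?p)
			= ?A ^ 3 * ?l ^ e * ?p ^ 3"
		unfolding e_def by (simp add: power_add numeral_3_eq_3 algebra_simps)
	also have "... = mixf z r * (?A ^ 3 * ?l ^ e * ?q ^ 3)"
		using qp by (simp add: mixf_def power_divide)
	also have "?A ^ 3 * ?l ^ e * ?q ^ 3 = (?A * ?l ^ (r - bet - gam) * ?q) * (?A * ?l ^ (r - bet' - gam') * ?q) * (?A * ?l ^ (L - alp' - alp) * ?q)"
		unfolding e_def ex by (simp add: power_add numeral_3_eq_3 algebra_simps)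
	finally have "Zp z (r - bet - alp) * Zp z (r - bet' - alp') * Zp z (L - gam' - gam)
			<= mixf z r * (Zp z (r - bet - gam) * Zp z (r - bet' - gam') * Zp z (L - alp' - alp))"
		using U V qp by (smt (verit) mixf_def divide_pos_pos mult_left_mono zero_less_power)
	hence "z ^ card T * (Zp z (r - bet - alp) * Zp z (r - bet' - alp') * Zp z (L - gam' - gam))
			<= z ^ card T * (mixf z r * (Zp z (r - bet - gam) * Zp z (r - bet' - gam') * Zp z (L - alp' - alp)))"
		using z by (intro mult_left_mono) auto
	thus ?thesis unfolding f s by (simp add: algebra_simps)
qed

section \<open>The hard-core model on the torus\<close>

text \<open>Every column is a cycle of \<open>m\<close> sites. With \<open>m >= 3\<close> a site and
  its two neighbours are distinct, so sets of disjoint exchanges of neighbours are the independent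
  sets of the cycle.\<close>

locale hc =
	fixes n m :: nat and z :: real
	assumes n_pos: "n > 0" and m_ge: "m >= 3" and z_pos: "z > 0"
begin

definition sh :: "int \<times> int => int => int \<times> int" where
	"sh p d = (fst p, (snd p + d) mod int m)"

abbreviation Tor :: "(int \<times> int) set" where "Tor == torus n m"

definition Om :: "(int \<times> int) set set" where
	"Om = {D. D <= Tor & (ALL x:D. sh x 1 ~: D)}"

definition Zt :: real where "Zt = (SUM D:Om. z ^ card D)"

text \<open>Expectation under the Gibbs measure, kept as a finite weighted mean so that toggling and
  transport arguments become reindexings of sums.\<close>

definition Ex :: "((int \<times> int) set => real) => real" where
	"Ex g = (SUM D:Om. z ^ card D * g D) / Zt"

definition Pr :: "((int \<times> int) set => bool) => real" where
	"Pr P = Ex (%D. of_bool (P D))"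

lemma m_pos: "int m > 0" using m_ge by simp

lemma sh_sh [simp]: "sh (sh p a) b = sh p (a + b)"
	by (simp add: sh_def mod_simps add.assoc)

lemma fst_sh [simp]: "fst (sh p a) = fst p" by (simp add: sh_def)

lemma sh_0 [simp]: "p \<in> Tor ==> sh p 0 = p"
	by (cases p) (auto simp: sh_def torus_def)

lemma sh_torus [simp]: "p \<in> Tor ==> sh p a \<in> Tor"
	using m_pos by (cases p) (auto simp: sh_def torus_def)

lemma sh_eq_iff: "sh p a = sh p b \<longleftrightarrow> int m dvd (a - b)"
	by (simp add: sh_def mod_eq_dvd_iff)

lemma sh_eq_iff': "p \<in> Tor ==> sh p a = p \<longleftrightarrow> int m dvd a"
	using sh_eq_iff[of p a 0] by simp

lemma finite_Om [simp]: "finite Om"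
	by (rule finite_subset[of _ "Pow Tor"]) (auto simp: Om_def)

lemma Om_subset: "D \<in> Om ==> F <= D ==> F \<in> Om"
	unfolding Om_def by blast

lemma Om_torus: "D \<in> Om ==> x \<in> D ==> x \<in> Tor"
	unfolding Om_def by blast

lemma Om_sh: "D \<in> Om ==> x \<in> D ==> sh x 1 ~: D"
	unfolding Om_def by blast

lemma finite_Om_el: "D \<in> Om ==> finite D"
	unfolding Om_def using finite_torus finite_subset by blast

lemma empty_Om [simp]: "{} \<in> Om" by (simp add: Om_def)

lemma Zt_pos: "Zt > 0"
	unfolding Zt_def by (rule sum_pos) (use z_pos empty_Om in "auto simp del: empty_Om")

lemma Ex_mono: "(!!D. D \<in> Om ==> f D <= g D) ==> Ex f <= Ex g"
	unfolding Ex_def using Zt_pos z_pos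
	by (intro divide_right_mono sum_mono mult_left_mono) auto

lemma Ex_cong: "(!!D. D \<in> Om ==> f D = g D) ==> Ex f = Ex g"
	unfolding Ex_def by (metis (mono_tags, lifting) sum.cong)

lemma Ex_const [simp]: "Ex (%D. c) = c"
	unfolding Ex_def using Zt_pos by (simp add: Zt_def flip: sum_distrib_right)

lemma Ex_add: "Ex (%D. f D + g D) = Ex f + Ex g"
	by (simp add: Ex_def algebra_simps sum.distrib add_divide_distrib)

lemma Ex_diff: "Ex (%D. f D - g D) = Ex f - Ex g"
	by (simp add: Ex_def algebra_simps sum_subtractf diff_divide_distrib)

lemma Ex_cmult: "Ex (%D. c * f D) = c * Ex f"
	by (simp add: Ex_def sum_distrib_left mult.left_commute)

lemma Ex_multc: "Ex (%D. f D * c) = Ex f * c"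
	using Ex_cmult[of c f] by (simp add: mult.commute)

lemma Ex_minus: "Ex (%D. - f D) = - Ex f"
	using Ex_cmult[of "-1" f] by simp

lemma Ex_sum: "Ex (%D. SUM i:A. f i D) = (SUM i:A. Ex (f i))"
	unfolding Ex_def by (simp add: sum_distrib_left sum_divide_distrib sum.swap[of _ A])

lemma Ex_nonneg: "(!!D. D \<in> Om ==> 0 <= f D) ==> 0 <= Ex f"
	using Ex_mono[of "%_. 0" f] by simp

lemma Ex_abs: "\<bar>Ex f\<bar> <= Ex (%D. \<bar>f D\<bar>)"
	using Ex_mono[of f "%D. \<bar>f D\<bar>"] Ex_mono[of "%D. - f D" "%D. \<bar>f D\<bar>"]
	by (simp add: Ex_minus abs_le_iff)

lemma Pr_nonneg [simp]: "0 <= Pr P" unfolding Pr_def by (rule Ex_nonneg) simp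

lemma Pr_mono: "(!!D. D \<in> Om ==> P D ==> Q D) ==> Pr P <= Pr Q"
	unfolding Pr_def by (rule Ex_mono) auto

lemma Pr_cong: "(!!D. D \<in> Om ==> P D = Q D) ==> Pr P = Pr Q"
	unfolding Pr_def by (rule Ex_cong) auto

lemma Pr_or: "Pr (%D. P D | Q D) <= Pr P + Pr Q"
	unfolding Pr_def Ex_add[symmetric] by (rule Ex_mono) auto

lemma Pr_union: "finite A ==> Pr (%D. EX i:A. P i D) <= (SUM i:A. Pr (P i))"
	unfolding Pr_def Ex_sum[symmetric]
proof (rule Ex_mono)
	fix D assume "finite A"
	show "of_bool (EX i:A. P i D) <= (SUM i:A. (of_bool (P i D) :: real))"
	proof (cases "EX i:A. P i D")
		case True
		then obtain i where i: "i \<in> A" "P i D" by blast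
		have "of_bool (P i D) <= (SUM i:A. (of_bool (P i D) :: real))"
			using i \<open>finite A\<close> by (intro member_le_sum) auto
		thus ?thesis using i True by simp
	qed (simp add: sum_nonneg)
qed

lemma Ex_partition:
	assumes "finite H" "!!D. D \<in> Om ==> h D \<in> H"
	shows "Ex f = (SUM x:H. Ex (%D. f D * of_bool (h D = x)))"
	unfolding Ex_sum[symmetric]
proof (rule Ex_cong)
	fix D assume "D \<in> Om"
	hence "h D \<in> H" using assms by simp
	thus "f D = (SUM x:H. f D * of_bool (h D = x))"
	proof -
		have "(SUM x:H. f D * of_bool (h D = x)) = (SUM x:H. if h D = x then f D else 0)"
			by (rule sum.cong) auto
		thus ?thesis using assms(1) \<open>h D \<in> H\<close> by simp
	qed
qed

text \<open>Configurations that agree away from a window interact with it only through the two sites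
	next to the window, and partition functions of long paths are nearly geometric.\<close>

lemma quasi_independence:
	assumes p: "p \<in> Tor" and r: "r >= 2" and len: "len > 0" and Lm: "2 * r + len + 1 <= m"
		and E: "!!D D'. D \<in> Om ==> D' \<in> Om ==> D - (%i. sh p (int i)) ` {0..<2*r+len} = D' - (%i. sh p (int i)) ` {0..<2*r+len} ==> E D ==> E D'"
		and W: "!!D D'. D \<in> Om ==> D' \<in> Om ==> D \<inter> (%i. sh p (int i)) ` {r..<r+len} = D' \<inter> (%i. sh p (int i)) ` {r..<r+len} ==> W D ==> W D'"
	shows "Pr (%D. E D & W D) <= mixf z r * (Pr E * Pr W)"
proof -
	define L where "L = 2*r+len"
	define M where "M = {r..<r+len}"
	define em where "em = (%i. sh p (int i))"
	define I where "I = em ` {0..<L}"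
	define K where "K = em ` M"
	\<comment> \<open>The configuration \<open>F\<close> outside the arc acts on the arc only through
	  these two bits, each of which blocks the adjacent end of the arc.\<close>
	define al where "al = (%F. of_bool (sh p (-1) \<in> F) :: nat)"
	define al' where "al' = (%F. of_bool (sh p (int L) \<in> F) :: nat)"
	define FF where "FF = (%D. D - I) ` Om"
	define dec where "dec = (%(F, S). F \<union> em ` S)"
	have inj: "inj_on em {0..<L}"
	proof (rule inj_onI)
		fix i j assume ij: "i \<in> {0..<L}" "j \<in> {0..<L}" "em i = em j"
		hence d: "int m dvd (int i - int j)" by (simp add: em_def sh_eq_iff)
		have "\<bar>int i - int j\<bar> < int m" using ij Lm by (auto simp: L_def)
		thus "i = j" using zdvd_not_zless[of "\<bar>int i - int j\<bar>" "int m"] d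
			by (metis abs_of_nonneg dvd_abs_iff eq_iff_diff_eq_0 of_nat_eq_iff zero_less_abs_iff)
	qed
	have MI: "M <= {0..<L}" by (auto simp: M_def L_def)
	have nI: "sh p (-1) ~: I" "sh p (int L) ~: I"
	proof -
		have "~ int m dvd (- 1 - int i)" if "i < L" for i
		proof -
			have "~ int m dvd (1 + int i)" using that Lm by (intro zdvd_not_zless) (auto simp: L_def)
			moreover have "- 1 - int i = - (1 + int i)" by simp
			ultimately show ?thesis by (metis dvd_minus_iff)
		qed
		thus "sh p (-1) ~: I" by (auto simp: I_def em_def sh_eq_iff)
		have "~ int m dvd (int L - int i)" if "i < L" for i
			using that Lm zdvd_not_zless[of "int L - int i" "int m"] by (auto simp: L_def)
		thus "sh p (int L) ~: I" by (auto simp: I_def em_def sh_eq_iff)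
	qed
	have emS: "sh (em i) 1 = em (Suc i)" for i by (simp add: em_def add.commute)
	have em_out: "sh x 1 = em i ==> x \<in> Tor ==> x = sh p (int i - 1)" for x i
	proof -
		assume a: "sh x 1 = em i" "x \<in> Tor"
		have "x = sh (sh x 1) (-1)" using a(2) by simp
		also have "... = sh p (int i - 1)" unfolding a(1) by (simp add: em_def)
		finally show ?thesis .
	qed
	have ptor: "em i \<in> Tor" for i using p by (simp add: em_def)
	have FFOm: "F \<in> Om" "F \<inter> I = {}" if "F \<in> FF" for F
		using that Om_subset by (auto simp: FF_def)
	have valid: "F \<union> em ` S \<in> Om \<longleftrightarrow> S \<in> Ind {al F..<L - al' F}" if F: "F \<in> FF" and S: "S <= {0..<L}" for F S
	proof
		assume U: "F \<union> em ` S \<in> Om"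
		have 1: "Suc i ~: S" if "i \<in> S" for i
			using Om_sh[OF U, of "em i"] that emS by auto
		have 2: "0 ~: S" if "sh p (-1) \<in> F"
		proof
			assume "0 \<in> S"
			hence "em 0 \<in> F \<union> em ` S" by blast
			moreover have "sh (sh p (-1)) 1 = em 0" by (simp add: em_def)
			ultimately show False using Om_sh[OF U, of "sh p (-1)"] that by auto
		qed
		have 3: "L - 1 ~: S" if "sh p (int L) \<in> F"
		proof
			assume "L - 1 \<in> S"
			hence "sh (em (L - 1)) 1 ~: F \<union> em ` S" using Om_sh[OF U, of "em (L - 1)"] by blast
			moreover have "sh (em (L - 1)) 1 = sh p (int L)" using len by (simp add: emS L_def em_def)
			ultimately show False using that by auto
		qed
		have "S <= {al F..<L - al' F}"
		proof
			fix i assume "i \<in> S"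
			thus "i \<in> {al F..<L - al' F}" using S 2 3
				by (cases "i = 0"; cases "i = L - 1") (auto simp: al_def al'_def subset_iff)
		qed
		thus "S \<in> Ind {al F..<L - al' F}" using 1 by (auto simp: Ind_def)
	next
		assume S': "S \<in> Ind {al F..<L - al' F}"
		hence ss: "S <= {al F..<L - al' F}" and si: "!!i. i \<in> S ==> Suc i ~: S" by (auto simp: Ind_def)
		show "F \<union> em ` S \<in> Om"
			unfolding Om_def
		proof (intro CollectI conjI ballI)
			show "F \<union> em ` S <= Tor" using FFOm(1)[OF F] ptor by (auto simp: Om_def)
			fix x assume x: "x \<in> F \<union> em ` S"
			show "sh x 1 ~: F \<union> em ` S"
			proof
				assume y: "sh x 1 \<in> F \<union> em ` S"
				have "x \<in> Tor" using x FFOm(1)[OF F] ptor by (auto simp: Om_def)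
				show False
				proof (cases "x \<in> F")
					case True
					hence "sh x 1 \<in> em ` S" using y Om_sh[OF FFOm(1)[OF F]] by auto
					then obtain i where i: "i \<in> S" "sh x 1 = em i" by auto
					hence xe: "x = sh p (int i - 1)" using em_out \<open>x \<in> Tor\<close> by auto
					show False
					proof (cases i)
						case 0 hence "sh p (-1) \<in> F" using xe True by simp
						thus False using 0 i ss by (auto simp: al_def)
					next
						case (Suc j)
						hence "x = em j" using xe by (simp add: em_def)
						hence "x \<in> I" using i S Suc by (auto simp: I_def)
						thus False using True FFOm(2)[OF F] by auto
					qed
				next
					case False
					then obtain i where i: "i \<in> S" "x = em i" using x by auto
					hence yy: "em (Suc i) \<in> F \<union> em ` S" using y emS by simp
					show False
					proof (cases "Suc i < L")
						case True
						hence "em (Suc i) \<in> I" by (auto simp: I_def)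
						hence "em (Suc i) \<in> em ` S" using yy FFOm(2)[OF F] by auto
						then obtain j where j: "j \<in> S" "em (Suc i) = em j" by auto
						hence "Suc i = j" using inj_onD[OF inj j(2)] True S by auto
						hence "Suc i \<in> S" using j by simp
						thus False using si i by auto
					next
						case False
						hence "Suc i = L" using i S by (auto simp: subset_iff)
						hence e: "em (Suc i) = sh p (int L)" by (simp add: em_def)
						have "em (Suc i) ~: em ` S" using nI(2) S unfolding e by (auto simp: I_def)
						hence "sh p (int L) \<in> F" using yy e by auto
						thus False using ss i \<open>Suc i = L\<close> by (auto simp: al'_def)
					qed
				qed
			qed
		qed
	qed
	define Sg where "Sg = Sigma FF (%F. Ind {al F..<L - al' F})"
	have fin: "finite FF" "!!F. finite (Ind {al F..<L - al' F})" by (auto simp: FF_def)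
	have SgI: "S <= {0..<L}" if "S \<in> Ind {al F..<L - al' F}" for F S
		using that by (fastforce simp: Ind_def)
	have cardU: "z ^ card (F \<union> em ` S) = z ^ card F * z ^ card S" if "F \<in> FF" "S \<in> Ind {al F..<L - al' F}" for F S
	proof -
		have "card (F \<union> em ` S) = card F + card (em ` S)"
		proof (rule card_Un_disjoint)
			show "finite F" using FFOm(1)[OF that(1)] finite_Om_el by auto
			show "finite (em ` S)" using SgI[OF that(2)] finite_subset by blast
			show "F \<inter> em ` S = {}" using SgI[OF that(2)] FFOm(2)[OF that(1)] by (auto simp: I_def)
		qed
		also have "card (em ` S) = card S"
			by (rule card_image) (meson SgI[OF that(2)] inj inj_on_subset)
		finally show ?thesis by (simp add: power_add)
	qed
	\<comment> \<open>Every configuration consists uniquely of its part outside the arc and an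
	  independent set on that portion of the arc which the outer part leaves available.\<close>
	have expand: "(SUM D:Om. z ^ card D * g D) =
		(SUM F:FF. SUM S:Ind {al F..<L - al' F}. z ^ card F * z ^ card S * g (F \<union> em ` S))" for g :: "(int \<times> int) set => real"
	proof -
		have "(SUM D:Om. z ^ card D * g D) = (SUM (F,S):Sg. z ^ card F * z ^ card S * g (F \<union> em ` S))"
		proof (rule sum.reindex_bij_witness[where i="%(F,S). F \<union> em ` S" and j="%D. (D - I, {i\<in>{0..<L}. em i \<in> D})"])
			fix D assume D: "D \<in> Om"
			show e: "(case (D - I, {i \<in> {0..<L}. em i \<in> D}) of (F, S) => F \<union> em ` S) = D"
				by (auto simp: I_def)
			have F: "D - I \<in> FF" using D by (auto simp: FF_def)
			have "{i \<in> {0..<L}. em i \<in> D} \<in> Ind {al (D - I)..<L - al' (D - I)}"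
			proof -
				have s: "{i \<in> {0..<L}. em i \<in> D} <= {0..<L}" by auto
				have "(D - I) \<union> em ` {i \<in> {0..<L}. em i \<in> D} \<in> Om" using e D by simp
				thus ?thesis unfolding valid[OF F s] .
			qed
			thus "(D - I, {i \<in> {0..<L}. em i \<in> D}) \<in> Sg"
				using F by (auto simp: Sg_def)
			hence "z ^ card ((D - I) \<union> em ` {i \<in> {0..<L}. em i \<in> D}) = z ^ card (D - I) * z ^ card {i \<in> {0..<L}. em i \<in> D}"
				by (intro cardU) (auto simp: Sg_def)
			thus "(case (D - I, {i \<in> {0..<L}. em i \<in> D}) of (F, S) => z ^ card F * z ^ card S * g (F \<union> em ` S)) = z ^ card D * g D"
				using e by simp
		next
			fix b assume "b \<in> Sg"
			then obtain F S where b: "b = (F,S)" "F \<in> FF" "S \<in> Ind {al F..<L - al' F}" by (auto simp: Sg_def)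
			show "(case b of (F, S) => F \<union> em ` S) \<in> Om" using b valid SgI by auto
			have SL: "S <= {0..<L}" using SgI[OF b(3)] .
			hence SI: "em ` S <= I" unfolding I_def by (rule image_mono)
			hence "F \<union> em ` S - I = F" using FFOm(2)[OF b(2)] by blast
			moreover have "{i\<in>{0..<L}. em i \<in> F \<union> em ` S} = S"
			proof (rule set_eqI)
				fix i
				show "i \<in> {i\<in>{0..<L}. em i \<in> F \<union> em ` S} \<longleftrightarrow> i \<in> S"
				proof (cases "i \<in> {0..<L}")
					case True
					hence "em i ~: F" using FFOm(2)[OF b(2)] unfolding I_def by blast
					thus ?thesis using True inj_on_image_mem_iff[OF inj True SL] by simp
				next
					case False thus ?thesis using SL by blast
				qed
			qed
			ultimately show "((case b of (F, S) => F \<union> em ` S) - I, {i\<in>{0..<L}. em i \<in> (case b of (F, S) => F \<union> em ` S)}) = b"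
				using b by simp
		qed
		thus ?thesis unfolding Sg_def using fin by (simp add: sum.Sigma)
	qed
	have IK: "(%i. sh p (int i)) ` {0..<2*r+len} = I" "(%i. sh p (int i)) ` {r..<r+len} = K"
		by (auto simp: I_def K_def em_def L_def M_def)
	have EF: "E (F \<union> em ` S) = E F" if "F \<in> FF" "S \<in> Ind {al F..<L - al' F}" for F S
	proof -
		have "F \<union> em ` S \<in> Om" using valid that SgI by auto
		moreover have "(F \<union> em ` S) - I = F - I" using SgI[OF that(2)] by (auto simp: I_def)
		ultimately show ?thesis using E FFOm(1)[OF that(1)] unfolding IK by metis
	qed
	have WS: "W (F \<union> em ` S) = W (em ` (S \<inter> M))" if "F \<in> FF" "S \<in> Ind {al F..<L - al' F}" for F S
	proof -
		have O: "F \<union> em ` S \<in> Om" using valid that SgI by auto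
		hence "em ` (S \<inter> M) \<in> Om" by (rule Om_subset) auto
		moreover have "(F \<union> em ` S) \<inter> K = em ` (S \<inter> M) \<inter> K"
		proof -
			have "F \<inter> K = {}" using FFOm(2)[OF that(1)] MI by (auto simp: K_def I_def)
			moreover have "em ` S \<inter> K = em ` (S \<inter> M)"
				unfolding K_def using inj MI SgI[OF that(2)] by (metis inj_on_image_Int)
			ultimately show ?thesis by auto
		qed
		ultimately show ?thesis using O W unfolding IK by metis
	qed
	define TT where "TT = {T\<in>Ind M. W (em ` T)}"
	have fM: "finite M" by (simp add: M_def)
	have fTT: "finite TT" by (simp add: TT_def fM)
	define y where "y = (%F T. hc_fix z (al F) (L - al' F) M T)"
	define Y where "Y = (%F. hc_sum z {al F..<L - al' F})"
	have grp: "(SUM S:Ind {al F..<L - al' F}. z ^ card S * of_bool (W (em ` (S \<inter> M)))) = (SUM T:TT. y F T)" for F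
	proof -
		let ?A = "{S\<in>Ind {al F..<L - al' F}. W (em ` (S \<inter> M))}"
		have "(SUM S:Ind {al F..<L - al' F}. z ^ card S * of_bool (W (em ` (S \<inter> M)))) = (SUM S:?A. z ^ card S)"
			by (rule sum.mono_neutral_cong_right) (use fin in auto)
		also have "... = (SUM T:TT. SUM S:{S\<in>?A. S \<inter> M = T}. z ^ card S)"
			by (rule sum.group[symmetric]) (use fTT fin in "auto simp: TT_def Ind_def")
		also have "... = (SUM T:TT. y F T)"
			unfolding y_def hc_fix_def by (intro sum.cong) (auto simp: TT_def)
		finally show ?thesis .
	qed
	define NE where "NE = {F\<in>FF. E F}"
	have fNE: "finite NE" "NE <= FF" using fin by (auto simp: NE_def)
	have NEW: "(SUM D:Om. z ^ card D * of_bool (E D & W D)) = (SUM F:NE. SUM T:TT. z ^ card F * y F T)"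
	proof -
		have "(SUM D:Om. z ^ card D * of_bool (E D & W D)) = (SUM F:FF. SUM S:Ind {al F..<L - al' F}. z ^ card F * of_bool (E F) * (z ^ card S * of_bool (W (em ` (S \<inter> M)))))"
			unfolding expand by (intro sum.cong) (auto simp: EF WS)
		also have "... = (SUM F:FF. z ^ card F * of_bool (E F) * (SUM T:TT. y F T))"
			by (simp add: grp flip: sum_distrib_left)
		also have "... = (SUM F:NE. z ^ card F * (SUM T:TT. y F T))"
			by (rule sum.mono_neutral_cong_right) (use fin in "auto simp: NE_def")
		finally show ?thesis by (simp add: sum_distrib_left)
	qed
	have NEs: "(SUM D:Om. z ^ card D * of_bool (E D)) = (SUM F:NE. z ^ card F * Y F)"
	proof -
		have "(SUM D:Om. z ^ card D * of_bool (E D)) = (SUM F:FF. SUM S:Ind {al F..<L - al' F}. z ^ card F * of_bool (E F) * z ^ card S)"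
			unfolding expand by (intro sum.cong) (auto simp: EF)
		also have "... = (SUM F:FF. z ^ card F * of_bool (E F) * Y F)"
			by (simp add: Y_def hc_sum_def flip: sum_distrib_left)
		also have "... = (SUM F:NE. z ^ card F * Y F)"
			by (rule sum.mono_neutral_cong_right) (use fin in "auto simp: NE_def")
		finally show ?thesis .
	qed
	have NWs: "(SUM D:Om. z ^ card D * of_bool (W D)) = (SUM F:FF. SUM T:TT. z ^ card F * y F T)"
	proof -
		have "(SUM D:Om. z ^ card D * of_bool (W D)) = (SUM F:FF. SUM S:Ind {al F..<L - al' F}. z ^ card F * (z ^ card S * of_bool (W (em ` (S \<inter> M)))))"
			unfolding expand by (intro sum.cong) (auto simp: WS)
		also have "... = (SUM F:FF. z ^ card F * (SUM T:TT. y F T))"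
			by (simp add: grp flip: sum_distrib_left)
		finally show ?thesis by (simp add: sum_distrib_left)
	qed
	have Zts: "Zt = (SUM F:FF. z ^ card F * Y F)"
	proof -
		have "Zt = (SUM F:FF. SUM S:Ind {al F..<L - al' F}. z ^ card F * z ^ card S)"
			unfolding Zt_def using expand[of "%_. 1"] by simp
		thus ?thesis by (simp add: Y_def hc_sum_def flip: sum_distrib_left)
	qed
	have cross: "y F T * Y F' <= mixf z r * (y F' T * Y F)" if "T \<in> TT" for F F' T
		unfolding y_def Y_def M_def L_def
		by (rule hc_cross) (use that z_pos r len in "auto simp: TT_def M_def al_def al'_def")
	\<comment> \<open>The claim is cleared of denominators. On both sides one sums over an outer part
	  \<open>F\<close> that satisfies \<open>E\<close>, an arbitrary outer part \<open>F'\<close> and a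
	  window pattern that satisfies \<open>W\<close>; \<open>hc_cross\<close> moves the pattern from
	  \<open>F\<close> to \<open>F'\<close>.\<close>
	have "(SUM F:NE. SUM T:TT. z ^ card F * y F T) * (SUM F:FF. z ^ card F * Y F)
			= (SUM F:NE. SUM T:TT. SUM F':FF. z ^ card F * z ^ card F' * (y F T * Y F'))"
		by (simp add: sum_product sum_distrib_left sum_distrib_right algebra_simps)
	also have "... <= (SUM F:NE. SUM T:TT. SUM F':FF. z ^ card F * z ^ card F' * (mixf z r * (y F' T * Y F)))"
		using cross z_pos by (intro sum_mono mult_left_mono) auto
	also have "... = mixf z r * ((SUM F:NE. z ^ card F * Y F) * (SUM T:TT. SUM F':FF. z ^ card F' * y F' T))"
	proof -
		define G where "G = (SUM T:TT. SUM F':FF. z ^ card F' * y F' T)"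
		have "(SUM T:TT. SUM F':FF. z ^ card F * z ^ card F' * (mixf z r * (y F' T * Y F))) = mixf z r * (z ^ card F * Y F) * G" for F
			unfolding G_def by (simp add: sum_distrib_left algebra_simps)
		thus ?thesis unfolding G_def[symmetric] by (simp add: sum_distrib_left sum_distrib_right algebra_simps)
	qed
	also have "(SUM T:TT. SUM F':FF. z ^ card F' * y F' T) = (SUM F':FF. SUM T:TT. z ^ card F' * y F' T)"
		by (rule sum.swap)
	finally have "(SUM D:Om. z ^ card D * of_bool (E D & W D)) * Zt
			<= mixf z r * ((SUM D:Om. z ^ card D * of_bool (E D)) * (SUM D:Om. z ^ card D * of_bool (W D)))"
		unfolding NEW NEs NWs Zts .
	thus ?thesis unfolding Pr_def Ex_def using Zt_pos
		by (simp add: field_simps)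
qed

end

section \<open>The permutation encoded by a configuration\<close>

context hc begin

definition phi :: "(int \<times> int) set => int \<times> int => int" where
	"phi D x = (if x ~: Tor then 0 else if x \<in> D then 1 else if sh x (-1) \<in> D then -1 else 0)"

definition Phi :: "(int \<times> int) set => int \<times> int => int \<times> int" where
	"Phi D = shift_map n m (phi D)"

lemma phi_cases: "phi D x = 0 | phi D x = 1 | phi D x = -1" by (auto simp: phi_def)

lemma phi_abs: "\<bar>phi D x\<bar> <= 1" by (auto simp: phi_def)

lemma phi_1: "D \<in> Om ==> phi D x = 1 \<longleftrightarrow> x \<in> D"
	using Om_torus by (auto simp: phi_def)

lemma phi_m1: "D \<in> Om ==> x \<in> Tor ==> phi D x = -1 \<longleftrightarrow> sh x (-1) \<in> D"
	using Om_sh[of D "sh x (-1)"] by (auto simp: phi_def)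

lemma phi_0: "D \<in> Om ==> x \<in> Tor ==> phi D x = 0 \<longleftrightarrow> x ~: D & sh x (-1) ~: D"
	by (auto simp: phi_def)

lemma phi_local: "(x \<in> D \<longleftrightarrow> x \<in> D') ==> (sh x (-1) \<in> D \<longleftrightarrow> sh x (-1) \<in> D') ==> phi D x = phi D' x"
	by (auto simp: phi_def)

text \<open>\<open>Phi D\<close> is this involution, which exchanges the pairs given by
  \<open>D\<close>, followed by the fixed rotation \<open>rt\<close>; its injectivity thus reduces
  to that of \<open>rt\<close>.\<close>

definition mv :: "(int \<times> int) set => int \<times> int => int \<times> int" where "mv D x = sh x (phi D x)"

lemma phi_mv: "D \<in> Om ==> x \<in> Tor ==> phi D (mv D x) = - phi D x"
proof -
	assume D: "D \<in> Om" and x: "x \<in> Tor"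
	consider "phi D x = 0" | "phi D x = 1" | "phi D x = -1" using phi_cases by blast
	thus ?thesis
	proof cases
		case 1 thus ?thesis using x by (simp add: mv_def)
	next
		case 2
		hence "x \<in> D" using phi_1 D by auto
		hence "phi D (sh x 1) = -1" using phi_m1[OF D, of "sh x 1"] x by simp
		thus ?thesis using 2 by (simp add: mv_def)
	next
		case 3
		hence "sh x (-1) \<in> D" using phi_m1 D x by auto
		thus ?thesis using 3 phi_1[OF D, of "sh x (-1)"] by (simp add: mv_def)
	qed
qed

lemma mv_mv: "D \<in> Om ==> x \<in> Tor ==> mv D (mv D x) = x"
	using phi_mv[of D x] unfolding mv_def by simp

lemma mv_torus: "x \<in> Tor ==> mv D x \<in> Tor" by (simp add: mv_def)

definition rt :: "int \<times> int => int \<times> int" where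
	"rt x = ((fst x + 1) mod int n, (snd x + 1) mod int m)"

lemma rt_torus: "rt x \<in> Tor" using n_pos m_pos by (auto simp: rt_def torus_def)

lemma rt_inj: "inj_on rt Tor"
proof (rule inj_on_inverseI[where g="%y. ((fst y - 1) mod int n, (snd y - 1) mod int m)"])
	fix x assume x: "x \<in> Tor"
	have "(fst (rt x) - 1) mod int n = fst x mod int n" unfolding rt_def by (simp add: mod_simps)
	moreover have "(snd (rt x) - 1) mod int m = snd x mod int m" unfolding rt_def by (simp add: mod_simps)
	ultimately show "((fst (rt x) - 1) mod int n, (snd (rt x) - 1) mod int m) = x"
		using x by (cases x) (auto simp: torus_def)
qed

abbreviation pos :: "(int \<times> int) set => nat => int \<times> int => int \<times> int" where
	"pos D t v == (Phi D ^^ t) v"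

lemma Phi_eq: "x \<in> Tor ==> Phi D x = rt (mv D x)"
	by (simp add: Phi_def shift_map_def mv_def rt_def sh_def mod_simps algebra_simps)

lemma Phi_out: "x ~: Tor ==> Phi D x = x"
	by (simp add: Phi_def shift_map_def)

lemma Phi_torus: "x \<in> Tor ==> Phi D x \<in> Tor"
	using Phi_eq rt_torus by simp

lemma Phi_permutes: "D \<in> Om ==> Phi D permutes Tor"
proof -
	assume D: "D \<in> Om"
	have inj: "inj_on (Phi D) Tor"
	proof (rule inj_onI)
		fix x y assume xy: "x \<in> Tor" "y \<in> Tor" "Phi D x = Phi D y"
		hence "rt (mv D x) = rt (mv D y)" by (simp add: Phi_eq)
		hence "mv D x = mv D y" using rt_inj mv_torus xy by (auto simp: inj_on_def)
		thus "x = y" using mv_mv[OF D] xy by metis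
	qed
	have "Phi D ` Tor = Tor"
		using Phi_torus by (intro endo_inj_surj inj) auto
	hence "bij_betw (Phi D) Tor Tor" using inj by (simp add: bij_betw_def)
	thus ?thesis using Phi_out by (intro bij_imp_permutes) auto
qed

subsection \<open>Local modifications\<close>

text \<open>A change of configuration that is injective and alters all weights by the same factor
  compares two probabilities at the price of that factor.\<close>

lemma Pr_transport:
	assumes c: "c >= 0" and f: "!!D. D \<in> Om ==> P D ==> f D \<in> Om & Q (f D) & z ^ card D = c * z ^ card (f D)"
		and inj: "inj_on f {D\<in>Om. P D}"
	shows "Pr P <= c * Pr Q"
proof -
	have "(SUM D:Om. z ^ card D * of_bool (P D)) = (SUM D:{D\<in>Om. P D}. z ^ card D)"
		by (rule sum.mono_neutral_cong_right) auto
	also have "... = (SUM D:{D\<in>Om. P D}. c * z ^ card (f D))"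
		by (rule sum.cong) (use f in auto)
	also have "... = c * (SUM D:f ` {D\<in>Om. P D}. z ^ card D)"
		using inj by (simp add: sum.reindex sum_distrib_left)
	also have "... <= c * (SUM D:{D\<in>Om. Q D}. z ^ card D)"
		using c f z_pos by (intro mult_left_mono sum_mono2) auto
	also have "(SUM D:{D\<in>Om. Q D}. z ^ card D) = (SUM D:Om. z ^ card D * of_bool (Q D))"
		by (rule sum.mono_neutral_cong_left) auto
	finally show ?thesis unfolding Pr_def Ex_def using Zt_pos by (simp add: field_simps)
qed

lemma inj_on_remove: "(!!D. D \<in> S ==> a \<in> D) ==> inj_on (%D. D - {a}) S"
	by (rule inj_on_inverseI[where g="insert a"]) auto

lemma card_insert_Om: "D \<in> Om ==> x ~: D ==> z ^ card (insert x D) = z * z ^ card D"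
	using finite_Om_el by simp

lemma card_remove_Om: "D \<in> Om ==> x \<in> D ==> z ^ card D = z * z ^ card (D - {x})"
	using finite_Om_el[of D] by (metis card_Suc_Diff1 power_Suc)

lemma Om_insert:
	assumes D: "D \<in> Om" and x: "x \<in> Tor" and "sh x 1 ~: D" "sh x (-1) ~: D"
	shows "insert x D \<in> Om"
	unfolding Om_def
proof (intro CollectI conjI ballI)
	show "insert x D <= Tor" using D x by (auto simp: Om_def)
	fix y assume y: "y \<in> insert x D"
	have "sh x 1 ~= x" using x m_ge by (simp add: sh_eq_iff') 
	moreover have "sh y 1 ~= x" if "y \<in> D"
	proof
		assume "sh y 1 = x"
		hence "sh x (-1) = sh y 0" by auto
		hence "sh x (-1) = y" using that Om_torus[OF D] by simp
		thus False using that assms(4) by simp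
	qed
	ultimately show "sh y 1 ~: insert x D" using y assms(3) Om_sh[OF D, of y] by (cases "y = x") simp_all
qed

text \<open>The denominator adds up the costs in \<open>Pr_phi_neq\<close>: 1 for the event itself,
  \<open>z\<close> for each of two removals, \<open>1 / z\<close> for an insertion and 1 for a
  slide.\<close>

definition vv :: real where "vv = 1 / (2 * z + 1 / z + 2)"

lemma vv_pos: "vv > 0" using z_pos by (simp add: vv_def add_pos_pos)

text \<open>Wherever the two steps agree, one local change near \<open>A\<close> makes them differ.
  The resulting bound depends on \<open>z\<close> alone, so it is uniform in the positions and in
  the size of the torus.\<close>

lemma Pr_phi_neq:
	assumes A: "A \<in> Tor" and B: "B \<in> Tor" and AB: "A ~= B"
	shows "Pr (%D. phi D A ~= phi D B) >= vv"
proof -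
	define R where "R = Pr (%D. phi D A ~= phi D B)"
	have 1: "Pr (%D. phi D A = phi D B & A \<in> D) <= z * R"
		unfolding R_def
	proof (rule Pr_transport[where f="%D. D - {A}"])
		fix D assume D: "D \<in> Om" and P: "phi D A = phi D B & A \<in> D"
		have O: "D - {A} \<in> Om" using D by (rule Om_subset) auto
		have "B \<in> D" using P D phi_1 by metis
		hence "phi (D - {A}) B = 1" using AB phi_1[OF O] by auto
		moreover have "phi (D - {A}) A ~= 1" using phi_1[OF O] by auto
		moreover have "z ^ card D = z * z ^ card (D - {A})"
			using card_remove_Om[OF D, of A] P by blast
		ultimately show "D - {A} \<in> Om & phi (D - {A}) A ~= phi (D - {A}) B & z ^ card D = z * z ^ card (D - {A})"
			using O by auto
	qed (use z_pos in "auto intro!: inj_on_remove")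
	have 2: "Pr (%D. phi D A = phi D B & sh A (-1) \<in> D) <= z * R"
		unfolding R_def
	proof (rule Pr_transport[where f="%D. D - {sh A (-1)}"])
		fix D assume D: "D \<in> Om" and P: "phi D A = phi D B & sh A (-1) \<in> D"
		let ?E = "D - {sh A (-1)}"
		have O: "?E \<in> Om" using D by (rule Om_subset) auto
		have "sh B (-1) \<in> D" using P phi_m1[OF D A] phi_m1[OF D B] by auto
		moreover have "sh B (-1) ~= sh A (-1)"
		proof
			assume "sh B (-1) = sh A (-1)"
			hence "sh (sh B (-1)) 1 = sh (sh A (-1)) 1" by simp
			thus False using AB A B by simp
		qed
		ultimately have "phi ?E B = -1" using phi_m1[OF O B] by auto
		moreover have "phi ?E A ~= -1" using phi_m1[OF O A] by auto
		moreover have "z ^ card D = z * z ^ card ?E"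
			using card_remove_Om[OF D, of "sh A (-1)"] P by blast
		ultimately show "?E \<in> Om & phi ?E A ~= phi ?E B & z ^ card D = z * z ^ card ?E"
			using O by auto
	qed (use z_pos in "auto intro!: inj_on_remove")
	have 3: "Pr (%D. (phi D A = 0 & phi D B = 0) & sh A 1 ~: D) <= 1 / z * R"
		unfolding R_def
	proof (rule Pr_transport[where f="%D. insert A D"])
		fix D assume D: "D \<in> Om" and P: "(phi D A = 0 & phi D B = 0) & sh A 1 ~: D"
		have a: "A ~: D" "sh A (-1) ~: D" "B ~: D" using P phi_0[OF D] A B by auto
		have O: "insert A D \<in> Om" using Om_insert D A P a by auto
		have "phi (insert A D) A = 1" using phi_1[OF O] by auto
		moreover have "phi (insert A D) B ~= 1" using phi_1[OF O] AB a by auto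
		moreover have "z ^ card D = 1 / z * z ^ card (insert A D)"
			using card_insert_Om[OF D a(1)] z_pos by simp
		ultimately show "insert A D \<in> Om & phi (insert A D) A ~= phi (insert A D) B & z ^ card D = 1 / z * z ^ card (insert A D)"
			using O by auto
	next
		show "inj_on (insert A) {D \<in> Om. (phi D A = 0 & phi D B = 0) & sh A 1 ~: D}"
		proof (rule inj_onI)
			fix D E assume "D \<in> {D \<in> Om. (phi D A = 0 & phi D B = 0) & sh A 1 ~: D}"
				"E \<in> {D \<in> Om. (phi D A = 0 & phi D B = 0) & sh A 1 ~: D}" "insert A D = insert A E"
			moreover from this have "A ~: D" "A ~: E" using phi_0[OF _ A] by auto
			ultimately show "D = E" by (metis insert_ident)
		qed
	qed (use z_pos in auto)
	\<comment> \<open>If the site above \<open>A\<close> is occupied, \<open>A\<close> cannot be added;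
	  moving that element down to \<open>A\<close> preserves the weight.\<close>
	have 4: "Pr (%D. (phi D A = 0 & phi D B = 0) & sh A 1 \<in> D) <= 1 * R"
		unfolding R_def
	proof (rule Pr_transport[where f="%D. insert A (D - {sh A 1})"])
		fix D assume D: "D \<in> Om" and P: "(phi D A = 0 & phi D B = 0) & sh A 1 \<in> D"
		let ?E = "D - {sh A 1}"
		have O: "?E \<in> Om" using D by (rule Om_subset) auto
		have a: "A ~: D" "sh A (-1) ~: D" "B ~: D" using P phi_0[OF D] A B by auto
		have O': "insert A ?E \<in> Om" using Om_insert[OF O A] a by auto
		have "phi (insert A ?E) A = 1" using phi_1[OF O'] by auto
		moreover have "phi (insert A ?E) B ~= 1" using phi_1[OF O'] AB a by auto
		moreover have "z ^ card D = z * z ^ card ?E"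
			using card_remove_Om[OF D, of "sh A 1"] P by blast
		moreover have "z ^ card (insert A ?E) = z * z ^ card ?E"
			using card_insert_Om[OF O, of A] a by auto
		ultimately show "insert A ?E \<in> Om & phi (insert A ?E) A ~= phi (insert A ?E) B & z ^ card D = 1 * z ^ card (insert A ?E)"
			using O' by auto
	next
		show "inj_on (%D. insert A (D - {sh A 1})) {D \<in> Om. (phi D A = 0 & phi D B = 0) & sh A 1 \<in> D}"
		proof (rule inj_onI)
			fix D E assume D: "D \<in> {D \<in> Om. (phi D A = 0 & phi D B = 0) & sh A 1 \<in> D}"
				and E: "E \<in> {D \<in> Om. (phi D A = 0 & phi D B = 0) & sh A 1 \<in> D}"
				and e: "insert A (D - {sh A 1}) = insert A (E - {sh A 1})"
			have "A ~: D" "A ~: E" using D E phi_0[OF _ A] by auto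
			hence "D - {sh A 1} = E - {sh A 1}" using e insert_ident[of A "D - {sh A 1}" "E - {sh A 1}"] by simp
			thus "D = E" using D E by blast
		qed
	qed auto
	have "1 = Pr (%D. True)" by (simp add: Pr_def)
	also have "... <= Pr (%D. phi D A ~= phi D B | ((phi D A = phi D B & A \<in> D) | ((phi D A = phi D B & sh A (-1) \<in> D) |
			(((phi D A = 0 & phi D B = 0) & sh A 1 ~: D) | ((phi D A = 0 & phi D B = 0) & sh A 1 \<in> D)))))"
		by (rule Pr_mono) (use phi_0 A in metis)
	also have "... <= R + (z * R + (z * R + (1 / z * R + 1 * R)))"
		by (intro order_trans[OF Pr_or] add_mono 1 2 3 4) (simp add: R_def)
	also have "... = (2 * z + 1 / z + 2) * R" by (simp add: algebra_simps)
	finally show ?thesis using z_pos unfolding R_def[symmetric] vv_def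
		by (simp add: divide_le_eq add_pos_pos mult.commute)
qed

text \<open>Translating all columns by one site preserves the weights, so a site is as often the
  lower as the upper element of an exchanged pair.\<close>

lemma Ex_phi:
	assumes x: "x \<in> Tor"
	shows "Ex (%D. ri (phi D x)) = 0"
proof -
	let ?t = "%x. sh x 1" and ?t' = "%x. sh x (-1)"
	have tt: "?t ` ?t' ` D = D" "?t' ` ?t ` D = D" if "D <= Tor" for D
	proof -
		have "(%x. sh x 0) ` D = id ` D" using that by (intro image_cong) auto
		thus "?t ` ?t' ` D = D" "?t' ` ?t ` D = D" by (simp_all add: image_image)
	qed
	have injt: "inj_on (%x. sh x d) Tor" for d
		by (rule inj_on_inverseI[where g="%x. sh x (-d)"]) auto
	have tOm: "(%x. sh x d) ` D \<in> Om" if D: "D \<in> Om" for D d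
		unfolding Om_def
	proof (intro CollectI conjI ballI)
		show "(%x. sh x d) ` D <= Tor" using D by (auto simp: Om_def)
		fix y assume "y \<in> (%x. sh x d) ` D"
		then obtain u where u: "u \<in> D" "y = sh u d" by auto
		show "sh y 1 ~: (%x. sh x d) ` D"
		proof
			assume "sh y 1 \<in> (%x. sh x d) ` D"
			then obtain v where v: "v \<in> D" "sh y 1 = sh v d" by auto
			hence "sh (sh u 1) d = sh v d" using u by (simp add: add.commute)
			hence "sh u 1 = v" using injt[of d] u v Om_torus[OF D] by (auto simp: inj_on_def)
			thus False using Om_sh[OF D u(1)] v by simp
		qed
	qed
	have "(SUM D:Om. z ^ card D * of_bool (x \<in> D)) = (SUM D:Om. z ^ card D * of_bool (?t' x \<in> D))"
	proof (rule sum.reindex_bij_witness[where i="(`) ?t" and j="(`) ?t'"])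
		fix D assume D: "D \<in> Om"
		hence sub: "D <= Tor" by (auto simp: Om_def)
		show "?t ` ?t' ` D = D" "?t' ` ?t ` D = D" using tt sub by auto
		show "?t ` D \<in> Om" "?t' ` D \<in> Om" using tOm D by auto
		have "card (?t' ` D) = card D" using injt sub by (meson card_image inj_on_subset)
		moreover have "?t' x \<in> ?t' ` D \<longleftrightarrow> x \<in> D" using inj_on_image_mem_iff[OF injt x sub] by simp
		ultimately show "z ^ card (?t' ` D) * of_bool (?t' x \<in> ?t' ` D) = z ^ card D * of_bool (x \<in> D)" by simp
	qed
	hence "Pr (%D. x \<in> D) = Pr (%D. ?t' x \<in> D)" by (simp add: Pr_def Ex_def)
	moreover have "Ex (%D. ri (phi D x)) = Ex (%D. of_bool (x \<in> D) - of_bool (?t' x \<in> D))"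
	proof (rule Ex_cong)
		fix D assume D: "D \<in> Om"
		show "ri (phi D x) = of_bool (x \<in> D) - of_bool (?t' x \<in> D)"
			using x Om_sh[OF D, of "?t' x"] by (auto simp: phi_def)
	qed
	ultimately show ?thesis by (simp add: Ex_diff Pr_def)
qed

lemma Ex_phi_diff_sq:
	assumes A: "A \<in> Tor" and B: "B \<in> Tor" and AB: "A ~= B"
	shows "Ex (%D. (ri (phi D B - phi D A))\<^sup>2) >= vv"
proof -
	have "Pr (%D. phi D A ~= phi D B) <= Ex (%D. (ri (phi D B - phi D A))\<^sup>2)"
		unfolding Pr_def
	proof (rule Ex_mono)
		fix D
		show "of_bool (phi D A ~= phi D B) <= (ri (phi D B - phi D A))\<^sup>2"
		proof (cases "phi D A = phi D B")
			case False
			hence "(1::int) <= \<bar>phi D B - phi D A\<bar>" by linarith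
			hence "1 <= \<bar>ri (phi D B - phi D A)\<bar>" by linarith
			hence "1\<^sup>2 <= \<bar>ri (phi D B - phi D A)\<bar>\<^sup>2" by (intro power_mono) auto
			thus ?thesis using False by simp
		qed simp
	qed
	thus ?thesis using Pr_phi_neq[OF assms] by linarith
qed

definition nb :: "int \<times> int => int => int => (int \<times> int) set" where
	"nb A g R = (%i. sh A i) ` {- R..g + R}"

text \<open>A step depends on its site and on the site below, so the two steps are functions of the
  sites from one below \<open>A\<close> up to \<open>sh A g\<close>. The window therefore has
  \<open>g + 2\<close> sites, with a margin of \<open>r\<close> sites on each side.\<close>

lemma QI2:
	assumes A: "A \<in> Tor" and g: "0 <= g" and r: "r >= 2" and m: "2 * int r + g + 3 <= int m"
		and E: "!!D D'. D \<in> Om ==> D' \<in> Om ==> D - nb A g (int r + 1) = D' - nb A g (int r + 1) ==> E D ==> E D'"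
	shows "Pr (%D. E D & Q (phi D A) (phi D (sh A g))) <= mixf z r * (Pr E * Pr (%D. Q (phi D A) (phi D (sh A g))))"
proof -
	define p where "p = sh A (- int r - 1)"
	define len where "len = nat (g + 2)"
	have p: "p \<in> Tor" using A by (simp add: p_def)
	have len: "len > 0" "2 * r + len + 1 <= m" using g m by (auto simp: len_def)
	show ?thesis
	proof (rule quasi_independence[OF p r len])
		fix D D' assume D: "D \<in> Om" "D' \<in> Om"
			"D - (%i. sh p (int i)) ` {0..<2*r+len} = D' - (%i. sh p (int i)) ` {0..<2*r+len}" "E D"
		have "(%i. sh p (int i)) ` {0..<2*r+len} <= nb A g (int r + 1)"
		proof
			fix y assume "y \<in> (%i. sh p (int i)) ` {0..<2*r+len}"
			then obtain i where i: "i < 2*r+len" "y = sh p (int i)" by auto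
			hence "y = sh A (int i - int r - 1)" by (simp add: p_def algebra_simps)
			moreover have "int i - int r - 1 \<in> {- (int r + 1)..g + (int r + 1)}" using i g by (auto simp: len_def)
			ultimately show "y \<in> nb A g (int r + 1)" unfolding nb_def by blast
		qed
		hence "D - nb A g (int r + 1) = D' - nb A g (int r + 1)" using D(3) by blast
		thus "E D'" using E D by blast
	next
		fix D D' assume D: "D \<in> Om" "D' \<in> Om"
			"D \<inter> (%i. sh p (int i)) ` {r..<r+len} = D' \<inter> (%i. sh p (int i)) ` {r..<r+len}" "Q (phi D A) (phi D (sh A g))"
		have mem: "sh A j \<in> D \<longleftrightarrow> sh A j \<in> D'" if "-1 <= j" "j <= g" for j
		proof -
			have "sh A j = sh p (int (nat (j + 1 + int r)))" using that by (simp add: p_def algebra_simps)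
			moreover have "nat (j + 1 + int r) \<in> {r..<r+len}" using that g by (auto simp: len_def)
			ultimately have "sh A j \<in> (%i. sh p (int i)) ` {r..<r+len}" by blast
			thus ?thesis using D(3) by blast
		qed
		have "phi D A = phi D' A" using mem[of 0] mem[of "-1"] A g by (intro phi_local) auto
		moreover have "phi D (sh A g) = phi D' (sh A g)" using mem[of g] mem[of "g - 1"] g by (intro phi_local) auto
		ultimately show "Q (phi D' A) (phi D' (sh A g))" using D by simp
	qed
qed

lemma QI1:
	assumes A: "A \<in> Tor" and r: "r >= 2" and m: "2 * int r + 3 <= int m"
		and E: "!!D D'. D \<in> Om ==> D' \<in> Om ==> D - nb A 0 (int r + 1) = D' - nb A 0 (int r + 1) ==> E D ==> E D'"
	shows "Pr (%D. E D & Q (phi D A)) <= mixf z r * (Pr E * Pr (%D. Q (phi D A)))"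
	using QI2[OF A order_refl r _ E, where Q="%a b. Q a"] m by simp

end

section \<open>Trajectories\<close>

context hc begin

abbreviation U3 :: "int set" where "U3 == {-1, 0, 1}"

lemma phi_U3: "phi D x \<in> U3" using phi_cases[of D x] by auto

lemma Ex_law: "Ex (%D. f (phi D A) (phi D B)) = (SUM a:U3. SUM b:U3. Pr (%D. phi D A = a & phi D B = b) * f a b)"
proof -
	have "Ex (%D. f (phi D A) (phi D B)) = Ex (%D. SUM a:U3. SUM b:U3. of_bool (phi D A = a & phi D B = b) * f a b)"
	proof (rule Ex_cong)
		fix D
		show "f (phi D A) (phi D B) = (SUM a:U3. SUM b:U3. of_bool (phi D A = a & phi D B = b) * f a b)"
			using phi_cases[of D A] phi_cases[of D B] by auto
	qed
	thus ?thesis by (simp only: Ex_sum Ex_multc Pr_def)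
qed

lemma Ex_law1: "Ex (%D. f (phi D A)) = (SUM a:U3. Pr (%D. phi D A = a) * f a)"
proof -
	have "Ex (%D. f (phi D A)) = Ex (%D. SUM a:U3. of_bool (phi D A = a) * f a)"
	proof (rule Ex_cong)
		fix D
		show "f (phi D A) = (SUM a:U3. of_bool (phi D A = a) * f a)"
			using phi_cases[of D A] by auto
	qed
	thus ?thesis by (simp only: Ex_sum Ex_multc Pr_def)
qed

text \<open>One step of a Markov-type estimate, with conditioning replaced by a sum over the
  finitely many histories. Since \<open>W\<close> is nonnegative on live histories, an upper bound
  for the law of the next two steps suffices. The comparison law \<open>mu\<close> will be a product
  for distant walkers and a joint law for close ones.\<close>

lemma step_bound:
	fixes hist :: "(int \<times> int) set => 'h" and W mu :: "'h => int => int => real"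
	assumes kap: "kap >= 0"
		and W: "!!h a b. alive h ==> h \<in> hist ` Om ==> a \<in> U3 ==> b \<in> U3 ==> W h a b >= 0"
		and ineq: "!!h a b. alive h ==> h \<in> hist ` Om ==> a \<in> U3 ==> b \<in> U3 ==>
				Pr (%D. hist D = h & phi D (pA h) = a & phi D (pB h) = b) <= kap * (Pr (%D. hist D = h) * mu h a b)"
		and w: "!!h. alive h ==> h \<in> hist ` Om ==> (SUM a:U3. SUM b:U3. mu h a b * W h a b) <= w h"
	shows "Ex (%D. of_bool (alive (hist D)) * W (hist D) (phi D (pA (hist D))) (phi D (pB (hist D))))
			<= kap * Ex (%D. of_bool (alive (hist D)) * w (hist D))"
proof -
	let ?H = "hist ` Om"
	have fin: "finite ?H" by simp
	have L: "Ex (%D. of_bool (alive (hist D)) * W (hist D) (phi D (pA (hist D))) (phi D (pB (hist D))))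
			= (SUM h:?H. of_bool (alive h) * (SUM a:U3. SUM b:U3. W h a b * Pr (%D. hist D = h & phi D (pA h) = a & phi D (pB h) = b)))"
		(is "Ex ?f = _")
	proof -
		have "Ex ?f = (SUM h:?H. Ex (%D. ?f D * of_bool (hist D = h)))"
			by (rule Ex_partition) auto
		also have "... = (SUM h:?H. of_bool (alive h) * (SUM a:U3. SUM b:U3. W h a b * Pr (%D. hist D = h & phi D (pA h) = a & phi D (pB h) = b)))"
		proof (rule sum.cong[OF refl])
			fix h
			have "Ex (%D. ?f D * of_bool (hist D = h)) = Ex (%D. of_bool (alive h) * (SUM a:U3. SUM b:U3. W h a b * of_bool (hist D = h & phi D (pA h) = a & phi D (pB h) = b)))"
			proof (rule Ex_cong)
				fix D
				show "?f D * of_bool (hist D = h) = of_bool (alive h) * (SUM a:U3. SUM b:U3. W h a b * of_bool (hist D = h & phi D (pA h) = a & phi D (pB h) = b))"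
					using phi_cases[of D "pA h"] phi_cases[of D "pB h"] by auto
			qed
			thus "Ex (%D. ?f D * of_bool (hist D = h)) = of_bool (alive h) * (SUM a:U3. SUM b:U3. W h a b * Pr (%D. hist D = h & phi D (pA h) = a & phi D (pB h) = b))"
				by (simp only: Ex_cmult Ex_sum Pr_def)
		qed
		finally show ?thesis .
	qed
	have R: "Ex (%D. of_bool (alive (hist D)) * w (hist D)) = (SUM h:?H. of_bool (alive h) * (w h * Pr (%D. hist D = h)))"
		(is "Ex ?f = _")
	proof -
		have "Ex ?f = (SUM h:?H. Ex (%D. ?f D * of_bool (hist D = h)))"
			by (rule Ex_partition) auto
		also have "... = (SUM h:?H. of_bool (alive h) * (w h * Pr (%D. hist D = h)))"
		proof (rule sum.cong[OF refl])
			fix h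
			have "Ex (%D. ?f D * of_bool (hist D = h)) = Ex (%D. (of_bool (alive h) * w h) * of_bool (hist D = h))"
				by (rule Ex_cong) auto
			thus "Ex (%D. ?f D * of_bool (hist D = h)) = of_bool (alive h) * (w h * Pr (%D. hist D = h))"
				by (simp only: Ex_cmult Pr_def mult.assoc)
		qed
		finally show ?thesis .
	qed
	show ?thesis unfolding L R sum_distrib_left[of kap]
	proof (rule sum_mono)
		fix h assume h: "h \<in> ?H"
		show "of_bool (alive h) * (SUM a:U3. SUM b:U3. W h a b * Pr (%D. hist D = h & phi D (pA h) = a & phi D (pB h) = b))
			<= kap * (of_bool (alive h) * (w h * Pr (%D. hist D = h)))"
		proof (cases "alive h")
			case True
			have "(SUM a:U3. SUM b:U3. W h a b * Pr (%D. hist D = h & phi D (pA h) = a & phi D (pB h) = b))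
					<= (SUM a:U3. SUM b:U3. W h a b * (kap * (Pr (%D. hist D = h) * mu h a b)))"
				using True h W ineq by (intro sum_mono mult_left_mono) blast+
			also have "... = kap * Pr (%D. hist D = h) * (SUM a:U3. SUM b:U3. mu h a b * W h a b)"
				by (simp add: sum_distrib_left algebra_simps)
			also have "... <= kap * Pr (%D. hist D = h) * w h"
				using w[OF True h] kap by (intro mult_left_mono) auto
			finally show ?thesis using True by (simp add: algebra_simps)
		qed simp
	qed
qed

text \<open>The linear term vanishes by \<open>Ex_phi\<close>, and the quadratic one is at least
  \<open>vv\<close>; only half of it is kept, to share the constant of
  \<open>drift_product\<close>.\<close>

lemma drift_joint:
	assumes A: "A \<in> Tor" and B: "B \<in> Tor" and AB: "A ~= B"
	shows "(SUM a:U3. SUM b:U3. Pr (%D. phi D A = a & phi D B = b) * (V + alp * of_int (b - a) - (of_int (b - a))\<^sup>2)) <= V - vv / 2"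
proof -
	have "(SUM a:U3. SUM b:U3. Pr (%D. phi D A = a & phi D B = b) * (V + alp * of_int (b - a) - (of_int (b - a))\<^sup>2))
			= Ex (%D. V + alp * of_int (phi D B - phi D A) - (of_int (phi D B - phi D A))\<^sup>2)"
		using Ex_law[of "%a b. V + alp * of_int (b - a) - (of_int (b - a))\<^sup>2" A B] by simp
	also have "... = V + alp * (Ex (%D. of_int (phi D B)) - Ex (%D. of_int (phi D A))) - Ex (%D. (of_int (phi D B - phi D A))\<^sup>2)"
		by (simp only: Ex_add Ex_diff Ex_cmult Ex_const of_int_diff)
	also have "... <= V - vv / 2"
		using Ex_phi_diff_sq[OF assms] Ex_phi[OF A] Ex_phi[OF B] vv_pos by simp
	finally show ?thesis .
qed

text \<open>For independent centred steps the mixed term vanishes. The inequality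
  \<open>(b - a)\<^sup>2 <= 2 * a\<^sup>2 + 2 * b\<^sup>2\<close> bounds the sum of the second
  moments from below by half of the joint moment, whence the factor 1/2.\<close>

lemma drift_product:
	assumes A: "A \<in> Tor" and B: "B \<in> Tor" and AB: "A ~= B"
	shows "(SUM a:U3. SUM b:U3. (Pr (%D. phi D A = a) * Pr (%D. phi D B = b)) * (V + alp * of_int (b - a) - (of_int (b - a))\<^sup>2)) <= V - vv / 2"
proof -
	define f where "f = (%a. Pr (%D. phi D A = a))"
	define g where "g = (%a. Pr (%D. phi D B = a))"
	have f: "(SUM a:U3. f a) = 1" "(SUM a:U3. f a * of_int a) = 0" "(SUM a:U3. f a * (of_int a)\<^sup>2) = Ex (%D. (of_int (phi D A))\<^sup>2)"
		using Ex_law1[of "%_. 1" A] Ex_law1[of "of_int" A] Ex_law1[of "%a. (of_int a)\<^sup>2" A] Ex_phi[OF A] unfolding f_def by simp_all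
	have g: "(SUM a:U3. g a) = 1" "(SUM a:U3. g a * of_int a) = 0" "(SUM a:U3. g a * (of_int a)\<^sup>2) = Ex (%D. (of_int (phi D B))\<^sup>2)"
		using Ex_law1[of "%_. 1" B] Ex_law1[of "of_int" B] Ex_law1[of "%a. (of_int a)\<^sup>2" B] Ex_phi[OF B] unfolding g_def by simp_all
	have "(SUM a:U3. SUM b:U3. (f a * g b) * (V + alp * of_int (b - a) - (of_int (b - a))\<^sup>2))
		= V * ((SUM a:U3. f a) * (SUM b:U3. g b)) + alp * ((SUM a:U3. f a) * (SUM b:U3. g b * of_int b) - (SUM a:U3. f a * of_int a) * (SUM b:U3. g b))
				- ((SUM a:U3. f a * (of_int a)\<^sup>2) * (SUM b:U3. g b) + (SUM a:U3. f a) * (SUM b:U3. g b * (of_int b)\<^sup>2)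
					- 2 * ((SUM a:U3. f a * of_int a) * (SUM b:U3. g b * of_int b)))"
		by (simp add: algebra_simps power2_eq_square)
	also have "... = V - (Ex (%D. (of_int (phi D A))\<^sup>2) + Ex (%D. (of_int (phi D B))\<^sup>2))"
		unfolding f g by simp
	also have "... <= V - vv / 2"
	proof -
		have "Ex (%D. (ri (phi D B - phi D A))\<^sup>2) <= Ex (%D. 2 * (of_int (phi D A))\<^sup>2 + 2 * (of_int (phi D B))\<^sup>2)"
		proof (rule Ex_mono)
			fix D
			have "0 <= (ri (phi D B) + ri (phi D A))\<^sup>2" by simp
			thus "(ri (phi D B - phi D A))\<^sup>2 <= 2 * (of_int (phi D A))\<^sup>2 + 2 * (of_int (phi D B))\<^sup>2"
				by (simp add: power2_eq_square algebra_simps)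
		qed
		thus ?thesis using Ex_phi_diff_sq[OF assms] by (simp add: Ex_add Ex_cmult)
	qed
	finally show ?thesis unfolding f_def g_def .
qed

section \<open>Positions and displacements of a walker\<close>

definition St :: "(int \<times> int) set => nat => int \<times> int => int" where
	"St D t v = (SUM s<t. phi D (pos D s v))"

lemma St_0 [simp]: "St D 0 v = 0" by (simp add: St_def)
lemma St_Suc: "St D (Suc t) v = St D t v + phi D (pos D t v)" by (simp add: St_def)

lemma St_add: "St D (s + t) v = St D s v + St D t (pos D s v)"
	by (induction t) (simp_all add: St_Suc add.commute[of _ s] flip: funpow_add[unfolded o_def, THEN fun_cong])

lemma walk_torus: "v \<in> Tor ==> pos D t v \<in> Tor"
	by (induction t) (auto simp: Phi_torus)

lemma Phi_expl: "v \<in> Tor ==> Phi D v = ((fst v + 1) mod int n, (snd v + phi D v + 1) mod int m)"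
	by (simp add: Phi_def shift_map_def)

text \<open>\<open>St\<close> is an integer and not a residue: it separates the random displacement
  from the deterministic rotation and keeps its size meaningful over several turns.\<close>

lemma walk_pos:
	assumes v: "v \<in> Tor"
	shows "pos D t v = ((fst v + int t) mod int n, (snd v + int t + St D t v) mod int m)"
proof (induction t)
	case 0 thus ?case using v by (cases v) (auto simp: torus_def)
next
	case (Suc t)
	have "pos D (Suc t) v = ((fst (pos D t v) + 1) mod int n, (snd (pos D t v) + phi D (pos D t v) + 1) mod int m)"
		using Phi_expl[OF walk_torus[OF v]] by simp
	moreover have "fst (pos D t v) = (fst v + int t) mod int n" "snd (pos D t v) = (snd v + int t + St D t v) mod int m"
		using Suc by simp_all
	ultimately have "pos D (Suc t) v = ((fst v + int t + 1) mod int n, (snd v + int t + St D t v + phi D (pos D t v) + 1) mod int m)"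
		by (simp only: mod_add_left_eq)  (simp only: mod_add_left_eq add.assoc)
	thus ?case by (simp add: St_Suc algebra_simps)
qed

lemma walk_sh:
	assumes v: "v \<in> Tor"
	shows "pos D t (sh v g) = sh (pos D t v) (g + St D t (sh v g) - St D t v)"
proof -
	define S where "S = St D t v"
	define S' where "S' = St D t (sh v g)"
	have "((snd v + g) mod int m + int t + S') mod int m = (snd v + g + int t + S') mod int m"
		by (simp only: mod_add_left_eq add.assoc)
	also have "... = ((snd v + int t + S) + (g + S' - S)) mod int m" by (simp add: algebra_simps)
	also have "... = ((snd v + int t + S) mod int m + (g + S' - S)) mod int m" by (simp only: mod_add_left_eq)
	finally show ?thesis
		unfolding walk_pos[OF v] walk_pos[OF sh_torus[OF v]] S_def[symmetric] S'_def[symmetric] by (simp add: sh_def)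
qed

lemma walk_inj:
	assumes D: "D \<in> Om" and "v \<in> Tor" "v' \<in> Tor" "pos D t v = pos D t v'"
	shows "v = v'"
proof -
	have "bij (Phi D ^^ t)" using Phi_permutes[OF D] permutes_bij bij_fn by blast
	thus ?thesis using assms(4) bij_is_inj injD by metis
qed

definition PA :: "int \<times> int => nat => (int \<times> int) set => (int \<times> int) list" where
	"PA v t D = map (%s. pos D s v) [0..<Suc t]"

lemma PA_nth: "s <= t ==> PA v t D ! s = pos D s v"
	unfolding PA_def by (simp del: upt_Suc)

lemma PA_length [simp]: "length (PA v t D) = Suc t" by (simp add: PA_def)

lemma PA_eq_iff: "PA v t D = PA v t D' \<longleftrightarrow> (ALL s<=t. pos D s v = pos D' s v)"
	unfolding PA_def by (auto simp del: upt_Suc)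

text \<open>A step depends only on its site and the site below. A change confined to
  \<open>X\<close> is thus invisible until the walker comes to \<open>X\<close> or just above
  it.\<close>

lemma walk_local:
	assumes v: "v \<in> Tor" and eq: "D - X = D' - X"
		and away: "!!s. s < t ==> pos D s v ~: X & sh (pos D s v) (-1) ~: X"
	shows "s <= t ==> pos D' s v = pos D s v"
proof (induction s)
	case (Suc s)
	hence e: "pos D' s v = pos D s v" by simp
	let ?x = "pos D s v"
	have "?x ~: X" "sh ?x (-1) ~: X" using away Suc by auto
	hence "phi D' ?x = phi D ?x" using eq by (intro phi_local) blast+
	hence "Phi D' ?x = Phi D ?x" using Phi_expl[OF walk_torus[OF v]] by simp
	thus ?case using e by simp
qed simp

lemma exp_quad: "\<bar>x\<bar> <= 1 ==> exp x <= 1 + x + x\<^sup>2" for x :: real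
proof (cases "x >= 0")
	case False
	assume "\<bar>x\<bar> <= 1"
	define y where "y = - x"
	have y: "0 <= y" "y <= 1" using False \<open>\<bar>x\<bar> <= 1\<close> by (auto simp: y_def)
	\<comment> \<open>The product is \<open>1 + y ^ 3\<close>.\<close>
	have "1 <= (1 + y) * (1 - y + y\<^sup>2)" using y by (simp add: algebra_simps power2_eq_square)
	also have "... <= exp y * (1 - y + y\<^sup>2)"
	proof (rule mult_right_mono)
		show "1 + y <= exp y" by (rule exp_ge_add_one_self)
		show "0 <= 1 - y + y\<^sup>2" using y zero_le_power2[of y] by linarith
	qed
	finally have "exp (- y) * 1 <= exp (- y) * (exp y * (1 - y + y\<^sup>2))" by (intro mult_left_mono) auto
	moreover have "exp (- y) * (exp y * (1 - y + y\<^sup>2)) = 1 - y + y\<^sup>2" by (simp add: exp_minus)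
	ultimately have "exp (- y) <= 1 - y + y\<^sup>2" by simp
	thus ?thesis by (simp add: y_def)
qed (use exp_bound[of x] in auto)

lemma Ex_exp_phi:
	assumes x: "x \<in> Tor" and a: "\<bar>alp\<bar> <= 1"
	shows "Ex (%D. exp (alp * of_int (phi D x))) <= exp (alp\<^sup>2)"
proof -
	have "Ex (%D. exp (alp * of_int (phi D x))) <= Ex (%D. 1 + alp * of_int (phi D x) + alp\<^sup>2)"
	proof (rule Ex_mono)
		fix D
		show "exp (alp * of_int (phi D x)) <= 1 + alp * of_int (phi D x) + alp\<^sup>2"
			using phi_cases[of D x] exp_quad[of alp] exp_quad[of "- alp"] a by auto
	qed
	also have "... = 1 + alp\<^sup>2" by (simp add: Ex_add Ex_cmult Ex_phi[OF x])
	also have "... <= exp (alp\<^sup>2)" by (metis add.commute exp_ge_add_one_self)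
	finally show ?thesis .
qed

lemma fst_nb: "y \<in> nb A g R ==> fst y = fst A" by (auto simp: nb_def)

text \<open>Every step raises the first coordinate by one, so repeating a column takes a multiple of
  \<open>n\<close> steps.\<close>

lemma column_differs:
	assumes v: "v \<in> Tor" and st: "s < t" "t - s < n"
	shows "fst (pos D s v) ~= fst (pos D t v)"
proof
	assume "fst (pos D s v) = fst (pos D t v)"
	hence "(fst v + int s) mod int n = (fst v + int t) mod int n" using walk_pos[OF v] by simp
	hence "int n dvd (fst v + int t) - (fst v + int s)" by (metis mod_eq_dvd_iff)
	hence "int n dvd int (t - s)" using st by simp
	thus False using st by (auto dest!: zdvd_imp_le)
qed

lemma mixf_ge1: assumes "r >= 1" shows "mixf z r >= 1"
proof -
	note tp = tht_props[OF z_pos]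
	have "tht z ^ r < 1" using tp assms by (simp add: power_less_one_iff)
	moreover have "tht z ^ r >= 0" using tp by simp
	ultimately have "(1 + tht z ^ r) / (1 - tht z ^ r) >= 1" by simp
	thus ?thesis unfolding mixf_def by (rule one_le_power)
qed

text \<open>During the first \<open>n\<close> steps no column is read twice, so the next step is
  nearly independent of the past and contributes a factor
  \<open>mixf z r * exp (alp\<^sup>2)\<close>.\<close>

lemma exp_moment:
	assumes v: "v \<in> Tor" and a: "\<bar>alp\<bar> <= 1" and r: "r >= 2" "2 * int r + 3 <= int m"
	shows "t <= n ==> Ex (%D. exp (alp * of_int (St D t v))) <= (mixf z r * exp (alp\<^sup>2)) ^ t"
proof (induction t)
	case (Suc t)
	\<comment> \<open>The displacement is recovered from the recorded positions: the steps in
	  \<open>U3\<close> are distinct modulo \<open>m\<close> because \<open>m >= 3\<close>, so it is a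
	  function of the history \<open>PA\<close>.\<close>
	define F where "F = (%h::(int \<times> int) list. exp (alp * of_int (SUM s<t. (THE k. k \<in> U3 & snd (h ! Suc s) = (snd (h ! s) + k + 1) mod int m))))"
	have Fx: "F (PA v t D) = exp (alp * of_int (St D t v))" if "D \<in> Om" for D
	proof -
		have "(THE k. k \<in> U3 & snd (PA v t D ! Suc s) = (snd (PA v t D ! s) + k + 1) mod int m) = phi D (pos D s v)" if s: "s < t" for s
		proof (rule the_equality)
			have e: "snd (PA v t D ! Suc s) = (snd (PA v t D ! s) + phi D (pos D s v) + 1) mod int m"
				using s Phi_expl[OF walk_torus[OF v], of D s] by (simp add: PA_nth)
			thus "phi D (pos D s v) \<in> U3 & snd (PA v t D ! Suc s) = (snd (PA v t D ! s) + phi D (pos D s v) + 1) mod int m"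
				using phi_U3 by blast
			fix k assume k: "k \<in> U3 & snd (PA v t D ! Suc s) = (snd (PA v t D ! s) + k + 1) mod int m"
			hence "(snd (PA v t D ! s) + k + 1) mod int m = (snd (PA v t D ! s) + phi D (pos D s v) + 1) mod int m"
				using e by simp
			hence "int m dvd (snd (PA v t D ! s) + k + 1) - (snd (PA v t D ! s) + phi D (pos D s v) + 1)"
				by (rule mod_eq_dvd_iff[THEN iffD1])
			hence d: "int m dvd k - phi D (pos D s v)" by simp
			have "\<bar>k - phi D (pos D s v)\<bar> <= 2" using k phi_abs[of D "pos D s v"] by auto
			thus "k = phi D (pos D s v)" using d m_ge dvd_imp_le_int[of "k - phi D (pos D s v)" "int m"] by auto
		qed
		thus ?thesis by (simp add: F_def St_def)
	qed
	have "Ex (%D. exp (alp * of_int (St D (Suc t) v))) =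
		Ex (%D. of_bool (True) * (F (PA v t D) * exp (alp * of_int (phi D (PA v t D ! t)))))"
		by (rule Ex_cong) (simp add: Fx St_Suc PA_nth algebra_simps exp_add)
	also have "... <= mixf z r * Ex (%D. of_bool True * (F (PA v t D) * exp (alp\<^sup>2)))"
	proof (rule step_bound[where alive="%_. True" and hist="PA v t" and pA="%h. h ! t" and pB="%h. h ! t" and W="%h a b. F h * exp (alp * of_int a)"
			and mu="%h a b. Pr (%D. phi D (h ! t) = a & phi D (h ! t) = b)"  and w="%h. F h * exp (alp\<^sup>2)"])
		show "0 <= mixf z r" using mixf_ge1[of r] r by simp
		show "0 <= F h * exp (alp * ri a)" for h a by (simp add: F_def)
	next
		fix h a b assume "h \<in> PA v t ` Om"
		then obtain D0 where D0: "D0 \<in> Om" "h = PA v t D0" by auto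
		define w where "w = h ! t"
		have w: "w \<in> Tor" "w = pos D0 t v" using D0 walk_torus[OF v] by (auto simp: w_def PA_nth)
		have "Pr (%D. PA v t D = h & (%c. c = a & c = b) (phi D w)) <= mixf z r * (Pr (%D. PA v t D = h) * Pr (%D. (%c. c = a & c = b) (phi D w)))"
		proof (rule QI1[OF w(1) r])
			fix D D' assume D: "D \<in> Om" "D' \<in> Om" "D - nb w 0 (int r + 1) = D' - nb w 0 (int r + 1)" "PA v t D = h"
			have eq: "pos D s v = pos D0 s v" if "s <= t" for s using D(4) D0(2) that PA_eq_iff by blast
			have "pos D' s v = pos D s v" if "s <= t" for s
			proof (rule walk_local[OF v D(3) _ that])
				fix s assume s: "s < t"
				have "fst (pos D s v) ~= fst w"
					using column_differs[OF v, of s t D] s Suc.prems eq w(2) by auto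
				thus "pos D s v ~: nb w 0 (int r + 1) & sh (pos D s v) (-1) ~: nb w 0 (int r + 1)"
					using fst_nb by fastforce
			qed
			thus "PA v t D' = h" using D(4) PA_eq_iff by metis
		qed
		thus "Pr (%D. PA v t D = h & phi D (h ! t) = a & phi D (h ! t) = b) <= mixf z r * (Pr (%D. PA v t D = h) * Pr (%D. phi D (h ! t) = a & phi D (h ! t) = b))"
			by (simp add: w_def)
	next
		fix h assume "h \<in> PA v t ` Om"
		then obtain D0 where D0: "D0 \<in> Om" "h = PA v t D0" by auto
		have w: "h ! t \<in> Tor" using D0 walk_torus[OF v] by (auto simp: PA_nth)
		have "(SUM a:U3. SUM b:U3. Pr (%D. phi D (h ! t) = a & phi D (h ! t) = b) * (F h * exp (alp * of_int a)))
			= F h * Ex (%D. exp (alp * of_int (phi D (h ! t))))"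
			using Ex_law[of "%a b. F h * exp (alp * of_int a)" "h ! t" "h ! t"] by (simp add: Ex_cmult)
		also have "... <= F h * exp (alp\<^sup>2)"
			using Ex_exp_phi[OF w a] by (intro mult_left_mono) (simp_all add: F_def)
		finally show "(SUM a:U3. SUM b:U3. Pr (%D. phi D (h ! t) = a & phi D (h ! t) = b) * (F h * exp (alp * of_int a))) <= F h * exp (alp\<^sup>2)" .
	qed
	also have "Ex (%D. of_bool True * (F (PA v t D) * exp (alp\<^sup>2))) = Ex (%D. exp (alp * of_int (St D t v)) * exp (alp\<^sup>2))"
		by (rule Ex_cong) (simp add: Fx)
	also have "... = Ex (%D. exp (alp * of_int (St D t v))) * exp (alp\<^sup>2)" by (rule Ex_multc)
	also have "mixf z r * (...) <= mixf z r * ((mixf z r * exp (alp\<^sup>2)) ^ t * exp (alp\<^sup>2))"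
		using Suc mixf_ge1[of r] r by (intro mult_left_mono mult_right_mono) auto
	finally show ?case by (simp add: algebra_simps)
qed simp

lemma Ex_abs_St:
	assumes v: "v \<in> Tor" and r: "r >= 2" "2 * int r + 3 <= int m"
	shows "Ex (%D. \<bar>of_int (St D n v)\<bar>) <= 2 * exp 1 * mixf z r ^ n * sqrt n"
proof -
	\<comment> \<open>At this scale the factor \<open>exp (alp\<^sup>2)\<close> accumulates to
	  \<open>exp 1\<close> over \<open>n\<close> steps.\<close>
	define alp where "alp = 1 / sqrt n"
	have a: "alp > 0" "alp <= 1" using n_pos by (auto simp: alp_def)
	have e: "exp (alp\<^sup>2) ^ n = exp 1" using n_pos by (simp add: alp_def power_divide flip: exp_of_nat_mult)
	have "alp * Ex (%D. \<bar>of_int (St D n v)\<bar>) = Ex (%D. \<bar>alp * of_int (St D n v)\<bar>)"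
		using a by (simp add: abs_mult Ex_cmult)
	also have "... <= Ex (%D. exp (alp * of_int (St D n v)) + exp ((- alp) * of_int (St D n v)))"
	proof (rule Ex_mono)
		fix D
		show "\<bar>alp * of_int (St D n v)\<bar> <= exp (alp * of_int (St D n v)) + exp ((- alp) * of_int (St D n v))"
			using exp_ge_add_one_self[of "alp * of_int (St D n v)"] exp_ge_add_one_self[of "- (alp * of_int (St D n v))"]
				exp_gt_zero[of "alp * of_int (St D n v)"] exp_gt_zero[of "- (alp * of_int (St D n v))"]
			unfolding mult_minus_left by linarith
	qed
	also have "... <= (mixf z r * exp (alp\<^sup>2)) ^ n + (mixf z r * exp ((-alp)\<^sup>2)) ^ n"
		unfolding Ex_add using a by (intro add_mono exp_moment[OF v _ r]) auto
	also have "... = 2 * exp 1 * mixf z r ^ n" by (simp add: power_mult_distrib e)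
	finally show ?thesis using n_pos by (simp add: alp_def field_simps)
qed

lemma St_tail:
	assumes v: "v \<in> Tor" and r: "r >= 2" "2 * int r + 3 <= int m" and t: "t <= n" and k: "0 < k" "k <= 2 * real n"
	shows "Pr (%D. k < \<bar>of_int (St D t v)\<bar>) <= 2 * mixf z r ^ n * exp (- k\<^sup>2 / (4 * n))"
proof -
	\<comment> \<open>The minimizer of \<open>n * alp\<^sup>2 - alp * k\<close>; the upper bound on
	  \<open>k\<close> keeps it at most 1.\<close>
	define alp where "alp = k / (2 * n)"
	have a: "alp > 0" "alp <= 1" using n_pos k by (auto simp: alp_def)
	have "exp (alp * k) * Pr (%D. k < \<bar>of_int (St D t v)\<bar>) = Ex (%D. exp (alp * k) * of_bool (k < \<bar>of_int (St D t v)\<bar>))"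
		by (simp add: Ex_cmult Pr_def)
	also have "... <= Ex (%D. exp (alp * of_int (St D t v)) + exp ((- alp) * of_int (St D t v)))"
	proof (rule Ex_mono)
		fix D
		let ?S = "ri (St D t v)"
		show "exp (alp * k) * of_bool (k < \<bar>?S\<bar>) <= exp (alp * ?S) + exp ((- alp) * ?S)"
		proof (cases "k < \<bar>?S\<bar>")
			case True
			hence h1: "exp (alp * k) <= exp (alp * \<bar>?S\<bar>)" using a by simp
			have h2: "exp (alp * \<bar>?S\<bar>) <= exp (alp * ?S) + exp ((- alp) * ?S)"
				by (cases "?S >= 0") auto
			show ?thesis using order_trans[OF h1 h2] True by (simp only: of_bool_eq mult_1_right)
		qed (auto intro: add_nonneg_nonneg)
	qed
	also have "... <= (mixf z r * exp (alp\<^sup>2)) ^ t + (mixf z r * exp ((-alp)\<^sup>2)) ^ t"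
		unfolding Ex_add using a by (intro add_mono exp_moment[OF v _ r] t) auto
	also have "... <= 2 * (mixf z r * exp (alp\<^sup>2)) ^ n"
	proof -
		have "1 <= exp (alp\<^sup>2)" by simp
		hence "1 * 1 <= mixf z r * exp (alp\<^sup>2)" using mixf_ge1[of r] r by (intro mult_mono) auto
		hence "(mixf z r * exp (alp\<^sup>2)) ^ t <= (mixf z r * exp (alp\<^sup>2)) ^ n"
			using t by (intro power_increasing) auto
		thus ?thesis by simp
	qed
	also have "... = 2 * mixf z r ^ n * exp (k\<^sup>2 / (4 * n))"
	proof -
		have "real n * alp\<^sup>2 = k\<^sup>2 / (4 * n)" using n_pos by (simp add: alp_def power2_eq_square field_simps)
		thus ?thesis by (simp add: power_mult_distrib flip: exp_of_nat_mult)
	qed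
	finally have "Pr (%D. k < \<bar>of_int (St D t v)\<bar>) <= 2 * mixf z r ^ n * (exp (k\<^sup>2 / (4 * n)) / exp (alp * k))"
		by (simp add: field_simps)
	also have "exp (k\<^sup>2 / (4 * n)) / exp (alp * k) = exp (- k\<^sup>2 / (4 * n))"
	proof -
		have "k\<^sup>2 / (4 * n) - alp * k = - k\<^sup>2 / (4 * n)" using n_pos by (simp add: alp_def power2_eq_square field_simps)
		thus ?thesis by (simp flip: exp_diff)
	qed
	finally show ?thesis .
qed

end

section \<open>Closeness within a column\<close>

context hc begin

definition near :: "int => int \<times> int => int \<times> int => bool" where
	"near r p q \<longleftrightarrow> (EX d. \<bar>d\<bar> <= r & q = sh p d)"

lemma near_sym: "p \<in> Tor ==> near r p q ==> near r q p"
	unfolding near_def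
proof (elim exE conjE)
	fix d assume p: "p \<in> Tor" and d: "\<bar>d\<bar> <= r" "q = sh p d"
	have "p = sh q (- d)" using p d by simp
	thus "EX d. \<bar>d\<bar> <= r & p = sh q d" using d by (intro exI[of _ "-d"]) auto
qed

lemma near_self: "p \<in> Tor ==> 0 <= r ==> near r p p"
	unfolding near_def by (intro exI[of _ 0]) auto

lemma near_mono: "near r p q ==> r <= r' ==> near r' p q"
	unfolding near_def using order_trans by blast

text \<open>The additional 1 in the margin covers the site below \<open>z'\<close>, which the step
  at \<open>z'\<close> also reads.\<close>

lemma not_near_nb:
	assumes p: "p \<in> Tor" and zt: "z' \<in> Tor" and "~ near k p z'" "int g + R + 1 <= k" "0 <= R"
	shows "z' ~: nb p (int g) R & sh z' (-1) ~: nb p (int g) R"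
proof (intro conjI notI)
	assume "z' \<in> nb p (int g) R"
	then obtain i where "-R <= i" "i <= int g + R" "z' = sh p i" by (auto simp: nb_def)
	hence "near k p z'" using assms(4,5) unfolding near_def by (intro exI[of _ i]) auto
	thus False using assms by simp
next
	assume "sh z' (-1) \<in> nb p (int g) R"
	then obtain i where i: "-R <= i" "i <= int g + R" "sh z' (-1) = sh p i" by (auto simp: nb_def)
	hence "sh (sh z' (-1)) 1 = sh (sh p i) 1" by simp
	hence "z' = sh p (i + 1)" using zt by simp
	hence "near k p z'" using assms(4,5) i unfolding near_def by (intro exI[of _ "i+1"]) auto
	thus False using assms by simp
qed

text \<open>Displacements are recorded next to the positions so that the gap between two walkers, as
  an integer, is a function of their histories.\<close>

definition WP :: "int \<times> int => nat => (int \<times> int) set => ((int \<times> int) \<times> int) list" where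
	"WP v t D = map (%s. (pos D s v, St D s v)) [0..<Suc t]"

lemma WP_nth: "s <= t ==> WP v t D ! s = (pos D s v, St D s v)"
	unfolding WP_def by (simp del: upt_Suc)

lemma WP_eq_iff: "WP v t D = WP v t D' \<longleftrightarrow> (ALL s<=t. pos D s v = pos D' s v & St D s v = St D' s v)"
	unfolding WP_def by (auto simp del: upt_Suc)

lemma St_local:
	assumes v: "v \<in> Tor" and eq: "D - X = D' - X"
		and away: "!!s. s < t ==> pos D s v ~: X & sh (pos D s v) (-1) ~: X"
	shows "s <= t ==> St D' s v = St D s v"
proof (induction s)
	case (Suc s)
	let ?x = "pos D s v"
	have e: "pos D' s v = ?x" using walk_local[OF v eq away] Suc by simp
	have "?x ~: X" "sh ?x (-1) ~: X" using away Suc by auto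
	hence "phi D' ?x = phi D ?x" using eq by (intro phi_local) blast+
	thus ?case using e Suc by (simp add: St_Suc)
qed simp

lemma WP_local:
	assumes v: "v \<in> Tor" and eq: "D - X = D' - X"
		and away: "!!s. s < t ==> pos D s v ~: X & sh (pos D s v) (-1) ~: X"
	shows "WP v t D' = WP v t D"
	unfolding WP_eq_iff using walk_local[OF assms] St_local[OF assms] by simp

end

text \<open>Supermartingale bookkeeping in expectation: \<open>v t\<close> is the mean potential of
  the runs still alive, \<open>p t\<close> their probability, and \<open>e t\<close> the probability
  of leaving at the far end, where the potential is at least \<open>B\<close>. Each step pays
  \<open>c * p t\<close> and \<open>B * e t\<close> out of the initial potential. As
  \<open>p\<close> decreases, the sum of its first \<open>T\<close> values is at least
  \<open>T * p T\<close>.\<close>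

lemma lyapunov_sum:
	fixes p v e :: "nat => real"
	assumes pos: "!!t. 0 <= p t" "!!t. 0 <= v t" "!!t. 0 <= e t" and k: "kap >= 1" and c: "c > 0" and B: "B > 0"
		and step: "!!t. t < T ==> v (Suc t) + B * e t <= kap * (v t - c * p t)"
		and dec: "!!t. p (Suc t) <= p t" and T: "T > 0"
	shows "p T + (SUM t<T. e t) <= kap ^ T * v 0 * (1 / (c * T) + 1 / B)"
proof -
	have M: "t <= T ==> v t + (SUM s<t. B * e s + c * p s) <= kap ^ t * v 0" for t
	proof (induction t)
		case (Suc t)
		define S where "S = (SUM s<t. B * e s + c * p s)"
		have S0: "0 <= S" unfolding S_def using pos c B by (intro sum_nonneg add_nonneg_nonneg mult_nonneg_nonneg) auto
		have "v (Suc t) + (SUM s<Suc t. B * e s + c * p s) = v (Suc t) + B * e t + c * p t + S"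
			by (simp add: S_def)
		also have "... <= kap * (v t - c * p t) + c * p t + S" using step[of t] Suc by simp
		also have "... <= kap * (v t + S)"
		proof -
			have "1 * (c * p t) <= kap * (c * p t)" using k c pos by (intro mult_right_mono) auto
			moreover have "1 * S <= kap * S" using k S0 by (intro mult_right_mono) auto
			ultimately show ?thesis by (simp add: algebra_simps)
		qed
		also have "... <= kap * (kap ^ t * v 0)" using Suc k by (intro mult_left_mono) (auto simp: S_def)
		finally show ?case by (simp add: mult.assoc)
	qed simp
	have decp: "s <= T ==> p T <= p s" for s
		by (rule lift_Suc_antimono_le[of p]) (auto simp: dec)
	have m: "(SUM s<T. B * e s + c * p s) <= kap ^ T * v 0" using M[of T] pos(2)[of T] by simp
	have "c * (T * p T) = (SUM s<T. c * p T)" by simp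
	also have "... <= (SUM s<T. c * p s)" using decp c by (intro sum_mono mult_left_mono) auto
	finally have 1: "c * (T * p T) + B * (SUM t<T. e t) <= kap ^ T * v 0"
		using m by (simp add: sum.distrib sum_distrib_left)
	have Ee: "0 <= (SUM t<T. e t)" using pos by (intro sum_nonneg) auto
	have a: "p T <= kap ^ T * v 0 / (c * T)"
		using 1 Ee B c T pos(1)[of T] by (simp add: field_simps) (smt (verit) mult_nonneg_nonneg)
	have b: "(SUM t<T. e t) <= kap ^ T * v 0 / B"
	proof -
		have "0 <= c * (T * p T)" using c pos by simp
		hence "B * (SUM t<T. e t) <= kap ^ T * v 0" using 1 by linarith
		thus ?thesis using B by (simp add: field_simps)
	qed
	show ?thesis using a b by (simp add: algebra_simps)
qed

section \<open>Winding of trajectories around the torus\<close>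

locale hcw = hc +
	fixes C :: nat
	assumes nC: "n = m + C" and C_pos: "C > 0"
begin

text \<open>The factor 16 is chosen for \<open>loop\<close>: the fluctuations over \<open>j\<close>
  turns are then at most \<open>3 / 16 * j * C\<close>, which together with two gaps of at most
  \<open>C / 4\<close> stays below the drift \<open>j * C\<close>.\<close>

definition Good :: "(int \<times> int) set => bool" where
	"Good D \<longleftrightarrow> (ALL v:Tor. ALL t<=n. 16 * \<bar>St D t v\<bar> <= int C)"

text \<open>A long path is cut into turns, each of which is controlled from its own starting point;
  the last, incomplete turn accounts for the additional 1.\<close>

lemma Good_long:
	assumes G: "Good D"
	shows "v \<in> Tor ==> 16 * \<bar>St D t v\<bar> <= int C * (int (t div n) + 1)"
proof (induction t arbitrary: v rule: less_induct)
	case (less t)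
	show ?case
	proof (cases "t < n")
		case True
		thus ?thesis using G less.prems unfolding Good_def by simp
	next
		case False
		define t' where "t' = t - n"
		have t: "t = n + t'" using False by (simp add: t'_def)
		have "16 * \<bar>St D t' (pos D n v)\<bar> <= int C * (int (t' div n) + 1)"
			using less.IH[of t'] walk_torus[OF less.prems] t n_pos by simp
		moreover have "16 * \<bar>St D n v\<bar> <= int C" using G less.prems unfolding Good_def by simp
		moreover have "t div n = t' div n + 1" using t n_pos by simp
		moreover have "\<bar>St D t v\<bar> <= \<bar>St D n v\<bar> + \<bar>St D t' (pos D n v)\<bar>" unfolding t St_add by linarith
		ultimately show ?thesis by (simp add: algebra_simps)
	qed
qed

text \<open>On \<open>Good\<close>, going round the torus \<open>j\<close> times in the first coordinate advances the second
	coordinate by about \<open>j C\<close>, so that a short closed loop of trajectory pieces is impossible.\<close>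

lemma loop:
	assumes G: "Good D" and v: "v \<in> Tor" and d: "4 * \<bar>d1\<bar> <= int C" "4 * \<bar>d2\<bar> <= int C"
		and q: "pos D t' (sh (pos D t v) d1) = sh v d2"
		and t: "0 < t + t'" "2 * (t + t') * C < n * m"
	shows False
proof -
	let ?p = "pos D t v"
	define p' where "p' = sh ?p d1"
	have pt: "?p \<in> Tor" "p' \<in> Tor" using walk_torus[OF v] by (auto simp: p'_def)
	define S where "S = St D t v"
	define S' where "S' = St D t' p'"
	have p: "?p = ((fst v + int t) mod int n, (snd v + int t + S) mod int m)" using walk_pos[OF v] by (simp add: S_def)
	have fp: "fst p' = (fst v + int t) mod int n" and sp: "snd p' = (snd v + int t + S + d1) mod int m"
		unfolding p'_def using p by (simp_all add: sh_def mod_simps)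
	have qq: "pos D t' p' = ((fst p' + int t') mod int n, (snd p' + int t' + S') mod int m)"
		using walk_pos[OF pt(2)] by (simp add: S'_def)
	have e: "sh v d2 = (fst v, (snd v + d2) mod int m)" by (simp add: sh_def)
	have 1: "(fst v + int t + int t') mod int n = fst v mod int n"
	proof -
		have "(fst p' + int t') mod int n = fst v" using qq q e unfolding p'_def[symmetric] by simp
		thus ?thesis unfolding fp mod_add_left_eq using v by (auto simp: torus_def)
	qed
	hence "int n dvd (fst v + int t + int t') - fst v" by (simp only: mod_eq_dvd_iff)
	hence "int n dvd int (t + t')" by simp
	then obtain j where j: "t + t' = n * j" by (metis dvdE int_dvd_int_iff)
	have j0: "j > 0" using j t by (cases j) auto
	have "(snd p' + int t' + S') mod int m = (snd v + d2) mod int m" using qq q e unfolding p'_def[symmetric] by simp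
	hence "((snd v + int t + S + d1) + (int t' + S')) mod int m = (snd v + d2) mod int m"
		unfolding sp add.assoc[of "_ mod _"] mod_add_left_eq .
	hence "int m dvd (snd v + int t + S + d1) + (int t' + S') - (snd v + d2)" by (simp only: mod_eq_dvd_iff)
	moreover have "(snd v + int t + S + d1) + (int t' + S') - (snd v + d2) = int (t + t') + (S + S' + d1 - d2)" by simp
	moreover have "int (t + t') = int m * int j + int j * int C" unfolding j nC by (simp add: algebra_simps)
	ultimately have "int m dvd int m * int j + (int j * int C + (S + S' + d1 - d2))" by (simp add: algebra_simps)
	hence dv: "int m dvd int j * int C + (S + S' + d1 - d2)" by (simp add: dvd_add_right_iff)
	\<comment> \<open>Two pieces with \<open>j\<close> turns in total contain at most \<open>j\<close>
	  complete turns, and \<open>Good_long\<close> charges one more turn for each piece.\<close>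
	have "t div n + t' div n <= j"
	proof -
		have "n * (t div n + t' div n) <= n * j" unfolding j[symmetric] distrib_left by (intro add_mono) simp_all
		thus ?thesis using n_pos by simp
	qed
	hence dj: "int (t div n) + int (t' div n) <= int j" by linarith
	have "16 * (\<bar>S\<bar> + \<bar>S'\<bar>) <= int C * (int (t div n) + 1) + int C * (int (t' div n) + 1)"
		using Good_long[OF G v, of t] Good_long[OF G pt(2), of t'] unfolding S_def S'_def by simp
	also have "... = int C * (int (t div n) + int (t' div n) + 2)" by (simp add: algebra_simps)
	also have "... <= int C * (3 * int j)" using dj j0 by (intro mult_left_mono) auto
	finally have s: "16 * (\<bar>S\<bar> + \<bar>S'\<bar>) <= 3 * (int j * int C)" by (simp add: algebra_simps)
	have cj: "int C <= int j * int C" using mult_right_mono[of 1 "int j" "int C"] j0 by simp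
	have cp: "0 < int C" using C_pos by simp
	\<comment> \<open>The bounds so far place the total advance between \<open>5 / 16 * X\<close> and
	  \<open>27 / 16 * X\<close>. As \<open>2 * X < m\<close>, it lies strictly between 0 and
	  \<open>m\<close>, which contradicts divisibility.\<close>
	define X where "X = int j * int C"
	have "0 < int j * int C + (S + S' + d1 - d2)" using s d cj cp unfolding X_def[symmetric] by (smt (verit))
	moreover have "int j * int C + (S + S' + d1 - d2) < int m"
	proof -
		have "n * (2 * j * C) < n * m" using t(2) unfolding j by (simp add: algebra_simps)
		hence "2 * j * C < m" using n_pos by simp
		hence "2 * (int j * int C) < int m" by (metis (no_types, lifting) mult.assoc of_nat_less_iff of_nat_mult of_nat_numeral)
		thus ?thesis using s d cj unfolding X_def[symmetric] by (smt (verit))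
	qed
	ultimately show False using dv zdvd_not_zless by blast
qed

lemma loop_near:
	assumes G: "Good D" and v: "v \<in> Tor" and q: "q \<in> Tor" and k: "4 * k <= int C"
		and pp: "near k (pos D t v) p'" and qv: "near k (pos D t' p') v | near k v (pos D t' p')"
		and t: "0 < t + t'" "2 * (t + t') * C < n * m"
	shows False
proof -
	obtain d1 where d1: "\<bar>d1\<bar> <= k" "p' = sh (pos D t v) d1" using pp by (auto simp: near_def)
	have pt: "p' \<in> Tor" using d1 walk_torus[OF v] by simp
	have "near k v (pos D t' p')" using qv near_sym[OF walk_torus[OF pt]] by blast
	then obtain d2 where d2: "\<bar>d2\<bar> <= k" "pos D t' p' = sh v d2" by (auto simp: near_def)
	show False by (rule loop[OF G v _ _ d2(2)[unfolded d1(2)] t]) (use d1 d2 k in auto)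
qed

lemma self_far:
	assumes G: "Good D" and v: "v \<in> Tor" and st: "s < t" and k: "4 * k <= int C" "0 <= k" and t: "2 * t * C < n * m"
	shows "~ near k (pos D s v) (pos D t v)"
proof
	assume nr: "near k (pos D s v) (pos D t v)"
	let ?v = "pos D s v"
	have w: "pos D t v = (Phi D ^^ (t - s)) ?v" using st by (simp flip: funpow_add[unfolded o_def, THEN fun_cong])
	have v': "?v \<in> Tor" using walk_torus[OF v] .
	have "2 * (t - s) * C <= 2 * t * C" by simp
	hence b: "2 * ((t - s) + 0) * C < n * m" using le_less_trans[OF _ t] by simp
	show False
		by (rule loop_near[OF G v' v' k(1), of "t - s" "(Phi D ^^ (t - s)) ?v" 0])
				(use b st near_self[OF walk_torus[OF v'] k(2)] nr[unfolded w] in auto)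
qed

definition ct :: "int => int \<times> int => int \<times> int => (int \<times> int) set => nat => nat => bool" where
	"ct d y x D t1 t2 \<longleftrightarrow> near d (pos D t1 y) (pos D t2 x)"

text \<open>The walkers may come close at different times, so an encounter is a pair of times, and a
  first one is minimal in the product order. Minimality depends only on the two paths up to these
  times, hence it survives toggles made later.\<close>

definition Minc :: "int => int \<times> int => int \<times> int => (int \<times> int) set => nat => nat => bool" where
	"Minc d y x D t1 t2 \<longleftrightarrow> ct d y x D t1 t2 & (ALL s1<=t1. ALL s2<=t2. (s1, s2) ~= (t1, t2) --> ~ ct d y x D s1 s2)"

lemma Minc_exists:
	assumes "ct d y x D t1 t2"
	shows "EX s1<=t1. EX s2<=t2. Minc d y x D s1 s2"
	using assms
proof (induction "t1 + t2" arbitrary: t1 t2 rule: less_induct)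
	case less
	show ?case
	proof (cases "Minc d y x D t1 t2")
		case True thus ?thesis by blast
	next
		case False
		then obtain s1 s2 where s: "s1 <= t1" "s2 <= t2" "(s1, s2) ~= (t1, t2)" "ct d y x D s1 s2"
			using less.prems by (auto simp: Minc_def)
		hence "s1 + s2 < t1 + t2" by auto
		then obtain r1 r2 where "r1 <= s1" "r2 <= s2" "Minc d y x D r1 r2" using less.hyps s(4) by blast
		thus ?thesis using s by (meson order_trans)
	qed
qed

text \<open>Two encounters in crossed order close up to a forbidden loop: along \<open>y\<close>
  from time \<open>s1\<close> to \<open>t1\<close>, over to \<open>x\<close> at time
  \<open>t2\<close>, along \<open>x\<close> until \<open>s2\<close>, and back.\<close>

lemma Minc_unique_aux:
	assumes G: "Good D" and yx: "y \<in> Tor" "x \<in> Tor" and k: "4 * d <= int C"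
		and c: "ct d y x D t1 t2" "ct d y x D s1 s2" and st: "s1 < t1" "t2 <= s2" and T: "2 * (t1 + s2) * C < n * m"
	shows False
proof -
	let ?v = "pos D s1 y"
	have v: "?v \<in> Tor" using walk_torus[OF yx(1)] .
	have 1: "(Phi D ^^ (t1 - s1)) ?v = pos D t1 y" using st by (simp flip: funpow_add[unfolded o_def, THEN fun_cong])
	have 2: "pos D ((s2 - t2)) (pos D t2 x) = pos D s2 x" using st by (simp flip: funpow_add[unfolded o_def, THEN fun_cong])
	have "2 * ((t1 - s1) + (s2 - t2)) * C <= 2 * (t1 + s2) * C" by (intro mult_right_mono mult_left_mono) auto
	hence b: "2 * ((t1 - s1) + (s2 - t2)) * C < n * m" using le_less_trans[OF _ T] by blast
	show False
		by (rule loop_near[OF G v v k, of "t1 - s1" "pos D t2 x" "s2 - t2"])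
			(use 1 2 c b st in "auto simp: ct_def")
qed

lemma Minc_unique:
	assumes G: "Good D" and yx: "y \<in> Tor" "x \<in> Tor" and k: "4 * d <= int C"
		and c: "Minc d y x D t1 t2" "Minc d y x D s1 s2"
		and T: "t1 <= T" "t2 <= T" "s1 <= T" "s2 <= T" "4 * T * C < n * m"
	shows "t1 = s1 & t2 = s2"
proof (rule ccontr)
	assume ne: "~ (t1 = s1 & t2 = s2)"
	have cc: "ct d y x D t1 t2" "ct d y x D s1 s2" using c by (auto simp: Minc_def)
	have b: "2 * (a + b) * C < n * m" if "a <= T" "b <= T" for a b
	proof -
		have "2 * (a + b) * C <= 4 * T * C" using that by (intro mult_right_mono) auto
		thus ?thesis using le_less_trans[OF _ T(5)] by blast
	qed
	consider "s1 <= t1" "s2 <= t2" | "t1 <= s1" "t2 <= s2" | "s1 < t1" "t2 <= s2" | "t1 < s1" "s2 <= t2" by linarith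
	thus False
	proof cases
		case 1 thus ?thesis using c(1) cc ne by (auto simp: Minc_def)
	next
		case 2 thus ?thesis using c(2) cc ne by (auto simp: Minc_def)
	next
		case 3 thus ?thesis using Minc_unique_aux[OF G yx k cc 3 b] T by blast
	next
		case 4 thus ?thesis using Minc_unique_aux[OF G yx k cc(2,1) 4 b] T by blast
	qed
qed

subsection \<open>Two distant walkers meet\<close>

text \<open>The gap is a nearly centred walk started at \<open>u\<close>. The potential
  \<open>2 * H * g - g\<^sup>2\<close> decreases in mean by \<open>drift_product\<close> and is
  large at the upper exit, so long survival and an exit above \<open>H\<close> are both unlikely;
  what remains is an encounter. As long as no two recorded positions are within distance
  \<open>d\<close>, every step reads fresh sites.\<close>

lemma stage1:
	fixes u H d :: int
	assumes x: "x \<in> Tor" and y: "y = sh x (- u)" and u: "d < u" "u < H"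
		and r: "r >= 2" "2 * int r + 3 <= int m" "int r + 2 <= d" and k: "4 * d <= int C" and T: "0 < T" "4 * T * C < n * m"
	shows "Pr (%D. Good D & (ALL t1<=T. ALL t2<=T. ~ ct d y x D t1 t2))
		<= (mixf z r)\<^sup>2 ^ T * (2 * ri H * ri u) * (1 / (vv / 2 * T) + 1 / ((ri H)\<^sup>2 - 1))"
proof -
	have yt: "y \<in> Tor" using x y by simp
	have H: "H > 5" using u r by linarith
	define gap where "gap = (%(h :: ((int \<times> int) \<times> int) list \<times> ((int \<times> int) \<times> int) list) s. u + snd (snd h ! s) - snd (fst h ! s))"
	define alive where "alive = (%t h. (ALL s<=t. d < gap h s & gap h s < H) &
			(ALL s1<=t. ALL s2<=t. ~ near d (fst (fst h ! s1)) (fst (snd h ! s2))) &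
			(ALL s2<=t. ALL s1<s2. ~ near d (fst (fst h ! s1)) (fst (fst h ! s2)) & ~ near d (fst (snd h ! s1)) (fst (snd h ! s2))))"
	define hist where "hist = (%t D. (WP y t D, WP x t D))"
	define g where "g = (%t D. u + St D t x - St D t y)"
	define al where "al = (%t D. alive t (hist t D))"
	have al_iff: "al t D \<longleftrightarrow> (ALL s<=t. d < g s D & g s D < H) &
			(ALL s1<=t. ALL s2<=t. ~ ct d y x D s1 s2) &
			(ALL s2<=t. ALL s1<s2. ~ near d (pos D s1 y) (pos D s2 y) & ~ near d (pos D s1 x) (pos D s2 x))" for t D
		unfolding al_def alive_def hist_def gap_def g_def ct_def by (auto simp: WP_nth)
	define V where "V = (%g::int. 2 * ri H * g - (ri g)\<^sup>2)"
	have V0: "0 <= V g" if "0 <= g" "g <= 2 * H" for g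
	proof -
		have "0 <= ri g * (2 * ri H - ri g)" using that by (intro mult_nonneg_nonneg) auto
		thus ?thesis by (simp add: V_def power2_eq_square algebra_simps)
	qed
	\<comment> \<open>The gap grows by at most 2 per step, so from below \<open>H\<close> it lands on
	  \<open>H\<close> or \<open>H + 1\<close>.\<close>
	have Vexit: "(ri H)\<^sup>2 - 1 <= V g" if "H <= g" "g <= H + 1" for g
	proof -
		have "\<bar>ri (H - g)\<bar> <= 1" using that by auto
		hence "(ri (H - g))\<^sup>2 <= 1" by (simp add: abs_square_le_1)
		thus ?thesis by (simp add: V_def power2_eq_square algebra_simps)
	qed
	have gstep: "g (Suc t) D = g t D + (phi D (pos D t x) - phi D (pos D t y))" for t D
		by (simp add: g_def St_Suc)
	have gstep2: "\<bar>g (Suc t) D - g t D\<bar> <= 2" for t D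
		using phi_abs[of D "pos D t x"] phi_abs[of D "pos D t y"] unfolding gstep by linarith
	define p where "p = (%t. Pr (al t))"
	define v where "v = (%t. Ex (%D. of_bool (al t D) * V (g t D)))"
	define e where "e = (%t. Pr (%D. al t D & g (Suc t) D >= H))"
	have al_mono: "al (Suc t) D ==> al t D" for t D unfolding al_iff by (meson le_SucI)
	have step: "v (Suc t) + ((ri H)\<^sup>2 - 1) * e t <= (mixf z r)\<^sup>2 * (v t - vv / 2 * p t)" for t
	proof -
		have "v (Suc t) + ((ri H)\<^sup>2 - 1) * e t =
			Ex (%D. of_bool (al (Suc t) D) * V (g (Suc t) D) + ((ri H)\<^sup>2 - 1) * of_bool (al t D & g (Suc t) D >= H))"
			by (simp add: v_def e_def Pr_def Ex_add Ex_cmult)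
		also have "... <= Ex (%D. of_bool (al t D) * V (g (Suc t) D))"
		proof (rule Ex_mono)
			fix D
			show "of_bool (al (Suc t) D) * V (g (Suc t) D) + ((ri H)\<^sup>2 - 1) * of_bool (al t D & g (Suc t) D >= H)
					<= of_bool (al t D) * V (g (Suc t) D)"
			proof (cases "al t D")
				case True
				hence gt: "d < g t D" "g t D < H" by (auto simp: al_iff)
				hence g': "0 <= g (Suc t) D" "g (Suc t) D <= H + 1" using gstep2[of t D] r by auto
				have V': "0 <= V (g (Suc t) D)" using g' H by (intro V0) auto
				show ?thesis
				proof (cases "g (Suc t) D >= H")
					case True
					hence "~ al (Suc t) D" unfolding al_iff by auto
					thus ?thesis using True \<open>al t D\<close> Vexit[of "g (Suc t) D"] g' by simp
				qed (use True V' in auto)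
			qed (use al_mono in auto)
		qed
		also have "... = Ex (%D. of_bool (alive t (hist t D)) *
				(V (gap (hist t D) t) + (2 * ri H - 2 * ri (gap (hist t D) t)) * of_int (phi D (fst (snd (hist t D) ! t)) - phi D (fst (fst (hist t D) ! t)))
					- (of_int (phi D (fst (snd (hist t D) ! t)) - phi D (fst (fst (hist t D) ! t))))\<^sup>2))"
			by (rule Ex_cong) (simp add: al_def hist_def WP_nth gap_def gstep V_def, simp add: g_def power2_eq_square algebra_simps)
		also have "... <= (mixf z r)\<^sup>2 * Ex (%D. of_bool (alive t (hist t D)) * (V (gap (hist t D) t) - vv / 2))"
		proof (rule step_bound[where hist="hist t" and alive="alive t" and pA="%h. fst (fst h ! t)" and pB="%h. fst (snd h ! t)"
					and W="%h a b. V (gap h t) + (2 * ri H - 2 * ri (gap h t)) * of_int (b - a) - (of_int (b - a))\<^sup>2"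
					and mu="%h a b. Pr (%D. phi D (fst (fst h ! t)) = a) * Pr (%D. phi D (fst (snd h ! t)) = b)"
					and w="%h. V (gap h t) - vv / 2"])
			show "0 <= (mixf z r)\<^sup>2" by simp
		next
			fix h a b assume h: "alive t h" "a \<in> U3" "b \<in> U3"
			define G where "G = gap h t"
			have G: "d < G" "G < H" using h by (auto simp: alive_def G_def)
			have "V G + (2 * ri H - 2 * ri G) * of_int (b - a) - (of_int (b - a))\<^sup>2 = V (G + (b - a))"
				by (simp add: V_def power2_eq_square algebra_simps)
			also have "... >= 0" using h G r H by (intro V0) auto
			finally show "V (gap h t) + (2 * ri H - 2 * ri (gap h t)) * of_int (b - a) - (of_int (b - a))\<^sup>2 >= 0"
				unfolding G_def .
		next
			fix h assume h: "alive t h" "h \<in> hist t ` Om"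
			then obtain D0 where D0: "D0 \<in> Om" "h = hist t D0" by auto
			define A where "A = fst (fst h ! t)"
			define B where "B = fst (snd h ! t)"
			have AB: "A = pos D0 t y" "B = pos D0 t x" using D0 by (auto simp: A_def B_def hist_def WP_nth)
			have AT: "A \<in> Tor" "B \<in> Tor" using AB walk_torus x yt by auto
			have al0: "al t D0" using h D0 by (simp add: al_def)
			have nAB: "~ near d A B" using al0 AB by (auto simp: al_iff ct_def)
			have d0: "d >= 0" using r by simp
			have ne: "A ~= B" using nAB near_self[OF AT(1) d0] by auto
			show "(SUM a:U3. SUM b:U3. (Pr (%D. phi D (fst (fst h ! t)) = a) * Pr (%D. phi D (fst (snd h ! t)) = b)) *
				(V (gap h t) + (2 * ri H - 2 * ri (gap h t)) * of_int (b - a) - (of_int (b - a))\<^sup>2)) <= V (gap h t) - vv / 2"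
				using drift_product[OF AT ne] unfolding A_def B_def .
			fix a b
			have far1: "~ near d A (pos D0 s y)" "~ near d B (pos D0 s y)" "~ near d A (pos D0 s x)" "~ near d B (pos D0 s x)" if "s < t" for s
				using al0 that near_sym[OF AT(1), of d "pos D0 s y"] near_sym[OF AT(2), of d "pos D0 s y"]
					near_sym[OF AT(1), of d "pos D0 s x"] near_sym[OF AT(2), of d "pos D0 s x"] unfolding AB
				by (auto simp: al_iff ct_def)
			have far: "pos D0 s y ~: nb A 0 (int r + 1) & sh (pos D0 s y) (-1) ~: nb A 0 (int r + 1)"
					"pos D0 s y ~: nb B 0 (int r + 1) & sh (pos D0 s y) (-1) ~: nb B 0 (int r + 1)"
					"pos D0 s x ~: nb A 0 (int r + 1) & sh (pos D0 s x) (-1) ~: nb A 0 (int r + 1)"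
					"pos D0 s x ~: nb B 0 (int r + 1) & sh (pos D0 s x) (-1) ~: nb B 0 (int r + 1)" if s: "s < t" for s
				using not_near_nb[OF AT(1) walk_torus[OF yt] far1(1)[OF s], of 0 "int r + 1"]
					not_near_nb[OF AT(2) walk_torus[OF yt] far1(2)[OF s], of 0 "int r + 1"]
					not_near_nb[OF AT(1) walk_torus[OF x] far1(3)[OF s], of 0 "int r + 1"]
					not_near_nb[OF AT(2) walk_torus[OF x] far1(4)[OF s], of 0 "int r + 1"] r by simp_all
			have farB: "B ~: nb A 0 (int r + 1) & sh B (-1) ~: nb A 0 (int r + 1)"
				using not_near_nb[OF AT nAB, of 0 "int r + 1"] r by simp
			have loc: "hist t D' = h" if D: "hist t D = h" "D - nb P 0 (int r + 1) = D' - nb P 0 (int r + 1)" "P = A | P = B" for D D' P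
			proof -
				have eq: "pos D s y = pos D0 s y" "pos D s x = pos D0 s x" if "s <= t" for s
					using D(1) D0(2) that unfolding hist_def by (auto simp: WP_eq_iff)
				have "WP y t D' = WP y t D"
					by (rule WP_local[OF yt D(2)]) (use eq far D(3) in auto)
				moreover have "WP x t D' = WP x t D"
					by (rule WP_local[OF x D(2)]) (use eq far D(3) in auto)
				ultimately show ?thesis using D(1) by (simp add: hist_def)
			qed
			\<comment> \<open>The two steps are detached one after the other, each at the cost of one factor
			  \<open>mixf z r\<close>.\<close>
			have "Pr (%D. (hist t D = h & phi D B = b) & phi D A = a) <= mixf z r * (Pr (%D. hist t D = h & phi D B = b) * Pr (%D. phi D A = a))"
			proof (rule QI1[OF AT(1) r(1,2), where Q="%c. c = a"])
				fix D D' assume D: "D \<in> Om" "D' \<in> Om" "D - nb A 0 (int r + 1) = D' - nb A 0 (int r + 1)" "hist t D = h & phi D B = b"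
				have "phi D' B = phi D B" using farB D(3) by (intro phi_local) blast+
				thus "hist t D' = h & phi D' B = b" using loc[of D A D'] D by simp
			qed
			also have "... <= mixf z r * ((mixf z r * (Pr (%D. hist t D = h) * Pr (%D. phi D B = b))) * Pr (%D. phi D A = a))"
			proof (intro mult_left_mono mult_right_mono)
				show "Pr (%D. hist t D = h & phi D B = b) <= mixf z r * (Pr (%D. hist t D = h) * Pr (%D. phi D B = b))"
					by (rule QI1[OF AT(2) r(1,2), where Q="%c. c = b"]) (use loc in blast)
				show "0 <= mixf z r" using mixf_ge1[of r] r by simp
			qed simp
			finally show "Pr (%D. hist t D = h & phi D (fst (fst h ! t)) = a & phi D (fst (snd h ! t)) = b)
					<= (mixf z r)\<^sup>2 * (Pr (%D. hist t D = h) * (Pr (%D. phi D (fst (fst h ! t)) = a) * Pr (%D. phi D (fst (snd h ! t)) = b)))"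
				unfolding A_def[symmetric] B_def[symmetric] by (simp add: power2_eq_square algebra_simps conj_commute conj_left_commute)
		qed
		also have "Ex (%D. of_bool (alive t (hist t D)) * (V (gap (hist t D) t) - vv / 2)) = v t - vv / 2 * p t"
		proof -
			have "Ex (%D. of_bool (alive t (hist t D)) * (V (gap (hist t D) t) - vv / 2)) = Ex (%D. of_bool (al t D) * V (g t D) - vv / 2 * of_bool (al t D))"
				by (rule Ex_cong) (auto simp: al_def hist_def gap_def g_def WP_nth algebra_simps)
			thus ?thesis by (simp only: v_def p_def Pr_def Ex_diff Ex_cmult)
		qed
		finally show ?thesis .
	qed
	have mx: "1 <= mixf z r" using mixf_ge1[of r] r by simp
	have H2: "(ri H)\<^sup>2 - 1 > 0"
	proof -
		have "1\<^sup>2 < (ri H)\<^sup>2" using H by (intro power_strict_mono) auto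
		thus ?thesis by simp
	qed
	have v0: "v 0 <= 2 * ri H * ri u"
	proof -
		have "v 0 <= Ex (%D. 2 * ri H * ri u)"
			unfolding v_def using u r H by (intro Ex_mono) (auto simp: g_def V_def of_bool_def)
		thus ?thesis by simp
	qed
	have "Pr (%D. Good D & (ALL t1<=T. ALL t2<=T. ~ ct d y x D t1 t2)) <= Pr (%D. al T D | (EX t:{..<T}. al t D & g (Suc t) D >= H))"
	proof (rule Pr_mono)
		fix D assume D: "D \<in> Om" and GD: "Good D & (ALL t1<=T. ALL t2<=T. ~ ct d y x D t1 t2)"
		have sf: "~ near d (pos D s1 w) (pos D s2 w)" if "s1 < s2" "s2 <= T" "w \<in> Tor" for s1 s2 w
		proof -
			have "2 * s2 * C <= 4 * T * C" using that by (intro mult_right_mono) auto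
			hence "2 * s2 * C < n * m" using le_less_trans[OF _ T(2)] by blast
			thus ?thesis using self_far[of D w s1 s2 d] GD that k r by auto
		qed
		show "al T D | (EX t:{..<T}. al t D & g (Suc t) D >= H)"
		proof (rule ccontr)
			assume no: "~ (al T D | (EX t:{..<T}. al t D & g (Suc t) D >= H))"
			have "al t D" if "t <= T" for t
				using that
			proof (induction t)
				case 0
				thus ?case unfolding al_iff using u GD by (auto simp: g_def)
			next
				case (Suc t)
				hence at: "al t D" by simp
				hence lt: "g (Suc t) D < H" using no Suc by force
				have gt: "d < g t D" using at by (auto simp: al_iff)
				\<comment> \<open>A gap above \<open>d\<close> decreases by at most 2 and cannot jump across the
				  whole range below \<open>d\<close>, so leaving downwards is an encounter at equal
				  times.\<close>
				have "d < g (Suc t) D"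
				proof (rule ccontr)
					assume "~ d < g (Suc t) D"
					hence "\<bar>g (Suc t) D\<bar> <= d" using gt gstep2[of t D] r by linarith
					moreover have "pos D (Suc t) x = sh (pos D (Suc t) y) (g (Suc t) D)"
					proof -
						have "x = sh y u" using y x by simp
						thus ?thesis using walk_sh[OF yt, where D=D and t="Suc t" and g=u] by (simp only: g_def)
					qed
					ultimately have "ct d y x D (Suc t) (Suc t)" unfolding ct_def near_def by blast
					thus False using GD Suc.prems by blast
				qed
				hence "d < g s D & g s D < H" if "s <= Suc t" for s
					using that at lt unfolding al_iff by (cases "s = Suc t") (simp_all only: le_Suc_eq simp_thms)
				moreover have "~ ct d y x D s1 s2" if "s1 <= Suc t" "s2 <= Suc t" for s1 s2
					using GD that Suc.prems by auto
				moreover have "~ near d (pos D s1 w) (pos D s2 w)" if "s2 <= Suc t" "s1 < s2" "w \<in> {x, y}" for s1 s2 w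
					using sf[of s1 s2 w] that Suc.prems x yt by auto
				ultimately show ?case unfolding al_iff by simp
			qed
			thus False using no by blast
		qed
	qed
	also have "... <= p T + (SUM t<T. e t)"
		unfolding p_def e_def by (rule order_trans[OF Pr_or]) (intro add_mono order_refl Pr_union, simp)
	also have "... <= ((mixf z r)\<^sup>2) ^ T * v 0 * (1 / (vv / 2 * T) + 1 / ((ri H)\<^sup>2 - 1))"
	proof (rule lyapunov_sum)
		show "0 <= v t" for t unfolding v_def
		proof (rule Ex_nonneg)
			fix D show "0 <= of_bool (al t D) * V (g t D)"
				using V0[of "g t D"] r H by (cases "al t D") (auto simp: al_iff)
		qed
		show "p (Suc t) <= p t" for t unfolding p_def using al_mono by (intro Pr_mono) auto
		show "1 <= (mixf z r)\<^sup>2" using mx by (rule one_le_power)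
	qed (use vv_pos H2 step T in "auto simp: p_def e_def")
	also have "... <= ((mixf z r)\<^sup>2) ^ T * (2 * ri H * ri u) * (1 / (vv / 2 * T) + 1 / ((ri H)\<^sup>2 - 1))"
		using v0 H2 vv_pos by (intro mult_right_mono mult_left_mono add_nonneg_nonneg) auto
	finally show ?thesis .
qed

end

context hcw begin

subsection \<open>Two close walkers meet often\<close>

text \<open>At the encounter the gap is known only modulo \<open>m\<close>; \<open>SOME\<close>
  picks a representative of size at most \<open>d\<close>, and later displacements are added as
  integers.\<close>

definition gp :: "int => int \<times> int => int \<times> int => nat => nat => (int \<times> int) set => nat => int" where
	"gp d y x t1 t2 D s = (SOME c. \<bar>c\<bar> <= d & pos D t2 x = sh (pos D t1 y) c)
			+ (St D (t2 + s) x - St D t2 x) - (St D (t1 + s) y - St D t1 y)"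

text \<open>At these times the walkers are neighbours before and after the step, so they either keep
  their order or trade places; by \<open>phi_pair\<close> the exchange between their sites can then
  be switched on or off.\<close>

definition Tg :: "int => int \<times> int => int \<times> int => nat => nat => nat => (int \<times> int) set => nat set" where
	"Tg d y x t1 t2 l D = {s. s < l & \<bar>gp d y x t1 t2 D s\<bar> = 1 & \<bar>gp d y x t1 t2 D (Suc s)\<bar> = 1}"

lemma dvd_small: "int m dvd c ==> \<bar>c\<bar> < int m ==> c = 0"
	using dvd_imp_le_int[of c "int m"] by auto

lemma gp_0:
	assumes "ct d y x D t1 t2"
	shows "\<bar>gp d y x t1 t2 D 0\<bar> <= d" "pos D t2 x = sh (pos D t1 y) (gp d y x t1 t2 D 0)"
proof -
	have "EX c. \<bar>c\<bar> <= d & pos D t2 x = sh (pos D t1 y) c" using assms by (simp add: ct_def near_def)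
	from someI_ex[OF this] show "\<bar>gp d y x t1 t2 D 0\<bar> <= d" "pos D t2 x = sh (pos D t1 y) (gp d y x t1 t2 D 0)"
		by (auto simp: gp_def)
qed

lemma gp_Suc: "gp d y x t1 t2 D (Suc s) = gp d y x t1 t2 D s + (phi D (pos D ((t2 + s)) x) - phi D (pos D ((t1 + s)) y))"
	by (simp add: gp_def St_Suc)

lemma walk_add: "pos D ((t + s)) v = pos D s (pos D t v)"
	by (simp add: funpow_add add.commute[of t])

lemma gp_pos:
	assumes y: "y \<in> Tor" and c: "ct d y x D t1 t2"
	shows "pos D ((t2 + s)) x = sh (pos D ((t1 + s)) y) (gp d y x t1 t2 D s)"
proof -
	let ?A = "pos D t1 y" and ?g = "gp d y x t1 t2 D"
	have "pos D ((t2 + s)) x = pos D s (sh ?A (?g 0))"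
		unfolding walk_add gp_0(2)[OF c, symmetric] ..
	also have "... = sh ((Phi D ^^ s) ?A) (?g 0 + St D s (sh ?A (?g 0)) - St D s ?A)"
		by (rule walk_sh[OF walk_torus[OF y]])
	also have "?g 0 + St D s (sh ?A (?g 0)) - St D s ?A = ?g s"
		unfolding gp_0(2)[OF c, symmetric] by (simp add: gp_def St_add)
	finally show ?thesis unfolding walk_add .
qed

text \<open>An earlier visit near the current site would close a forbidden loop. The exception are
  the positions of the other walker since the encounter, and these lie in other columns because
  fewer than \<open>n\<close> steps have passed.\<close>

lemma stage2_fresh:
	assumes G: "Good D" and x: "x \<in> Tor" and y: "y \<in> Tor" and c: "ct d y x D t1 t2"
		and k: "d <= k" "4 * k <= int C" "0 <= k" and s: "s <= l" "l < n" and T: "2 * (t1 + t2 + l) * C < n * m"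
	shows "i < t1 + s ==> ~ near k (pos D ((t1 + s)) y) (pos D i y)"
		and "i < t2 + s ==> ~ near k (pos D ((t1 + s)) y) (pos D i x)"
proof -
	have T': "2 * j * C < n * m" if "j <= t1 + t2 + l" for j
	proof -
		have "2 * j * C <= 2 * (t1 + t2 + l) * C" using that by (intro mult_right_mono mult_left_mono) auto
		thus ?thesis using T by (rule le_less_trans)
	qed
	note tor = walk_torus[OF x] walk_torus[OF y]
	show "~ near k (pos D ((t1 + s)) y) (pos D i y)" if "i < t1 + s"
	proof -
		have "2 * (t1 + s) * C < n * m" using T'[of "t1 + s"] s by simp
		thus ?thesis using self_far[OF G y that k(2,3)] near_sym[OF tor(2)] by blast
	qed
	show "~ near k (pos D ((t1 + s)) y) (pos D i x)" if i: "i < t2 + s"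
	proof
		assume nr: "near k (pos D ((t1 + s)) y) (pos D i x)"
		show False
		proof (cases "i < t2")
			case True
			have 1: "pos D ((t2 - i)) (pos D i x) = pos D t2 x" using walk_add[of i "t2 - i" D x] True by simp
			have 2: "near k (pos D t2 x) (pos D t1 y)"
				using c near_sym[OF tor(2)] near_mono[OF _ k(1)] unfolding ct_def by blast
			have v: "pos D i x \<in> Tor" by (rule tor(1))
			have 3: "near k (pos D s (pos D t1 y)) (pos D i x)" using nr unfolding walk_add .
			have 4: "2 * (t2 - i + s) * C < n * m" by (rule T') (use s in simp)
			show False
				by (rule loop_near[OF G v v k(2), of "t2 - i" "pos D t1 y" s])
					(use 1 2 3 4 True in simp_all)
		next
			case False
			have "fst (pos D i x) ~= fst (pos D ((t2 + s)) x)"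
				by (rule column_differs[OF x i]) (use False s in auto)
			moreover have "fst (pos D ((t2 + s)) x) = fst (pos D ((t1 + s)) y)"
				unfolding gp_pos[OF y c] by simp
			moreover have "fst (pos D i x) = fst (pos D ((t1 + s)) y)"
				using nr by (auto simp: near_def)
			ultimately show False by simp
		qed
	qed
qed

text \<open>The gap never vanishes, and its sign can change only by a jump between 1 and -1, which
  is a time in \<open>Tg\<close>. The potential of \<open>stage1\<close>, taken at the absolute gap,
  is increased by \<open>4 * H\<close> for each toggle time still missing; so the reflection at zero
  is paid for by the counter, and too few toggle times mean long survival or an exit beyond
  \<open>H\<close>.\<close>

lemma stage2:
	fixes d H k :: int and N :: nat
	assumes x: "x \<in> Tor" and y: "y \<in> Tor"
		and r: "r >= 2" "2 * int r + H + 3 <= int m" and d: "0 <= d" "d < H" "d <= k" and H: "H >= 2"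
		and k: "2 * H + int r + 3 <= k" "4 * k <= int C" and l: "0 < l" "l < n" and T: "2 * (t1 + t2 + l) * C < n * m"
	shows "Pr (%D. Minc d y x D t1 t2 & pos D t1 y ~= pos D t2 x & Good D & card (Tg d y x t1 t2 l D) < N)
		<= mixf z r ^ l * ((2 * ri H * ri d + 4 * ri H * real N) * Pr (%D. Minc d y x D t1 t2))
				* (1 / (vv / 2 * l) + 1 / ((ri H)\<^sup>2 - 1))"
proof -
	define hist where "hist = (%s D. (WP y (t1 + s) D, WP x (t2 + s) D))"
	define gap where "gap = (%(h :: ((int \<times> int) \<times> int) list \<times> ((int \<times> int) \<times> int) list) s.
		(SOME c. \<bar>c\<bar> <= d & fst (snd h ! t2) = sh (fst (fst h ! t1)) c)
			+ (snd (snd h ! (t2 + s)) - snd (snd h ! t2)) - (snd (fst h ! (t1 + s)) - snd (fst h ! t1)))"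
	define cnt where "cnt = (%h s. card {s'. s' < s & \<bar>gap h s'\<bar> = 1 & \<bar>gap h (Suc s')\<bar> = 1})"
	define alive where "alive = (%s h.
			(near d (fst (fst h ! t1)) (fst (snd h ! t2)) & (ALL s1<=t1. ALL s2<=t2. (s1, s2) ~= (t1, t2) --> ~ near d (fst (fst h ! s1)) (fst (snd h ! s2)))) &
			(ALL s'<=s. gap h s' ~= 0 & \<bar>gap h s'\<bar> < H &
				(ALL i<t1 + s'. ~ near k (fst (fst h ! (t1 + s'))) (fst (fst h ! i))) &
				(ALL i<t2 + s'. ~ near k (fst (fst h ! (t1 + s'))) (fst (snd h ! i)))) & cnt h s < N)"
	define g where "g = (%s D. gp d y x t1 t2 D s)"
	define nt where "nt = (%s D. card {s'. s' < s & \<bar>g s' D\<bar> = 1 & \<bar>g (Suc s') D\<bar> = 1})"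
	define al where "al = (%s D. alive s (hist s D))"
	have hg: "gap (hist s D) s' = g s' D" if "s' <= s" for s s' D
		using that unfolding gap_def hist_def g_def gp_def by (simp add: WP_nth)
	have hn: "cnt (hist s D) s = nt s D" for s D
		unfolding cnt_def nt_def by (rule arg_cong[where f=card]) (auto simp: hg)
	have hA: "fst (fst (hist s D) ! i) = pos D i y" if "i <= t1 + s" for s D i
		using that by (simp add: hist_def WP_nth)
	have hB: "fst (snd (hist s D) ! i) = pos D i x" if "i <= t2 + s" for s D i
		using that by (simp add: hist_def WP_nth)
	have al_iff: "al s D \<longleftrightarrow> Minc d y x D t1 t2 &
			(ALL s'<=s. g s' D ~= 0 & \<bar>g s' D\<bar> < H &
				(ALL i<t1 + s'. ~ near k (pos D ((t1 + s')) y) (pos D i y)) &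
				(ALL i<t2 + s'. ~ near k (pos D ((t1 + s')) y) (pos D i x))) & nt s D < N" for s D
		unfolding al_def alive_def Minc_def ct_def hn by (simp add: hg hA hB)
	\<comment> \<open>\<open>4 * ri H\<close> is the difference of the quadratic part between 1 and -1.
	  A jump from 1 to -1 that lowers \<open>q\<close> by one thus leaves the potential equal to its
	  smooth continuation.\<close>
	define V where "V = (%(e::int) (q::real). 2 * ri H * e - (ri e)\<^sup>2 + 4 * ri H * q)"
	have V0: "0 <= V e q" if "0 <= e" "e <= 2 * H" "0 <= q" for e q
	proof -
		have "0 <= ri e * (2 * ri H - ri e)" using that by (intro mult_nonneg_nonneg) auto
		moreover have "0 <= 4 * ri H * q" using H that by simp
		ultimately show ?thesis by (simp add: V_def power2_eq_square algebra_simps)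
	qed
	have Vexit: "(ri H)\<^sup>2 - 1 <= V e q" if "H <= e" "e <= H + 1" "0 <= q" for e q
	proof -
		have "\<bar>ri (H - e)\<bar> <= 1" using that by auto
		hence "(ri (H - e))\<^sup>2 <= 1" by (simp add: abs_square_le_1)
		moreover have "0 <= 4 * ri H * q" using H that by simp
		ultimately show ?thesis by (simp add: V_def power2_eq_square algebra_simps)
	qed
	\<comment> \<open>The continuation of the potential across zero in the direction of the sign of the
	  gap; it is the polynomial to which \<open>drift_joint\<close> applies.\<close>
	define Vt where "Vt = (%(g::int) q (X::int). V \<bar>g\<bar> q + of_int (sgn g) * (2 * ri H - 2 * ri \<bar>g\<bar>) * of_int X - (of_int X)\<^sup>2)"
	have Vt_eq: "Vt g q X = V (\<bar>g\<bar> + sgn g * X) q" if "g ~= 0" for g q X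
	proof -
		have "g > 0 | g < 0" using that by auto
		thus ?thesis unfolding Vt_def V_def by (auto simp: power2_eq_square algebra_simps)
	qed
	have Vt0: "0 <= Vt g q X" if "g ~= 0" "\<bar>g\<bar> < H" "1 <= q" "\<bar>X\<bar> <= 2" for g q X
	proof (cases "\<bar>g\<bar> + sgn g * X >= 0")
		case True
		have "sgn g * X <= 2" using that by (cases "g > 0") auto
		thus ?thesis unfolding Vt_eq[OF that(1)] using True that H by (intro V0) auto
	next
		case False
		have "\<bar>g\<bar> + sgn g * X = -1"
		proof (cases "g > 0")
			case True
			hence "\<bar>g\<bar> + sgn g * X = g + X" by simp
			thus ?thesis using False that(4) True by linarith
		next
			case g: False
			hence "\<bar>g\<bar> + sgn g * X = - g - X" using that(1) by simp
			thus ?thesis using False that(1,4) g by linarith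
		qed
		moreover have "0 <= V (-1) q"
		proof -
			have "4 * ri H * 1 <= 4 * ri H * q" using that(3) H by (intro mult_left_mono) auto
			moreover have "2 <= ri H" using H by simp
			moreover have "V (-1) q = - 2 * ri H - 1 + 4 * ri H * q" by (simp add: V_def)
			ultimately show ?thesis by linarith
		qed
		ultimately show ?thesis unfolding Vt_eq[OF that(1)] by simp
	qed
	have gstep: "g (Suc s) D = g s D + (phi D (pos D ((t2 + s)) x) - phi D (pos D ((t1 + s)) y))" for s D
		by (simp add: g_def gp_Suc)
	have X2: "\<bar>phi D p - phi D q\<bar> <= 2" for D p q
		using phi_abs[of D p] phi_abs[of D q] by linarith
	have nstep: "nt (Suc s) D = nt s D + of_bool (\<bar>g s D\<bar> = 1 & \<bar>g (Suc s) D\<bar> = 1)" for s D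
	proof -
		have "{s'. s' < Suc s & \<bar>g s' D\<bar> = 1 & \<bar>g (Suc s') D\<bar> = 1} = {s'. s' < s & \<bar>g s' D\<bar> = 1 & \<bar>g (Suc s') D\<bar> = 1}
				\<union> (if \<bar>g s D\<bar> = 1 & \<bar>g (Suc s) D\<bar> = 1 then {s} else {})" by (auto simp: less_Suc_eq)
		thus ?thesis unfolding nt_def by (auto simp: card_insert_if)
	qed
	have Hm: "H < int m" using r by linarith
	\<comment> \<open>\<open>Phi D\<close> is injective, so walkers at distinct sites stay apart, and a
	  nonzero gap below \<open>m\<close> cannot become zero.\<close>
	have gne: "g (Suc s) D ~= 0" if D: "D \<in> Om" and a: "al s D" for s D
	proof
		assume g0: "g (Suc s) D = 0"
		have c: "ct d y x D t1 t2" using a by (auto simp: al_iff Minc_def)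
		have "pos D ((t2 + Suc s)) x = sh (pos D ((t1 + Suc s)) y) 0" using gp_pos[OF y c, of "Suc s"] g0 by (simp add: g_def)
		hence "pos D ((t2 + Suc s)) x = pos D ((t1 + Suc s)) y" by (simp only: sh_0[OF walk_torus[OF y]])
		hence "Phi D (pos D ((t2 + s)) x) = Phi D (pos D ((t1 + s)) y)" by simp
		hence "pos D ((t2 + s)) x = pos D ((t1 + s)) y"
			using Phi_permutes[OF D] permutes_inj by (metis injD)
		hence "sh (pos D ((t1 + s)) y) (g s D) = pos D ((t1 + s)) y" using gp_pos[OF y c, of s] by (simp add: g_def)
		hence "int m dvd g s D" using sh_eq_iff'[OF walk_torus[OF y]] by blast
		moreover have "g s D ~= 0" "\<bar>g s D\<bar> < int m" using a Hm by (auto simp: al_iff)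
		ultimately show False using dvd_small by blast
	qed
	define Q where "Q = (%s D. real N - real (nt s D))"
	have next_V: "V \<bar>g (Suc s) D\<bar> (Q (Suc s) D) <= Vt (g s D) (Q s D) (g (Suc s) D - g s D)"
		if D: "D \<in> Om" and a: "al s D" for s D
	proof -
		have gs: "g s D ~= 0" using a by (auto simp: al_iff)
		note gn = gne[OF D a]
		define X where "X = g (Suc s) D - g s D"
		have X: "\<bar>X\<bar> <= 2" using X2 unfolding X_def gstep by simp
		have H4: "0 <= 4 * ri H" using H by simp
		show ?thesis
		proof (cases "\<bar>g (Suc s) D\<bar> = \<bar>g s D\<bar> + sgn (g s D) * X")
			case True
			have "Q (Suc s) D <= Q s D" by (simp add: Q_def nstep)
			hence "4 * ri H * Q (Suc s) D <= 4 * ri H * Q s D" using H4 by (rule mult_left_mono)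
			thus ?thesis unfolding Vt_eq[OF gs] X_def[symmetric] True V_def by simp
		next
			case False
			have e: "g (Suc s) D = g s D + X" by (simp add: X_def)
			have sg: "\<bar>g s D\<bar> = 1 & \<bar>g (Suc s) D\<bar> = 1 & \<bar>g s D\<bar> + sgn (g s D) * X = -1"
				using False gs gn X unfolding e by (cases "g s D > 0") (auto simp: abs_if split: if_splits)
			hence q: "Q (Suc s) D = Q s D - 1" by (simp add: Q_def nstep)
			have a: "\<bar>g (Suc s) D\<bar> = 1" "\<bar>g s D\<bar> + sgn (g s D) * X = -1" using sg by blast+
			show ?thesis unfolding Vt_eq[OF gs] X_def[symmetric] q a V_def by (simp add: algebra_simps)
		qed
	qed
	define p where "p = (%s. Pr (al s))"
	define v where "v = (%s. Ex (%D. of_bool (al s D) * V \<bar>g s D\<bar> (Q s D)))"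
	define e where "e = (%s. Pr (%D. al s D & \<bar>g (Suc s) D\<bar> >= H))"
	have al_mono: "al (Suc s) D ==> al s D" for s D unfolding al_iff nstep by (auto dest: le_SucI)
	have Q1: "al s D ==> 1 <= Q s D" for s D unfolding al_iff Q_def by linarith
	have step: "v (Suc s) + ((ri H)\<^sup>2 - 1) * e s <= mixf z r * (v s - vv / 2 * p s)" for s
	proof -
		have "v (Suc s) + ((ri H)\<^sup>2 - 1) * e s =
			Ex (%D. of_bool (al (Suc s) D) * V \<bar>g (Suc s) D\<bar> (Q (Suc s) D) + ((ri H)\<^sup>2 - 1) * of_bool (al s D & \<bar>g (Suc s) D\<bar> >= H))"
			by (simp add: v_def e_def Pr_def Ex_add Ex_cmult)
		also have "... <= Ex (%D. of_bool (al s D) * Vt (g s D) (Q s D) (g (Suc s) D - g s D))"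
		proof (rule Ex_mono)
			fix D assume D: "D \<in> Om"
			show "of_bool (al (Suc s) D) * V \<bar>g (Suc s) D\<bar> (Q (Suc s) D) + ((ri H)\<^sup>2 - 1) * of_bool (al s D & \<bar>g (Suc s) D\<bar> >= H)
					<= of_bool (al s D) * Vt (g s D) (Q s D) (g (Suc s) D - g s D)"
			proof (cases "al s D")
				case True
				hence gs: "g s D ~= 0" "\<bar>g s D\<bar> < H" by (auto simp: al_iff)
				have Xb: "\<bar>g (Suc s) D - g s D\<bar> <= 2" unfolding gstep using X2 by simp
				hence g': "\<bar>g (Suc s) D\<bar> <= H + 1" using gs by linarith
				have Q': "0 <= Q (Suc s) D" using Q1[OF True] by (simp add: Q_def nstep)
				note nv = next_V[OF D True]
				have V': "0 <= V \<bar>g (Suc s) D\<bar> (Q (Suc s) D)" using g' H Q' by (intro V0) auto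
				show ?thesis
				proof (cases "\<bar>g (Suc s) D\<bar> >= H")
					case True
					hence "~ al (Suc s) D" unfolding al_iff by auto
					thus ?thesis using True \<open>al s D\<close> Vexit[OF True g' Q'] nv by simp
				next
					case False
					thus ?thesis using nv V' \<open>al s D\<close> by (cases "al (Suc s) D") auto
				qed
			qed (use al_mono in auto)
		qed
		also have "... = Ex (%D. of_bool (alive s (hist s D)) *
				Vt (gap (hist s D) s) (real N - real (cnt (hist s D) s)) (phi D (fst (snd (hist s D) ! (t2 + s))) - phi D (fst (fst (hist s D) ! (t1 + s)))))"
			by (rule Ex_cong) (simp add: al_def hg hn hA hB gstep Q_def)
		also have "... <= mixf z r * Ex (%D. of_bool (alive s (hist s D)) * (V \<bar>gap (hist s D) s\<bar> (real N - real (cnt (hist s D) s)) - vv / 2))"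
		proof (rule step_bound[where hist="hist s" and alive="alive s" and pA="%h. fst (fst h ! (t1 + s))" and pB="%h. fst (snd h ! (t2 + s))"
					and W="%h a b. Vt (gap h s) (real N - real (cnt h s)) (b - a)"
					and mu="%h a b. Pr (%D. phi D (fst (fst h ! (t1 + s))) = a & phi D (fst (snd h ! (t2 + s))) = b)"
					and w="%h. V \<bar>gap h s\<bar> (real N - real (cnt h s)) - vv / 2"])
			show "0 <= mixf z r" using mixf_ge1[of r] r by simp
		next
			fix h a b assume h: "alive s h" "a \<in> U3" "b \<in> U3"
			show "0 <= Vt (gap h s) (real N - real (cnt h s)) (b - a)"
				by (rule Vt0) (use h in "auto simp: alive_def")
		next
			fix h assume h: "alive s h" "h \<in> hist s ` Om"
			then obtain D0 where D0: "D0 \<in> Om" "h = hist s D0" by auto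
			define A where "A = fst (fst h ! (t1 + s))"
			define B where "B = fst (snd h ! (t2 + s))"
			have AB: "A = pos D0 ((t1 + s)) y" "B = pos D0 ((t2 + s)) x" using D0 by (auto simp: A_def B_def hA hB)
			have AT: "A \<in> Tor" "B \<in> Tor" using AB walk_torus x y by auto
			have al0: "al s D0" using h D0 by (simp add: al_def)
			define G where "G = g s D0"
			have c: "ct d y x D0 t1 t2" using al0 by (auto simp: al_iff Minc_def)
			have G: "G ~= 0" "\<bar>G\<bar> < H" using al0 by (auto simp: al_iff G_def)
			have BA: "B = sh A G" unfolding AB G_def g_def by (rule gp_pos[OF y c])
			have AB': "A = sh B (- G)" using BA AT by simp
			have ne: "A ~= B"
			proof
				assume "A = B"
				hence "int m dvd G" using BA sh_eq_iff'[OF AT(1)] by metis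
				thus False using G Hm dvd_small[of G] by simp
			qed
			show "(SUM a:U3. SUM b:U3. Pr (%D. phi D (fst (fst h ! (t1 + s))) = a & phi D (fst (snd h ! (t2 + s))) = b) *
				Vt (gap h s) (real N - real (cnt h s)) (b - a)) <= V \<bar>gap h s\<bar> (real N - real (cnt h s)) - vv / 2"
				using drift_joint[OF AT ne] unfolding A_def B_def Vt_def .
			fix a b
			have farA: "~ near k A (pos D0 i y)" if "i < t1 + s" for i using al0 that unfolding AB by (auto simp: al_iff)
			have farA': "~ near k A (pos D0 i x)" if "i < t2 + s" for i using al0 that unfolding AB by (auto simp: al_iff)
			have BtoA: "near k A q" if q: "near (H + int r + 3) B q" for q
			proof -
				obtain c where "\<bar>c\<bar> <= H + int r + 3" "q = sh B c" using q by (auto simp: near_def)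
				hence "q = sh A (G + c)" "\<bar>G + c\<bar> <= k" using BA G k by auto
				thus ?thesis unfolding near_def by blast
			qed
			define gn where "gn = nat \<bar>G\<bar>"
			have gn: "int gn = \<bar>G\<bar>" by (simp add: gn_def)
			have away: "q ~: nb P (int gn) (int r + 1) & sh q (-1) ~: nb P (int gn) (int r + 1)"
				if q: "q \<in> Tor" "~ near k A q" and P: "P = A | P = B" for q P
			proof (rule not_near_nb[where k="H + int r + 3"])
				show "P \<in> Tor" using P AT by auto
				show "~ near (H + int r + 3) P q" using q P BtoA[of q] near_mono[of "H + int r + 3" A q k] k H by auto
			qed (use q gn G in auto)
			have loc: "hist s D' = h" if D: "hist s D = h" "D - nb P (int gn) (int r + 1) = D' - nb P (int gn) (int r + 1)" "P = A | P = B" for D D' P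
			proof -
				have eq1: "pos D i y = pos D0 i y" if "i <= t1 + s" for i
					using D(1) D0(2) that unfolding hist_def by (auto simp: WP_eq_iff)
				have eq2: "pos D i x = pos D0 i x" if "i <= t2 + s" for i
					using D(1) D0(2) that unfolding hist_def by (auto simp: WP_eq_iff)
				have "WP y (t1 + s) D' = WP y (t1 + s) D"
					by (rule WP_local[OF y D(2)]) (use eq1 away[OF walk_torus[OF y] farA D(3)] in auto)
				moreover have "WP x (t2 + s) D' = WP x (t2 + s) D"
					by (rule WP_local[OF x D(2)]) (use eq2 away[OF walk_torus[OF x] farA' D(3)] in auto)
				ultimately show ?thesis using D(1) by (simp add: hist_def)
			qed
			have bound: "2 * int r + int gn + 3 <= int m" using r gn G by linarith
			\<comment> \<open>The window has to reach from the lower to the upper walker, and the sign of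
			  \<open>G\<close> tells which of them is the lower one.\<close>
			have "Pr (%D. hist s D = h & (phi D A = a & phi D B = b)) <= mixf z r * (Pr (%D. hist s D = h) * Pr (%D. phi D A = a & phi D B = b))"
			proof (cases "G > 0")
				case True
				hence b: "B = sh A (int gn)" using BA gn by simp
				show ?thesis unfolding b
					by (rule QI2[OF AT(1) _ r(1) bound, where Q="%u v. u = a & v = b"]) (use loc in "auto simp del: of_nat_eq_iff")
			next
				case False
				hence b: "A = sh B (int gn)" using AB' gn G by simp
				have "Pr (%D. hist s D = h & (phi D (sh B (int gn)) = a & phi D B = b)) <= mixf z r * (Pr (%D. hist s D = h) * Pr (%D. phi D (sh B (int gn)) = a & phi D B = b))"
					by (rule QI2[OF AT(2) _ r(1) bound, where Q="%u v. v = a & u = b"]) (use loc in auto)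
				thus ?thesis unfolding b[symmetric] .
			qed
			thus "Pr (%D. hist s D = h & phi D (fst (fst h ! (t1 + s))) = a & phi D (fst (snd h ! (t2 + s))) = b)
					<= mixf z r * (Pr (%D. hist s D = h) * Pr (%D. phi D (fst (fst h ! (t1 + s))) = a & phi D (fst (snd h ! (t2 + s))) = b))"
				unfolding A_def[symmetric] B_def[symmetric] .
		qed
		also have "Ex (%D. of_bool (alive s (hist s D)) * (V \<bar>gap (hist s D) s\<bar> (real N - real (cnt (hist s D) s)) - vv / 2)) = v s - vv / 2 * p s"
		proof -
			have "Ex (%D. of_bool (alive s (hist s D)) * (V \<bar>gap (hist s D) s\<bar> (real N - real (cnt (hist s D) s)) - vv / 2)) = Ex (%D. of_bool (al s D) * V \<bar>g s D\<bar> (Q s D) - vv / 2 * of_bool (al s D))"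
				by (rule Ex_cong) (simp add: al_def hg hn Q_def algebra_simps)
			thus ?thesis by (simp only: v_def p_def Pr_def Ex_diff Ex_cmult)
		qed
		finally show ?thesis .
	qed
	have H2: "(ri H)\<^sup>2 - 1 > 0"
	proof -
		have "1\<^sup>2 < (ri H)\<^sup>2" using H by (intro power_strict_mono) auto
		thus ?thesis by simp
	qed
	define c0 where "c0 = 2 * ri H * ri d + 4 * ri H * real N"
	have c0: "0 <= c0" using H d by (simp add: c0_def)
	have v0: "v 0 <= c0 * Pr (%D. Minc d y x D t1 t2)"
	proof -
		have "v 0 <= Ex (%D. c0 * of_bool (Minc d y x D t1 t2))"
			unfolding v_def
		proof (rule Ex_mono)
			fix D
			show "of_bool (al 0 D) * V \<bar>g 0 D\<bar> (Q 0 D) <= c0 * of_bool (Minc d y x D t1 t2)"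
			proof (cases "al 0 D")
				case True
				hence M: "Minc d y x D t1 t2" by (auto simp: al_iff)
				hence "ct d y x D t1 t2" by (simp add: Minc_def)
				hence "\<bar>g 0 D\<bar> <= d" unfolding g_def by (rule gp_0(1))
				hence "2 * ri H * ri \<bar>g 0 D\<bar> <= 2 * ri H * ri d"
					using H by (intro mult_left_mono) auto
				moreover have q0: "Q 0 D = N" by (simp add: Q_def nt_def)
				moreover have "0 <= (ri \<bar>g 0 D\<bar>)\<^sup>2" by simp
				ultimately have "V \<bar>g 0 D\<bar> (Q 0 D) <= c0" unfolding V_def c0_def q0 by linarith
				thus ?thesis using True M by simp
			qed (use c0 in auto)
		qed
		thus ?thesis by (simp add: Ex_cmult Pr_def)
	qed
	have "Pr (%D. Minc d y x D t1 t2 & pos D t1 y ~= pos D t2 x & Good D & card (Tg d y x t1 t2 l D) < N)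
			<= Pr (%D. al l D | (EX t:{..<l}. al t D & \<bar>g (Suc t) D\<bar> >= H))"
	proof (rule Pr_mono)
		fix D assume D: "D \<in> Om" and A: "Minc d y x D t1 t2 & pos D t1 y ~= pos D t2 x & Good D & card (Tg d y x t1 t2 l D) < N"
		have c: "ct d y x D t1 t2" using A by (auto simp: Minc_def)
		have kd: "0 <= k" using d by linarith
		have fresh: "ALL i<t1 + s'. ~ near k (pos D ((t1 + s')) y) (pos D i y)"
				"ALL i<t2 + s'. ~ near k (pos D ((t1 + s')) y) (pos D i x)" if "s' <= l" for s'
			using stage2_fresh[OF _ x y c d(3) k(2) kd that l(2) T] A by auto
		have ntl: "nt s D < N" if "s <= l" for s
		proof -
			have "nt s D <= card (Tg d y x t1 t2 l D)"
				unfolding nt_def Tg_def g_def using that by (intro card_mono) auto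
			thus ?thesis using A by simp
		qed
		show "al l D | (EX t:{..<l}. al t D & \<bar>g (Suc t) D\<bar> >= H)"
		proof (rule ccontr)
			assume no: "~ (al l D | (EX t:{..<l}. al t D & \<bar>g (Suc t) D\<bar> >= H))"
			have "al t D" if "t <= l" for t
				using that
			proof (induction t)
				case 0
				have "g 0 D ~= 0"
				proof
					assume "g 0 D = 0"
					hence "pos D t2 x = pos D t1 y" using gp_0(2)[OF c] walk_torus[OF y] by (simp add: g_def)
					thus False using A by simp
				qed
				moreover have "\<bar>g 0 D\<bar> < H" using gp_0(1)[OF c] d by (simp add: g_def)
				ultimately show ?case unfolding al_iff using A fresh[of 0] ntl[of 0] by simp
			next
				case (Suc t)
				hence at: "al t D" by simp
				hence lt: "\<bar>g (Suc t) D\<bar> < H" using no Suc by force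
				have gn: "g (Suc t) D ~= 0" using gne[OF D at] .
				have "g s' D ~= 0 & \<bar>g s' D\<bar> < H" if "s' <= Suc t" for s'
					using that at lt gn unfolding al_iff by (cases "s' = Suc t") (simp_all only: le_Suc_eq simp_thms)
				moreover have "s' <= l" if "s' <= Suc t" for s' using that Suc.prems by simp
				ultimately show ?case unfolding al_iff using A fresh ntl[OF Suc.prems] by simp
			qed
			thus False using no by blast
		qed
	qed
	also have "... <= p l + (SUM t<l. e t)"
		unfolding p_def e_def by (rule order_trans[OF Pr_or]) (intro add_mono order_refl Pr_union, simp)
	also have "... <= (mixf z r) ^ l * v 0 * (1 / (vv / 2 * l) + 1 / ((ri H)\<^sup>2 - 1))"
	proof (rule lyapunov_sum)
		show "0 <= v s" for s unfolding v_def
		proof (rule Ex_nonneg)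
			fix D show "0 <= of_bool (al s D) * V \<bar>g s D\<bar> (Q s D)"
				using V0[of "\<bar>g s D\<bar>" "Q s D"] Q1[of s D] H by (cases "al s D") (auto simp: al_iff)
		qed
		show "p (Suc t) <= p t" for t unfolding p_def using al_mono by (intro Pr_mono) auto
		show "1 <= mixf z r" using mixf_ge1[of r] r by simp
	qed (use vv_pos H2 step l in "auto simp: p_def e_def")
	also have "... <= (mixf z r) ^ l * (c0 * Pr (%D. Minc d y x D t1 t2)) * (1 / (vv / 2 * l) + 1 / ((ri H)\<^sup>2 - 1))"
		using v0 H2 vv_pos mixf_ge1[of r] r by (intro mult_right_mono mult_left_mono add_nonneg_nonneg) auto
	finally show ?thesis unfolding c0_def .
qed

end

section \<open>First returns and transpositions\<close>

definition first_return :: "('a => 'a) => 'a set => 'a => 'a" where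
	"first_return f X v = (f ^^ (LEAST t. 0 < t & (f ^^ t) v \<in> X)) v"

lemma first_return_eq:
	assumes "0 < t" "(f ^^ t) v \<in> X" "!!s. 0 < s ==> s < t ==> (f ^^ s) v ~: X"
	shows "first_return f X v = (f ^^ t) v"
proof -
	have "(LEAST t. 0 < t & (f ^^ t) v \<in> X) = t"
		using assms by (intro Least_equality) (auto simp: not_less[symmetric])
	thus ?thesis by (simp add: first_return_def)
qed

lemma first_return_obtain:
	assumes f: "f permutes S" "finite S" and v: "v \<in> X"
	obtains t where "0 < t" "(f ^^ t) v \<in> X" "!!s. 0 < s ==> s < t ==> (f ^^ s) v ~: X" "first_return f X v = (f ^^ t) v"
proof -
	have "permutation f" using f by (auto simp: permutation_permutes)
	hence "v \<in> orbit f v" by (rule permutation_self_in_orbit)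
	then obtain n where n: "0 < n" "(f ^^ n) v = v" by (auto simp: orbit_altdef)
	define t where "t = (LEAST t. 0 < t & (f ^^ t) v \<in> X)"
	have P: "0 < t & (f ^^ t) v \<in> X" unfolding t_def by (rule LeastI[of _ n]) (use n v in auto)
	moreover have "(f ^^ s) v ~: X" if "0 < s" "s < t" for s
		using not_less_Least[of s "%t. 0 < t & (f ^^ t) v \<in> X"] that unfolding t_def by auto
	ultimately show ?thesis using that[of t] by (auto simp: first_return_def t_def)
qed

lemma funpow_eq_diff:
	assumes "inj f" "(f ^^ s) v = (f ^^ t) w" "s <= t"
	shows "v = (f ^^ (t - s)) w"
proof -
	have "(f ^^ s) v = (f ^^ s) ((f ^^ (t - s)) w)" using assms(2,3) by (simp flip: funpow_add[unfolded o_def, THEN fun_cong])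
	thus ?thesis using inj_fn[OF assms(1)] by (simp add: inj_eq)
qed

text \<open>The starts \<open>p\<close> and \<open>q\<close> reach the two exchanged points before
  they meet \<open>X\<close> again. Precomposing \<open>f\<close> with this exchange swaps the
  remaining parts of the two paths, so it acts on first returns as a transposition.\<close>

locale path_swap =
	fixes f :: "'a => 'a" and X :: "'a set" and p q :: 'a and a b :: nat
	assumes inj: "inj f" and pq: "p ~= q" "p \<in> X" "q \<in> X"
		and pa: "!!s. 0 < s ==> s <= a ==> (f ^^ s) p ~: X"
		and qb: "!!s. 0 < s ==> s <= b ==> (f ^^ s) q ~: X"
begin

definition f' where "f' = f \<circ> swp ((f ^^ a) p) ((f ^^ b) q)"

text \<open>Paths that start in \<open>X\<close> and have not yet returned are disjoint: followed
  backwards from a common point, one of the starts would lie inside the other path.\<close>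

lemma avoid:
	assumes v: "v \<in> X" and s: "!!i. 0 < i ==> i <= s ==> (f ^^ i) v ~: X"
	shows "(f ^^ s) v = (f ^^ a) p \<longleftrightarrow> v = p & s = a" "(f ^^ s) v = (f ^^ b) q \<longleftrightarrow> v = q & s = b"
proof -
	have *: "v = w & s = c" if e: "(f ^^ s) v = (f ^^ c) w" and w: "w \<in> X" "!!i. 0 < i ==> i <= c ==> (f ^^ i) w ~: X" for c w
	proof (cases "s <= c")
		case True
		hence "v = (f ^^ (c - s)) w" using funpow_eq_diff[OF inj e] by simp
		hence "c - s = 0" using w(2)[of "c - s"] v by (cases "c - s = 0") auto
		thus ?thesis using True \<open>v = (f ^^ (c - s)) w\<close> by simp
	next
		case False
		hence "w = (f ^^ (s - c)) v" using funpow_eq_diff[OF inj e[symmetric]] by simp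
		hence "s - c = 0" using s[of "s - c"] w by (cases "s - c = 0") auto
		thus ?thesis using False by simp
	qed
	show "(f ^^ s) v = (f ^^ a) p \<longleftrightarrow> v = p & s = a" using *[of a p] pa pq by auto
	show "(f ^^ s) v = (f ^^ b) q \<longleftrightarrow> v = q & s = b" using *[of b q] qb pq by auto
qed

lemma f'_other: "v ~= (f ^^ a) p ==> v ~= (f ^^ b) q ==> f' v = f v"
	by (simp add: f'_def Transposition.transpose_def)

lemma path_other:
	assumes v: "v \<in> X" "v ~= p" "v ~= q" and s: "!!i. 0 < i ==> i < s ==> (f ^^ i) v ~: X"
	shows "(f' ^^ s) v = (f ^^ s) v"
	using s
proof (induction s)
	case (Suc s)
	hence "(f' ^^ s) v = (f ^^ s) v" by simp
	moreover have "(f ^^ s) v ~= (f ^^ a) p" "(f ^^ s) v ~= (f ^^ b) q" using avoid[OF v(1), of s] Suc.prems v by auto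
	ultimately show ?case using f'_other by simp
qed simp

lemma path_p: "s <= a ==> (f' ^^ s) p = (f ^^ s) p"
proof (induction s)
	case (Suc s)
	hence "(f ^^ s) p ~= (f ^^ a) p" "(f ^^ s) p ~= (f ^^ b) q" using avoid[OF pq(2), of s] pa pq by auto
	thus ?case using Suc f'_other by simp
qed simp

lemma path_p_after:
	assumes s: "!!i. 0 < i ==> i < b + Suc j ==> (f ^^ i) q ~: X"
	shows "(f' ^^ (a + Suc j)) p = (f ^^ (b + Suc j)) q"
	using s
proof (induction j)
	case 0
	have "(f' ^^ Suc a) p = f' ((f ^^ a) p)" using path_p[of a] by simp
	also have "... = f ((f ^^ b) q)" by (simp add: f'_def)
	finally show ?case by simp
next
	case (Suc j)
	have "(f' ^^ (a + Suc (Suc j))) p = f' ((f ^^ (b + Suc j)) q)" using Suc by simp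
	moreover have "(f ^^ (b + Suc j)) q ~= (f ^^ a) p" "(f ^^ (b + Suc j)) q ~= (f ^^ b) q"
		using avoid[OF pq(3), of "b + Suc j"] Suc.prems pq by auto
	ultimately show ?case using f'_other by simp
qed

lemma swap: "path_swap f X q p b a"
	using inj pq pa qb by unfold_locales auto

lemma f'_swap: "path_swap.f' f q p b a = f'"
	unfolding path_swap.f'_def[OF swap] f'_def by (simp add: Transposition.transpose_commute)

lemmas path_q = path_swap.path_p[OF swap, unfolded f'_swap]
lemmas path_q_after = path_swap.path_p_after[OF swap, unfolded f'_swap]

text \<open>The new path of \<open>p\<close> runs along its old path for \<open>a\<close> steps and
  then continues along the old path of \<open>q\<close> after step \<open>b\<close>.\<close>

lemma return_p:
	assumes f: "f permutes S" "finite S"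
	shows "first_return f' X p = first_return f X q"
proof -
	obtain t where t: "0 < t" "(f ^^ t) q \<in> X" "!!s. 0 < s ==> s < t ==> (f ^^ s) q ~: X" "first_return f X q = (f ^^ t) q"
		using first_return_obtain[OF f pq(3)] by blast
	have "b < t" using t(1,2) qb[of t] by (cases "t <= b") auto
	define j where "j = t - b - 1"
	have j: "t = b + Suc j" using \<open>b < t\<close> by (simp add: j_def)
	have after: "(f' ^^ (a + Suc i)) p = (f ^^ (b + Suc i)) q" if "i <= j" for i
		using that t(3) j by (intro path_p_after) auto
	have "first_return f' X p = (f' ^^ (a + Suc j)) p"
	proof (rule first_return_eq)
		show "(f' ^^ (a + Suc j)) p \<in> X" using after[of j] t(2) j by simp
		fix s assume s: "0 < s" "s < a + Suc j"
		show "(f' ^^ s) p ~: X"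
		proof (cases "s <= a")
			case True thus ?thesis using path_p pa s by simp
		next
			case False
			define i where "i = s - a - 1"
			have i: "s = a + Suc i" "i < j" using False s by (auto simp: i_def)
			thus ?thesis using after[of i] t(3)[of "b + Suc i"] j by simp
		qed
	qed simp
	thus ?thesis using after[of j] t(4) j by simp
qed

lemma return_q:
	assumes f: "f permutes S" "finite S"
	shows "first_return f' X q = first_return f X p"
	using path_swap.return_p[OF swap f] unfolding f'_swap .

lemma return_other:
	assumes f: "f permutes S" "finite S" and v: "v \<in> X" "v ~= p" "v ~= q"
	shows "first_return f' X v = first_return f X v"
proof -
	obtain t where t: "0 < t" "(f ^^ t) v \<in> X" "!!s. 0 < s ==> s < t ==> (f ^^ s) v ~: X" "first_return f X v = (f ^^ t) v"
		using first_return_obtain[OF f v(1)] by blast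
	have e: "(f' ^^ s) v = (f ^^ s) v" if "s <= t" for s using that t(3) by (intro path_other[OF v]) auto
	have "first_return f' X v = (f' ^^ t) v"
		by (rule first_return_eq) (use t e in auto)
	thus ?thesis using e t by simp
qed

end

text \<open>The first-return map in terms of sample indices, to be used for injective samples; the
  identity from \<open>k\<close> on makes it a permutation in the sense of
  \<open>permutes\<close>.\<close>

definition induced :: "('a => 'a) => nat => (nat => 'a) => nat => nat" where
	"induced f k x i = (if i < k then inv_into {..<k} x (first_return f (x ` {..<k}) (x i)) else i)"

lemma induced_swap:
	assumes "path_swap f (x ` {..<k}) (x i) (x j) a b" and f: "f permutes S" "finite S" and ij: "i < k" "j < k"
		and x: "inj_on x {..<k}"
	shows "induced (path_swap.f' f (x i) (x j) a b) k x = induced f k x \<circ> swp i j"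
proof
	interpret path_swap f "x ` {..<k}" "x i" "x j" a b by fact
	fix l
	show "induced f' k x l = (induced f k x \<circ> swp i j) l"
	proof (cases "l < k")
		case True
		consider "l = i" | "l = j" | "l ~= i" "l ~= j" by blast
		thus ?thesis
		proof cases
			case 1 thus ?thesis using ij return_p[OF f] by (simp add: induced_def)
		next
			case 2 thus ?thesis using ij return_q[OF f] by (simp add: induced_def)
		next
			case 3
			have "x l ~= x i" "x l ~= x j" using 3 True ij x by (auto simp: inj_on_def)
			hence "first_return f' (x ` {..<k}) (x l) = first_return f (x ` {..<k}) (x l)"
				using return_other[OF f, of "x l"] True by auto
			thus ?thesis using 3 True by (simp add: induced_def Transposition.transpose_def)
		qed
	next
		case False
		thus ?thesis using ij by (auto simp: induced_def Transposition.transpose_def)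
	qed
qed

context hcw begin

subsection \<open>Toggling an edge between the two walkers\<close>

definition tgl :: "int \<times> int => (int \<times> int) set => (int \<times> int) set" where
	"tgl e D = (if e \<in> D then D - {e} else insert e D)"

lemma tgl_tgl [simp]: "tgl e (tgl e D) = D" by (auto simp: tgl_def)

lemma in_tgl: "u \<in> tgl e D \<longleftrightarrow> (if u = e then e ~: D else u \<in> D)" by (auto simp: tgl_def)

lemma sh1_ne: "e \<in> Tor ==> sh e 1 ~= e" "e \<in> Tor ==> sh e (-1) ~= e"
	using m_ge by (auto simp: sh_eq_iff')

lemma tgl_Om:
	assumes D: "D \<in> Om" and e: "e \<in> Tor" and free: "sh e 1 ~: D" "sh e (-1) ~: D"
	shows "tgl e D \<in> Om"
proof (cases "e \<in> D")
	case True
	hence "tgl e D <= D" by (auto simp: tgl_def)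
	thus ?thesis using Om_subset[OF D] by blast
next
	case False
	thus ?thesis using Om_insert[OF D e free] by (simp add: tgl_def)
qed

text \<open>A difference of 0 or -2 forces the steps of the pair to be both 0, or 1 and -1; that is,
  neither site is exchanged with a third one.\<close>

lemma phi_pair:
	assumes D: "D \<in> Om" and e: "e \<in> Tor"
	shows "phi D (sh e 1) - phi D e \<in> {0, -2} \<longleftrightarrow> sh e 1 ~: D & sh e (-1) ~: D"
proof -
	have h: "sh e 1 \<in> Tor" using e by simp
	have b: "sh (sh e 1) (-1) = e" using e by simp
	have n1: "e \<in> D ==> sh e 1 ~: D" using Om_sh[OF D] by blast
	have n2: "sh e (-1) \<in> D ==> e ~: D" using Om_sh[OF D, of "sh e (-1)"] e by auto
	show ?thesis using e h b n1 n2 by (auto simp: phi_def)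
qed

lemma Phi_tgl:
	assumes D: "D \<in> Om" and e: "e \<in> Tor" and free: "sh e 1 ~: D" "sh e (-1) ~: D"
	shows "Phi (tgl e D) = Phi D \<circ> swp e (sh e 1)"
proof
	fix v
	have h: "sh e 1 \<in> Tor" using e by simp
	have b: "sh (sh e 1) (-1) = e" using e by simp
	note ne = sh1_ne[OF e]
	show "Phi (tgl e D) v = (Phi D \<circ> swp e (sh e 1)) v"
	proof (cases "v \<in> Tor")
		case False
		hence "v ~= e" "v ~= sh e 1" using e h by auto
		thus ?thesis using False by (simp add: Phi_out)
	next
		case True
		consider "v = e" | "v = sh e 1" | "v ~= e" "v ~= sh e 1" by blast
		thus ?thesis
		proof cases
			case 1
			have "mv (tgl e D) e = mv D (sh e 1)"
				using e h b ne free by (auto simp: mv_def phi_def in_tgl)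
			thus ?thesis using 1 e h by (simp add: Phi_eq)
		next
			case 2
			have "mv (tgl e D) (sh e 1) = mv D e"
				using e h b ne free by (auto simp: mv_def phi_def in_tgl)
			thus ?thesis using 2 e h by (simp add: Phi_eq)
		next
			case 3
			have "sh v (-1) ~= e"
			proof
				assume "sh v (-1) = e"
				hence "sh (sh v (-1)) 1 = sh e 1" by simp
				thus False using 3 True by simp
			qed
			hence "phi (tgl e D) v = phi D v" using 3 by (intro phi_local) (auto simp: in_tgl)
			thus ?thesis using 3 True by (simp add: Phi_expl)
		qed
	qed
qed

lemma card_tgl:
	assumes D: "D \<in> Om" and e: "e ~: D"
	shows "z ^ card (tgl e D) = z * z ^ card D"
	using card_insert_Om[OF D e] e by (simp add: tgl_def)

end

section \<open>Certified encounters and cancellation\<close>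

context hcw begin

definition NoHit :: "(int \<times> int) set => int \<times> int => int \<times> int => (int \<times> int) set => nat => nat => bool" where
	"NoHit X y x D T1 T2 \<longleftrightarrow> (ALL i. 0 < i --> i <= T1 --> pos D i y ~: X) & (ALL i. 0 < i --> i <= T2 --> pos D i x ~: X)"

text \<open>The encounter and \<open>l\<close> further steps of both walkers happen before either
  meets \<open>X\<close> again, so a toggle there transposes the induced permutation. The event
  itself is invariant under such toggles, see \<open>cert_toggle\<close>.\<close>

definition Cert :: "int => int \<times> int => int \<times> int => (int \<times> int) set => nat => nat => nat => (int \<times> int) set => bool" where
	"Cert d y x X t1 t2 l D \<longleftrightarrow> Minc d y x D t1 t2 & NoHit X y x D (t1 + l) (t2 + l)"

text \<open>Meaningful at times in \<open>Tg\<close>, where it is the lower of the two neighbouring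
  sites.\<close>

definition lo :: "int => int \<times> int => int \<times> int => nat => nat => (int \<times> int) set => nat => int \<times> int" where
	"lo d y x t1 t2 D s = (if gp d y x t1 t2 D s = 1 then pos D ((t1 + s)) y else pos D ((t2 + s)) x)"

lemma phi_tgl_other:
	assumes v: "v \<in> Tor" and "v ~= e" "v ~= sh e 1"
	shows "phi (tgl e D) v = phi D v"
proof -
	have "sh v (-1) ~= e"
	proof
		assume "sh v (-1) = e"
		hence "sh (sh v (-1)) 1 = sh e 1" by simp
		thus False using assms by simp
	qed
	thus ?thesis using assms by (intro phi_local) (auto simp: in_tgl)
qed

lemma phi_tgl_pair:
	assumes D: "D \<in> Om" and e: "e \<in> Tor" and free: "sh e 1 ~: D" "sh e (-1) ~: D"
	shows "phi (tgl e D) (sh e 1) - phi (tgl e D) e = - 2 - (phi D (sh e 1) - phi D e)"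
proof -
	have h: "sh e 1 \<in> Tor" using e by simp
	have b: "sh (sh e 1) (-1) = e" using e by simp
	note ne = sh1_ne[OF e]
	show ?thesis using e h b ne free by (auto simp: phi_def in_tgl)
qed

text \<open>Up to step \<open>s\<close> nothing changes; afterwards the two paths are exchanged and
  the gap changes its sign. Whatever is expressed by the earlier paths, by the unordered pair of
  paths or by the absolute gap is therefore preserved, and toggles at different times do not
  interfere.\<close>

lemma cert_toggle:
	assumes D: "D \<in> Om" and x: "x \<in> Tor" and y: "y \<in> Tor" and X: "x \<in> X" "y \<in> X" "x ~= y"
		and c: "Cert d y x X t1 t2 l D" and l: "l < n" and s: "s \<in> Tg d y x t1 t2 l D"
	defines "D' == tgl (lo d y x t1 t2 D s) D"
	shows "D' \<in> Om" and "path_swap (Phi D) X y x (t1 + s) (t2 + s)"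
		and "Phi D' = path_swap.f' (Phi D) y x (t1 + s) (t2 + s)"
		and "Cert d y x X t1 t2 l D'" and "Tg d y x t1 t2 l D' = Tg d y x t1 t2 l D"
		and "!!j. j \<in> Tg d y x t1 t2 l D ==> lo d y x t1 t2 D' j = lo d y x t1 t2 D j"
		and "!!j. j \<in> Tg d y x t1 t2 l D ==> j ~= s ==> lo d y x t1 t2 D j \<in> D' \<longleftrightarrow> lo d y x t1 t2 D j \<in> D"
proof -
	define e where "e = lo d y x t1 t2 D s"
	define g where "g = gp d y x t1 t2 D"
	define A where "A = (%i. pos D i y)"
	define B where "B = (%i. pos D i x)"
	have ctD: "ct d y x D t1 t2" using c by (auto simp: Cert_def Minc_def)
	have sl: "s < l" and gs: "\<bar>g s\<bar> = 1" "\<bar>g (Suc s)\<bar> = 1" using s by (auto simp: Tg_def g_def)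
	have tor: "A i \<in> Tor" "B i \<in> Tor" for i unfolding A_def B_def using walk_torus x y by auto
	have BA: "B (t2 + j) = sh (A (t1 + j)) (g j)" for j
		unfolding A_def B_def g_def by (rule gp_pos[OF y ctD])
	have AB: "A (t1 + j) = sh (B (t2 + j)) (- g j)" for j unfolding BA using tor by simp
	have eh: "g j = 1 ==> lo d y x t1 t2 D j = A (t1 + j) & sh (lo d y x t1 t2 D j) 1 = B (t2 + j)"
			"g j = -1 ==> lo d y x t1 t2 D j = B (t2 + j) & sh (lo d y x t1 t2 D j) 1 = A (t1 + j)" for j
		using BA[of j] AB[of j] by (auto simp: lo_def g_def A_def B_def)
	have gs': "g s = 1 | g s = -1" using gs by auto
	have et: "e \<in> Tor" using eh[of s] gs' tor unfolding e_def by auto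
	have gS: "g (Suc j) = g j + (phi D (B (t2 + j)) - phi D (A (t1 + j)))" for j
		by (simp add: g_def gp_Suc A_def B_def)
	have "phi D (sh e 1) - phi D e \<in> {0, -2}"
		using gs' gs eh[of s] gS[of s] unfolding e_def[symmetric] by auto
	hence free: "sh e 1 ~: D" "sh e (-1) ~: D" using phi_pair[OF D et] by auto
	have D'e: "D' = tgl e D" by (simp add: D'_def e_def)
	show O': "D' \<in> Om" unfolding D'e by (rule tgl_Om[OF D et free])
	have nh: "!!i. 0 < i ==> i <= t1 + l ==> A i ~: X" "!!i. 0 < i ==> i <= t2 + l ==> B i ~: X"
		using c unfolding Cert_def NoHit_def A_def B_def by auto
	show ps: "path_swap (Phi D) X y x (t1 + s) (t2 + s)"
		using X Phi_permutes[OF D] permutes_inj nh sl unfolding A_def B_def by unfold_locales auto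
	interpret P: path_swap "Phi D" X y x "t1 + s" "t2 + s" by (rule ps)
	have "swp e (sh e 1) = swp (A (t1 + s)) (B (t2 + s))"
		using gs' eh[of s] unfolding e_def[symmetric] by (auto simp: Transposition.transpose_commute)
	thus f': "Phi D' = P.f'" unfolding D'e Phi_tgl[OF D et free] P.f'_def A_def B_def by simp
	have pathA: "pos D' i y = A i" if "i <= t1 + s" for i using P.path_p[OF that] unfolding f' A_def .
	have pathB: "pos D' i x = B i" if "i <= t2 + s" for i using P.path_q[OF that] unfolding f' B_def .
	have pathA': "pos D' ((t1 + j)) y = B (t2 + j)" if "s < j" "j <= l" for j
	proof -
		have "(P.f' ^^ (t1 + s + Suc (j - Suc s))) y = pos D ((t2 + s + Suc (j - Suc s))) x"
			by (rule P.path_p_after) (use nh(2) that in "auto simp: B_def")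
		moreover have "t1 + s + Suc (j - Suc s) = t1 + j" "t2 + s + Suc (j - Suc s) = t2 + j" using that by auto
		ultimately show ?thesis unfolding f' B_def by simp
	qed
	have pathB': "pos D' ((t2 + j)) x = A (t1 + j)" if "s < j" "j <= l" for j
	proof -
		have "(P.f' ^^ (t2 + s + Suc (j - Suc s))) x = pos D ((t1 + s + Suc (j - Suc s))) y"
			by (rule P.path_q_after) (use nh(1) that in "auto simp: A_def")
		moreover have "t2 + s + Suc (j - Suc s) = t2 + j" "t1 + s + Suc (j - Suc s) = t1 + j" using that by auto
		ultimately show ?thesis unfolding f' A_def by simp
	qed
	\<comment> \<open>By \<open>avoid\<close> the two toggled sites are visited at no other time of the
	  encounter, so the remaining steps of both paths keep their values.\<close>
	have avA: "A (t1 + j) ~= A (t1 + s) & A (t1 + j) ~= B (t2 + s)" if "j <= l" "j ~= s" for j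
		using P.avoid[of y "t1 + j"] nh(1) X that unfolding A_def B_def by auto
	have avB: "B (t2 + j) ~= A (t1 + s) & B (t2 + j) ~= B (t2 + s)" if "j <= l" "j ~= s" for j
		using P.avoid[of x "t2 + j"] nh(2) X that unfolding A_def B_def by auto
	have ese: "{e, sh e 1} = {A (t1 + s), B (t2 + s)}" using gs' eh[of s] unfolding e_def[symmetric] by auto
	have phA: "phi D' (A (t1 + j)) = phi D (A (t1 + j))" if "j <= l" "j ~= s" for j
		unfolding D'e by (rule phi_tgl_other[OF tor(1)]) (use avA[OF that] ese in auto)
	have phB: "phi D' (B (t2 + j)) = phi D (B (t2 + j))" if "j <= l" "j ~= s" for j
		unfolding D'e by (rule phi_tgl_other[OF tor(2)]) (use avB[OF that] ese in auto)
	define g' where "g' = gp d y x t1 t2 D'"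
	have g'S: "g' (Suc j) = g' j + (phi D' (pos D' ((t2 + j)) x) - phi D' (pos D' ((t1 + j)) y))" for j
		by (simp add: g'_def gp_Suc)
	have g1: "g' j = g j" if "j <= s" for j
		using that
	proof (induction j)
		case 0
		have "pos D' t1 y = pos D t1 y" "pos D' t2 x = pos D t2 x"
			using pathA[of t1] pathB[of t2] by (auto simp: A_def B_def)
		thus ?case by (simp add: g'_def g_def gp_def)
	next
		case (Suc j)
		thus ?case using g'S[of j] gS[of j] pathA[of "t1 + j"] pathB[of "t2 + j"] phA[of j] phB[of j] sl by simp
	qed
	have gSs: "g' (Suc s) = - g (Suc s)"
	proof -
		have a: "g' (Suc s) = g s + (phi D' (B (t2 + s)) - phi D' (A (t1 + s)))"
			using g'S[of s] g1[of s] pathA[of "t1 + s"] pathB[of "t2 + s"] by simp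
		have b: "phi D' (sh e 1) - phi D' e = - 2 - (phi D (sh e 1) - phi D e)"
			unfolding D'e by (rule phi_tgl_pair[OF D et free])
		show ?thesis using gs'
		proof
			assume g1: "g s = 1"
			hence "e = A (t1 + s)" "sh e 1 = B (t2 + s)" using eh(1)[of s] unfolding e_def[symmetric] by auto
			thus ?thesis using a b gS[of s] g1 by simp
		next
			assume g1: "g s = -1"
			hence "e = B (t2 + s)" "sh e 1 = A (t1 + s)" using eh(2)[of s] unfolding e_def[symmetric] by auto
			thus ?thesis using a b gS[of s] g1 by simp
		qed
	qed
	have g2: "g' (Suc s + j) = - g (Suc s + j)" if "Suc s + j <= l" for j
		using that
	proof (induction j)
		case 0 thus ?case using gSs by simp
	next
		case (Suc j)
		have "g' (Suc (Suc s + j)) = g' (Suc s + j) + (phi D (A (t1 + (Suc s + j))) - phi D (B (t2 + (Suc s + j))))"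
			using g'S[of "Suc s + j"] pathA'[of "Suc s + j"] pathB'[of "Suc s + j"] phA[of "Suc s + j"] phB[of "Suc s + j"] Suc.prems by simp
		thus ?case using Suc gS[of "Suc s + j"] by simp
	qed
	have ga: "g' j = (if j <= s then g j else - g j)" if "j <= l" for j
	proof (cases "j <= s")
		case False
		hence "j = Suc s + (j - Suc s)" by simp
		thus ?thesis using g2[of "j - Suc s"] that False by metis
	qed (use g1 in simp)
	have gabs: "\<bar>g' j\<bar> = \<bar>g j\<bar>" if "j <= l" for j using ga[OF that] by simp
	show Tg': "Tg d y x t1 t2 l D' = Tg d y x t1 t2 l D"
		unfolding Tg_def g'_def[symmetric] g_def[symmetric] using gabs by auto
	show lo': "lo d y x t1 t2 D' j = lo d y x t1 t2 D j" if j: "j \<in> Tg d y x t1 t2 l D" for j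
	proof -
		have jl: "j < l" and gj: "g j = 1 | g j = -1" using j by (auto simp: Tg_def g_def)
		show ?thesis
		proof (cases "j <= s")
			case True
			thus ?thesis using ga[of j] jl pathA[of "t1 + j"] pathB[of "t2 + j"]
				unfolding lo_def g'_def[symmetric] g_def[symmetric] A_def B_def by simp
		next
			case False
			thus ?thesis using ga[of j] jl gj pathA'[of j] pathB'[of j]
				unfolding lo_def g'_def[symmetric] g_def[symmetric] A_def B_def by auto
		qed
	qed
	show "lo d y x t1 t2 D j \<in> D' \<longleftrightarrow> lo d y x t1 t2 D j \<in> D" if j: "j \<in> Tg d y x t1 t2 l D" "j ~= s" for j
	proof -
		have jl: "j <= l" and gj: "g j = 1 | g j = -1" using j by (auto simp: Tg_def g_def)
		have e1: "e = A (t1 + s) | e = B (t2 + s)" using ese by blast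
		have e2: "lo d y x t1 t2 D j = A (t1 + j) | lo d y x t1 t2 D j = B (t2 + j)" using eh[of j] gj by blast
		have "lo d y x t1 t2 D j ~= e" using e1 e2 avA[OF jl j(2)] avB[OF jl j(2)] by metis
		thus ?thesis by (simp add: D'e in_tgl)
	qed
	have "Minc d y x D' t1 t2"
	proof -
		have "ct d y x D' s1 s2 = ct d y x D s1 s2" if "s1 <= t1" "s2 <= t2" for s1 s2
			using that pathA[of s1] pathB[of s2] by (simp add: ct_def A_def B_def)
		thus ?thesis using c by (simp add: Cert_def Minc_def)
	qed
	moreover have "NoHit X y x D' (t1 + l) (t2 + l)"
		unfolding NoHit_def
	proof (intro conjI allI impI)
		fix i assume i: "0 < i" "i <= t1 + l"
		show "pos D' i y ~: X"
		proof (cases "i <= t1 + s")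
			case True thus ?thesis using pathA nh(1) i by simp
		next
			case False
			hence "i = t1 + (i - t1)" "s < i - t1" "i - t1 <= l" using i by auto
			thus ?thesis using pathA'[of "i - t1"] nh(2)[of "t2 + (i - t1)"] by simp
		qed
	next
		fix i assume i: "0 < i" "i <= t2 + l"
		show "pos D' i x ~: X"
		proof (cases "i <= t2 + s")
			case True thus ?thesis using pathB nh(2) i by simp
		next
			case False
			hence "i = t2 + (i - t2)" "s < i - t2" "i - t2 <= l" using i by auto
			thus ?thesis using pathB'[of "i - t2"] nh(1)[of "t1 + (i - t2)"] by simp
		qed
	qed
	ultimately show "Cert d y x X t1 t2 l D'" by (simp add: Cert_def)
qed

text \<open>Toggling pairs up the configurations with the edge absent and present; the weights have the
	ratio \<open>z\<close>, and \<open>F\<close> changes sign.\<close>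

lemma toggle_expectation:
	assumes E: "!!D. D \<in> Om ==> E D ==> tgl (ep D) D \<in> Om & E (tgl (ep D) D) & ep (tgl (ep D) D) = ep D & F (tgl (ep D) D) = - F D"
	shows "Ex (%D. of_bool (E D) * F D) = (1 - z) / (1 + z) * Ex (%D. of_bool (E D) * (F D * (if ep D \<in> D then -1 else 1)))"
proof -
	define S0 where "S0 = {D\<in>Om. E D & ep D ~: D}"
	define S1 where "S1 = {D\<in>Om. E D & ep D \<in> D}"
	have fin: "finite S0" "finite S1" "S0 \<inter> S1 = {}" by (auto simp: S0_def S1_def)
	have split: "(SUM D:Om. z ^ card D * (of_bool (E D) * G D)) = (SUM D:S0. z ^ card D * G D) + (SUM D:S1. z ^ card D * G D)" for G
	proof -
		have "(SUM D:Om. z ^ card D * (of_bool (E D) * G D)) = (SUM D:S0 \<union> S1. z ^ card D * G D)"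
			by (rule sum.mono_neutral_cong_right) (auto simp: S0_def S1_def)
		thus ?thesis using fin by (simp add: sum.union_disjoint)
	qed
	have swap: "(SUM D:S1. z ^ card D * F D) = - z * (SUM D:S0. z ^ card D * F D)"
	proof -
		have "(SUM D:S1. z ^ card D * F D) = (SUM D:S0. - z * (z ^ card D * F D))"
		proof (rule sum.reindex_bij_witness[where i="%D. tgl (ep D) D" and j="%D. tgl (ep D) D"])
			fix D assume "D \<in> S1"
			hence D: "D \<in> Om" "E D" "ep D \<in> D" by (auto simp: S1_def)
			note e = E[OF D(1,2)]
			show "tgl (ep (tgl (ep D) D)) (tgl (ep D) D) = D" using e by simp
			show "tgl (ep D) D \<in> S0" using e D by (auto simp: S0_def in_tgl)
			have "z ^ card (tgl (ep D) (tgl (ep D) D)) = z * z ^ card (tgl (ep D) D)"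
				by (rule card_tgl) (use e D in "auto simp: in_tgl")
			thus "- z * (z ^ card (tgl (ep D) D) * F (tgl (ep D) D)) = z ^ card D * F D" using e by simp
		next
			fix D assume "D \<in> S0"
			hence D: "D \<in> Om" "E D" "ep D ~: D" by (auto simp: S0_def)
			note e = E[OF D(1,2)]
			show "tgl (ep (tgl (ep D) D)) (tgl (ep D) D) = D" using e by simp
			show "tgl (ep D) D \<in> S1" using e D by (auto simp: S1_def in_tgl)
		qed
		thus ?thesis by (simp add: sum_distrib_left)
	qed
	define R where "R = (SUM D:S0. z ^ card D * F D)"
	have 1: "(SUM D:Om. z ^ card D * (of_bool (E D) * F D)) = (1 - z) * R"
		unfolding split swap R_def by (simp add: algebra_simps)
	have "(SUM D:S1. z ^ card D * (F D * (if ep D \<in> D then -1 else 1))) = - (SUM D:S1. z ^ card D * F D)"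
		unfolding sum_negf[symmetric] by (rule sum.cong) (auto simp: S1_def)
	moreover have "(SUM D:S0. z ^ card D * (F D * (if ep D \<in> D then -1 else 1))) = R"
		unfolding R_def by (rule sum.cong) (auto simp: S0_def)
	ultimately have 2: "(SUM D:Om. z ^ card D * (of_bool (E D) * (F D * (if ep D \<in> D then -1 else 1)))) = (1 + z) * R"
		unfolding split swap R_def[symmetric] by (simp add: algebra_simps)
	show ?thesis unfolding Ex_def 1 2 using z_pos by simp
qed

definition bt :: "int => int \<times> int => int \<times> int => nat => nat => (int \<times> int) set => nat => real" where
	"bt d y x t1 t2 D s = (if lo d y x t1 t2 D s \<in> D then -1 else 1)"

text \<open>\<open>toggle_expectation\<close> is iterated over \<open>Q\<close>. A toggle leaves the
  signs belonging to the other toggle times unchanged, so each time in \<open>Q\<close> contributes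
  one factor \<open>(1 - z) / (1 + z)\<close> and leaves behind a sign of absolute value 1.\<close>

lemma cert_Q:
	assumes x: "x \<in> Tor" and y: "y \<in> Tor" and X: "x \<in> X" "y \<in> X" "x ~= y" and l: "l < n"
		and F: "!!D s. D \<in> Om ==> path_swap (Phi D) X y x (t1 + s) (t2 + s) ==> tgl (lo d y x t1 t2 D s) D \<in> Om ==>
				Phi (tgl (lo d y x t1 t2 D s) D) = path_swap.f' (Phi D) y x (t1 + s) (t2 + s) ==>
				F (tgl (lo d y x t1 t2 D s) D) = - F D"
		and F1: "!!D. \<bar>F D\<bar> <= 1" and Q: "finite Q"
	shows "\<bar>Ex (%D. of_bool (Cert d y x X t1 t2 l D & Tg d y x t1 t2 l D = Q) * F D)\<bar>
		<= \<bar>(1 - z) / (1 + z)\<bar> ^ card Q * Pr (%D. Cert d y x X t1 t2 l D & Tg d y x t1 t2 l D = Q)"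
proof -
	define E where "E = (%D. Cert d y x X t1 t2 l D & Tg d y x t1 t2 l D = Q)"
	define b where "b = bt d y x t1 t2"
	define ep where "ep = (%s D. lo d y x t1 t2 D s)"
	have main: "Ex (%D. of_bool (E D) * F D) = ((1 - z) / (1 + z)) ^ card R * Ex (%D. of_bool (E D) * (F D * (PROD j:R. b D j)))"
		if "R <= Q" for R
		using finite_subset[OF that Q] that
	proof (induction R rule: finite_induct)
		case (insert s R)
		have sQ: "s \<in> Q" "R <= Q" using insert by auto
		have "Ex (%D. of_bool (E D) * (F D * (PROD j:R. b D j))) = (1 - z) / (1 + z) *
				Ex (%D. of_bool (E D) * ((F D * (PROD j:R. b D j)) * (if ep s D \<in> D then -1 else 1)))"
		proof (rule toggle_expectation)
			fix D assume D: "D \<in> Om" and ED: "E D"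
			define D' where "D' = tgl (ep s D) D"
			have c: "Cert d y x X t1 t2 l D" "Tg d y x t1 t2 l D = Q" using ED by (auto simp: E_def)
			have s: "s \<in> Tg d y x t1 t2 l D" using c sQ by simp
			note ct = cert_toggle[OF D x y X c(1) l s]
			have D'e: "D' = tgl (lo d y x t1 t2 D s) D" by (simp add: D'_def ep_def)
			have 1: "D' \<in> Om" "E D'" using ct(1,4,5) c unfolding D'e E_def by auto
			have 2: "ep s D' = ep s D" using ct(6)[OF s] unfolding D'e ep_def .
			have 3: "F D' = - F D" unfolding D'e by (rule F[OF D ct(2) ct(1) ct(3)])
			have 4: "b D' j = b D j" if "j \<in> R" for j
			proof -
				have j: "j \<in> Tg d y x t1 t2 l D" "j ~= s" using that sQ insert c by auto
				show ?thesis using ct(6)[OF j(1)] ct(7)[OF j] unfolding b_def bt_def D'e by simp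
			qed
			have 5: "(PROD j:R. b D' j) = (PROD j:R. b D j)" by (rule prod.cong) (use 4 in auto)
			show "tgl (ep s D) D \<in> Om & E (tgl (ep s D) D) & ep s (tgl (ep s D) D) = ep s D &
					F (tgl (ep s D) D) * (PROD j:R. b (tgl (ep s D) D) j) = - (F D * (PROD j:R. b D j))"
				using 1 2 3 5 unfolding D'_def by simp
		qed
		moreover have "Ex (%D. of_bool (E D) * ((F D * (PROD j:R. b D j)) * (if ep s D \<in> D then -1 else 1)))
			= Ex (%D. of_bool (E D) * (F D * (PROD j:insert s R. b D j)))"
			by (rule Ex_cong) (use insert in "simp add: b_def bt_def ep_def")
		ultimately show ?case using insert sQ by simp
	qed simp
	have "\<bar>Ex (%D. of_bool (E D) * (F D * (PROD j:Q. b D j)))\<bar> <= Ex (%D. \<bar>of_bool (E D) * (F D * (PROD j:Q. b D j))\<bar>)"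
		by (rule Ex_abs)
	also have "... <= Pr E"
		unfolding Pr_def
	proof (rule Ex_mono)
		fix D
		have "\<bar>PROD j:Q. b D j\<bar> = 1" unfolding abs_prod by (rule prod.neutral) (auto simp: b_def bt_def)
		thus "\<bar>of_bool (E D) * (F D * (PROD j:Q. b D j))\<bar> <= of_bool (E D)" using F1[of D] by (simp add: abs_mult)
	qed
	finally have "\<bar>(1 - z) / (1 + z)\<bar> ^ card Q * \<bar>Ex (%D. of_bool (E D) * (F D * (PROD j:Q. b D j)))\<bar> <= \<bar>(1 - z) / (1 + z)\<bar> ^ card Q * Pr E"
		by (intro mult_left_mono) auto
	thus ?thesis using main[of Q] unfolding E_def by (simp add: abs_mult power_abs)
qed

lemma rho_bounds: "\<bar>(1 - z) / (1 + z)\<bar> < 1" using z_pos by (auto simp: abs_less_iff field_simps)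

text \<open>The event is partitioned according to the exact set of toggle times, a subset of
  \<open>{..<l}\<close>, because \<open>cert_Q\<close> works with a fixed set.\<close>

lemma cert_N:
	assumes x: "x \<in> Tor" and y: "y \<in> Tor" and X: "x \<in> X" "y \<in> X" "x ~= y" and l: "l < n"
		and F: "!!D s. D \<in> Om ==> path_swap (Phi D) X y x (t1 + s) (t2 + s) ==> tgl (lo d y x t1 t2 D s) D \<in> Om ==>
				Phi (tgl (lo d y x t1 t2 D s) D) = path_swap.f' (Phi D) y x (t1 + s) (t2 + s) ==>
				F (tgl (lo d y x t1 t2 D s) D) = - F D"
		and F1: "!!D. \<bar>F D\<bar> <= 1"
	shows "\<bar>Ex (%D. of_bool (Cert d y x X t1 t2 l D & N <= card (Tg d y x t1 t2 l D)) * F D)\<bar>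
		<= \<bar>(1 - z) / (1 + z)\<bar> ^ N * Pr (%D. Cert d y x X t1 t2 l D & N <= card (Tg d y x t1 t2 l D))"
proof -
	let ?QQ = "{Q. Q <= {..<l} & N <= card Q}"
	have fin: "finite ?QQ" by (rule finite_subset[of _ "Pow {..<l}"]) auto
	have split: "of_bool (Cert d y x X t1 t2 l D & N <= card (Tg d y x t1 t2 l D)) * G D
		= (SUM Q:?QQ. of_bool (Cert d y x X t1 t2 l D & Tg d y x t1 t2 l D = Q) * G D)" for D and G :: "_ => real"
	proof -
		have "Tg d y x t1 t2 l D <= {..<l}" by (auto simp: Tg_def)
		hence "(Tg d y x t1 t2 l D \<in> ?QQ) = (N <= card (Tg d y x t1 t2 l D))" by auto
		moreover have "(SUM Q:?QQ. of_bool (Cert d y x X t1 t2 l D & Tg d y x t1 t2 l D = Q) * G D)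
			= (SUM Q:?QQ. if Tg d y x t1 t2 l D = Q then of_bool (Cert d y x X t1 t2 l D) * G D else 0)"
			by (rule sum.cong) auto
		ultimately show ?thesis using fin by (simp add: sum.delta')
	qed
	have fQ: "Q \<in> ?QQ ==> finite Q" for Q using finite_subset by blast
	have "\<bar>Ex (%D. of_bool (Cert d y x X t1 t2 l D & N <= card (Tg d y x t1 t2 l D)) * F D)\<bar>
			= \<bar>SUM Q:?QQ. Ex (%D. of_bool (Cert d y x X t1 t2 l D & Tg d y x t1 t2 l D = Q) * F D)\<bar>"
		unfolding split Ex_sum ..
	also have "... <= (SUM Q:?QQ. \<bar>Ex (%D. of_bool (Cert d y x X t1 t2 l D & Tg d y x t1 t2 l D = Q) * F D)\<bar>)"
		by (rule sum_abs)
	also have "... <= (SUM Q:?QQ. \<bar>(1 - z) / (1 + z)\<bar> ^ N * Pr (%D. Cert d y x X t1 t2 l D & Tg d y x t1 t2 l D = Q))"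
	proof (rule sum_mono)
		fix Q assume Q: "Q \<in> ?QQ"
		have "\<bar>Ex (%D. of_bool (Cert d y x X t1 t2 l D & Tg d y x t1 t2 l D = Q) * F D)\<bar>
			<= \<bar>(1 - z) / (1 + z)\<bar> ^ card Q * Pr (%D. Cert d y x X t1 t2 l D & Tg d y x t1 t2 l D = Q)"
			by (rule cert_Q[OF x y X l F F1 fQ[OF Q]])
		also have "... <= \<bar>(1 - z) / (1 + z)\<bar> ^ N * Pr (%D. Cert d y x X t1 t2 l D & Tg d y x t1 t2 l D = Q)"
			using Q rho_bounds by (intro mult_right_mono power_decreasing) auto
		finally show "\<bar>Ex (%D. of_bool (Cert d y x X t1 t2 l D & Tg d y x t1 t2 l D = Q) * F D)\<bar> <= ..." .
	qed
	also have "... = \<bar>(1 - z) / (1 + z)\<bar> ^ N * Pr (%D. Cert d y x X t1 t2 l D & N <= card (Tg d y x t1 t2 l D))"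
	proof -
		have "Pr (%D. Cert d y x X t1 t2 l D & N <= card (Tg d y x t1 t2 l D))
			= Ex (%D. SUM Q:?QQ. of_bool (Cert d y x X t1 t2 l D & Tg d y x t1 t2 l D = Q))"
			unfolding Pr_def using split[of _ "%_. 1"] by (intro Ex_cong) (simp only: mult_1_right)
		thus ?thesis unfolding Ex_sum Pr_def[symmetric] by (simp only: sum_distrib_left)
	qed
	finally show ?thesis .
qed

end

section \<open>Cancellation for two points of one column\<close>

context hcw begin

lemma Pr_not_Good:
	assumes r: "r >= 2" "2 * int r + 3 <= int m"
	shows "Pr (%D. ~ Good D) <= real (n * m) * (real n + 1) * (2 * mixf z r ^ n * exp (- (real C / 16)\<^sup>2 / (4 * n)))"
proof -
	have k: "0 < real C / 16" "real C / 16 <= 2 * real n" using C_pos nC by auto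
	have "Pr (%D. ~ Good D) <= Pr (%D. EX p:Tor \<times> {..n}. real C / 16 < \<bar>of_int (St D (snd p) (fst p))\<bar>)"
	proof (rule Pr_mono)
		fix D assume "~ Good D"
		then obtain v t where vt: "v \<in> Tor" "t <= n" "int C < 16 * \<bar>St D t v\<bar>" by (auto simp: Good_def not_le)
		hence "ri (int C) < ri (16 * \<bar>St D t v\<bar>)" by (simp only: of_int_less_iff)
		hence "real C / 16 < \<bar>of_int (St D t v)\<bar>" by simp
		thus "EX p:Tor \<times> {..n}. real C / 16 < \<bar>of_int (St D (snd p) (fst p))\<bar>"
			using vt by (intro bexI[of _ "(v, t)"]) auto
	qed
	also have "... <= (SUM p:Tor \<times> {..n}. Pr (%D. real C / 16 < \<bar>of_int (St D (snd p) (fst p))\<bar>))"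
		by (rule Pr_union) simp
	also have "... <= (SUM p:Tor \<times> {..n}. 2 * mixf z r ^ n * exp (- (real C / 16)\<^sup>2 / (4 * n)))"
		by (rule sum_mono) (use St_tail[OF _ r _ k] in auto)
	also have "... = real (n * m) * (real n + 1) * (2 * mixf z r ^ n * exp (- (real C / 16)\<^sup>2 / (4 * n)))"
		by (simp add: card_cartesian_product card_torus algebra_simps)
	finally show ?thesis .
qed

lemma sum_le_one:
	assumes "finite A" "!!i. i \<in> A ==> f i = 0 | f i = (1::real)" "!!i j. i \<in> A ==> j \<in> A ==> f i = 1 ==> f j = 1 ==> i = j"
	shows "sum f A <= 1"
proof (cases "EX i:A. f i = 1")
	case True
	then obtain i where i: "i \<in> A" "f i = 1" by blast
	have "sum f A = f i + sum f (A - {i})" using i assms(1) by (simp add: sum.remove)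
	moreover have "sum f (A - {i}) = 0" using assms(2,3) i by (intro sum.neutral) auto
	ultimately show ?thesis using i by simp
next
	case False
	hence "sum f A = 0" using assms(2) by (intro sum.neutral) auto
	thus ?thesis by simp
qed

text \<open>On \<open>Good\<close> at most one pair of times is a minimal encounter, so the number
  \<open>U D\<close> of certified encounters is 0 or 1 there. The part \<open>U * F\<close> is small
  by \<open>cert_N\<close>. The rest lives on configurations without a certificate, where the
  walkers fail to meet (\<open>stage1\<close>), meet with too few toggle times
  (\<open>stage2\<close>) or return to \<open>X\<close> too early. Off \<open>Good\<close> all
  \<open>(T + 1)\<^sup>2\<close> pairs of times are counted, which gives \<open>gd\<close>.\<close>

lemma pair_bound:
	fixes u d H1 H2 k :: int and N T l :: nat
	assumes x: "x \<in> Tor" and y: "y = sh x (- u)" and X: "x \<in> X" "y \<in> X" "x ~= y"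
		and u: "0 < u" "u <= w" "w < H1" and r: "r >= 2" "2 * int r + H2 + 3 <= int m" "int r + 2 <= d"
		and d: "d < H2" "2 * H2 + int r + 3 <= k" "4 * k <= int C" and l: "0 < l" "l < n" and T: "0 < T" "2 * (2 * T + l) * C < n * m"
		and F: "!!D s t1 t2. D \<in> Om ==> path_swap (Phi D) X y x (t1 + s) (t2 + s) ==> tgl (lo d y x t1 t2 D s) D \<in> Om ==>
				Phi (tgl (lo d y x t1 t2 D s) D) = path_swap.f' (Phi D) y x (t1 + s) (t2 + s) ==>
				F (tgl (lo d y x t1 t2 D s) D) = - F D"
		and F1: "!!D. \<bar>F D\<bar> <= 1"
	defines "gd == (real T + 1)\<^sup>2 * Pr (%D. ~ Good D)"
	shows "\<bar>Ex F\<bar> <= \<bar>(1 - z) / (1 + z)\<bar> ^ N * (1 + gd)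
			+ ((mixf z r)\<^sup>2 ^ T * (2 * ri H1 * ri w) * (1 / (vv / 2 * T) + 1 / ((ri H1)\<^sup>2 - 1))
			+ (mixf z r ^ l * (2 * ri H2 * ri d + 4 * ri H2 * real N) * (1 / (vv / 2 * l) + 1 / ((ri H2)\<^sup>2 - 1)) * (1 + gd)
			+ Pr (%D. ~ NoHit X y x D (T + l) (T + l)) + 2 * gd))"
proof -
	define g where "g = Pr (%D. ~ Good D)"
	define I where "I = {..T} \<times> {..T}"
	have fI: "finite I" and cI: "real (card I) = (real T + 1)\<^sup>2" by (auto simp: I_def card_cartesian_product power2_eq_square algebra_simps)
	have gd: "gd = real (card I) * g" by (simp add: gd_def g_def cI)
	have yt: "y \<in> Tor" using x y by simp
	have ord: "int r + 2 <= d" "0 <= d" "d < H2" "d <= k" "H2 >= 2" using r d by linarith+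
	have d4: "4 * d <= int C" using ord d by linarith
	have TT: "4 * T * C < n * m" "2 * (t1 + t2 + l) * C < n * m" if "t1 <= T" "t2 <= T" for t1 t2
	proof -
		have "2 * (t1 + t2 + l) * C <= 2 * (2 * T + l) * C" using that by (intro mult_right_mono mult_left_mono) auto
		thus "2 * (t1 + t2 + l) * C < n * m" using T by linarith
		have "4 * T * C <= 2 * (2 * T + l) * C" by (intro mult_right_mono) auto
		thus "4 * T * C < n * m" using T by linarith
	qed
	have T4: "4 * T * C < n * m" using TT(1)[of 0 0] by simp
	define M where "M = (%p D. Minc d y x D (fst p) (snd p))"
	define CN where "CN = (%p D. Cert d y x X (fst p) (snd p) l D & N <= card (Tg d y x (fst p) (snd p) l D))"
	have CM: "CN p D ==> M p D" for p D by (auto simp: CN_def M_def Cert_def)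
	have uni: "p = q" if "Good D" "p \<in> I" "q \<in> I" "M p D" "M q D" for p q D
		using Minc_unique[OF that(1) yt x d4, of "fst p" "snd p" "fst q" "snd q" T] that(2-) T4
		by (auto simp: M_def I_def prod_eq_iff)
	have le1: "(SUM p:I. of_bool (M p D)) <= (1::real) + real (card I) * of_bool (~ Good D)" for D
	proof (cases "Good D")
		case True
		have "(SUM p:I. of_bool (M p D)) <= (1::real)"
			by (rule sum_le_one[OF fI]) (use uni[OF True] in "auto simp: of_bool_def split: if_splits")
		thus ?thesis using True by simp
	next
		case False
		have "(SUM p:I. of_bool (M p D)) <= (SUM p:I. (1::real))" by (intro sum_mono) auto
		thus ?thesis using False by simp
	qed
	have sumM: "(SUM p:I. Pr (M p)) <= 1 + gd"
	proof -
		have "(SUM p:I. Pr (M p)) = Ex (%D. SUM p:I. of_bool (M p D))" by (simp add: Ex_sum Pr_def)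
		also have "... <= Ex (%D. 1 + real (card I) * of_bool (~ Good D))" by (rule Ex_mono) (rule le1)
		also have "... = 1 + gd" unfolding gd g_def Pr_def by (simp add: Ex_add Ex_cmult)
		finally show ?thesis .
	qed
	define U where "U = (%D. SUM p:I. (of_bool (CN p D) :: real))"
	have U0: "0 <= U D" for D unfolding U_def by (intro sum_nonneg) auto
	have UM: "U D <= (SUM p:I. of_bool (M p D))" for D unfolding U_def using CM by (intro sum_mono) auto
	define Z where "Z = (%D. ALL p:I. ~ CN p D)"
	have U1: "\<bar>1 - U D\<bar> <= of_bool (Z D) + real (card I) * of_bool (~ Good D)" for D
	proof (cases "Z D")
		case True
		hence "U D = 0" by (simp add: U_def Z_def)
		thus ?thesis using True by simp
	next
		case False
		then obtain p where p: "p \<in> I" "CN p D" by (auto simp: Z_def)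
		have "of_bool (CN p D) <= U D" unfolding U_def using p fI by (intro member_le_sum) auto
		hence "1 <= U D" using p by simp
		moreover have "U D <= 1 + real (card I) * of_bool (~ Good D)" using UM le1 order_trans by blast
		ultimately show ?thesis using False by simp
	qed
	have EFU: "\<bar>Ex (%D. U D * F D)\<bar> <= \<bar>(1 - z) / (1 + z)\<bar> ^ N * (1 + gd)"
	proof -
		have "Ex (%D. U D * F D) = (SUM p:I. Ex (%D. of_bool (CN p D) * F D))"
			unfolding U_def sum_distrib_right by (rule Ex_sum)
		also have "\<bar>...\<bar> <= (SUM p:I. \<bar>Ex (%D. of_bool (CN p D) * F D)\<bar>)" by (rule sum_abs)
		also have "... <= (SUM p:I. \<bar>(1 - z) / (1 + z)\<bar> ^ N * Pr (M p))"
		proof (rule sum_mono)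
			fix p assume "p \<in> I"
			have "\<bar>Ex (%D. of_bool (CN p D) * F D)\<bar> <= \<bar>(1 - z) / (1 + z)\<bar> ^ N * Pr (CN p)"
				unfolding CN_def by (rule cert_N[OF x yt X l(2) F F1])
			also have "... <= \<bar>(1 - z) / (1 + z)\<bar> ^ N * Pr (M p)"
				by (intro mult_left_mono Pr_mono CM) auto
			finally show "\<bar>Ex (%D. of_bool (CN p D) * F D)\<bar> <= \<bar>(1 - z) / (1 + z)\<bar> ^ N * Pr (M p)" .
		qed
		also have "... <= \<bar>(1 - z) / (1 + z)\<bar> ^ N * (1 + gd)"
			unfolding sum_distrib_left[symmetric] using sumM by (intro mult_left_mono) auto
		finally show ?thesis .
	qed
	define S1 where "S1 = (mixf z r)\<^sup>2 ^ T * (2 * ri H1 * ri w) * (1 / (vv / 2 * T) + 1 / ((ri H1)\<^sup>2 - 1))"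
	define K2 where "K2 = mixf z r ^ l * (2 * ri H2 * ri d + 4 * ri H2 * real N) * (1 / (vv / 2 * l) + 1 / ((ri H2)\<^sup>2 - 1))"
	have mx: "1 <= mixf z r" using mixf_ge1[of r] r by simp
	have H1p: "(ri H1)\<^sup>2 - 1 > 0" if "H1 > 1" for H1
	proof -
		have "1\<^sup>2 < (ri H1)\<^sup>2" using that by (intro power_strict_mono) auto
		thus ?thesis by simp
	qed
	have H1: "H1 > 1" using u by linarith
	have S1: "Pr (%D. Good D & (ALL t1<=T. ALL t2<=T. ~ ct d y x D t1 t2)) <= S1"
	proof (cases "d < u")
		case True
		have "Pr (%D. Good D & (ALL t1<=T. ALL t2<=T. ~ ct d y x D t1 t2))
			<= (mixf z r)\<^sup>2 ^ T * (2 * ri H1 * ri u) * (1 / (vv / 2 * T) + 1 / ((ri H1)\<^sup>2 - 1))"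
			by (rule stage1[OF x y True _ r(1) _ ord(1) d4 T(1) T4]) (use u r ord in linarith)+
		also have "... <= S1"
			unfolding S1_def using u H1 H1p[OF H1] vv_pos by (intro mult_right_mono mult_left_mono add_nonneg_nonneg) auto
		finally show ?thesis .
	next
		\<comment> \<open>Starting points within distance \<open>d\<close> are in contact at time
		  0.\<close>
		case False
		have "\<bar>u\<bar> <= d" "x = sh y u" using False u y x by auto
		hence "ct d y x D 0 0" for D unfolding ct_def near_def by auto
		hence "Pr (%D. Good D & (ALL t1<=T. ALL t2<=T. ~ ct d y x D t1 t2)) = Pr (%D. False)"
			by (intro Pr_cong) blast
		also have "... = 0" by (simp add: Pr_def)
		also have "0 <= S1"
			unfolding S1_def using u H1 H1p[OF H1] vv_pos by (intro mult_nonneg_nonneg add_nonneg_nonneg) auto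
		finally show ?thesis .
	qed
	have kk: "k >= 0" using d ord by linarith
	have S2: "Pr (%D. M p D & pos D (fst p) y ~= pos D (snd p) x & Good D & card (Tg d y x (fst p) (snd p) l D) < N) <= K2 * Pr (M p)"
		if "p \<in> I" for p
	proof -
		have "2 * (fst p + snd p + l) * C < n * m" using TT(2)[of "fst p" "snd p"] that by (auto simp: I_def)
		from stage2[OF x yt r(1,2) ord(2,3,4,5) d(2,3) l this, of N] show ?thesis
			unfolding M_def K2_def by (simp add: mult_ac)
	qed
	have ZP: "Pr Z <= g + (S1 + ((SUM p:I. K2 * Pr (M p)) + Pr (%D. ~ NoHit X y x D (T + l) (T + l))))"
	proof -
		have "Pr Z <= Pr (%D. ~ Good D | ((Good D & (ALL t1<=T. ALL t2<=T. ~ ct d y x D t1 t2)) |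
				((EX p:I. M p D & pos D (fst p) y ~= pos D (snd p) x & Good D & card (Tg d y x (fst p) (snd p) l D) < N)
				| ~ NoHit X y x D (T + l) (T + l))))"
		proof (rule Pr_mono, rule ccontr)
			fix D assume D: "D \<in> Om" and ZD: "Z D" and no: "~ (~ Good D | ((Good D & (ALL t1<=T. ALL t2<=T. ~ ct d y x D t1 t2)) |
				((EX p:I. M p D & pos D (fst p) y ~= pos D (snd p) x & Good D & card (Tg d y x (fst p) (snd p) l D) < N)
				| ~ NoHit X y x D (T + l) (T + l))))"
			hence G: "Good D" and nh: "NoHit X y x D (T + l) (T + l)" by auto
			obtain s1 s2 where "s1 <= T" "s2 <= T" "ct d y x D s1 s2" using no by auto
			then obtain t1 t2 where t: "t1 <= T" "t2 <= T" "Minc d y x D t1 t2"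
				using Minc_exists[of d y x D s1 s2] by (meson order_trans)
			have nh': "NoHit X y x D (t1 + l) (t2 + l)" using nh t unfolding NoHit_def by auto
			\<comment> \<open>Before the return to \<open>X\<close> the two paths are disjoint, which
			  supplies the distinct positions that \<open>stage2\<close> asks for.\<close>
			have "path_swap (Phi D) X y x t1 t2"
				using X Phi_permutes[OF D] permutes_inj nh' unfolding NoHit_def by unfold_locales auto
			hence ne: "pos D t1 y ~= pos D t2 x"
				using path_swap.avoid(1)[of "Phi D" X y x t1 t2 x t2] X nh' unfolding NoHit_def by auto
			have p: "(t1, t2) \<in> I" using t by (simp add: I_def)
			have "~ card (Tg d y x t1 t2 l D) < N" using no G p t(3) ne by (auto simp: M_def)
			hence "CN (t1, t2) D" using t nh' by (simp add: CN_def Cert_def)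
			thus False using ZD p by (auto simp: Z_def)
		qed
		also have "... <= g + (S1 + ((SUM p:I. K2 * Pr (M p)) + Pr (%D. ~ NoHit X y x D (T + l) (T + l))))"
		proof -
			have "Pr (%D. EX p:I. M p D & pos D (fst p) y ~= pos D (snd p) x & Good D & card (Tg d y x (fst p) (snd p) l D) < N) <= (SUM p:I. K2 * Pr (M p))"
				by (rule order_trans[OF Pr_union[OF fI]]) (intro sum_mono S2)
			thus ?thesis
				by (intro order_trans[OF Pr_or] add_mono S1) (auto simp: g_def)
		qed
		finally show ?thesis .
	qed
	have K2: "0 <= K2" unfolding K2_def using ord mx H1p[of H2] vv_pos by (intro mult_nonneg_nonneg add_nonneg_nonneg) auto
	have "(SUM p:I. K2 * Pr (M p)) <= K2 * (1 + gd)" unfolding sum_distrib_left[symmetric] using sumM K2 by (rule mult_left_mono)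
	moreover have "g <= gd"
	proof -
		have "1 * g <= real (card I) * g" unfolding cI by (intro mult_right_mono) (auto simp: g_def power2_eq_square algebra_simps)
		thus ?thesis by (simp add: gd)
	qed
	ultimately have ZP': "Pr Z <= gd + (S1 + (K2 * (1 + gd) + Pr (%D. ~ NoHit X y x D (T + l) (T + l))))"
		using ZP by linarith
	have "\<bar>Ex F\<bar> <= \<bar>Ex (%D. U D * F D)\<bar> + \<bar>Ex (%D. (1 - U D) * F D)\<bar>"
	proof -
		have "Ex F = Ex (%D. U D * F D) + Ex (%D. (1 - U D) * F D)"
			unfolding Ex_add[symmetric] by (rule Ex_cong) (simp add: algebra_simps)
		thus ?thesis by linarith
	qed
	also have "\<bar>Ex (%D. (1 - U D) * F D)\<bar> <= Pr Z + gd"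
	proof -
		have "\<bar>Ex (%D. (1 - U D) * F D)\<bar> <= Ex (%D. \<bar>(1 - U D) * F D\<bar>)" by (rule Ex_abs)
		also have "... <= Ex (%D. of_bool (Z D) + real (card I) * of_bool (~ Good D))"
		proof (rule Ex_mono)
			fix D
			have "\<bar>(1 - U D) * F D\<bar> <= \<bar>1 - U D\<bar> * 1" unfolding abs_mult using F1 by (intro mult_left_mono) auto
			thus "\<bar>(1 - U D) * F D\<bar> <= of_bool (Z D) + real (card I) * of_bool (~ Good D)"
				unfolding mult_1_right using U1[of D] by (rule order_trans)
		qed
		also have "... = Pr Z + gd" unfolding gd g_def Pr_def by (simp add: Ex_add Ex_cmult)
		finally show ?thesis .
	qed
	finally show ?thesis using EFU ZP' unfolding S1_def[symmetric] K2_def[symmetric] by linarith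
qed

end

context hcw begin

subsection \<open>From a uniform point to a point in a short window\<close>

definition hW :: "nat => int => real" where "hW w i = of_bool (int m - int w <= i mod int m)"
definition psi :: "nat => int => real" where "psi w i = hW w i - real w / real m"
text \<open>A primitive of \<open>psi\<close>, periodic because \<open>psi\<close> sums to zero over
  a period when \<open>w <= m\<close>. The window consists of the last \<open>w\<close> residues,
  that is, of the sites just below the base point.\<close>

definition Psi :: "nat => int => real" where "Psi w j = (SUM i:{0..<j mod int m}. psi w i)"

lemma hW_mod [simp]: "hW w (i mod int m) = hW w i" by (simp add: hW_def)
lemma psi_mod [simp]: "psi w (i mod int m) = psi w i" by (simp add: psi_def)
lemma Psi_mod [simp]: "Psi w (i mod int m) = Psi w i" by (simp add: Psi_def)

lemma hW_bounds: "0 <= hW w i" "hW w i <= 1" by (auto simp: hW_def)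

lemma sum_hW:
	assumes "w <= m" shows "(SUM i:{0..<int m}. hW w i) = real w"
proof -
	have "(SUM i:{0..<int m}. hW w i) = (SUM i:{int m - int w..<int m}. 1)"
		by (rule sum.mono_neutral_cong_right) (use assms in "auto simp: hW_def")
	thus ?thesis by simp
qed

lemma Psi_bound:
	assumes "w <= m" shows "\<bar>Psi w j\<bar> <= real w"
proof -
	define a where "a = j mod int m"
	have a: "0 <= a" "a < int m" using m_pos by (auto simp: a_def)
	have e: "Psi w j = (SUM i:{0..<a}. hW w i) - ri a * (real w / real m)"
		using a by (simp add: Psi_def a_def[symmetric] psi_def sum_subtractf)
	have 1: "0 <= (SUM i:{0..<a}. hW w i)" by (intro sum_nonneg hW_bounds)
	have "(SUM i:{0..<a}. hW w i) <= (SUM i:{0..<int m}. hW w i)"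
		using a by (intro sum_mono2 hW_bounds) auto
	hence 2: "(SUM i:{0..<a}. hW w i) <= real w" using sum_hW[OF assms] by simp
	have 3: "0 <= ri a * (real w / real m)" using a by (intro mult_nonneg_nonneg) auto
	have "ri a * (real w / real m) <= real m * (real w / real m)" using a by (intro mult_right_mono) auto
	hence 4: "ri a * (real w / real m) <= real w" using m_ge by simp
	show ?thesis using 1 2 3 4 unfolding e by linarith
qed

lemma Psi_step:
	assumes "w <= m" shows "Psi w (j + 1) = Psi w j + psi w j"
proof -
	define a where "a = j mod int m"
	have a: "0 <= a" "a < int m" using m_pos by (auto simp: a_def)
	have p: "psi w j = psi w a" by (simp add: a_def)
	have j1: "(j + 1) mod int m = (a + 1) mod int m" by (simp add: a_def mod_simps)
	show ?thesis
	proof (cases "a + 1 < int m")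
		case True
		hence "(j + 1) mod int m = a + 1" using j1 a by simp
		moreover have "{0..<a+1} = insert a {0..<a}" using a by auto
		ultimately show ?thesis by (simp add: Psi_def p a_def[symmetric])
	next
		case False
		hence am: "a + 1 = int m" using a by simp
		hence "(j + 1) mod int m = 0" using j1 by simp
		hence 0: "Psi w (j + 1) = 0" by (simp add: Psi_def)
		have "{0..<int m} = insert a {0..<a}" using a am by auto
		hence "(SUM i:{0..<int m}. psi w i) = psi w a + Psi w j" by (simp add: Psi_def a_def[symmetric])
		moreover have "(SUM i:{0..<int m}. psi w i) = 0"
			using m_ge by (simp add: psi_def sum_subtractf sum_hW[OF assms])
		ultimately show ?thesis using 0 p by simp
	qed
qed

lemma Psi_add:
	assumes "w <= m" shows "Psi w (j + int t) = Psi w j + (SUM i<t. psi w (j + int i))"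
proof (induction t)
	case (Suc t)
	have "Psi w (j + int (Suc t)) = Psi w ((j + int t) + 1)" by (simp add: algebra_simps)
	thus ?case using Suc Psi_step[OF assms, of "j + int t"] by simp
qed simp

lemma Psi_diff:
	assumes w: "w <= m" and b: "!!i. min j (j + s) <= i ==> i < max j (j + s) ==> hW w i <= c"
	shows "\<bar>Psi w (j + s) - Psi w j\<bar> <= ri \<bar>s\<bar> * (real w / real m + c)"
proof -
	have main: "\<bar>Psi w (j' + int t) - Psi w j'\<bar> <= real t * (real w / real m + c)"
		if "!!i. j' <= i ==> i < j' + int t ==> hW w i <= c" for j' t
	proof -
		have "\<bar>SUM i<t. psi w (j' + int i)\<bar> <= (SUM i<t. \<bar>psi w (j' + int i)\<bar>)" by (rule sum_abs)
		also have "... <= (SUM i<t. real w / real m + c)"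
		proof (rule sum_mono)
			fix i assume "i \<in> {..<t}"
			hence "hW w (j' + int i) <= c" using that by auto
			moreover have "0 <= real w / real m" by simp
			ultimately show "\<bar>psi w (j' + int i)\<bar> <= real w / real m + c" using hW_bounds[of w "j' + int i"] unfolding psi_def by linarith
		qed
		finally show ?thesis using Psi_add[OF w, of j' t] by simp
	qed
	show ?thesis
	proof (cases "s >= 0")
		case True
		thus ?thesis using main[of j "nat s"] b by simp
	next
		case False
		have "\<bar>Psi w ((j + s) + int (nat (- s))) - Psi w (j + s)\<bar> <= real (nat (- s)) * (real w / real m + c)"
			by (rule main) (use b False in auto)
		thus ?thesis using False by (simp add: abs_minus_commute)
	qed
qed

lemma walk_col:
	assumes x: "x \<in> Tor"
	shows "pos D n (sh x j) = sh x (j + int C + St D n (sh x j))"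
proof -
	have "pos D n (sh x j) = ((fst x + int n) mod int n, ((snd x + j) mod int m + int n + St D n (sh x j)) mod int m)"
		using walk_pos[OF sh_torus[OF x]] by (simp add: sh_def)
	also have "(fst x + int n) mod int n = fst x" using x by (auto simp: torus_def)
	also have "((snd x + j) mod int m + int n + St D n (sh x j)) mod int m = (snd x + (j + int C + St D n (sh x j))) mod int m"
	proof -
		have "((snd x + j) mod int m + (int n + St D n (sh x j))) mod int m = ((snd x + j) + (int n + St D n (sh x j))) mod int m"
			by (rule mod_add_left_eq)
		also have "(snd x + j) + (int n + St D n (sh x j)) = (snd x + (j + int C + St D n (sh x j))) + int m" by (simp add: nC)
		also have "... mod int m = (snd x + (j + int C + St D n (sh x j))) mod int m" by (rule mod_add_self2)
		finally show ?thesis by (simp only: add.assoc)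
	qed
	finally show ?thesis by (simp add: sh_def)
qed

lemma sh_inj_nat:
	assumes "sh x (int i) = sh x (int j)" "i < m" "j < m" shows "i = j"
proof -
	have "int m dvd int i - int j" using assms(1) by (simp add: sh_eq_iff)
	hence "int i - int j = 0" using dvd_small[of "int i - int j"] assms(2,3) by linarith
	thus ?thesis by simp
qed

lemma walk_inj2:
	assumes D: "D \<in> Om" and x: "x \<in> Tor" and e: "pos D i (sh x (int j)) = pos D i' (sh x (int j'))"
		and b: "i < n" "i' < n" "j < m" "j' < m"
	shows "i = i' & j = j'"
proof -
	have xt: "sh x (int j) \<in> Tor" "sh x (int j') \<in> Tor" using x by auto
	have "(fst x + int i) mod int n = (fst x + int i') mod int n"
		using e unfolding walk_pos[OF xt(1)] walk_pos[OF xt(2)] by simp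
	hence "int n dvd int i - int i'" by (simp add: mod_eq_dvd_iff)
	moreover have "\<bar>int i - int i'\<bar> < int n" using b by linarith
	ultimately have ii: "i = i'" using dvd_imp_le_int[of "int i - int i'" "int n"] by fastforce
	hence "sh x (int j) = sh x (int j')" using walk_inj[OF D xt] e by simp
	thus ?thesis using ii sh_inj_nat b by blast
qed

text \<open>The trajectories of one turn from a column cover the torus once, and \<open>F\<close> is
  constant along most of them; this is the first claim. For the second, one turn permutes the column
  by \<open>j\<close> to \<open>j + C + St\<close>, so summing \<open>F\<close> against the
  increments of \<open>Psi\<close> gives almost 0. The constant advance contributes \<open>C\<close>
  times the sum of \<open>F * psi\<close>, and the random displacement is an error.\<close>

lemma window_det:
	assumes D: "D \<in> Om" and x: "x \<in> Tor" and F1: "!!v. \<bar>F v\<bar> <= (1::real)"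
		and X': "finite X'" "card X' <= K"
		and inv: "!!v. v \<in> Tor ==> v ~: X' ==> Phi D v ~: X' ==> F (Phi D v) = F v"
		and w: "0 < w" "w + 2 * C <= m"
	shows "\<bar>(SUM v:Tor. F v) - real n * (SUM j<m. F (sh x (int j)))\<bar> <= 4 * real n * real K"
		and "real C * \<bar>(SUM j<m. F (sh x (int j)) * psi w (int j))\<bar> <= 4 * real K * real w + 2 * (real C)\<^sup>2
				+ (SUM j<m. ri \<bar>St D n (sh x (int j))\<bar> * (real w / real m + of_bool (m <= j + w + 2 * C)) + real n * of_bool (~ Good D))"
proof -
	define c where "c = (%j::nat. sh x (int j))"
	have ct: "c j \<in> Tor" for j using x by (simp add: c_def)
	define Bd where "Bd = {j. j < m & (EX i<=n. pos D i (c j) \<in> X')}"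
	\<comment> \<open>Trajectories of length \<open>n\<close> from different points of the column are
	  disjoint, so each element of \<open>X'\<close> spoils at most one of them. The end point
	  \<open>i = n\<close>, which is back in the column, is counted separately; hence the factor
	  2.\<close>
	have cardBd: "card Bd <= 2 * K"
	proof -
		define B1 where "B1 = {j. j < m & (EX i<n. pos D i (c j) \<in> X')}"
		define B2 where "B2 = {j. j < m & pos D n (c j) \<in> X'}"
		define h where "h = (%j. SOME i. i < n & pos D i (c j) \<in> X')"
		have h: "h j < n & pos D (h j) (c j) \<in> X'" if "j \<in> B1" for j
			unfolding h_def by (rule someI_ex) (use that in "auto simp: B1_def")
		have "card B1 <= card X'"
		proof (rule card_inj_on_le[where f="%j. pos D (h j) (c j)"])
			show "inj_on (%j. pos D (h j) (c j)) B1"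
			proof (rule inj_onI)
				fix i j assume ij: "i \<in> B1" "j \<in> B1" "pos D (h i) (c i) = pos D (h j) (c j)"
				thus "i = j" using walk_inj2[OF D x, of "h i" i "h j" j] h[OF ij(1)] h[OF ij(2)] by (auto simp: c_def B1_def)
			qed
		qed (use h X' in auto)
		moreover have "card B2 <= card X'"
		proof (rule card_inj_on_le[where f="%j. pos D n (c j)"])
			show "inj_on (%j. pos D n (c j)) B2"
			proof (rule inj_onI)
				fix i j assume ij: "i \<in> B2" "j \<in> B2" "pos D n (c i) = pos D n (c j)"
				hence "c i = c j" using walk_inj[OF D ct ct] by blast
				thus "i = j" using sh_inj_nat ij by (auto simp: c_def B2_def)
			qed
		qed (use X' in "auto simp: B2_def")
		moreover have "Bd <= B1 \<union> B2" by (auto simp: Bd_def B1_def B2_def le_less)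
		moreover have "finite (B1 \<union> B2)" by (simp add: B1_def B2_def)
		ultimately have "card Bd <= card B1 + card B2" by (meson card_Un_le card_mono le_trans)
		thus ?thesis using \<open>card B1 <= card X'\<close> \<open>card B2 <= card X'\<close> X' by simp
	qed
	have Bdm: "Bd <= {..<m}" by (auto simp: Bd_def)
	have same: "F (pos D i (c j)) = F (c j)" if "j < m" "j ~: Bd" "i <= n" for i j
		using that(3)
	proof (induction i)
		case (Suc i)
		have "pos D i (c j) ~: X'" "Phi D (pos D i (c j)) ~: X'"
			using that Suc.prems unfolding Bd_def by (auto dest: spec[of _ i] spec[of _ "Suc i"])
		thus ?case using inv[OF walk_torus[OF ct]] Suc by simp
	qed simp
	have diff2: "\<bar>F p - F q\<bar> <= 2" for p q using F1[of p] F1[of q] by linarith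
	show "\<bar>(SUM v:Tor. F v) - real n * (SUM j<m. F (sh x (int j)))\<bar> <= 4 * real n * real K"
	proof -
		let ?rh = "%(j, i). pos D i (c j)"
		have inj: "inj_on ?rh ({..<m} \<times> {..<n})"
			unfolding inj_on_def using walk_inj2[OF D x] by (auto simp: c_def)
		have "?rh ` ({..<m} \<times> {..<n}) = Tor"
		proof (rule card_subset_eq)
			show "?rh ` ({..<m} \<times> {..<n}) <= Tor" using walk_torus[OF ct] by auto
			show "card (?rh ` ({..<m} \<times> {..<n})) = card Tor"
				using card_image[OF inj] by (simp add: card_torus)
		qed simp
		hence "(SUM v:Tor. F v) = (SUM p:{..<m} \<times> {..<n}. F (?rh p))"
			using sum.reindex[OF inj, of F] by (simp add: o_def)
		also have "... = (SUM j<m. SUM i<n. F (pos D i (c j)))" by (simp add: sum.cartesian_product case_prod_beta)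
		finally have "(SUM v:Tor. F v) - real n * (SUM j<m. F (c j)) = (SUM j<m. SUM i<n. F (pos D i (c j)) - F (c j))"
			by (simp add: sum_subtractf sum_distrib_left)
		also have "\<bar>...\<bar> <= (SUM j<m. \<bar>SUM i<n. F (pos D i (c j)) - F (c j)\<bar>)" by (rule sum_abs)
		also have "... <= (SUM j<m. if j \<in> Bd then 2 * real n else 0)"
		proof (rule sum_mono)
			fix j assume j: "j \<in> {..<m}"
			show "\<bar>SUM i<n. F (pos D i (c j)) - F (c j)\<bar> <= (if j \<in> Bd then 2 * real n else 0)"
			proof (cases "j \<in> Bd")
				case True
				have "\<bar>SUM i<n. F (pos D i (c j)) - F (c j)\<bar> <= (SUM i<n. 2)"
					by (rule order_trans[OF sum_abs]) (intro sum_mono diff2)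
				thus ?thesis using True by simp
			next
				case False
				have "(SUM i<n. F (pos D i (c j)) - F (c j)) = 0"
					by (rule sum.neutral) (use same[of j] False j in auto)
				thus ?thesis using False by simp
			qed
		qed
		also have "... = (SUM j:Bd. 2 * real n)"
			by (rule sum.mono_neutral_cong_right) (use Bdm in auto)
		also have "... = 2 * real n * real (card Bd)" by simp
		also have "... <= 2 * real n * (2 * real K)" using cardBd by (intro mult_left_mono) auto
		finally show ?thesis by (simp add: c_def)
	qed
	define S where "S = (%j. St D n (c j))"
	define sgm where "sgm = (%j::nat. nat ((int j + int C + S j) mod int m))"
	have sgm: "int (sgm j) = (int j + int C + S j) mod int m" for j using m_pos by (simp add: sgm_def)
	have csgm: "c (sgm j) = pos D n (c j)" for j
		unfolding c_def sgm walk_col[OF x] S_def by (simp add: sh_def mod_simps)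
	have bij: "bij_betw sgm {..<m} {..<m}"
	proof -
		have "sgm j < m" for j using sgm[of j] m_pos by (metis Euclidean_Rings.pos_mod_bound of_nat_less_iff)
		moreover have "inj_on sgm {..<m}"
		proof (rule inj_onI)
			fix i j assume ij: "i \<in> {..<m}" "j \<in> {..<m}" "sgm i = sgm j"
			hence "pos D n (c i) = pos D n (c j)" using csgm by metis
			hence "c i = c j" using walk_inj[OF D ct ct] by blast
			thus "i = j" using sh_inj_nat ij by (auto simp: c_def)
		qed
		ultimately show ?thesis using endo_inj_surj[of "{..<m}" sgm] by (auto simp: bij_betw_def)
	qed
	have wm: "w <= m" using w by simp
	define A where "A = (%j. F (c j))"
	have A1: "\<bar>A j\<bar> <= 1" for j using F1 by (simp add: A_def)
	\<comment> \<open>\<open>sgm\<close> permutes the column, so reindexing one of the sums leaves only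
	  the differences of \<open>F\<close> over one turn, which vanish off \<open>Bd\<close>.\<close>
	have E1: "\<bar>SUM j<m. A j * (Psi w (int j + int C + S j) - Psi w (int j))\<bar> <= 4 * real K * real w"
	proof -
		have "(SUM j<m. A j * Psi w (int j)) = (SUM j<m. A (sgm j) * Psi w (int (sgm j)))"
			by (rule sum.reindex_bij_betw[OF bij, symmetric])
		also have "... = (SUM j<m. A (sgm j) * Psi w (int j + int C + S j))" unfolding sgm by simp
		finally have "(SUM j<m. A j * (Psi w (int j + int C + S j) - Psi w (int j))) = (SUM j<m. (A j - A (sgm j)) * Psi w (int j + int C + S j))"
			by (simp add: algebra_simps sum_subtractf)
		also have "\<bar>...\<bar> <= (SUM j<m. \<bar>(A j - A (sgm j)) * Psi w (int j + int C + S j)\<bar>)" by (rule sum_abs)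
		also have "... <= (SUM j<m. if j \<in> Bd then 2 * real w else 0)"
		proof (rule sum_mono)
			fix j assume j: "j \<in> {..<m}"
			show "\<bar>(A j - A (sgm j)) * Psi w (int j + int C + S j)\<bar> <= (if j \<in> Bd then 2 * real w else 0)"
			proof (cases "j \<in> Bd")
				case True
				have "\<bar>A j - A (sgm j)\<bar> * \<bar>Psi w (int j + int C + S j)\<bar> <= 2 * real w"
					unfolding A_def using diff2 Psi_bound[OF wm] by (intro mult_mono) auto
				thus ?thesis using True by (simp add: abs_mult)
			next
				case False
				hence "A (sgm j) = A j" unfolding A_def csgm using same[of j n] j by simp
				thus ?thesis using False by simp
			qed
		qed
		also have "... = (SUM j:Bd. 2 * real w)"
			by (rule sum.mono_neutral_cong_right) (use Bdm in auto)
		also have "... = 2 * real w * real (card Bd)" by simp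
		also have "... <= 2 * real w * (2 * real K)" using cardBd by (intro mult_left_mono) auto
		finally show ?thesis by (simp add: mult_ac)
	qed
	have E2: "\<bar>SUM j<m. A j * (Psi w (int j + int C + S j) - Psi w (int j + int C))\<bar>
		<= (SUM j<m. ri \<bar>S j\<bar> * (real w / real m + of_bool (m <= j + w + 2 * C)) + real n * of_bool (~ Good D))"
	proof (rule order_trans[OF sum_abs], rule sum_mono)
		fix j assume j: "j \<in> {..<m}"
		have Sn: "\<bar>S j\<bar> <= int n"
		proof -
			have "\<bar>St D t v\<bar> <= int t" for t v
			proof (induction t)
				case (Suc t) thus ?case using phi_abs[of D "pos D t v"] by (simp add: St_Suc)
			qed simp
			thus ?thesis by (simp add: S_def)
		qed
		have "\<bar>Psi w (int j + int C + S j) - Psi w (int j + int C)\<bar> <= ri \<bar>S j\<bar> * (real w / real m + of_bool (m <= j + w + 2 * C)) + real n * of_bool (~ Good D)"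
		proof (cases "Good D")
			case True
			have "16 * \<bar>S j\<bar> <= int C" using True ct[of j] by (simp add: Good_def S_def)
			hence SC: "\<bar>S j\<bar> <= int C" by simp
			have "\<bar>Psi w ((int j + int C) + S j) - Psi w (int j + int C)\<bar> <= ri \<bar>S j\<bar> * (real w / real m + of_bool (m <= j + w + 2 * C))"
			proof (rule Psi_diff[OF wm])
				fix i assume i: "min (int j + int C) (int j + int C + S j) <= i" "i < max (int j + int C) (int j + int C + S j)"
				hence ii: "0 <= i" "i < int j + 2 * int C" using SC by auto
				show "hW w i <= of_bool (m <= j + w + 2 * C)"
				proof (cases "m <= j + w + 2 * C")
					case False
					hence "i < int m - int w" using ii by linarith
					hence "hW w i = 0" using ii by (simp add: hW_def)
					thus ?thesis by simp
				qed (use hW_bounds in auto)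
			qed
			thus ?thesis using True by simp
		next
			case False
			have "\<bar>Psi w ((int j + int C) + S j) - Psi w (int j + int C)\<bar> <= ri \<bar>S j\<bar> * (real w / real m + 1)"
				by (rule Psi_diff[OF wm]) (rule hW_bounds)
			also have "... <= ri \<bar>S j\<bar> * (real w / real m) + real n" using Sn by (simp add: algebra_simps)
			also have "... <= ri \<bar>S j\<bar> * (real w / real m + of_bool (m <= j + w + 2 * C)) + real n"
				by (intro add_right_mono mult_left_mono) auto
			finally show ?thesis using False by simp
		qed
		moreover have "\<bar>A j * (Psi w (int j + int C + S j) - Psi w (int j + int C))\<bar> <= 1 * \<bar>Psi w (int j + int C + S j) - Psi w (int j + int C)\<bar>"
			unfolding abs_mult using A1 by (intro mult_right_mono) auto
		ultimately show "\<bar>A j * (Psi w (int j + int C + S j) - Psi w (int j + int C))\<bar> <= ri \<bar>S j\<bar> * (real w / real m + of_bool (m <= j + w + 2 * C)) + real n * of_bool (~ Good D)"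
			by (simp only: mult_1_left)
	qed
	\<comment> \<open>The advance \<open>C\<close> is split into unit steps; each of the translated
	  windows differs from the original one at no more than \<open>2 * C\<close> indices.\<close>
	have E3: "\<bar>(SUM j<m. A j * (Psi w (int j + int C) - Psi w (int j))) - real C * (SUM j<m. A j * psi w (int j))\<bar> <= 2 * (real C)\<^sup>2"
	proof -
		have "(SUM j<m. A j * (Psi w (int j + int C) - Psi w (int j))) = (SUM j<m. SUM i<C. A j * psi w (int j + int i))"
			using Psi_add[OF wm] by (simp add: sum_distrib_left)
		also have "... = (SUM i<C. SUM j<m. A j * psi w (int j + int i))" by (rule sum.swap)
		finally have "(SUM j<m. A j * (Psi w (int j + int C) - Psi w (int j))) - real C * (SUM j<m. A j * psi w (int j))
			= (SUM i<C. SUM j<m. A j * (hW w (int j + int i) - hW w (int j)))"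
			by (simp add: psi_def algebra_simps sum_subtractf)
		also have "\<bar>...\<bar> <= (SUM i<C. \<bar>SUM j<m. A j * (hW w (int j + int i) - hW w (int j))\<bar>)" by (rule sum_abs)
		also have "... <= (SUM i<C. 2 * real C)"
		proof (rule sum_mono)
			fix i assume i: "i \<in> {..<C}"
			define E where "E = {m - w - C..<m - w} \<union> {m - C..<m}"
			have cE: "card E <= 2 * C"
			proof -
				have "card E <= card {m - w - C..<m - w} + card {m - C..<m}" unfolding E_def by (rule card_Un_le)
				thus ?thesis by simp
			qed
			have "\<bar>SUM j<m. A j * (hW w (int j + int i) - hW w (int j))\<bar> <= (SUM j<m. \<bar>A j * (hW w (int j + int i) - hW w (int j))\<bar>)" by (rule sum_abs)
			also have "... <= (SUM j<m. if j \<in> E then 1 else 0)"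
			proof (rule sum_mono)
				fix j assume j: "j \<in> {..<m}"
				show "\<bar>A j * (hW w (int j + int i) - hW w (int j))\<bar> <= (if j \<in> E then 1 else 0)"
				proof (cases "j \<in> E")
					case True
					have "\<bar>A j\<bar> * \<bar>hW w (int j + int i) - hW w (int j)\<bar> <= 1 * 1"
						using A1 hW_bounds[of w "int j + int i"] hW_bounds[of w "int j"] by (intro mult_mono) auto
					thus ?thesis using True by (simp add: abs_mult)
				next
					case False
					hence "j + C < m - w | m - w <= j & j + C < m" using j w by (auto simp: E_def)
					hence "hW w (int j + int i) = hW w (int j)"
					proof
						assume a: "j + C < m - w"
						hence "(int j + int i) mod int m = int j + int i" "int j mod int m = int j" using i j w by auto
						thus ?thesis using a i w by (auto simp: hW_def)
					next
						assume a: "m - w <= j & j + C < m"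
						hence "(int j + int i) mod int m = int j + int i" "int j mod int m = int j" using i j w by auto
						thus ?thesis using a i w by (auto simp: hW_def)
					qed
					thus ?thesis using False by simp
				qed
			qed
			also have "... = (SUM j:E. 1)" by (rule sum.mono_neutral_cong_right) (use w in "auto simp: E_def")
			also have "... <= 2 * real C" using cE by simp
			finally show "\<bar>SUM j<m. A j * (hW w (int j + int i) - hW w (int j))\<bar> <= 2 * real C" .
		qed
		finally show ?thesis by (simp add: power2_eq_square)
	qed
	have "(SUM j<m. A j * (Psi w (int j + int C + S j) - Psi w (int j))) =
			(SUM j<m. A j * (Psi w (int j + int C + S j) - Psi w (int j + int C))) + (SUM j<m. A j * (Psi w (int j + int C) - Psi w (int j)))"
		by (simp add: algebra_simps flip: sum.distrib)
	hence "\<bar>real C * (SUM j<m. A j * psi w (int j))\<bar> <= 4 * real K * real w + 2 * (real C)\<^sup>2 + (SUM j<m. ri \<bar>S j\<bar> * (real w / real m + of_bool (m <= j + w + 2 * C)) + real n * of_bool (~ Good D))"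
		using E1 E2 E3 by linarith
	thus "real C * \<bar>(SUM j<m. F (sh x (int j)) * psi w (int j))\<bar> <= 4 * real K * real w + 2 * (real C)\<^sup>2
				+ (SUM j<m. ri \<bar>St D n (sh x (int j))\<bar> * (real w / real m + of_bool (m <= j + w + 2 * C)) + real n * of_bool (~ Good D))"
		by (simp add: abs_mult A_def S_def c_def)
qed

text \<open>The displacement enters through its first absolute moment, of order
  \<open>sqrt n\<close>. It is divided by the advance \<open>C\<close>, so the error is small once
  the excess is large against \<open>sqrt n\<close>.\<close>

lemma window_Ex:
	assumes x: "x \<in> Tor" and F1: "!!D v. \<bar>F D v\<bar> <= (1::real)"
		and X': "finite X'" "card X' <= K"
		and inv: "!!D v. D \<in> Om ==> v \<in> Tor ==> v ~: X' ==> Phi D v ~: X' ==> F D (Phi D v) = F D v"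
		and w: "0 < w" "w + 2 * C <= m" and r: "r >= 2" "2 * int r + 3 <= int m"
	defines "sgm == 2 * exp 1 * mixf z r ^ n * sqrt n"
	shows "\<bar>SUM v:Tor. Ex (%D. F D v)\<bar> / (n * m) <= (SUM u:{1..w}. \<bar>Ex (%D. F D (sh x (- int u)))\<bar>) / w + 4 * real K / m
			+ (4 * real K * w + 2 * (real C)\<^sup>2 + 2 * sgm * (w + C) + real m * real n * Pr (%D. ~ Good D)) / (C * w)"
proof -
	define T where "T = (%D. SUM v:Tor. F D v)"
	define L where "L = (%D. SUM j<m. F D (sh x (int j)))"
	define P where "P = (%D. SUM j<m. F D (sh x (int j)) * psi w (int j))"
	define Wn where "Wn = (%D. SUM u:{1..w}. F D (sh x (- int u)))"
	have wm: "w <= m" using w by simp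
	have PW: "P D = Wn D - real w / real m * L D" for D
	proof -
		have "(SUM j<m. F D (sh x (int j)) * hW w (int j)) = (SUM j:{m-w..<m}. F D (sh x (int j)))"
			by (rule sum.mono_neutral_cong_right) (use wm in "auto simp: hW_def of_nat_diff")
		also have "... = Wn D" unfolding Wn_def
		proof (rule sum.reindex_bij_witness[where i="%u. m - u" and j="%j. m - j"])
			fix j assume j: "j \<in> {m-w..<m}"
			have "sh x (- int (m - j)) = sh x (int j)" using j by (simp add: sh_eq_iff of_nat_diff)
			thus "F D (sh x (- int (m - j))) = F D (sh x (int j))" by simp
		qed (use wm in auto)
		finally show ?thesis
			unfolding P_def L_def by (simp add: psi_def algebra_simps sum_subtractf sum_distrib_left)
	qed
	have TL: "\<bar>Ex T - real n * Ex L\<bar> <= 4 * real n * real K"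
	proof -
		have "\<bar>Ex (%D. T D - real n * L D)\<bar> <= Ex (%D. \<bar>T D - real n * L D\<bar>)" by (rule Ex_abs)
		also have "... <= Ex (%D. 4 * real n * real K)"
			unfolding T_def L_def
		proof (rule Ex_mono)
			fix D assume D: "D \<in> Om"
			show "\<bar>(SUM v:Tor. F D v) - real n * (SUM j<m. F D (sh x (int j)))\<bar> <= 4 * real n * real K"
				by (rule window_det(1)[where F="F D", OF D x F1 X' inv[OF D] w])
		qed
		finally show ?thesis by (simp add: Ex_diff Ex_cmult)
	qed
	have EP: "real C * \<bar>Ex P\<bar> <= 4 * real K * w + 2 * (real C)\<^sup>2 + 2 * sgm * (w + C) + real m * real n * Pr (%D. ~ Good D)"
	proof -
		have "real C * \<bar>Ex P\<bar> <= real C * Ex (%D. \<bar>P D\<bar>)" by (intro mult_left_mono Ex_abs) simp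
		also have "... = Ex (%D. real C * \<bar>P D\<bar>)" by (simp add: Ex_cmult)
		also have "... <= Ex (%D. 4 * real K * real w + 2 * (real C)\<^sup>2
				+ (SUM j<m. ri \<bar>St D n (sh x (int j))\<bar> * (real w / real m + of_bool (m <= j + w + 2 * C)) + real n * of_bool (~ Good D)))"
			unfolding P_def
		proof (rule Ex_mono)
			fix D assume D: "D \<in> Om"
			show "real C * \<bar>SUM j<m. F D (sh x (int j)) * psi w (int j)\<bar> <= 4 * real K * real w + 2 * (real C)\<^sup>2
				+ (SUM j<m. ri \<bar>St D n (sh x (int j))\<bar> * (real w / real m + of_bool (m <= j + w + 2 * C)) + real n * of_bool (~ Good D))"
				by (rule window_det(2)[where F="F D", OF D x F1 X' inv[OF D] w])
		qed
		also have "... = 4 * real K * real w + 2 * (real C)\<^sup>2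
				+ (SUM j<m. Ex (%D. ri \<bar>St D n (sh x (int j))\<bar>) * (real w / real m + of_bool (m <= j + w + 2 * C)) + real n * Pr (%D. ~ Good D))"
			by (simp only: Ex_add Ex_const Ex_sum Ex_multc Ex_cmult Pr_def)
		also have "... <= 4 * real K * real w + 2 * (real C)\<^sup>2
				+ (SUM j<m. sgm * (real w / real m + of_bool (m <= j + w + 2 * C)) + real n * Pr (%D. ~ Good D))"
		proof (intro add_left_mono sum_mono add_right_mono mult_right_mono)
			fix j
			show "Ex (%D. ri \<bar>St D n (sh x (int j))\<bar>) <= sgm"
				using Ex_abs_St[OF sh_torus[OF x] r, of "int j"] unfolding sgm_def by simp
		qed simp
		also have "(SUM j<m. sgm * (real w / real m + of_bool (m <= j + w + 2 * C)) + real n * Pr (%D. ~ Good D))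
			= sgm * (real w + (SUM j<m. of_bool (m <= j + w + 2 * C))) + real m * real n * Pr (%D. ~ Good D)"
			using m_ge by (simp add: sum.distrib sum_distrib_left algebra_simps flip: sum_distrib_left)
		also have "(SUM j<m. of_bool (m <= j + w + 2 * C)) = (SUM j:{m - w - 2 * C..<m}. (1::real))"
			by (rule sum.mono_neutral_cong_right) auto
		also have "... = w + 2 * C" using w by simp
		finally show ?thesis by (simp add: algebra_simps)
	qed
	have C0: "real C > 0" using C_pos by simp
	have w0: "real w > 0" using w by simp
	have nm: "real n > 0" "real m > 0" using n_pos m_ge by auto
	define R where "R = 4 * real K * w + 2 * (real C)\<^sup>2 + 2 * sgm * (w + C) + real m * real n * Pr (%D. ~ Good D)"
	have EP': "\<bar>Ex P\<bar> <= R / C" using EP C0 unfolding R_def[symmetric] by (simp add: field_simps)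
	have eL: "Ex L = (real m / real w) * (Ex Wn - Ex P)"
	proof -
		have "Ex P = Ex Wn - real w / real m * Ex L" unfolding PW by (simp only: Ex_diff Ex_cmult)
		thus ?thesis using w0 nm by (simp add: field_simps)
	qed
	have "\<bar>Ex T\<bar> <= real n * \<bar>Ex L\<bar> + 4 * real n * real K"
	proof -
		have "\<bar>real n * Ex L\<bar> = real n * \<bar>Ex L\<bar>" by (simp add: abs_mult)
		thus ?thesis using TL by linarith
	qed
	hence "\<bar>Ex T\<bar> / (n * m) <= (real n * \<bar>Ex L\<bar> + 4 * real n * real K) / (n * m)" using nm by (intro divide_right_mono) auto
	also have "... = \<bar>Ex L\<bar> / m + 4 * real K / m" using nm by (simp add: field_simps)
	also have "\<bar>Ex L\<bar> / m = \<bar>Ex Wn - Ex P\<bar> / w" unfolding eL using nm w0 by (simp add: abs_mult)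
	also have "... <= ((SUM u:{1..w}. \<bar>Ex (%D. F D (sh x (- int u)))\<bar>) + R / C) / w"
	proof (rule divide_right_mono)
		have "\<bar>Ex Wn\<bar> <= (SUM u:{1..w}. \<bar>Ex (%D. F D (sh x (- int u)))\<bar>)" unfolding Wn_def Ex_sum by (rule sum_abs)
		thus "\<bar>Ex Wn - Ex P\<bar> <= (SUM u:{1..w}. \<bar>Ex (%D. F D (sh x (- int u)))\<bar>) + R / C" using EP' by linarith
	qed simp
	also have "... = (SUM u:{1..w}. \<bar>Ex (%D. F D (sh x (- int u)))\<bar>) / w + R / (C * w)"
		by (simp add: add_divide_distrib)
	finally show ?thesis unfolding T_def Ex_sum R_def by (simp add: algebra_simps)
qed

end

section \<open>Sliding one sampled point along its trajectory\<close>

lemma first_return_move: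
	assumes f: "f permutes S" "finite S" and v: "v ~: X'" "f v ~: X'"
	shows "w \<in> X' ==> first_return f (insert (f v) X') w = (if first_return f (insert v X') w = v then f v else first_return f (insert v X') w)"
		and "first_return f (insert (f v) X') (f v) = (if first_return f (insert v X') v = v then f v else first_return f (insert v X') v)"
proof -
	have inj: "inj f" using f permutes_inj by blast
	define X where "X = insert v X'"
	have pre: "(f ^^ (s - 1)) w = v" if "(f ^^ s) w = f v" "0 < s" for s w
	proof -
		have "f ((f ^^ (s - 1)) w) = f v" using that by (cases s) auto
		thus ?thesis using inj by (simp add: inj_eq)
	qed
	show "first_return f (insert (f v) X') w = (if first_return f (insert v X') w = v then f v else first_return f (insert v X') w)"
		if w: "w \<in> X'"
	proof -
		have wX: "w \<in> X" using w by (simp add: X_def)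
		obtain t where t: "0 < t" "(f ^^ t) w \<in> X" "!!s. 0 < s ==> s < t ==> (f ^^ s) w ~: X" "first_return f X w = (f ^^ t) w"
			using first_return_obtain[OF f wX] by blast
		have nf: "(f ^^ s) w ~= f v" if s: "0 < s" "s <= t" for s
		proof
			assume "(f ^^ s) w = f v"
			hence e: "(f ^^ (s - 1)) w = v" using pre s by blast
			show False
			proof (cases "s = 1")
				case True thus False using e w v by simp
			next
				case False
				thus False using t(3)[of "s - 1"] e s by (simp add: X_def)
			qed
		qed
		show ?thesis
		proof (cases "(f ^^ t) w = v")
			case True
			have "first_return f (insert (f v) X') w = (f ^^ Suc t) w"
			proof (rule first_return_eq)
				show "(f ^^ Suc t) w \<in> insert (f v) X'" using True by simp
				fix s assume s: "0 < s" "s < Suc t"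
				hence "(f ^^ s) w ~: X'" using t(3)[of s] True v by (cases "s = t") (auto simp: X_def)
				thus "(f ^^ s) w ~: insert (f v) X'" using nf s by auto
			qed simp
			thus ?thesis using True t(4) by (simp add: X_def)
		next
			case False
			have "first_return f (insert (f v) X') w = (f ^^ t) w"
			proof (rule first_return_eq)
				show "(f ^^ t) w \<in> insert (f v) X'" using t(2) False by (simp add: X_def)
				fix s assume "0 < s" "s < t"
				thus "(f ^^ s) w ~: insert (f v) X'" using t(3) nf by (auto simp: X_def)
			qed (rule t(1))
			thus ?thesis using False t(4) by (simp add: X_def)
		qed
	qed
	have vX: "v \<in> X" by (simp add: X_def)
	obtain t where t: "0 < t" "(f ^^ t) v \<in> X" "!!s. 0 < s ==> s < t ==> (f ^^ s) v ~: X" "first_return f X v = (f ^^ t) v"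
		using first_return_obtain[OF f vX] by blast
	have sh: "(f ^^ s) (f v) = (f ^^ Suc s) v" for s by (simp add: funpow_swap1)
	have nf: "(f ^^ s) (f v) ~= f v" if s: "0 < s" "s < t" for s
	proof
		assume "(f ^^ s) (f v) = f v"
		hence "(f ^^ s) v = v" using inj unfolding sh by (simp add: inj_eq)
		thus False using t(3)[OF s] by (simp add: X_def)
	qed
	show "first_return f (insert (f v) X') (f v) = (if first_return f (insert v X') v = v then f v else first_return f (insert v X') v)"
	proof (cases "(f ^^ t) v = v")
		case True
		have "first_return f (insert (f v) X') (f v) = (f ^^ t) (f v)"
		proof (rule first_return_eq)
			show "(f ^^ t) (f v) \<in> insert (f v) X'" unfolding sh using True by simp
			fix s assume s: "0 < s" "s < t"
			have "(f ^^ Suc s) v ~: X'" using t(3)[of "Suc s"] s True v by (cases "Suc s = t") (auto simp: X_def)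
			thus "(f ^^ s) (f v) ~: insert (f v) X'" using nf[OF s] unfolding sh by auto
		qed (rule t(1))
		thus ?thesis unfolding sh using True t(4) by (simp add: X_def)
	next
		case False
		hence tX: "(f ^^ t) v \<in> X'" using t(2) by (simp add: X_def)
		hence "t ~= 1" using v by auto
		hence t1: "0 < t - 1" "Suc (t - 1) = t" using t(1) by auto
		have e: "(f ^^ (t - 1)) (f v) = (f ^^ t) v" unfolding sh t1 ..
		have "first_return f (insert (f v) X') (f v) = (f ^^ (t - 1)) (f v)"
		proof (rule first_return_eq)
			show "(f ^^ (t - 1)) (f v) \<in> insert (f v) X'" unfolding e using tX by simp
			fix s assume s: "0 < s" "s < t - 1"
			have "(f ^^ Suc s) v ~: X'" using t(3)[of "Suc s"] s by (auto simp: X_def)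
			thus "(f ^^ s) (f v) ~: insert (f v) X'" using nf[of s] s unfolding sh by auto
		qed (rule t1)
		thus ?thesis unfolding e using False t(4) by (simp add: X_def)
	qed
qed

lemma inj_on_fun_upd_new:
	assumes "inj_on xi (A - {i})" "w ~: xi ` (A - {i})"
	shows "inj_on (xi(i := w)) A"
proof (rule inj_onI)
	fix a b assume ab: "a \<in> A" "b \<in> A" and e: "(xi(i := w)) a = (xi(i := w)) b"
	consider "a = i" "b = i" | "a = i" "b ~= i" | "a ~= i" "b = i" | "a ~= i" "b ~= i" by blast
	thus "a = b"
	proof cases
		case 2
		hence "w = xi b" using e by simp
		thus ?thesis using assms(2) ab 2 by blast
	next
		case 3
		hence "w = xi a" using e by simp
		thus ?thesis using assms(2) ab 3 by blast
	next
		case 4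
		thus ?thesis using e ab assms(1) by (auto dest: inj_onD)
	qed simp
qed

text \<open>Replacing a sampled point by its image keeps the order of the sampled points along the
  trajectories as long as no other sampled point is met. This is the invariance that
  \<open>window_Ex\<close> requires.\<close>

lemma induced_move:
	assumes f: "f permutes S" "finite S" and i: "i < k" and inj: "inj_on xi ({..<k} - {i})"
		and v: "v ~: xi ` ({..<k} - {i})" "f v ~: xi ` ({..<k} - {i})"
	shows "induced f k (xi(i := f v)) = induced f k (xi(i := v))"
proof
	fix l
	define X' where "X' = xi ` ({..<k} - {i})"
	define eta where "eta = xi(i := v)"
	define eta2 where "eta2 = xi(i := f v)"
	have im: "eta ` {..<k} = insert v X'" "eta2 ` {..<k} = insert (f v) X'"
		using i by (auto simp: eta_def eta2_def X'_def)
	have injs: "inj_on eta {..<k}" "inj_on eta2 {..<k}"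
		unfolding eta_def eta2_def by (rule inj_on_fun_upd_new[OF inj], rule v)+
	show "induced f k (xi(i := f v)) l = induced f k (xi(i := v)) l"
	proof (cases "l < k")
		case True
		have vl: "eta l \<in> insert v X'" using True im(1) by blast
		obtain t where t: "(f ^^ t) (eta l) \<in> insert v X'" "first_return f (insert v X') (eta l) = (f ^^ t) (eta l)"
			by (rule first_return_obtain[OF f vl])
		have "first_return f (insert v X') (eta l) \<in> eta ` {..<k}" unfolding t(2) im(1) by (rule t(1))
		then obtain j where j: "first_return f (insert v X') (eta l) = eta j" "j \<in> {..<k}" by (rule imageE)
		hence j: "j < k" "first_return f (insert v X') (eta l) = eta j" by auto
		have eqs: "first_return f (insert (f v) X') (eta2 l) = (if first_return f (insert v X') (eta l) = v then f v else first_return f (insert v X') (eta l))"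
			using first_return_move[OF f v[folded X'_def]] True by (cases "l = i") (auto simp: eta_def eta2_def X'_def)
		have "(if eta j = v then f v else eta j) = eta2 j"
			using j v(1) by (cases "j = i") (auto simp: eta_def eta2_def)
		hence f2: "first_return f (insert (f v) X') (eta2 l) = eta2 j" unfolding eqs j(2) .
		have "induced f k eta2 l = j" "induced f k eta l = j"
			unfolding induced_def im f2 j(2) using True j(1) injs by (simp_all add: inv_into_f_f)
		thus ?thesis by (simp add: eta_def eta2_def)
	qed (simp add: induced_def)
qed

lemma sum_PiE_split:
	fixes g :: "('i => 'a) => real"
	assumes "finite I" "i \<in> I" "finite S"
	shows "(SUM xi:PiE I (%_. S). g xi) = (SUM xi:PiE (I - {i}) (%_. S). SUM v:S. g (xi(i := v)))"
proof -
	have "(SUM xi:PiE I (%_. S). g xi) = (SUM p:PiE (I - {i}) (%_. S) \<times> S. g ((fst p)(i := snd p)))"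
	proof (rule sum.reindex_bij_witness[where i="%p. (fst p)(i := snd p)" and j="%xi. (xi(i := undefined), xi i)"])
		fix xi assume "xi \<in> PiE I (%_. S)"
		thus "(xi(i := undefined), xi i) \<in> PiE (I - {i}) (%_. S) \<times> S" using assms by (auto simp: PiE_def extensional_def)
	next
		fix p assume p: "p \<in> PiE (I - {i}) (%_. S) \<times> S"
		thus "(fst p)(i := snd p) \<in> PiE I (%_. S)" using assms by (auto simp: PiE_def extensional_def Pi_def)
		have "fst p i = undefined" using p by (auto simp: PiE_def extensional_def)
		thus "(((fst p)(i := snd p))(i := undefined), ((fst p)(i := snd p)) i) = p" by (cases p) auto
	qed auto
	thus ?thesis by (simp add: sum.cartesian_product case_prod_beta)
qed

context hcw begin

text \<open>Samples with repeated points get the value 0, so that the sign rule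
  \<open>swapF_toggle\<close> and the invariance \<open>swapF_inv\<close> hold without an
  injectivity assumption.\<close>

definition swapF :: "nat => (nat => nat) => nat => nat => (int \<times> int) set => (nat => int \<times> int) => real" where
	"swapF k s i j D xi = (if inj_on xi {..<k} then of_bool (induced (Phi D) k xi = s)
			- of_bool (induced (Phi D) k xi = s \<circ> swp i j) else 0)"

lemma swapF_bound: "\<bar>swapF k s i j D xi\<bar> <= 1" by (simp add: swapF_def)

lemma swapF_inv:
	assumes D: "D \<in> Om" and i: "i < k" and v: "v ~: xi ` ({..<k} - {i})" "Phi D v ~: xi ` ({..<k} - {i})"
	shows "swapF k s i j D (xi(i := Phi D v)) = swapF k s i j D (xi(i := v))"
proof (cases "inj_on xi ({..<k} - {i})")
	case True
	have "inj_on (xi(i := v)) {..<k}" "inj_on (xi(i := Phi D v)) {..<k}"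
		by (rule inj_on_fun_upd_new[OF True], rule v)+
	thus ?thesis using induced_move[OF Phi_permutes[OF D] _ i True v] by (simp add: swapF_def)
next
	case False
	have "~ inj_on (xi(i := w)) {..<k}" for w
	proof
		assume "inj_on (xi(i := w)) {..<k}"
		hence "inj_on (xi(i := w)) ({..<k} - {i})" by (rule inj_on_subset) auto
		hence "inj_on xi ({..<k} - {i})" by (rule inj_on_cong[THEN iffD1, rotated]) auto
		thus False using False by simp
	qed
	thus ?thesis by (simp add: swapF_def)
qed

lemma swapF_toggle:
	assumes D: "D \<in> Om" and ij: "i < k" "j < k" and ps: "path_swap (Phi D) (xi ` {..<k}) (xi i) (xi j) a b"
		and P: "Phi D' = path_swap.f' (Phi D) (xi i) (xi j) a b"
	shows "swapF k s i j D' xi = - swapF k s i j D xi"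
proof (cases "inj_on xi {..<k}")
	case True
	have e: "induced (Phi D') k xi = induced (Phi D) k xi \<circ> swp i j"
		unfolding P by (rule induced_swap[OF ps Phi_permutes[OF D] _ ij True]) simp
	have tt: "(h \<circ> swp i j = h') = (h = h' \<circ> swp i j)" for h h' :: "nat => nat"
		by (auto simp: fun_eq_iff) (metis transpose_involutory)+
	have "(induced (Phi D') k xi = s) = (induced (Phi D) k xi = s \<circ> swp i j)" unfolding e tt ..
	moreover have "(induced (Phi D') k xi = s \<circ> swp i j) = (induced (Phi D) k xi = s)"
		unfolding e tt by (simp add: o_assoc[symmetric])
	ultimately show ?thesis using True by (simp add: swapF_def)
qed (simp add: swapF_def)

subsection \<open>Unintended encounters\<close>

text \<open>A path is back in its column only at multiples of \<open>n\<close>, and each such time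
  serves at most one \<open>u\<close>: in the first count because the steps are injective, in the
  second because the position is determined.\<close>

lemma count_returns:
	assumes D: "D \<in> Om" and x: "x \<in> Tor" and w: "w < m"
	shows "(SUM u:{1..w}. of_bool (EX i. 0 < i & i <= L & pos D i (sh x (- int u)) = x)) <= real (L div n)"
		and "(SUM u:{1..w}. of_bool (EX i. 0 < i & i <= L & pos D i x = sh x (- int u))) <= real (L div n)"
proof -
	have shinj: "u = u'" if "sh x (- int u) = sh x (- int u')" "u \<in> {1..w}" "u' \<in> {1..w}" for u u'
	proof -
		have "int m dvd (- int u) - (- int u')" using that(1) by (simp only: sh_eq_iff)
		hence "(- int u) - (- int u') = 0" by (rule dvd_small) (use that w in auto)
		thus ?thesis by simp
	qed
	define J where "J = (%q. n * q) ` {1..L div n}"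
	have cJ: "finite J" "card J <= L div n" unfolding J_def using card_image_le[of "{1..L div n}" "%q. n * q"] by auto
	have inJ: "i \<in> J" if i: "0 < i" "i <= L" and e: "fst (pos D i p) = fst p" "p \<in> Tor" for i p
	proof -
		have "(fst p + int i) mod int n = fst p mod int n" using e walk_pos[OF e(2), where D=D and t=i] by (auto simp: torus_def)
		hence "int n dvd (fst p + int i) - fst p" by (simp only: mod_eq_dvd_iff)
		hence "n dvd i" by simp
		then obtain q where q: "i = n * q" by auto
		have "q >= 1" using i(1) q by (cases q) auto
		moreover have "q <= L div n" using div_le_mono[of "n * q" L n] i(2) q n_pos by simp
		ultimately show ?thesis unfolding J_def q by (intro imageI) simp
	qed
	have gen: "(SUM u:{1..w}. of_bool (EX i. 0 < i & i <= L & R i u)) <= real (L div n)"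
		if R: "!!i u. 0 < i ==> i <= L ==> u \<in> {1..w} ==> R i u ==> i \<in> J" "!!i u u'. u \<in> {1..w} ==> u' \<in> {1..w} ==> R i u ==> R i u' ==> u = u'" for R
	proof -
		define B where "B = {u\<in>{1..w}. EX i. 0 < i & i <= L & R i u}"
		define h where "h = (%u. SOME i. 0 < i & i <= L & R i u)"
		have h: "0 < h u & h u <= L & R (h u) u" if "u \<in> B" for u
			unfolding h_def by (rule someI_ex) (use that in "auto simp: B_def")
		have "card B <= card J"
		proof (rule card_inj_on_le[where f=h])
			show "inj_on h B"
			proof (rule inj_onI)
				fix u u' assume uu: "u \<in> B" "u' \<in> B" "h u = h u'"
				have "R (h u) u" "R (h u) u'" using h[OF uu(1)] h[OF uu(2)] uu(3) by auto
				thus "u = u'" using R(2) uu by (auto simp: B_def)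
			qed
			show "h ` B <= J" using h R(1) by (auto simp: B_def)
		qed (rule cJ)
		moreover have "(SUM u:{1..w}. of_bool (EX i. 0 < i & i <= L & R i u)) = (SUM u:B. (1::real))"
			by (rule sum.mono_neutral_cong_right) (auto simp: B_def)
		ultimately show ?thesis using cJ by simp
	qed
	show "(SUM u:{1..w}. of_bool (EX i. 0 < i & i <= L & pos D i (sh x (- int u)) = x)) <= real (L div n)"
	proof (rule gen)
		fix i u assume "0 < i" "i <= L" "pos D i (sh x (- int u)) = x"
		thus "i \<in> J" using inJ[of i "sh x (- int u)"] x by simp
	next
		fix i u u' assume "u \<in> {1..w}" "u' \<in> {1..w}" "pos D i (sh x (- int u)) = x" "pos D i (sh x (- int u')) = x"
		thus "u = u'" using walk_inj[OF D sh_torus[OF x] sh_torus[OF x], of i "- int u" "- int u'"] shinj by auto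
	qed
	show "(SUM u:{1..w}. of_bool (EX i. 0 < i & i <= L & pos D i x = sh x (- int u))) <= real (L div n)"
	proof (rule gen)
		fix i u assume "0 < i" "i <= L" "pos D i x = sh x (- int u)"
		thus "i \<in> J" using inJ[of i x] x by simp
	next
		fix i u u' assume "u \<in> {1..w}" "u' \<in> {1..w}" "pos D i x = sh x (- int u)" "pos D i x = sh x (- int u')"
		thus "u = u'" using shinj by auto
	qed
qed

lemma count_path:
	"(SUM v:Tor. of_bool (EX i. 0 < i & i <= L & pos D i y = v)) <= real L"
proof -
	have "(SUM v:Tor. of_bool (EX i. 0 < i & i <= L & pos D i y = v)) = (SUM v:{v\<in>Tor. EX i. 0 < i & i <= L & pos D i y = v}. (1::real))"
		by (rule sum.mono_neutral_cong_right) auto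
	also have "... <= real (card ((%i. pos D i y) ` {1..L}))"
	proof -
		have "{v \<in> Tor. EX i. 0 < i & i <= L & pos D i y = v} <= (%i. pos D i y) ` {1..L}"
		proof
			fix v assume "v \<in> {v \<in> Tor. EX i. 0 < i & i <= L & pos D i y = v}"
			then obtain i where i: "0 < i" "i <= L" "pos D i y = v" by blast
			hence "i \<in> {1..L}" by simp
			thus "v \<in> (%i. pos D i y) ` {1..L}" unfolding i(3)[symmetric] by (rule imageI)
		qed
		hence "card {v \<in> Tor. EX i. 0 < i & i <= L & pos D i y = v} <= card ((%i. pos D i y) ` {1..L})"
			by (rule card_mono[rotated]) simp
		thus ?thesis by simp
	qed
	also have "... <= real L" using card_image_le[of "{1..L}" "%i. pos D i y"] by simp
	finally show ?thesis .
qed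

text \<open>Three kinds of early returns: to the own starting point, excluded on \<open>Good\<close>
  by \<open>self_far\<close>; from one of the two starting points to the other, rare on average over
  \<open>u\<close>; to a further sampled point, rare on average over the sample, because a path of
  \<open>L\<close> steps covers at most \<open>L\<close> sites.\<close>

lemma hits:
	assumes ij: "i0 < k" "j0 < k" "i0 ~= j0" and w: "0 < w" "w < m" and L: "2 * L * C < n * m"
	defines "Xi == PiE ({..<k} - {i0}) (%_. Tor)"
	shows "(SUM xi:Xi. (SUM u:{1..w}. Pr (%D. ~ NoHit (insert (sh (xi j0) (- int u)) (xi ` ({..<k} - {i0}))) (sh (xi j0) (- int u)) (xi j0) D L L)) / w)
		<= real (n * m) ^ (k - 1) * (Pr (%D. ~ Good D) + 2 * real (L div n) / w + 2 * real k * real L / (n * m))"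
proof -
	define g where "g = Pr (%D. ~ Good D)"
	define I where "I = {..<k} - {i0}"
	have I: "finite I" "j0 \<in> I" "card I = k - 1" using ij by (auto simp: I_def)
	have ft: "finite Tor" by simp
	have Xi: "Xi = PiE I (%_. Tor)" by (simp add: Xi_def I_def)
	have fXi: "finite Xi" unfolding Xi using I by (intro finite_PiE) auto
	have cXi: "real (card Xi) = real (n * m) ^ (k - 1)" unfolding Xi using I by (simp add: card_PiE card_torus)
	have jt: "xi j0 \<in> Tor" if "xi \<in> Xi" for xi using that I unfolding Xi by auto
	define a1 where "a1 = (%x u D. (of_bool (EX i. 0 < i & i <= L & pos D i (sh x (- int u)) = x) :: real))"
	define a2 where "a2 = (%x u D. (of_bool (EX i. 0 < i & i <= L & pos D i x = sh x (- int u)) :: real))"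
	define b where "b = (%y v D. (of_bool (EX i. 0 < i & i <= L & pos D i y = v) :: real))"
	have pt: "Pr (%D. ~ NoHit (insert (sh (xi j0) (- int u)) (xi ` I)) (sh (xi j0) (- int u)) (xi j0) D L L)
		<= g + Ex (a1 (xi j0) u) + Ex (a2 (xi j0) u) + (SUM l:I - {j0}. Ex (b (sh (xi j0) (- int u)) (xi l)) + Ex (b (xi j0) (xi l)))"
		if xi: "xi \<in> Xi" for xi u
	proof -
		let ?x = "xi j0" and ?y = "sh (xi j0) (- int u)"
		have xt: "?x \<in> Tor" "?y \<in> Tor" using jt[OF xi] by auto
		have "Pr (%D. ~ NoHit (insert ?y (xi ` I)) ?y ?x D L L) <= Ex (%D. of_bool (~ Good D) + a1 ?x u D + a2 ?x u D + (SUM l:I - {j0}. b ?y (xi l) D + b ?x (xi l) D))"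
			unfolding Pr_def
		proof (rule Ex_mono)
			fix D assume D: "D \<in> Om"
			have nn: "0 <= a1 ?x u D" "0 <= a2 ?x u D" "0 <= b p q D" for p q by (auto simp: a1_def a2_def b_def)
			have sn: "0 <= (SUM l:I - {j0}. b ?y (xi l) D + b ?x (xi l) D)" using nn by (intro sum_nonneg) auto
			show "of_bool (~ NoHit (insert ?y (xi ` I)) ?y ?x D L L) <= of_bool (~ Good D) + a1 ?x u D + a2 ?x u D + (SUM l:I - {j0}. b ?y (xi l) D + b ?x (xi l) D)"
			proof (cases "NoHit (insert ?y (xi ` I)) ?y ?x D L L | ~ Good D")
				case True
				thus ?thesis using nn sn by (auto intro!: add_nonneg_nonneg)
			next
				case False
				hence G: "Good D" by simp
				have noself: "pos D i p ~= p" if "0 < i" "i <= L" "p \<in> Tor" for i p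
				proof
					assume e: "pos D i p = p"
					have "2 * i * C <= 2 * L * C" using that by (intro mult_right_mono) auto
					hence "2 * i * C < n * m" using L by linarith
					hence "~ near 0 (pos D 0 p) (pos D i p)" using self_far[OF G that(3,1), of 0] by simp
					thus False using e near_self[OF that(3), of 0] by simp
				qed
				have lge: "b p (xi l) D <= (SUM l:I - {j0}. b ?y (xi l) D + b ?x (xi l) D)" if "l \<in> I - {j0}" "p = ?x | p = ?y" for l p
				proof -
					have "b ?y (xi l) D + b ?x (xi l) D <= (SUM l:I - {j0}. b ?y (xi l) D + b ?x (xi l) D)"
						using that I nn by (intro member_le_sum) auto
					thus ?thesis using that nn(3)[of ?x "xi l"] nn(3)[of ?y "xi l"] by auto
				qed
				obtain i p where i: "0 < i" "i <= L" and p: "p = ?x | p = ?y" and h: "pos D i p \<in> insert ?y (xi ` I)"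
					using False unfolding NoHit_def by blast
				consider "pos D i p = ?y" | "pos D i p = ?x" | l where "l \<in> I - {j0}" "pos D i p = xi l"
					using h by blast
				hence "1 <= a1 ?x u D | 1 <= a2 ?x u D | (EX l:I - {j0}. 1 <= b p (xi l) D)"
				proof cases
					case 1
					hence "p = ?x" using p noself[OF i xt(2)] by auto
					thus ?thesis using 1 i by (auto simp: a2_def)
				next
					case 2
					hence "p = ?y" using p noself[OF i xt(1)] by auto
					thus ?thesis using 2 i by (auto simp: a1_def)
				next
					case 3
					thus ?thesis using i by (auto simp: b_def)
				qed
				hence "1 <= a1 ?x u D + a2 ?x u D + (SUM l:I - {j0}. b ?y (xi l) D + b ?x (xi l) D)"
					using nn sn lge p by (smt (verit))
				thus ?thesis using False by simp
			qed
		qed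
		also have "... = g + Ex (a1 ?x u) + Ex (a2 ?x u) + (SUM l:I - {j0}. Ex (b ?y (xi l)) + Ex (b ?x (xi l)))"
			by (simp only: Ex_add Ex_sum g_def Pr_def)
		finally show ?thesis .
	qed
	have s1: "(SUM u:{1..w}. Ex (a1 x u)) <= real (L div n)" "(SUM u:{1..w}. Ex (a2 x u)) <= real (L div n)" if x: "x \<in> Tor" for x
	proof -
		have "(SUM u:{1..w}. Ex (a1 x u)) = Ex (%D. SUM u:{1..w}. a1 x u D)" by (rule Ex_sum[symmetric])
		also have "... <= Ex (%D. real (L div n))" unfolding a1_def by (rule Ex_mono) (rule count_returns(1)[OF _ x w(2)])
		finally show "(SUM u:{1..w}. Ex (a1 x u)) <= real (L div n)" by simp
		have "(SUM u:{1..w}. Ex (a2 x u)) = Ex (%D. SUM u:{1..w}. a2 x u D)" by (rule Ex_sum[symmetric])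
		also have "... <= Ex (%D. real (L div n))" unfolding a2_def by (rule Ex_mono) (rule count_returns(2)[OF _ x w(2)])
		finally show "(SUM u:{1..w}. Ex (a2 x u)) <= real (L div n)" by simp
	qed
	have s3: "(SUM xi:Xi. Ex (b (sh (xi j0) c) (xi l))) <= real (n * m) ^ (k - 2) * real L" if l: "l \<in> I - {j0}" for l c
	proof -
		have lI: "l \<in> I" "l ~= j0" using l by auto
		have c2: "card (I - {l}) = k - 2" using I lI by simp
		have "(SUM xi:Xi. Ex (b (sh (xi j0) c) (xi l))) = (SUM xi:PiE (I - {l}) (%_. Tor). SUM v:Tor. Ex (b (sh (xi j0) c) v))"
			unfolding Xi sum_PiE_split[OF I(1) lI(1) ft] using lI by simp
		also have "... <= (SUM xi:PiE (I - {l}) (%_. Tor). real L)"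
		proof (rule sum_mono)
			fix xi
			have "(SUM v:Tor. Ex (b (sh (xi j0) c) v)) = Ex (%D. SUM v:Tor. b (sh (xi j0) c) v D)" by (rule Ex_sum[symmetric])
			also have "... <= Ex (%D. real L)" unfolding b_def by (rule Ex_mono) (rule count_path)
			finally show "(SUM v:Tor. Ex (b (sh (xi j0) c) v)) <= real L" by simp
		qed
		also have "... = real (n * m) ^ (k - 2) * real L" using I by (simp add: card_PiE card_torus c2)
		finally show ?thesis .
	qed
	have k2: "k >= 2" using ij by linarith
	have NN: "real (n * m) > 0" using n_pos m_ge by simp
	have pw: "real (n * m) ^ (k - 2) = real (n * m) ^ (k - 1) / real (n * m)"
	proof -
		have "k - 1 = Suc (k - 2)" using k2 by simp
		thus ?thesis using n_pos m_ge by simp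
	qed
	have "(SUM xi:Xi. (SUM u:{1..w}. Pr (%D. ~ NoHit (insert (sh (xi j0) (- int u)) (xi ` I)) (sh (xi j0) (- int u)) (xi j0) D L L)))
		<= (SUM xi:Xi. SUM u:{1..w}. g + Ex (a1 (xi j0) u) + Ex (a2 (xi j0) u) + (SUM l:I - {j0}. Ex (b (sh (xi j0) (- int u)) (xi l)) + Ex (b (xi j0) (xi l))))"
		using pt by (intro sum_mono) auto
	also have "... = (SUM xi:Xi. real w * g + (SUM u:{1..w}. Ex (a1 (xi j0) u)) + (SUM u:{1..w}. Ex (a2 (xi j0) u)))
			+ (SUM u:{1..w}. SUM l:I - {j0}. (SUM xi:Xi. Ex (b (sh (xi j0) (- int u)) (xi l))) + (SUM xi:Xi. Ex (b (xi j0) (xi l))))"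
	proof -
		have "(SUM xi:Xi. SUM u:{1..w}. SUM l:I - {j0}. Ex (b (sh (xi j0) (- int u)) (xi l)) + Ex (b (xi j0) (xi l)))
				= (SUM u:{1..w}. SUM l:I - {j0}. SUM xi:Xi. Ex (b (sh (xi j0) (- int u)) (xi l)) + Ex (b (xi j0) (xi l)))"
			by (subst sum.swap) (intro sum.cong refl sum.swap)
		thus ?thesis by (simp add: sum.distrib)
	qed
	also have "... <= (SUM xi:Xi. real w * g + real (L div n) + real (L div n))
			+ (SUM u:{1..w}. SUM l:I - {j0}. real (n * m) ^ (k - 2) * real L + real (n * m) ^ (k - 2) * real L)"
	proof (intro add_mono sum_mono order_refl)
		fix xi assume xi: "xi \<in> Xi"
		show "(SUM u:{1..w}. Ex (a1 (xi j0) u)) <= real (L div n)" "(SUM u:{1..w}. Ex (a2 (xi j0) u)) <= real (L div n)"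
			using s1[OF jt[OF xi]] by auto
	next
		fix u l assume l: "l \<in> I - {j0}"
		show "(SUM xi:Xi. Ex (b (sh (xi j0) (- int u)) (xi l))) <= real (n * m) ^ (k - 2) * real L" by (rule s3[OF l])
		have "(SUM xi:Xi. Ex (b (xi j0) (xi l))) = (SUM xi:Xi. Ex (b (sh (xi j0) 0) (xi l)))"
			by (rule sum.cong) (use jt in auto)
		thus "(SUM xi:Xi. Ex (b (xi j0) (xi l))) <= real (n * m) ^ (k - 2) * real L" using s3[OF l, of 0] by simp
	qed
	also have "... <= real (n * m) ^ (k - 1) * (real w * g + 2 * real (L div n)) + real w * (real k * (2 * (real (n * m) ^ (k - 2) * real L)))"
	proof -
		define B where "B = real (n * m) ^ (k - 2) * real L"
		have B0: "0 <= B" by (simp add: B_def)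
		have "real (card (I - {j0})) <= real k" using I card_Diff1_le[of I j0] by simp
		hence "real w * (real (card (I - {j0})) * (2 * B)) <= real w * (real k * (2 * B))"
			using B0 by (intro mult_left_mono mult_right_mono) auto
		moreover have "(SUM u:{1..w}. SUM l:I - {j0}. B + B) = real w * (real (card (I - {j0})) * (2 * B))" by simp
		moreover have "(SUM xi:Xi. real w * g + real (L div n) + real (L div n)) = real (n * m) ^ (k - 1) * (real w * g + 2 * real (L div n))"
			by (simp only: sum_constant cXi) (simp add: algebra_simps)
		ultimately show ?thesis unfolding B_def by linarith
	qed
	also have "... = real w * (real (n * m) ^ (k - 1) * (g + 2 * real (L div n) / w + 2 * real k * real L / real (n * m)))"
	proof -
		have "P * (W * g + 2 * Ld) + W * (K * (2 * (P / M * L'))) = W * (P * (g + 2 * Ld / W + 2 * K * L' / M))"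
			if "W > 0" "M > 0" for P W g Ld K M L' :: real
			using that by (simp add: field_simps)
		thus ?thesis unfolding pw using w NN by (simp only: of_nat_0_less_iff)
	qed
	finally have fin: "(SUM xi:Xi. (SUM u:{1..w}. Pr (%D. ~ NoHit (insert (sh (xi j0) (- int u)) (xi ` I)) (sh (xi j0) (- int u)) (xi j0) D L L)))
		<= real w * (real (n * m) ^ (k - 1) * (g + 2 * real (L div n) / w + 2 * real k * real L / real (n * m)))" .
	have w0: "real w ~= 0" using w by simp
	show ?thesis unfolding sum_divide_distrib[symmetric] I_def[symmetric] g_def[symmetric]
		using divide_right_mono[OF fin, of "real w"] unfolding nonzero_mult_div_cancel_left[OF w0] by simp
qed

end

section \<open>Approximate invariance under transpositions\<close>

context hcw begin

text \<open>With all points but the one of index \<open>i0\<close> fixed, \<open>window_Ex\<close>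
  moves this point into the window of length \<open>w\<close> below the point of index
  \<open>j0\<close>, where \<open>pair_bound\<close> applies. The early returns are averaged over
  the sample by \<open>hits\<close>.\<close>

lemma swap_bound:
	fixes d H1 H2 kk :: int and N T l k w r :: nat
	assumes ij: "i0 < k" "j0 < k" "i0 ~= j0"
		and w: "0 < w" "w + 2 * C <= m" "int w < H1"
		and r: "r >= 2" "2 * int r + H2 + 3 <= int m" "int r + 2 <= d"
		and d: "d < H2" "2 * H2 + int r + 3 <= kk" "4 * kk <= int C" and l: "0 < l" "l < n" and T: "0 < T" "2 * (2 * T + l) * C < n * m"
	defines "g == Pr (%D. ~ Good D)"
	defines "gd == (real T + 1)\<^sup>2 * g"
	defines "sgm == 2 * exp 1 * mixf z r ^ n * sqrt n"
	shows "\<bar>SUM xi:PiE {..<k} (%_. Tor). Ex (%D. swapF k s i0 j0 D xi)\<bar> / real (n * m) ^ k <=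
			\<bar>(1 - z) / (1 + z)\<bar> ^ N * (1 + gd)
			+ ((mixf z r)\<^sup>2 ^ T * (2 * ri H1 * real w) * (1 / (vv / 2 * T) + 1 / ((ri H1)\<^sup>2 - 1))
			+ (mixf z r ^ l * (2 * ri H2 * ri d + 4 * ri H2 * real N) * (1 / (vv / 2 * l) + 1 / ((ri H2)\<^sup>2 - 1)) * (1 + gd)
			+ (g + 2 * real ((T + l) div n) / w + 2 * real k * real (T + l) / (n * m)) + 2 * gd))
			+ (4 * real k / m + (4 * real k * w + 2 * (real C)\<^sup>2 + 2 * sgm * (w + C) + real m * real n * g) / (C * w))"
proof -
	define A where "A = \<bar>(1 - z) / (1 + z)\<bar> ^ N * (1 + gd)
			+ ((mixf z r)\<^sup>2 ^ T * (2 * ri H1 * real w) * (1 / (vv / 2 * T) + 1 / ((ri H1)\<^sup>2 - 1))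
			+ (mixf z r ^ l * (2 * ri H2 * ri d + 4 * ri H2 * real N) * (1 / (vv / 2 * l) + 1 / ((ri H2)\<^sup>2 - 1)) * (1 + gd) + 2 * gd))"
	define B where "B = 4 * real k / m + (4 * real k * w + 2 * (real C)\<^sup>2 + 2 * sgm * (w + C) + real m * real n * g) / (C * w)"
	define I where "I = {..<k} - {i0}"
	define Xi where "Xi = PiE I (%_. Tor)"
	define hp where "hp = (%xi u. Pr (%D. ~ NoHit (insert (sh (xi j0) (- int u)) (xi ` I)) (sh (xi j0) (- int u)) (xi j0) D (T + l) (T + l)))"
	have I: "finite I" "j0 \<in> I" "card I = k - 1" "i0 ~: I" using ij by (auto simp: I_def)
	have jt: "xi j0 \<in> Tor" if "xi \<in> Xi" for xi using that I unfolding Xi_def by auto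
	have cXi: "real (card Xi) = real (n * m) ^ (k - 1)" unfolding Xi_def using I by (simp add: card_PiE card_torus)
	have H2: "H2 >= 0" using r d by linarith
	have wm: "w < m" using w C_pos by linarith
	have per: "\<bar>SUM v:Tor. Ex (%D. swapF k s i0 j0 D (xi(i0 := v)))\<bar> / real (n * m) <= (A + B) + (SUM u:{1..w}. hp xi u) / w"
		if xi: "xi \<in> Xi" for xi
	proof -
		define F where "F = (%D v. swapF k s i0 j0 D (xi(i0 := v)))"
		have "\<bar>SUM v:Tor. Ex (%D. F D v)\<bar> / (n * m) <= (SUM u:{1..w}. \<bar>Ex (%D. F D (sh (xi j0) (- int u)))\<bar>) / w + B"
			unfolding B_def sgm_def g_def add.assoc[symmetric]
		proof (rule window_Ex[OF jt[OF xi], where X'="xi ` I"])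
			show "\<bar>F D v\<bar> <= 1" for D v by (simp add: F_def swapF_bound)
			show "finite (xi ` I)" using I by simp
			show "card (xi ` I) <= k" using card_image_le[OF I(1), of xi] I(3) by linarith
			show "F D (Phi D v) = F D v" if "D \<in> Om" "v \<in> Tor" "v ~: xi ` I" "Phi D v ~: xi ` I" for D v
				unfolding F_def using swapF_inv[OF that(1) ij(1), of v xi] that(3,4) unfolding I_def by blast
			show "2 * int r + 3 <= int m" using r H2 by linarith
		qed (use w r in auto)
		also have "(SUM u:{1..w}. \<bar>Ex (%D. F D (sh (xi j0) (- int u)))\<bar>) / w <= (SUM u:{1..w}. A + hp xi u) / w"
		proof (intro divide_right_mono sum_mono)
			fix u assume u: "u \<in> {1..w}"
			define y where "y = sh (xi j0) (- int u)"
			define X where "X = insert y (xi ` I)"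
			have im: "(xi(i0 := y)) ` {..<k} = X" using ij by (auto simp: X_def I_def)
			have "y ~= xi j0"
			proof
				assume "y = xi j0"
				hence "sh (xi j0) (- int u) = sh (xi j0) 0" using jt[OF xi] by (simp add: y_def)
				hence "int m dvd - int u - 0" by (simp only: sh_eq_iff)
				thus False using u wm by (auto dest: dvd_imp_le)
			qed
			hence xy: "xi j0 ~= y" by simp
			have "\<bar>Ex (%D. F D y)\<bar> <= \<bar>(1 - z) / (1 + z)\<bar> ^ N * (1 + gd)
			+ ((mixf z r)\<^sup>2 ^ T * (2 * ri H1 * ri (int w)) * (1 / (vv / 2 * T) + 1 / ((ri H1)\<^sup>2 - 1))
			+ (mixf z r ^ l * (2 * ri H2 * ri d + 4 * ri H2 * real N) * (1 / (vv / 2 * l) + 1 / ((ri H2)\<^sup>2 - 1)) * (1 + gd)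
			+ Pr (%D. ~ NoHit X y (xi j0) D (T + l) (T + l)) + 2 * gd))"
				unfolding gd_def g_def
			proof (rule pair_bound[OF jt[OF xi] y_def _ _ xy _ _ w(3) r d l T])
				show "xi j0 \<in> X" "y \<in> X" using I by (auto simp: X_def)
				show "0 < int u" "int u <= int w" using u by auto
				show "\<bar>F D y\<bar> <= 1" for D by (simp add: F_def swapF_bound)
				show "F (tgl (lo d y (xi j0) t1 t2 D s') D) y = - F D y" if "D \<in> Om" "path_swap (Phi D) X y (xi j0) (t1 + s') (t2 + s')"
					"Phi (tgl (lo d y (xi j0) t1 t2 D s') D) = path_swap.f' (Phi D) y (xi j0) (t1 + s') (t2 + s')" for D s' t1 t2
					unfolding F_def
				proof (rule swapF_toggle[OF that(1) ij(1,2)])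
					show "path_swap (Phi D) ((xi(i0 := y)) ` {..<k}) ((xi(i0 := y)) i0) ((xi(i0 := y)) j0) (t1 + s') (t2 + s')"
						unfolding im using that(2) ij by simp
					show "Phi (tgl (lo d y (xi j0) t1 t2 D s') D) = path_swap.f' (Phi D) ((xi(i0 := y)) i0) ((xi(i0 := y)) j0) (t1 + s') (t2 + s')"
						using that(3) ij by simp
				qed
			qed
			thus "\<bar>Ex (%D. F D (sh (xi j0) (- int u)))\<bar> <= A + hp xi u"
				unfolding y_def[symmetric] A_def hp_def X_def by simp
		qed simp
		also have "... = A + (SUM u:{1..w}. hp xi u) / w" using w by (simp add: sum.distrib add_divide_distrib)
		finally show ?thesis by (simp add: F_def)
	qed
	have NN: "real (n * m) > 0" using n_pos m_ge by simp
	have "\<bar>SUM xi:PiE {..<k} (%_. Tor). Ex (%D. swapF k s i0 j0 D xi)\<bar> = \<bar>SUM xi:Xi. SUM v:Tor. Ex (%D. swapF k s i0 j0 D (xi(i0 := v)))\<bar>"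
		unfolding Xi_def I_def by (subst sum_PiE_split[where i=i0]) (use ij in auto)
	also have "... <= (SUM xi:Xi. \<bar>SUM v:Tor. Ex (%D. swapF k s i0 j0 D (xi(i0 := v)))\<bar>)" by (rule sum_abs)
	also have "... = real (n * m) * (SUM xi:Xi. \<bar>SUM v:Tor. Ex (%D. swapF k s i0 j0 D (xi(i0 := v)))\<bar> / real (n * m))"
		unfolding sum_divide_distrib[symmetric] using n_pos m_ge by simp
	also have "... <= real (n * m) * (SUM xi:Xi. (A + B) + (SUM u:{1..w}. hp xi u) / w)"
		using NN by (intro mult_left_mono sum_mono per) auto
	also have "... = real (n * m) * (real (n * m) ^ (k - 1) * (A + B) + (SUM xi:Xi. (SUM u:{1..w}. hp xi u) / w))"
		by (simp only: sum.distrib sum_constant cXi distrib_left)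
	also have "... <= real (n * m) * (real (n * m) ^ (k - 1) * (A + B) + real (n * m) ^ (k - 1) * (g + 2 * real ((T + l) div n) / w + 2 * real k * real (T + l) / (n * m)))"
	proof (intro mult_left_mono add_left_mono)
		have "2 * (T + l) * C <= 2 * (2 * T + l) * C" by (intro mult_right_mono mult_left_mono) auto
		hence "2 * (T + l) * C < n * m" using T by linarith
		thus "(SUM xi:Xi. (SUM u:{1..w}. hp xi u) / w) <= real (n * m) ^ (k - 1) * (g + 2 * real ((T + l) div n) / w + 2 * real k * real (T + l) / (n * m))"
			unfolding hp_def Xi_def I_def g_def by (rule hits[OF ij w(1) wm])
	qed simp
	also have "... = real (n * m) ^ k * ((A + B) + (g + 2 * real ((T + l) div n) / w + 2 * real k * real (T + l) / (n * m)))"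
	proof -
		have "P * (P ^ (k - 1) * a + P ^ (k - 1) * b) = P ^ k * (a + b)" for P a b :: real
			using ij by (cases k) (auto simp: algebra_simps)
		thus ?thesis .
	qed
	finally have "\<bar>SUM xi:PiE {..<k} (%_. Tor). Ex (%D. swapF k s i0 j0 D xi)\<bar> / real (n * m) ^ k <= (A + B) + (g + 2 * real ((T + l) div n) / w + 2 * real k * real (T + l) / (n * m))"
		using NN by (simp only: pos_divide_le_eq zero_less_power mult.commute)
	thus ?thesis unfolding A_def B_def by linarith
qed

end

lemma mixf_power_le:
	assumes "z > 0" "tht z ^ r <= 1 / 2"
	shows "mixf z r ^ M <= exp (12 * tht z ^ r * M)"
proof -
	define x where "x = tht z ^ r"
	have x: "0 <= x" "x <= 1 / 2" using assms tht_props[OF assms(1)] by (auto simp: x_def)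
	have "(1 + x) / (1 - x) <= 1 + 4 * x"
	proof -
		have "x * x <= x * (1 / 2)" using x by (intro mult_left_mono) auto
		hence "1 + x <= (1 + 4 * x) * (1 - x)" by (simp add: algebra_simps)
		thus ?thesis using x by (simp add: divide_le_eq)
	qed
	also have "... <= exp (4 * x)" by (rule exp_ge_add_one_self)
	finally have "((1 + x) / (1 - x)) ^ 3 <= exp (4 * x) ^ 3" using x by (intro power_mono) auto
	hence "mixf z r <= exp (12 * x)" by (simp add: mixf_def x_def exp_of_nat_mult[symmetric])
	moreover have "0 <= mixf z r" using x by (auto simp: mixf_def x_def)
	ultimately have "mixf z r ^ M <= exp (12 * x) ^ M" by (intro power_mono) auto
	thus ?thesis by (simp add: exp_of_nat_mult[symmetric] x_def algebra_simps)
qed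

text \<open>Since the margin \<open>r\<close> is a power of \<open>m\<close>, all mixing factors
  stay bounded. The potentials leave errors of order \<open>H1 * w / T\<close> and
  \<open>H2 * r / l\<close>, both about \<open>m powr (-1/20)\<close>, where \<open>T\<close> and
  \<open>l\<close> are comparable to the squares of \<open>H1\<close> and \<open>H2\<close>. Further
  requirements are that \<open>w\<close> be long and \<open>H2\<close> short against
  \<open>C\<close>, and \<open>T * C\<close> small against \<open>m\<^sup>2\<close>.\<close>

lemma swap_limit:
	fixes c z :: real and s :: "nat => nat"
	assumes z: "z > 0" and c: "c >= 200" and ij: "i0 < k" "j0 < k" "i0 ~= j0"
	defines "n == %m. m + excess c m"
	shows "(%m. \<bar>SUM xi:PiE {..<k} (%_. torus (n m) m). hc.Ex (n m) m z (%D. hcw.swapF (n m) m k s i0 j0 D xi)\<bar>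
			/ real (n m * m) ^ k) \<longlonglongrightarrow> 0" (is "?X \<longlonglongrightarrow> 0")
proof -
	define C where "C = excess c"
	define r where "r = (%m::nat. nat \<lfloor>real m powr (2/5)\<rfloor>)"
	define H2 where "H2 = (%m::nat. nat \<lfloor>real m powr (9/20)\<rfloor>)"
	define w where "w = (%m::nat. nat \<lfloor>real m powr (3/5)\<rfloor>)"
	define H1 where "H1 = (%m::nat. nat \<lfloor>real m powr (13/20)\<rfloor>)"
	define T where "T = (%m::nat. nat \<lfloor>real m powr (13/10)\<rfloor>)"
	define l where "l = (%m::nat. nat \<lfloor>real m powr (9/10)\<rfloor>)"
	define rh where "rh = \<bar>(1 - z) / (1 + z)\<bar>"
	define b where "b = - ln (tht z)"
	have b: "b > 0" and q: "tht z ^ j = exp (- b * real j)" for j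
		using tht_props[OF z] by (auto simp: b_def exp_of_nat_mult mult.commute[of "ln _"])
	have rho: "0 <= rh" "rh < 1" using z by (auto simp: rh_def abs_less_iff field_simps)
	have c0: "c > 0" using c by simp
	have Cf: "C m = nat \<lceil>c * sqrt (real m * ln (real m))\<rceil>" for m by (simp add: C_def excess_def)
	have n: "n m = m + C m" for m by (simp add: n_def C_def)
	have "\<forall>\<^sub>F m in sequentially. real (C m) >= 1" unfolding Cf using c0 by real_asymp
	moreover have "\<forall>\<^sub>F m in sequentially. real (w m) >= 1" unfolding w_def by real_asymp
	moreover have "\<forall>\<^sub>F m in sequentially. real (w m) + 2 * real (C m) <= real m" unfolding w_def Cf using c0 by real_asymp
	moreover have "\<forall>\<^sub>F m in sequentially. real (w m) < real (H1 m)" unfolding w_def H1_def by real_asymp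
	moreover have "\<forall>\<^sub>F m in sequentially. real (r m) >= 2" unfolding r_def by real_asymp
	moreover have "\<forall>\<^sub>F m in sequentially. 2 * real (r m) + real (H2 m) + 3 <= real m" unfolding r_def H2_def by real_asymp
	moreover have "\<forall>\<^sub>F m in sequentially. real (r m) + 2 < real (H2 m)" unfolding r_def H2_def by real_asymp
	moreover have "\<forall>\<^sub>F m in sequentially. 8 * real (H2 m) + 4 * real (r m) + 12 <= real (C m)" unfolding r_def H2_def Cf using c0 by real_asymp
	moreover have "\<forall>\<^sub>F m in sequentially. real (l m) >= 1" unfolding l_def by real_asymp
	moreover have "\<forall>\<^sub>F m in sequentially. real (l m) < real m" unfolding l_def by real_asymp
	moreover have "\<forall>\<^sub>F m in sequentially. real (T m) >= 1" unfolding T_def by real_asymp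
	moreover have "\<forall>\<^sub>F m in sequentially. 2 * (2 * real (T m) + real (l m)) * real (C m) < real m * real m" unfolding T_def l_def Cf using c0 by real_asymp
	ultimately have side: "\<forall>\<^sub>F m in sequentially. 0 < C m & 0 < w m & w m + 2 * C m <= m & w m < H1 m & 2 <= r m
			& 2 * r m + H2 m + 3 <= m & r m + 2 < H2 m & 8 * H2 m + 4 * r m + 12 <= C m & 0 < l m & l m < m & 0 < T m
			& 2 * (2 * T m + l m) * C m < n m * m"
	proof eventually_elim
		case (elim m)
		have "real (2 * (2 * T m + l m) * C m) < real (m * m)" using elim by simp
		hence *: "2 * (2 * T m + l m) * C m < m * m" by (simp only: of_nat_less_iff)
		have "m * m <= n m * m" by (simp add: n)
		hence "2 * (2 * T m + l m) * C m < n m * m" using * by linarith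
		thus ?case using elim(1-11) by (intro conjI; (assumption | linarith))
	qed
	have "\<forall>\<^sub>F m in sequentially. exp (- b * real (r m)) <= 1 / 2" unfolding r_def using b by real_asymp
	moreover have "\<forall>\<^sub>F m in sequentially. 12 * exp (- b * real (r m)) * (2 * real (T m)) <= 1 / 2" unfolding r_def T_def using b by real_asymp
	moreover have "\<forall>\<^sub>F m in sequentially. 12 * exp (- b * real (r m)) * real (l m) <= 1 / 2" unfolding r_def l_def using b by real_asymp
	moreover have "\<forall>\<^sub>F m in sequentially. 12 * exp (- b * real (r m)) * (real m + real (C m)) <= 1 / 2" unfolding r_def Cf using b c0 by real_asymp
	ultimately have mix: "\<forall>\<^sub>F m in sequentially. (mixf z (r m))\<^sup>2 ^ T m <= 2 & mixf z (r m) ^ l m <= 2 & mixf z (r m) ^ n m <= 2"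
	proof eventually_elim
		case (elim m)
		have e2: "exp (x::real) <= 2" if "x <= 1 / 2" for x
		proof -
			have "exp x <= exp (1/2)" using that by simp
			also have "... <= 2" using exp_half_le2 by simp
			finally show ?thesis .
		qed
		have th: "tht z ^ r m <= 1 / 2" using elim by (simp only: q)
		have *: "mixf z (r m) ^ M <= 2" if "12 * exp (- b * real (r m)) * real M <= 1 / 2" for M
			using mixf_power_le[OF z th, of M] e2[of "12 * tht z ^ r m * real M"] that unfolding q by linarith
		have "(mixf z (r m))\<^sup>2 ^ T m = mixf z (r m) ^ (2 * T m)" by (simp add: power_mult)
		thus ?case using *[of "2 * T m"] *[of "l m"] *[of "n m"] elim by (simp add: n)
	qed
	define g where "g = (%m. hc.Pr (n m) m z (%D. ~ hcw.Good (n m) m (C m) D))"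
	have "\<forall>\<^sub>F m in sequentially. real (C m) <= real m" unfolding Cf using c0 by real_asymp
	moreover have "\<forall>\<^sub>F m in sequentially. 2 * real m * real m * (2 * real m + 1) * (2 * 2 * real m powr (-10)) <= real m powr (-6)" by real_asymp
	moreover have "\<forall>\<^sub>F m in sequentially. real m >= 3" by real_asymp
	\<comment> \<open>The union bound runs over about \<open>m ^ 3\<close> pairs of a site and a time.
	  The bound \<open>m powr (-6)\<close> is small enough to absorb the factor
	  \<open>(T + 1)\<^sup>2\<close> in \<open>gd'\<close> as well.\<close>
	ultimately have gb: "\<forall>\<^sub>F m in sequentially. 0 <= g m & g m <= real m powr (-6)"
		using side mix
	proof eventually_elim
		case (elim m)
		interpret hcw "n m" m z "C m"
			by unfold_locales (use elim z in "auto simp: n")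
		have n2: "real (n m) <= 2 * real m" "real (n m) > 0" using elim by (auto simp: n)
		have Cc: "real (C m) >= 200 * sqrt (real m * ln (real m))"
		proof -
			have "200 * sqrt (real m * ln (real m)) <= c * sqrt (real m * ln (real m))" using c elim by (intro mult_right_mono) auto
			also have "... <= real (C m)" unfolding Cf by linarith
			finally show ?thesis .
		qed
		have ln0: "ln (real m) >= 0" using elim by simp
		have "(real (C m) / 16)\<^sup>2 = (real (C m))\<^sup>2 / 256" by (simp add: power2_eq_square)
		moreover have "(200 * sqrt (real m * ln (real m)))\<^sup>2 <= (real (C m))\<^sup>2" using Cc ln0 by (intro power_mono) auto
		moreover have "(200 * sqrt (real m * ln (real m)))\<^sup>2 = 40000 * (real m * ln (real m))" using ln0 by (simp add: power_mult_distrib)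
		\<comment> \<open>Here \<open>c >= 200\<close> enters: \<open>200\<^sup>2 / 256\<close> exceeds
		  80, and \<open>4 * n <= 8 * m\<close>.\<close>
		ultimately have "10 * ln (real m) * (4 * real (n m)) <= (real (C m) / 16)\<^sup>2"
			using mult_left_mono[OF n2(1) ln0] mult_nonneg_nonneg[OF of_nat_0_le_iff[of m] ln0] by (simp add: algebra_simps)
		hence "10 * ln (real m) <= (real (C m) / 16)\<^sup>2 / (4 * real (n m))" using n2 by (simp add: le_divide_eq)
		hence "exp (- (real (C m) / 16)\<^sup>2 / (4 * real (n m))) <= exp (- 10 * ln (real m))" by simp
		also have "... = real m powr (-10)" using elim by (simp add: powr_def)
		finally have e: "exp (- (real (C m) / 16)\<^sup>2 / (4 * real (n m))) <= real m powr (-10)" .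
		have "g m <= real (n m * m) * (real (n m) + 1) * (2 * mixf z (r m) ^ n m * exp (- (real (C m) / 16)\<^sup>2 / (4 * real (n m))))"
			unfolding g_def using Pr_not_Good[of "r m"] elim by simp
		also have "... <= (2 * real m * real m) * (2 * real m + 1) * (2 * 2 * real m powr (-10))"
		proof (intro mult_mono e)
			show "real (n m * m) <= 2 * real m * real m" using n2 by (simp add: mult_right_mono)
		qed (use n2 elim mixf_ge1[of "r m"] in auto)
		also have "... <= real m powr (-6)" using elim by simp
		finally show ?case by (simp add: g_def Pr_nonneg)
	qed
	define V where "V = hc.vv z"
	have V: "V > 0"
	proof -
		interpret hc 1 3 z by unfold_locales (use z in auto)
		show ?thesis unfolding V_def by (rule vv_pos)
	qed
	define g' where "g' = (%m. real m powr (-6))"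
	define gd' where "gd' = (%m. (real (T m) + 1)\<^sup>2 * g' m)"
	define R1 where "R1 = (%m. 2 * (2 * real (H1 m) * real (w m)) * (1 / (V / 2 * T m) + 1 / ((real (H1 m))\<^sup>2 - 1)))"
	define R2 where "R2 = (%N m. 2 * (2 * real (H2 m) * (real (r m) + 2) + 4 * real (H2 m) * real N) * (1 / (V / 2 * l m) + 1 / ((real (H2 m))\<^sup>2 - 1)) * (1 + gd' m))"
	define R3 where "R3 = (%m. g' m + 2 * (real (T m + l m) / real m) / w m + 2 * real k * real (T m + l m) / (real m * real m))"
	define R4 where "R4 = (%m. 4 * real k / m + (4 * real k * w m + 2 * (real (C m))\<^sup>2 + 2 * (2 * exp 1 * 2 * sqrt (real m + real (C m))) * (real (w m) + real (C m)) + real m * (real m + real (C m)) * g' m) / (real (C m) * real (w m)))"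
	define R where "R = (%N m. gd' m + (R1 m + (R2 N m + R3 m + 2 * gd' m)) + R4 m)"
	have gd0: "gd' \<longlonglongrightarrow> 0" unfolding gd'_def g'_def T_def by real_asymp
	note gd0
	moreover have "R1 \<longlonglongrightarrow> 0"
	proof -
		have "(%m. 4 * real (H1 m) * real (w m) * (1 / (V / 2 * T m))) \<longlonglongrightarrow> 0" unfolding H1_def w_def T_def using V by real_asymp
		moreover have "(%m. 4 * real (H1 m) * real (w m) * (1 / ((real (H1 m))\<^sup>2 - 1))) \<longlonglongrightarrow> 0" unfolding H1_def w_def by real_asymp
		ultimately have "(%m. 4 * real (H1 m) * real (w m) * (1 / (V / 2 * T m)) + 4 * real (H1 m) * real (w m) * (1 / ((real (H1 m))\<^sup>2 - 1))) \<longlonglongrightarrow> 0 + 0"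
			by (rule tendsto_add)
		thus ?thesis by (simp add: R1_def algebra_simps)
	qed
	moreover have "R2 N \<longlonglongrightarrow> 0" for N
	proof -
		have "(%m. real (H2 m) * (real (r m) + 2) * (1 / (V / 2 * l m))) \<longlonglongrightarrow> 0" unfolding H2_def r_def l_def using V by real_asymp
		moreover have "(%m. real (H2 m) * (1 / (V / 2 * l m))) \<longlonglongrightarrow> 0" unfolding H2_def l_def using V by real_asymp
		moreover have "(%m. real (H2 m) * (real (r m) + 2) * (1 / ((real (H2 m))\<^sup>2 - 1))) \<longlonglongrightarrow> 0" unfolding H2_def r_def by real_asymp
		moreover have "(%m. real (H2 m) * (1 / ((real (H2 m))\<^sup>2 - 1))) \<longlonglongrightarrow> 0" unfolding H2_def by real_asymp
		ultimately have "(%m. 4 * (real (H2 m) * (real (r m) + 2) * (1 / (V / 2 * l m))) + 8 * real N * (real (H2 m) * (1 / (V / 2 * l m)))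
			+ (4 * (real (H2 m) * (real (r m) + 2) * (1 / ((real (H2 m))\<^sup>2 - 1))) + 8 * real N * (real (H2 m) * (1 / ((real (H2 m))\<^sup>2 - 1)))))
				\<longlonglongrightarrow> 4 * 0 + 8 * real N * 0 + (4 * 0 + 8 * real N * 0)"
			by (intro tendsto_intros)
		hence "(%m. 2 * (2 * real (H2 m) * (real (r m) + 2) + 4 * real (H2 m) * real N) * (1 / (V / 2 * l m) + 1 / ((real (H2 m))\<^sup>2 - 1))) \<longlonglongrightarrow> 0"
			by (simp add: algebra_simps)
		moreover have "(%m. 1 + gd' m) \<longlonglongrightarrow> 1 + 0" by (intro tendsto_intros gd0)
		ultimately have "R2 N \<longlonglongrightarrow> 0 * (1 + 0)" unfolding R2_def by (rule tendsto_mult)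
		thus ?thesis by simp
	qed
	moreover have "R3 \<longlonglongrightarrow> 0"
	proof -
		have "(%m. g' m + 2 * (real (T m + l m) / real m) / w m) \<longlonglongrightarrow> 0" unfolding g'_def T_def l_def w_def by real_asymp
		moreover have "(%m. real (T m + l m) / (real m * real m)) \<longlonglongrightarrow> 0" unfolding T_def l_def by real_asymp
		ultimately have "(%m. g' m + 2 * (real (T m + l m) / real m) / w m + 2 * real k * (real (T m + l m) / (real m * real m))) \<longlonglongrightarrow> 0 + 2 * real k * 0"
			by (intro tendsto_add tendsto_mult_left)
		thus ?thesis by (simp add: R3_def)
	qed
	moreover have "R4 \<longlonglongrightarrow> 0"
	proof -
		have "(%m. 1 / real m) \<longlonglongrightarrow> 0" by real_asymp
		moreover have "(%m. real (w m) / (real (C m) * real (w m))) \<longlonglongrightarrow> 0" unfolding w_def Cf using c0 by real_asymp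
		moreover have "(%m. (real (C m))\<^sup>2 / (real (C m) * real (w m))) \<longlonglongrightarrow> 0" unfolding w_def Cf using c0 by real_asymp
		moreover have "(%m. sqrt (real m + real (C m)) * (real (w m) + real (C m)) / (real (C m) * real (w m))) \<longlonglongrightarrow> 0" unfolding w_def Cf using c0 by real_asymp
		moreover have "(%m. real m * (real m + real (C m)) * g' m / (real (C m) * real (w m))) \<longlonglongrightarrow> 0" unfolding w_def Cf g'_def using c0 by real_asymp
		ultimately have "(%m. 4 * real k * (1 / real m) + (4 * real k * (real (w m) / (real (C m) * real (w m))) + 2 * ((real (C m))\<^sup>2 / (real (C m) * real (w m)))
			+ 2 * (2 * exp 1 * 2) * (sqrt (real m + real (C m)) * (real (w m) + real (C m)) / (real (C m) * real (w m))) + real m * (real m + real (C m)) * g' m / (real (C m) * real (w m))))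
			\<longlonglongrightarrow> 4 * real k * 0 + (4 * real k * 0 + 2 * 0 + 2 * (2 * exp 1 * 2) * 0 + 0)"
			by (intro tendsto_add tendsto_mult_left)
		thus ?thesis unfolding R4_def by (simp only: add_divide_distrib mult.assoc times_divide_eq_right mult_zero_right add_0_left mult_1_right)
	qed
	ultimately have R0: "R N \<longlonglongrightarrow> 0" for N
		unfolding R_def by (auto intro!: tendsto_eq_intros)
	have bound: "\<forall>\<^sub>F m in sequentially. ?X m <= rh ^ N + R N m" for N
		using side mix gb eventually_ge_at_top[of 3]
	proof eventually_elim
		case (elim m)
		interpret hcw "n m" m z "C m"
			by unfold_locales (use elim z in "auto simp: n")
		have gm: "g m = Pr (%D. ~ Good D)" by (simp add: g_def)
		define gd where "gd = (real (T m) + 1)\<^sup>2 * g m"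
		have g0: "0 <= g m" "g m <= g' m" using elim by (auto simp: g'_def)
		have gd: "0 <= gd" "gd <= gd' m" using g0 by (auto simp: gd_def gd'_def intro: mult_left_mono)
		have H: "(real (H1 m))\<^sup>2 - 1 > 0" "(real (H2 m))\<^sup>2 - 1 > 0" "real (T m) > 0" "real (l m) > 0" "real (w m) > 0" "real (C m) > 0" "real m > 0"
			using elim by (auto simp: power2_eq_square less_1_mult)
		have sb: "?X m <= rh ^ N * (1 + gd)
			+ ((mixf z (r m))\<^sup>2 ^ T m * (2 * real (H1 m) * real (w m)) * (1 / (V / 2 * T m) + 1 / ((real (H1 m))\<^sup>2 - 1))
			+ (mixf z (r m) ^ l m * (2 * real (H2 m) * (real (r m) + 2) + 4 * real (H2 m) * real N) * (1 / (V / 2 * l m) + 1 / ((real (H2 m))\<^sup>2 - 1)) * (1 + gd)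
			+ (g m + 2 * real ((T m + l m) div n m) / w m + 2 * real k * real (T m + l m) / (n m * m)) + 2 * gd))
			+ (4 * real k / m + (4 * real k * w m + 2 * (real (C m))\<^sup>2 + 2 * (2 * exp 1 * mixf z (r m) ^ n m * sqrt (n m)) * (w m + C m) + real m * real (n m) * g m) / (C m * w m))"
			using swap_bound[OF ij, where s=s and w="w m" and r="r m" and d="int (r m) + 2" and ?H1.0="int (H1 m)" and ?H2.0="int (H2 m)" and l="l m" and T="T m" and N=N and kk="2 * int (H2 m) + int (r m) + 3"] elim
			unfolding gd_def gm rh_def V_def by (simp add: n)
		have m0: "0 <= mixf z (r m)" using mixf_ge1[of "r m"] elim by linarith
		have "rh ^ N * (1 + gd) <= rh ^ N + gd' m"
		proof -
			have "rh ^ N * gd <= 1 * gd" using rho gd by (intro mult_right_mono power_le_one) auto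
			thus ?thesis using gd by (simp add: algebra_simps)
		qed
		moreover have "(mixf z (r m))\<^sup>2 ^ T m * (2 * real (H1 m) * real (w m)) * (1 / (V / 2 * T m) + 1 / ((real (H1 m))\<^sup>2 - 1)) <= R1 m"
			unfolding R1_def using elim V H by (intro mult_right_mono) auto
		moreover have "mixf z (r m) ^ l m * (2 * real (H2 m) * (real (r m) + 2) + 4 * real (H2 m) * real N) * (1 / (V / 2 * l m) + 1 / ((real (H2 m))\<^sup>2 - 1)) * (1 + gd) <= R2 N m"
			unfolding R2_def using elim V H gd by (intro mult_mono) (auto intro!: mult_nonneg_nonneg add_nonneg_nonneg)
		moreover have "g m + 2 * real ((T m + l m) div n m) / w m + 2 * real k * real (T m + l m) / (n m * m) <= R3 m"
			unfolding R3_def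
		proof (intro add_mono g0 divide_right_mono mult_left_mono)
			have "real ((T m + l m) div n m) <= real (T m + l m) / real (n m)" by (rule of_nat_div_le_of_nat)
			also have "... <= real (T m + l m) / real m" using elim by (intro divide_left_mono) (auto simp: n)
			finally show "real ((T m + l m) div n m) <= real (T m + l m) / real m" .
			show "2 * real k * real (T m + l m) / (n m * m) <= 2 * real k * real (T m + l m) / (real m * real m)"
				using elim by (intro divide_left_mono) (auto simp: n)
		qed auto
		moreover have "4 * real k / m + (4 * real k * w m + 2 * (real (C m))\<^sup>2 + 2 * (2 * exp 1 * mixf z (r m) ^ n m * sqrt (n m)) * (w m + C m) + real m * real (n m) * g m) / (C m * w m) <= R4 m"
			unfolding R4_def of_nat_mult
		proof (intro add_left_mono divide_right_mono add_mono mult_left_mono mult_mono)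
			show "sqrt (real (n m)) <= sqrt (real m + real (C m))" by (simp add: n)
		qed (use elim g0 m0 in "auto simp: n")
		ultimately show ?case using sb gd unfolding R_def by linarith
	qed
	have X0: "0 <= ?X m" for m by simp
	show ?thesis
	proof (rule LIMSEQ_I)
		fix e :: real assume e: "e > 0"
		\<comment> \<open>\<open>N\<close> is fixed before \<open>m\<close> grows: the required number of
		  toggle times enters the error \<open>R N\<close> only through a term that still tends to
		  0.\<close>
		obtain N where N: "rh ^ N < e / 2" using real_arch_pow_inv[of "e / 2" rh] rho e by auto
		have "\<forall>\<^sub>F m in sequentially. R N m < e / 2" using R0[of N] e by (intro order_tendstoD) auto
		hence "\<forall>\<^sub>F m in sequentially. norm (?X m - 0) < e"
			using bound[of N]
		proof eventually_elim
			case (elim m)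
			thus ?case using N X0[of m] by (simp only: real_norm_def diff_0_right abs_of_nonneg)
		qed
		thus "EX no. ALL m>=no. norm (?X m - 0) < e" by (simp only: eventually_sequentially)
	qed
qed

section \<open>Decreasing rearrangements\<close>

text \<open>\<open>y\<close> lists the values of \<open>v\<close> in decreasing order, padded with
  zeros. Counting at positive levels covers finite and infinite families alike and ignores members
  of value 0.\<close>

definition ranks :: "'i set => ('i => real) => (nat => real) => bool" where
	"ranks I v y \<longleftrightarrow> (ALL j. 0 <= y j) & (ALL t>0. finite {i\<in>I. t < v i} & (ALL j. t < y j \<longleftrightarrow> j < card {i\<in>I. t < v i}))"

lemma ranks_le:
	assumes "ranks I v y" "ranks I v' y'" "!!i. i \<in> I ==> v i <= v' i + d" "0 <= d"
	shows "y j <= y' j + d"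
proof (rule ccontr)
	assume "~ y j <= y' j + d"
	then obtain t where t: "y' j < t" "t < y j - d" using dense[of "y' j" "y j - d"] by auto
	have t0: "0 < t" using assms(2) t by (auto simp: ranks_def intro: le_less_trans)
	have "t + d < y j" using t by simp
	hence "j < card {i\<in>I. t + d < v i}" using assms(1,4) t0 by (auto simp: ranks_def)
	also have "... <= card {i\<in>I. t < v' i}"
	proof (rule card_mono)
		show "finite {i\<in>I. t < v' i}" using assms(2) t0 by (auto simp: ranks_def)
		show "{i\<in>I. t + d < v i} <= {i\<in>I. t < v' i}" using assms(3) by fastforce
	qed
	finally have "t < y' j" using assms(2) t0 by (auto simp: ranks_def)
	thus False using t by simp
qed

text \<open>Sorting does not increase the sup distance, because moving all values by at most
  \<open>d\<close> moves every level set into the one for a level lower by \<open>d\<close>.\<close>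

lemma ranks_lipschitz:
	assumes "ranks I v y" "ranks I v' y'" "!!i. i \<in> I ==> \<bar>v i - v' i\<bar> <= d" "0 <= d"
	shows "\<bar>y j - y' j\<bar> <= d"
proof -
	have "v i <= v' i + d" "v' i <= v i + d" if "i \<in> I" for i using assms(3)[OF that] by linarith+
	thus ?thesis using ranks_le[OF assms(1,2), of d j] ranks_le[OF assms(2,1), of d j] assms(4) by (simp add: abs_le_iff)
qed

section \<open>Sorted multisets and rearranged sequences\<close>

definition sortd :: "real multiset => nat => real" where
	"sortd A = (let ls = rev (sorted_list_of_multiset A) in (%j. if j < length ls then ls ! j else 0))"

lemma sorted_nth_filter:
	fixes ls :: "real list"
	assumes "sorted_wrt (>=) ls"
	shows "(j < length ls & t < ls ! j) = (j < length (filter (%x. t < x) ls))"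
	using assms
proof (induction ls arbitrary: j)
	case (Cons a ls)
	show ?case
	proof (cases "t < a")
		case True
		thus ?thesis using Cons.IH[of "j - 1"] Cons.prems by (cases j) auto
	next
		case False
		hence "filter (%x. t < x) ls = []" using Cons.prems by (auto simp: filter_empty_conv)
		moreover have "~ t < (a # ls) ! j" if "j < length (a # ls)"
			using that False Cons.prems by (cases j) (auto simp: not_less dest!: nth_mem intro: order_trans)
		ultimately show ?thesis using False by auto
	qed
qed simp

lemma sortd_less:
	assumes "0 <= t" shows "t < sortd A j \<longleftrightarrow> j < size (filter_mset (%x. t < x) A)"
proof -
	define ls where "ls = rev (sorted_list_of_multiset A)"
	have s: "sorted_wrt (>=) ls" by (simp add: ls_def sorted_wrt_rev)
	have m: "mset ls = A" by (simp add: ls_def)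
	have "t < sortd A j \<longleftrightarrow> j < length ls & t < ls ! j"
		using assms by (auto simp: sortd_def ls_def[symmetric] Let_def)
	also have "... \<longleftrightarrow> j < size (mset (filter (%x. t < x) ls))" unfolding sorted_nth_filter[OF s] size_mset ..
	finally show ?thesis by (simp only: mset_filter m)
qed

lemma sortd_nonneg:
	assumes "!!x. x \<in># A ==> 0 <= x" shows "0 <= sortd A j"
proof -
	have "rev (sorted_list_of_multiset A) ! j \<in># A" if "j < length (rev (sorted_list_of_multiset A))"
		using nth_mem[OF that] by simp
	thus ?thesis using assms by (auto simp: sortd_def Let_def)
qed

lemma ranks_sortd:
	assumes "!!x. x \<in># A ==> 0 <= x" "!!t. 0 < t ==> finite {i\<in>I. t < v i} & card {i\<in>I. t < v i} = size (filter_mset (%x. t < x) A)"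
	shows "ranks I v (sortd A)"
	unfolding ranks_def using assms sortd_nonneg[OF assms(1)] by (auto simp: sortd_less)

lemma cycle_structure_sortd:
	"cycle_structure S \<pi> = sortd (image_mset (%C. real (card C) / real (card S)) (mset_set (orbit \<pi> ` S)))"
	by (simp only: cycle_structure_def sortd_def)

lemma ranks_cycle_structure:
	assumes "finite S"
	shows "ranks (orbit \<pi> ` S) (%C. real (card C) / real (card S)) (cycle_structure S \<pi>)"
	unfolding cycle_structure_sortd
proof (rule ranks_sortd)
	fix t :: real
	have "size (filter_mset (%x. t < x) (image_mset (%C. real (card C) / real (card S)) (mset_set (orbit \<pi> ` S))))
		= size (filter_mset (%C. t < real (card C) / real (card S)) (mset_set (orbit \<pi> ` S)))"
		by (simp only: filter_mset_image_mset size_image_mset)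
	thus "finite {C \<in> orbit \<pi> ` S. t < real (card C) / real (card S)} &
		card {C \<in> orbit \<pi> ` S. t < real (card C) / real (card S)}
		= size (filter_mset (%x. t < x) (image_mset (%C. real (card C) / real (card S)) (mset_set (orbit \<pi> ` S))))"
		using assms by simp
qed auto

text \<open>The levels of \<open>y\<close> are described through \<open>x\<close> alone, so the
  permutation \<open>sgm\<close> drops out; uniqueness and measurability of the rearrangement rest
  on this.\<close>

lemma decseq_rearrangement_less:
	fixes x :: "nat => real"
	assumes "decseq y" "bij sgm" "y = x \<circ> sgm"
	shows "t < y j \<longleftrightarrow> (EX F. finite F & card F = Suc j & (ALL i:F. t < x i))"
proof
	assume "t < y j"
	hence "t < y l" if "l <= j" for l using decseqD[OF assms(1) that] by simp
	moreover have "inj_on sgm {..j}" using assms(2) by (meson bij_is_inj inj_on_subset subset_UNIV)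
	ultimately show "EX F. finite F & card F = Suc j & (ALL i:F. t < x i)"
		using assms(3) by (intro exI[of _ "sgm ` {..j}"]) (auto simp: card_image)
next
	assume "EX F. finite F & card F = Suc j & (ALL i:F. t < x i)"
	then obtain F where F: "finite F" "card F = Suc j" "ALL i:F. t < x i" by blast
	define G where "G = inv sgm ` F"
	have "card G = Suc j" unfolding G_def using F inj_on_subset[OF bij_is_inj[OF bij_imp_bij_inv[OF assms(2)]] subset_UNIV] by (subst card_image) auto
	hence "~ G <= {..<j}" using card_mono[of "{..<j}" G] by auto
	then obtain l where l: "l \<in> G" "j <= l" by (meson lessThan_iff not_less subsetI)
	then obtain i where i: "i \<in> F" "l = inv sgm i" by (auto simp: G_def)
	hence "sgm l = i" using assms(2) by (simp add: bij_is_surj surj_f_inv_f)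
	hence "t < y l" using assms(3) F i by simp
	also have "y l <= y j" using decseqD[OF assms(1) l(2)] .
	finally show "t < y j" .
qed

lemma decseq_rearrangement_unique:
	fixes x :: "nat => real"
	assumes "decseq y" "bij sgm" "y = x \<circ> sgm" "decseq y'" "bij sgm'" "y' = x \<circ> sgm'"
	shows "y = y'"
proof
	fix j
	have "t < y j \<longleftrightarrow> t < y' j" for t
		using decseq_rearrangement_less[OF assms(1-3)] decseq_rearrangement_less[OF assms(4-6)] by simp
	thus "y j = y' j" by (meson linorder_neqE_linordered_idom less_irrefl)
qed

lemma decseq_rearrangement_exists:
	fixes x :: "nat => real"
	assumes fin: "!!k. finite {i. x k < x i}"
	shows "EX y. decseq y & (EX sgm. bij sgm & y = x \<circ> sgm)"
proof -
	\<comment> \<open>Entries are ordered by value and, among equal values, by index; the number of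
	  predecessors is then a bijective rank.\<close>
	define pr where "pr = (%k. {i. x k < x i | (x i = x k & i < k)})"
	define rk where "rk = (%k. card (pr k))"
	have fpr: "finite (pr k)" for k
		by (rule finite_subset[of _ "{i. x k < x i} \<union> {..<k}"]) (use fin in "auto simp: pr_def")
	have tot: "i \<in> pr k | k \<in> pr i" if "i ~= k" for i k using that by (auto simp: pr_def)
	have mono: "rk i < rk k" if "i \<in> pr k" for i k
		unfolding rk_def by (rule psubset_card_mono[OF fpr]) (use that in "auto simp: pr_def")
	have inj: "inj rk" using tot mono by (intro injI) (metis less_irrefl)
	have im: "rk ` pr k = {..<rk k}" for k
	proof (rule card_subset_eq)
		show "rk ` pr k <= {..<rk k}" using mono by auto
		have "card (rk ` pr k) = card (pr k)" by (rule card_image) (use inj inj_on_subset in blast)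
		thus "card (rk ` pr k) = card {..<rk k}" by (simp add: rk_def)
	qed simp
	have "infinite (range rk)" using inj finite_imageD by blast
	have surj: "surj rk"
	unfolding surj_def
	proof
		fix j
		have "~ range rk <= {..j}" using \<open>infinite (range rk)\<close> finite_subset by blast
		then obtain k where "j < rk k" by (metis atMost_iff imageE not_le subsetI)
		hence "j \<in> rk ` pr k" using im by simp
		thus "EX k. j = rk k" by auto
	qed
	have b: "bij rk" using inj surj by (rule bijI)
	have "decseq (x \<circ> inv rk)"
	proof (rule decseq_SucI)
		fix j
		have r: "rk (inv rk l) = l" for l using surj by (rule surj_f_inv_f)
		have "inv rk (Suc j) ~: pr (inv rk j)" using mono[of "inv rk (Suc j)" "inv rk j"] r by auto
		thus "(x \<circ> inv rk) (Suc j) <= (x \<circ> inv rk) j" by (auto simp: pr_def not_less)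
	qed
	thus ?thesis using bij_imp_bij_inv[OF b] by blast
qed

text \<open>Existence is reduced to countably many comparisons between coordinates, hence to a
  measurable condition.\<close>

lemma decseq_rearrangement_exists_iff:
	fixes x :: "nat => real"
	shows "(EX y. decseq y & (EX sgm. bij sgm & y = x \<circ> sgm)) \<longleftrightarrow> (ALL k. EX N. ALL i>=N. x i <= x k)"
proof -
	have eq: "finite {i. x k < x i} \<longleftrightarrow> (EX N. ALL i>=N. x i <= x k)" for k
		unfolding finite_nat_set_iff_bounded by (auto simp: not_less) (metis not_less)+
	have "finite {i. x k < x i}" if "decseq y" "bij sgm" "y = x \<circ> sgm" for y sgm k
	proof -
		define j where "j = inv sgm k"
		have k: "x k = y j" using that by (simp add: j_def bij_is_surj surj_f_inv_f)
		have "{i. x k < x i} <= sgm ` {..<j}"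
		proof
			fix i assume "i \<in> {i. x k < x i}"
			moreover have i: "i = sgm (inv sgm i)" using that by (simp add: bij_is_surj surj_f_inv_f)
			ultimately have "y j < y (inv sgm i)" using that(3) k by simp
			hence "inv sgm i < j" using decseqD[OF that(1), of j "inv sgm i"] by (meson not_le)
			thus "i \<in> sgm ` {..<j}" using i by blast
		qed
		thus ?thesis by (rule finite_subset) simp
	qed
	thus ?thesis using decseq_rearrangement_exists[of x] unfolding eq by blast
qed

lemma decreasing_rearrangementI:
	assumes "decseq y" "bij sgm" "y = x \<circ> sgm"
	shows "decreasing_rearrangement x = y"
	unfolding decreasing_rearrangement_def
proof (rule the_equality)
	show "decseq y & (EX sgm. bij sgm & y = x \<circ> sgm)" using assms by blast
	show "y' = y" if "decseq y' & (EX sgm. bij sgm & y' = x \<circ> sgm)" for y'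
		using that decseq_rearrangement_unique[OF _ _ _ assms] by blast
qed

text \<open>Where no rearrangement exists, the definite description denotes one fixed function, so
  measurability is not lost there.\<close>

lemma decreasing_rearrangement_none:
	assumes "~ (ALL k. EX N. ALL i>=N. x i <= x k)"
	shows "decreasing_rearrangement x = (THE y. False)"
proof -
	have "(%y. decseq y & (EX sgm. bij sgm & y = x \<circ> sgm)) = (%y. False)"
		using assms unfolding decseq_rearrangement_exists_iff[symmetric] by blast
	thus ?thesis unfolding decreasing_rearrangement_def by simp
qed

text \<open>On the set where a rearrangement exists, the event that its entry exceeds a level is a
  countable union, over finite index sets, of conditions on finitely many coordinates.\<close>

lemma decreasing_rearrangement_measurable:
	assumes [measurable]: "!!i. (%u. x u i) \<in> borel_measurable M"
	shows "(%u. decreasing_rearrangement (x u)) \<in> borel_measurable M"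
proof (rule measurable_coordinatewise_then_product)
	fix j :: nat
	define E where "E = (%u. ALL k. EX N. ALL i>=N. x u i <= x u k)"
	have [measurable]: "Measurable.pred M E" unfolding E_def by measurable
	define c where "c = (THE y :: nat => real. False)"
	have less: "t < decreasing_rearrangement (x u) j \<longleftrightarrow>
			(if E u then EX F:{F. finite F}. card F = Suc j & (ALL i:F. t < x u i) else t < c j)" for t u
	proof (cases "E u")
		case True
		then obtain y sgm where y: "decseq y" "bij sgm" "y = x u \<circ> sgm"
			unfolding E_def decseq_rearrangement_exists_iff[symmetric] by blast
		show ?thesis using decseq_rearrangement_less[OF y, of t j] True unfolding decreasing_rearrangementI[OF y] by simp
	next
		case False
		hence "decreasing_rearrangement (x u) = c"
			unfolding c_def by (intro decreasing_rearrangement_none) (simp add: E_def)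
		thus ?thesis using False by simp
	qed
	show "(%u. decreasing_rearrangement (x u) j) \<in> borel_measurable M"
	proof (subst borel_measurable_iff_greater, intro allI)
		fix t
		have cF: "countable {F :: nat set. finite F}" by (rule countable_Collect_finite)
		have "Measurable.pred M (%u. EX F:{F. finite F}. card F = Suc j & (ALL i:F. t < x u i))"
		proof (rule measurable_pred_countable(2)[OF cF])
			fix F :: "nat set" assume "F \<in> {F. finite F}"
			hence "countable F" by (simp add: countable_finite)
			hence "Measurable.pred M (%u. ALL i:F. t < x u i)" by (intro measurable_pred_countable(1)) measurable
			thus "Measurable.pred M (%u. card F = Suc j & (ALL i:F. t < x u i))" by simp
		qed
		hence "Measurable.pred M (%u. t < decreasing_rearrangement (x u) j)"
			unfolding less by measurable
		thus "{w \<in> space M. t < decreasing_rearrangement (x w) j} \<in> sets M" by (simp add: pred_def)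
	qed
qed

lemma decreasing_rearrangement_positive:
	assumes pos: "!!i. 0 < x i" and one: "x sums 1"
	shows "decreasing_rearrangement x \<in> Delta" "ranks UNIV x (decreasing_rearrangement x)"
proof -
	have lim: "x \<longlonglongrightarrow> 0" using one by (simp add: sums_iff summable_LIMSEQ_zero)
	have fin: "finite {i. t < x i}" if "0 < t" for t
	proof -
		have "\<forall>\<^sub>F i in sequentially. x i < t" using lim that by (rule order_tendstoD)
		then obtain N where "ALL i>=N. x i < t" by (auto simp: eventually_sequentially)
		hence "{i. t < x i} <= {..<N}" by (auto simp: not_less[symmetric])
		thus ?thesis by (rule finite_subset) simp
	qed
	obtain y sgm where y: "decseq y" "bij sgm" "y = x \<circ> sgm"
		using decseq_rearrangement_exists[of x] fin pos by blast
	\<comment> \<open>A series of nonnegative terms converges unconditionally, so its sum survives the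
	  rearrangement.\<close>
	have "(x has_sum 1) UNIV" using one pos by (intro sums_nonneg_imp_has_sum) (auto intro: less_imp_le)
	hence "(y has_sum 1) UNIV" unfolding y(3) comp_def using y(2) has_sum_reindex_bij_betw[of sgm UNIV UNIV x 1] by simp
	hence "y sums 1" by (rule has_sum_imp_sums)
	thus "decreasing_rearrangement x \<in> Delta"
		unfolding decreasing_rearrangementI[OF y] using y pos by (auto simp: Delta_def intro: less_imp_le)
	show "ranks UNIV x (decreasing_rearrangement x)"
		unfolding decreasing_rearrangementI[OF y] ranks_def
	proof (intro conjI allI impI)
		show "0 <= y j" for j using pos y by (simp add: less_imp_le)
		fix t :: real and j assume t: "0 < t"
		show "finite {i \<in> UNIV. t < x i}" using fin[OF t] by simp
		show "t < y j \<longleftrightarrow> j < card {i \<in> UNIV. t < x i}"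
			unfolding decseq_rearrangement_less[OF y]
		proof
			assume "EX F. finite F & card F = Suc j & (ALL i:F. t < x i)"
			then obtain F where "card F = Suc j" "F <= {i \<in> UNIV. t < x i}" by auto
			thus "j < card {i \<in> UNIV. t < x i}" using card_mono[of "{i \<in> UNIV. t < x i}" F] fin[OF t] by simp
		next
			assume "j < card {i \<in> UNIV. t < x i}"
			then obtain F where "F <= {i \<in> UNIV. t < x i}" "card F = Suc j" "finite F"
				using obtain_subset_with_card_n[of "Suc j" "{i \<in> UNIV. t < x i}"] by auto
			thus "EX F. finite F & card F = Suc j & (ALL i:F. t < x i)" by blast
		qed
	qed
qed

section \<open>Uniform permutations and stick breaking\<close>

text \<open>One step of the Chinese restaurant process acting on functions of the cycle type: the
  new element forms a cycle of its own or is inserted at one of the \<open>c\<close> places of a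
  cycle of length \<open>c\<close>.\<close>

definition crp :: "(nat multiset => real) => nat multiset => real" where
	"crp h M = h (add_mset 1 M) + (SUM c:#M. real c * h (add_mset (Suc c) (M - {#c#})))"

text \<open>The mean of \<open>h\<close> over the cycle type of a uniform permutation of
  \<open>k\<close> elements, see \<open>cyc_avg_permutations\<close>. It is defined without
  permutations so that the recursions by insertion and by stick breaking can be compared
  algebraically.\<close>

fun cyc_avg :: "nat => (nat multiset => real) => real" where
	"cyc_avg 0 h = h {#}"
| "cyc_avg (Suc k) h = cyc_avg k (crp h) / real (Suc k)"

lemma cyc_avg_add: "cyc_avg k (%M. g M + h M) = cyc_avg k g + cyc_avg k h"
proof (induction k arbitrary: g h)
	case (Suc k)
	have "crp (%M. g M + h M) = (%M. crp g M + crp h M)"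
		by (rule ext) (simp add: crp_def algebra_simps sum_mset.distrib)
	thus ?case using Suc by (simp add: add_divide_distrib)
qed simp

lemma cyc_avg_cmult: "cyc_avg k (%M. c * h M) = c * cyc_avg k h"
proof (induction k arbitrary: h)
	case (Suc k)
	have "crp (%M. c * h M) = (%M. c * crp h M)"
		by (rule ext) (simp add: crp_def algebra_simps sum_mset_distrib_left)
	thus ?case using Suc by simp
qed simp

text \<open>A distinguished cycle either absorbs the new element or stays as it is while the rest
  makes a step.\<close>

lemma crp_add_mset:
	"crp h (add_mset l M) = crp (%M. h (add_mset l M)) M + real l * h (add_mset (Suc l) M)"
proof -
	have "real c * h (add_mset (Suc c) (add_mset l M - {#c#})) = real c * h (add_mset l (add_mset (Suc c) (M - {#c#})))"
		if "c \<in># M" for c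
	proof -
		have "add_mset l M - {#c#} = add_mset l (M - {#c#})"
			using that by (cases "c = l") (simp_all add: insert_DiffM)
		thus ?thesis by (simp only: add_mset_commute)
	qed
	hence "(SUM c:#M. real c * h (add_mset (Suc c) (add_mset l M - {#c#}))) = (SUM c:#M. real c * h (add_mset l (add_mset (Suc c) (M - {#c#}))))"
		by (intro arg_cong[where f=sum_mset] image_mset_cong) auto
	thus ?thesis by (simp add: crp_def add_mset_commute)
qed

text \<open>In a uniform permutation the cycle of a distinguished element has uniform length, and
  the remainder is again uniform. Here this is derived from the insertion recursion.\<close>

lemma cyc_avg_stick:
	assumes "k > 0"
	shows "cyc_avg k h = (SUM l=1..k. cyc_avg (k - l) (%M. h (add_mset l M))) / real k"
	using assms
proof (induction k arbitrary: h)
	case (Suc k)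
	define a where "a = (%l. cyc_avg (Suc k - l) (%M. h (add_mset l M)))"
	show ?case
	proof (cases "k = 0")
		case True
		thus ?thesis by (simp add: crp_def)
	next
		case False
		have t: "cyc_avg (k - l) (%M. crp h (add_mset l M)) = real (Suc k - l) * a l + real l * a (Suc l)" if l: "l \<in> {1..k}" for l
		proof -
			have "cyc_avg (k - l) (%M. crp h (add_mset l M)) = cyc_avg (k - l) (crp (%M. h (add_mset l M))) + real l * a (Suc l)"
				by (simp only: crp_add_mset cyc_avg_add cyc_avg_cmult a_def diff_Suc_Suc)
			moreover have "Suc k - l = Suc (k - l)" using l by auto
			hence "cyc_avg (k - l) (crp (%M. h (add_mset l M))) = real (Suc k - l) * a l" by (simp add: a_def)
			ultimately show ?thesis by simp
		qed
		\<comment> \<open>Length \<open>l\<close> collects weight \<open>k + 1 - l\<close> from insertions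
		  elsewhere and \<open>l - 1\<close> from the growth of a distinguished cycle of length
		  \<open>l - 1\<close>; together this is \<open>k\<close> for every \<open>l\<close>.\<close>
		have "(SUM l=1..k. real l * a (Suc l)) = (SUM l=2..Suc k. real (l - 1) * a l)"
			by (rule sum.reindex_bij_witness[where i="%l. l - 1" and j=Suc]) auto
		also have "... = (SUM l=1..Suc k. real (l - 1) * a l)"
			by (rule sum.mono_neutral_left) (auto simp: Suc_le_eq)
		finally have s2: "(SUM l=1..k. real l * a (Suc l)) = (SUM l=1..Suc k. real (l - 1) * a l)" .
		have s1: "(SUM l=1..k. real (Suc k - l) * a l) = (SUM l=1..Suc k. real (Suc k - l) * a l)" by simp
		have "(SUM l=1..k. cyc_avg (k - l) (%M. crp h (add_mset l M))) = (SUM l=1..k. real (Suc k - l) * a l + real l * a (Suc l))"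
			by (rule sum.cong) (use t in auto)
		also have "... = (SUM l=1..Suc k. real (Suc k - l) * a l) + (SUM l=1..Suc k. real (l - 1) * a l)"
			by (simp only: sum.distrib s1 s2)
		also have "... = (SUM l=1..Suc k. real k * a l)"
			unfolding sum.distrib[symmetric] by (rule sum.cong) (auto simp: of_nat_diff algebra_simps)
		finally have *: "(SUM l=1..k. cyc_avg (k - l) (%M. crp h (add_mset l M))) = real k * (SUM l=1..Suc k. a l)"
			by (simp only: sum_distrib_left)
		have "cyc_avg (Suc k) h = cyc_avg k (crp h) / real (Suc k)" by simp
		also have "cyc_avg k (crp h) = real k * (SUM l=1..Suc k. a l) / real k" using Suc.IH[of "crp h"] False * by simp
		also have "... = (SUM l=1..Suc k. a l)" using False by simp
		finally show ?thesis by (simp only: a_def)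
	qed
qed simp

subsection \<open>Cycle types of uniform permutations\<close>

definition cyc_type :: "nat => (nat => nat) => nat multiset" where
	"cyc_type k s = image_mset card (mset_set (orbit s ` {..<k}))"

lemma orbit_permutes_eq:
	assumes "s permutes S" "finite S" "y \<in> orbit s x"
	shows "orbit s y = orbit s x"
	using orbit_cyclic_eq3[OF cyclic_on_orbit'[of s x] assms(3)] assms(1,2) by (auto simp: permutation_permutes)

lemma self_in_orbit_permutes: "s permutes S ==> finite S ==> x \<in> orbit s x"
	by (rule permutation_self_in_orbit) (auto simp: permutation_permutes)

text \<open>Composition with this transposition inserts the fixed point \<open>k\<close> into the
  cycle of \<open>b\<close>, directly before \<open>b\<close>.\<close>

lemma orbit_insert:
	fixes k :: nat
	assumes s: "s permutes {..<k}" and b: "b < k"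
	defines "s' == swp k b \<circ> s"
	shows "x < k ==> x ~: orbit s b ==> orbit s' x = orbit s x"
		and "x \<in> orbit s b ==> orbit s' x = insert k (orbit s b)"
		and "orbit s' k = insert k (orbit s b)"
proof -
	have s': "s' permutes {..<Suc k}"
		unfolding s'_def lessThan_Suc using s b
		by (intro permutes_compose permutes_swap_id permutes_subset[OF s]) auto
	have sk: "s k = k" using s by (simp add: permutes_not_in)
	have snk: "s x = k \<longleftrightarrow> x = k" for x using permutes_inj[OF s] sk by (metis injD)
	have val: "s' x = (if x = k then b else if s x = b then k else s x)" for x
		using snk[of x] sk by (auto simp: s'_def Transposition.transpose_def)
	have self: "x \<in> orbit s x" for x by (rule self_in_orbit_permutes[OF s]) simp
	have obk: "orbit s b <= {..<k}" using permutes_orbit_subset[OF s] b by simp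
	show "orbit s' x = orbit s x" if x: "x < k" "x ~: orbit s b" for x
	proof -
		have "s' y = s y" if y: "y \<in> orbit s x" for y
		proof -
			have "orbit s y = orbit s x" using orbit_permutes_eq[OF s _ y] by simp
			moreover have "y ~= k" using y permutes_orbit_subset[OF s, of x] x by auto
			moreover have "s y ~= b"
			proof
				assume "s y = b"
				hence "b \<in> orbit s y" using orbit.base[of s y] by simp
				hence "orbit s b = orbit s x" using orbit_permutes_eq[OF s, of b y] \<open>orbit s y = orbit s x\<close> by simp
				thus False using x self[of x] by simp
			qed
			ultimately show ?thesis by (simp add: val)
		qed
		thus ?thesis using self[of x] by (intro orbit_cong0[of x "orbit s x", symmetric, THEN sym]) (auto intro: orbit.step)
	qed
	have ok: "orbit s' k = insert k (orbit s b)"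
	proof
		show "orbit s' k <= insert k (orbit s b)"
		proof
			fix y assume "y \<in> orbit s' k"
			thus "y \<in> insert k (orbit s b)"
			proof induction
				case base thus ?case using self[of b] by (simp add: val)
			next
				case (step y) thus ?case using self[of b] by (auto simp: val intro: orbit.step)
			qed
		qed
		have bk: "b \<in> orbit s' k" using orbit.base[of s' k] by (simp add: val)
		have kk: "k \<in> orbit s' k" by (rule self_in_orbit_permutes[OF s']) simp
		have "y \<in> orbit s' k" if "y \<in> orbit s b" for y
			using that
		proof induction
			case base
			show ?case
			proof (cases "s b = b")
				case False
				hence "s' b = s b" using b by (simp add: val)
				thus ?thesis using orbit.step[OF bk] by simp
			qed (simp add: bk)
		next
			case (step y)
			have "y ~= k" using step obk by auto
			hence "s y = b | s' y = s y" unfolding val by simp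
			thus ?case
			proof
				assume "s y = b"
				thus ?thesis using bk by (simp only:)
			next
				assume "s' y = s y"
				thus ?thesis using orbit.step[OF step.IH] by (simp only:)
			qed
		qed
		thus "insert k (orbit s b) <= orbit s' k" using kk by auto
	qed
	thus "orbit s' k = insert k (orbit s b)" .
	show "orbit s' x = insert k (orbit s b)" if "x \<in> orbit s b" for x
		using orbit_permutes_eq[OF s', of x k] ok that by auto
qed

lemma sum_orbits:
	fixes ph :: "'a set => real"
	assumes s: "s permutes S" "finite S"
	shows "(SUM b:S. ph (orbit s b)) = (SUM C:orbit s ` S. real (card C) * ph C)"
proof -
	have "(SUM b:S. ph (orbit s b)) = (SUM C:orbit s ` S. SUM b | b \<in> S & orbit s b = C. ph (orbit s b))"
		using s by (rule_tac sum.image_gen) simp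
	also have "... = (SUM C:orbit s ` S. real (card C) * ph C)"
	proof (rule sum.cong)
		fix C assume "C \<in> orbit s ` S"
		then obtain a where a: "a \<in> S" "C = orbit s a" by blast
		have "{b. b \<in> S & orbit s b = C} = C"
			using a permutes_orbit_subset[OF s(1) a(1)] orbit_permutes_eq[OF s] self_in_orbit_permutes[OF s] by auto
		moreover have "(SUM b | b \<in> S & orbit s b = C. ph (orbit s b)) = (SUM b | b \<in> S & orbit s b = C. ph C)"
			by (rule sum.cong) auto
		ultimately show "(SUM b | b \<in> S & orbit s b = C. ph (orbit s b)) = real (card C) * ph C" by simp
	qed simp
	finally show ?thesis .
qed

text \<open>A cycle \<open>C\<close> offers \<open>card C\<close> places for the new element, one
  for each \<open>b\<close> in it, and \<open>b = k\<close> leaves the new element fixed; this is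
  the recursion \<open>crp\<close>.\<close>

lemma cyc_type_insert:
	fixes h :: "nat multiset => real"
	assumes s: "s permutes {..<k}"
	shows "(SUM b:insert k {..<k}. h (cyc_type (Suc k) (swp k b \<circ> s))) = crp h (cyc_type k s)"
proof -
	define Os where "Os = orbit s ` {..<k}"
	have fOs: "finite Os" by (simp add: Os_def)
	have sk: "s k = k" using s by (simp add: permutes_not_in)
	have obk: "orbit s b <= {..<k}" if "b < k" for b using permutes_orbit_subset[OF s] that by simp
	have kO: "C <= {..<k}" if "C \<in> Os" for C using that obk unfolding Os_def by fastforce
	have "orbit s k = {k}" using sk by (simp add: orbit_eq_singleton_iff)
	hence "orbit s ` {..<Suc k} = insert {k} Os" by (simp add: Os_def lessThan_Suc)
	moreover have "{k} ~: Os" using kO by auto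
	ultimately have e1: "cyc_type (Suc k) (swp k k \<circ> s) = add_mset 1 (cyc_type k s)"
		using fOs by (simp add: cyc_type_def Os_def)
	have e2: "cyc_type (Suc k) (swp k b \<circ> s) = add_mset (Suc (card (orbit s b))) (cyc_type k s - {#card (orbit s b)#})"
		if b: "b < k" for b
	proof -
		define B where "B = orbit s b"
		have BO: "B \<in> Os" using b by (auto simp: B_def Os_def)
		have "orbit (swp k b \<circ> s) x = (if x = k | x \<in> B then insert k B else orbit s x)" if "x < Suc k" for x
			using orbit_insert[OF s b] that unfolding B_def by (auto simp: less_Suc_eq)
		hence "orbit (swp k b \<circ> s) ` {..<Suc k} = (%x. if x = k | x \<in> B then insert k B else orbit s x) ` {..<Suc k}"
			by (intro image_cong) auto
		also have "... = insert (insert k B) (orbit s ` ({..<k} - B))"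
			using obk[OF b] b by (auto simp: B_def less_Suc_eq image_iff)
		also have "orbit s ` ({..<k} - B) = Os - {B}"
		proof -
			have "orbit s x = B \<longleftrightarrow> x \<in> B" if "x < k" for x
				using orbit_permutes_eq[OF s, of x b] self_in_orbit_permutes[OF s, of x] unfolding B_def by auto
			thus ?thesis unfolding Os_def by auto
		qed
		finally have im: "orbit (swp k b \<circ> s) ` {..<Suc k} = insert (insert k B) (Os - {B})" .
		have nin: "insert k B ~: Os - {B}" using kO by auto
		have cB: "card (insert k B) = Suc (card B)" using kO[OF BO] by (subst card_insert_disjoint) (auto intro: finite_subset)
		have "mset_set Os = add_mset B (mset_set (Os - {B}))" using BO fOs by (rule mset_set.remove[rotated])
		hence "cyc_type k s = add_mset (card B) (image_mset card (mset_set (Os - {B})))" by (simp add: cyc_type_def Os_def)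
		moreover have "cyc_type (Suc k) (swp k b \<circ> s) = add_mset (Suc (card B)) (image_mset card (mset_set (Os - {B})))"
			unfolding cyc_type_def im using nin fOs cB by simp
		ultimately show ?thesis by (simp add: B_def)
	qed
	have "(SUM b<k. h (add_mset (Suc (card (orbit s b))) (cyc_type k s - {#card (orbit s b)#})))
		= (SUM C:Os. real (card C) * h (add_mset (Suc (card C)) (cyc_type k s - {#card C#})))"
		unfolding Os_def by (rule sum_orbits[OF s]) simp
	also have "... = (SUM c:#cyc_type k s. real c * h (add_mset (Suc c) (cyc_type k s - {#c#})))"
		by (simp add: sum_unfold_sum_mset cyc_type_def Os_def image_mset.compositionality comp_def)
	finally show ?thesis using e1 by (simp add: crp_def e2 cong: sum.cong_simp)
qed

lemma cyc_avg_permutations: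
	"(SUM s | s permutes {..<k}. h (cyc_type k s)) = fact k * cyc_avg k h"
proof (induction k arbitrary: h)
	case 0
	thus ?case by (simp add: cyc_type_def)
next
	case (Suc k)
	have "(SUM s | s permutes {..<Suc k}. h (cyc_type (Suc k) s)) = (SUM b:insert k {..<k}. SUM p | p permutes {..<k}. h (cyc_type (Suc k) (swp k b \<circ> p)))"
		unfolding lessThan_Suc by (rule sum_over_permutations_insert) auto
	also have "... = (SUM p | p permutes {..<k}. SUM b:insert k {..<k}. h (cyc_type (Suc k) (swp k b \<circ> p)))"
		by (rule sum.swap)
	also have "... = (SUM p | p permutes {..<k}. crp h (cyc_type k p))"
		by (rule sum.cong) (use cyc_type_insert in auto)
	also have "... = fact k * cyc_avg k (crp h)" by (rule Suc.IH)
	finally show ?case by simp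
qed

subsection \<open>Discrete stick breaking\<close>

text \<open>For uniform \<open>a\<close> and \<open>k > 0\<close> this is uniform on
  \<open>{1..k}\<close>; \<open>min\<close> treats the endpoint \<open>a = 1\<close> and the empty
  stick \<open>k = 0\<close>.\<close>

definition cut :: "nat => real => nat" where
	"cut k a = min k (Suc (nat \<lfloor>real k * a\<rfloor>))"

text \<open>The discrete sticks as an infinite sequence, padded with 0 once the stick is used up,
  whereas \<open>mseq\<close> collects the nonzero pieces in a multiset. The sequence suits limits,
  the multiset cycle types.\<close>

fun lens :: "nat => (nat => real) => nat => nat" where
	"lens k u 0 = cut k (u 0)"
| "lens k u (Suc i) = lens (k - cut k (u 0)) (%i. u (Suc i)) i"

lemma cut_le: "cut k a <= k" by (simp add: cut_def)
lemma cut_pos: "0 < k ==> 0 < cut k a" by (simp add: cut_def)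
lemma cut_0 [simp]: "cut 0 a = 0" by (simp add: cut_def)

function mseq :: "nat => (nat => real) => nat multiset" where
	"mseq k u = (if k = 0 then {#} else add_mset (cut k (u 0)) (mseq (k - cut k (u 0)) (%i. u (Suc i))))"
	by auto
termination by (relation "Wellfounded.measure fst") (auto simp: cut_pos)

declare mseq.simps [simp del]

lemma mseq_0 [simp]: "mseq 0 u = {#}" by (simp add: mseq.simps)

lemma lens_0 [simp]: "lens 0 u i = 0" by (induction i arbitrary: u) auto

lemma sum_lens_le: "(SUM i<n. lens k u i) <= k"
proof (induction n arbitrary: k u)
	case (Suc n)
	have "(SUM i<Suc n. lens k u i) = cut k (u 0) + (SUM i<n. lens (k - cut k (u 0)) (%i. u (Suc i)) i)"
		by (subst sum.lessThan_Suc_shift) simp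
	also have "... <= cut k (u 0) + (k - cut k (u 0))" by (intro add_left_mono Suc.IH)
	finally show ?case using cut_le[of k "u 0"] by simp
qed simp

lemma sum_mset_mseq: "sum_mset (mseq k u) = k"
proof (induction k u rule: mseq.induct)
	case (1 k u)
	thus ?case using cut_le[of k "u 0"] by (cases "k = 0") (auto simp: mseq.simps[of k u])
qed

lemma lens_mseq:
	assumes "0 <= a"
	shows "finite {i. a < real (lens k u i)} & card {i. a < real (lens k u i)} = size (filter_mset (%c. a < real c) (mseq k u))"
proof (induction k u rule: mseq.induct)
	case (1 k u)
	show ?case
	proof (cases "k = 0")
		case True
		thus ?thesis using assms by simp
	next
		case False
		define A where "A = {i. a < real (lens (k - cut k (u 0)) (%i. u (Suc i)) i)}"
		have IH: "finite A" "card A = size (filter_mset (%c. a < real c) (mseq (k - cut k (u 0)) (%i. u (Suc i))))"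
			using 1[OF False] by (auto simp: A_def)
		have eq: "{i. a < real (lens k u i)} = (if a < real (cut k (u 0)) then insert 0 (Suc ` A) else Suc ` A)"
		proof (rule set_eqI)
			fix i show "i \<in> {i. a < real (lens k u i)} \<longleftrightarrow> i \<in> (if a < real (cut k (u 0)) then insert 0 (Suc ` A) else Suc ` A)"
				by (cases i) (auto simp: A_def)
		qed
		have "card (insert 0 (Suc ` A)) = Suc (card A)" "card (Suc ` A) = card A" using IH(1) by (simp_all add: card_image)
		thus ?thesis unfolding eq using IH False by (simp add: mseq.simps[of k u])
	qed
qed

lemma stick_breaking_0 [simp]: "stick_breaking u 0 = u 0" by (subst stick_breaking.simps) simp

text \<open>Self-similarity after the first break, in the form of the recursion for
  \<open>lens\<close>.\<close>

lemma stick_breaking_Suc: "stick_breaking u (Suc i) = (1 - u 0) * stick_breaking (%i. u (Suc i)) i"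
proof (induction i rule: less_induct)
	case (less i)
	have "(SUM j<Suc i. stick_breaking u j) = u 0 + (SUM j<i. stick_breaking u (Suc j))"
		by (subst sum.lessThan_Suc_shift) simp
	also have "(SUM j<i. stick_breaking u (Suc j)) = (SUM j<i. (1 - u 0) * stick_breaking (%i. u (Suc i)) j)"
		by (rule sum.cong) (use less in auto)
	also have "... = (1 - u 0) * (SUM j<i. stick_breaking (%i. u (Suc i)) j)" by (rule sum_distrib_left[symmetric])
	finally have *: "(SUM j<Suc i. stick_breaking u j) = u 0 + (1 - u 0) * (SUM j<i. stick_breaking (%i. u (Suc i)) j)" .
	show ?case unfolding stick_breaking.simps[of u "Suc i"] stick_breaking.simps[of "%i. u (Suc i)" i] *
		by (simp add: algebra_simps)
qed

lemma stick_breaking_bounds: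
	assumes "!!i. 0 <= u i & u i <= 1" shows "0 <= stick_breaking u i & stick_breaking u i <= 1"
	using assms
proof (induction i arbitrary: u)
	case (Suc i)
	have "0 <= stick_breaking (%i. u (Suc i)) i & stick_breaking (%i. u (Suc i)) i <= 1"
		by (rule Suc.IH) (rule Suc.prems)
	thus ?case using Suc.prems[of 0] by (auto simp: stick_breaking_Suc intro: mult_le_one)
qed simp

lemma cut_approx:
	assumes "0 <= a" "a <= 1" shows "\<bar>real (cut k a) - real k * a\<bar> <= 1"
proof -
	have "real k * a <= real k" using assms mult_left_mono[of a 1 "real k"] by simp
	moreover have "0 <= real k * a" using assms by simp
	moreover have "real (nat \<lfloor>real k * a\<rfloor>) = of_int \<lfloor>real k * a\<rfloor>" using \<open>0 <= real k * a\<close> by simp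
	moreover have "of_int \<lfloor>real k * a\<rfloor> <= real k * a" "real k * a < of_int \<lfloor>real k * a\<rfloor> + 1" by linarith+
	ultimately show ?thesis unfolding cut_def of_nat_min of_nat_Suc by (smt (verit))
qed

text \<open>Each of the first \<open>i + 1\<close> cuts rounds by at most 1, and a rounding error is
  later multiplied only by fractions of at most 1.\<close>

lemma lens_approx:
	assumes "!!i. 0 <= u i & u i <= 1"
	shows "\<bar>real (lens k u i) - real k * stick_breaking u i\<bar> <= real (Suc i)"
	using assms
proof (induction i arbitrary: k u)
	case 0
	thus ?case using cut_approx[of "u 0" k] by simp
next
	case (Suc i)
	define u' where "u' = (%i. u (Suc i))"
	define x where "x = stick_breaking u' i"
	have u': "0 <= u' i & u' i <= 1" for i using Suc.prems by (simp add: u'_def)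
	have x: "0 <= x" "x <= 1" using stick_breaking_bounds[of u' i, OF u'] by (auto simp: x_def)
	define k' where "k' = k - cut k (u 0)"
	have "real k' = real k - real (cut k (u 0))" unfolding k'_def using cut_le[of k "u 0"] by (simp add: of_nat_diff)
	hence k': "\<bar>real k' - real k * (1 - u 0)\<bar> <= 1"
		using cut_approx[of "u 0" k] Suc.prems[of 0] by (simp add: algebra_simps)
	have "\<bar>(real k' - real k * (1 - u 0)) * x\<bar> <= 1 * 1" unfolding abs_mult using k' x by (intro mult_mono) auto
	moreover have "\<bar>real (lens k' u' i) - real k' * x\<bar> <= real (Suc i)" unfolding x_def by (rule Suc.IH) (rule u')
	moreover have "real (lens k u (Suc i)) - real k * stick_breaking u (Suc i) = (real (lens k' u' i) - real k' * x) + (real k' - real k * (1 - u 0)) * x"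
		by (simp add: stick_breaking_Suc k'_def u'_def x_def algebra_simps)
	ultimately show ?case by (simp add: abs_le_iff)
qed

text \<open>An almost sure event on which all sticks are positive and exhaust the unit interval: the
  remainder is at least halved infinitely often.\<close>

definition good_stick :: "(nat => real) => bool" where
	"good_stick u \<longleftrightarrow> (ALL i. 0 < u i & u i < 1) & (ALL N. EX i>=N. 1 / 2 < u i)"

lemma good_stick_props:
	assumes "good_stick u"
	shows "0 < stick_breaking u i" "stick_breaking u sums 1"
proof -
	have u: "0 < u i" "u i < 1" for i using assms by (auto simp: good_stick_def)
	define R where "R = (%i. 1 - (SUM j<i. stick_breaking u j))"
	have R: "R (Suc i) = (1 - u i) * R i" for i
		by (simp add: R_def stick_breaking.simps[of u i] algebra_simps)
	have R0: "R 0 = 1" by (simp add: R_def)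
	have pos: "0 < R i" for i by (induction i) (use u R R0 in auto)
	show "0 < stick_breaking u i" for i using u pos[of i] by (simp add: stick_breaking.simps[of u i] R_def)
	have dec: "decseq R"
	proof (rule decseq_SucI)
		fix i show "R (Suc i) <= R i" unfolding R using u[of i] pos[of i] by (simp add: algebra_simps)
	qed
	have "ALL i. 0 <= R i" using pos by (auto intro: less_imp_le)
	then obtain L where "R \<longlonglongrightarrow> L" "ALL i. L <= R i" by (rule decseq_convergent[OF dec])
	hence L: "R \<longlonglongrightarrow> L" "!!i. L <= R i" by auto
	have L0: "0 <= L" using L(1) pos by (intro LIMSEQ_le_const) (auto intro: less_imp_le)
	have "L <= 0"
	proof (rule ccontr)
		assume "~ L <= 0"
		hence "\<forall>\<^sub>F i in sequentially. R i < 2 * L" using L(1) by (intro order_tendstoD(2)[of R L]) auto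
		then obtain N where N: "!!i. i >= N ==> R i < 2 * L" by (auto simp: eventually_sequentially)
		obtain i where i: "i >= N" "1 / 2 < u i" using assms by (auto simp: good_stick_def)
		have "R (Suc i) <= 1 / 2 * R i" unfolding R using i pos[of i] by (intro mult_right_mono) auto
		thus False using N[OF i(1)] L(2)[of "Suc i"] by linarith
	qed
	hence "R \<longlonglongrightarrow> 0" using L L0 by simp
	hence "(%i. 1 - R i) \<longlonglongrightarrow> 1 - 0" by (intro tendsto_intros)
	thus "stick_breaking u sums 1" by (simp add: sums_def R_def)
qed

text \<open>Finitely many sticks carry nearly all the mass. For these \<open>lens_approx\<close>
  applies, and beyond them both sequences are small because both have total at most 1.\<close>

lemma lens_uniform:
	assumes "good_stick u" "0 < e"
	shows "\<forall>\<^sub>F k in sequentially. ALL i. \<bar>real (lens k u i) / real k - stick_breaking u i\<bar> <= e"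
proof -
	note gs = good_stick_props[OF assms(1)]
	have u01: "0 <= u i & u i <= 1" for i using assms(1) by (auto simp: good_stick_def less_imp_le)
	have "\<forall>\<^sub>F n in sequentially. 1 - e / 2 < (SUM i<n. stick_breaking u i)"
		using gs(2) assms(2) unfolding sums_def by (intro order_tendstoD(1)[of _ 1]) auto
	then obtain n where n: "1 - e / 2 < (SUM i<n. stick_breaking u i)" by (auto simp: eventually_sequentially)
	have "\<forall>\<^sub>F k in sequentially. real n * real (Suc n) / real k <= e / 2" using assms(2) by real_asymp
	moreover have "\<forall>\<^sub>F k in sequentially. real (Suc n) / real k <= e" using assms(2) by real_asymp
	moreover have "\<forall>\<^sub>F k in sequentially. 0 < (k::nat)" by (rule eventually_gt_at_top)
	ultimately show ?thesis
	proof eventually_elim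
		case (elim k)
		have ap: "\<bar>real (lens k u i) / real k - stick_breaking u i\<bar> <= real (Suc n) / real k" if "i < n" for i
		proof -
			have "\<bar>real (lens k u i) / real k - stick_breaking u i\<bar> = \<bar>real (lens k u i) - real k * stick_breaking u i\<bar> / real k"
			proof -
				have "real (lens k u i) / real k - stick_breaking u i = (real (lens k u i) - real k * stick_breaking u i) / real k"
					using elim by (simp add: field_simps)
				thus ?thesis by (simp only: abs_divide abs_of_nat)
			qed
			also have "... <= real (Suc n) / real k" using lens_approx[of u k i, OF u01] that by (intro divide_right_mono) auto
			finally show ?thesis .
		qed
		show ?case
		proof
			fix i
			show "\<bar>real (lens k u i) / real k - stick_breaking u i\<bar> <= e"
			proof (cases "i < n")
				case True
				thus ?thesis using ap elim by fastforce
			next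
				case False
				have le1: "(SUM j<n. f j) + f i <= 1" if "!!j. 0 <= f j" "(SUM j<Suc i. f j) <= 1" for f :: "nat => real"
				proof -
					have "(SUM j<n. f j) + f i = (SUM j:insert i {..<n}. f j)" using False by simp
					also have "... <= (SUM j<Suc i. f j)" using False that by (intro sum_mono2) auto
					finally show ?thesis using that by simp
				qed
				have "(SUM j<n. stick_breaking u j) + stick_breaking u i <= 1"
				proof (rule le1)
					have "(SUM j<Suc i. stick_breaking u j) <= suminf (stick_breaking u)"
						using gs by (intro sum_le_suminf) (auto simp: sums_iff intro: less_imp_le)
					thus "(SUM j<Suc i. stick_breaking u j) <= 1" using gs by (simp add: sums_iff)
				qed (use gs in "auto intro: less_imp_le")
				moreover have "(SUM j<n. real (lens k u j) / real k) + real (lens k u i) / real k <= 1"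
				proof (rule le1)
					have "real (SUM j<Suc i. lens k u j) <= real k" using sum_lens_le by (simp only: of_nat_le_iff)
					thus "(SUM j<Suc i. real (lens k u j) / real k) <= 1"
						unfolding sum_divide_distrib[symmetric] using elim by (simp add: divide_le_eq)
				qed simp
				moreover have "(SUM j<n. stick_breaking u j) - (SUM j<n. real (lens k u j) / real k) <= real n * (real (Suc n) / real k)"
				proof -
					have "(SUM j<n. stick_breaking u j) - (SUM j<n. real (lens k u j) / real k) = (SUM j<n. stick_breaking u j - real (lens k u j) / real k)"
						by (simp add: sum_subtractf)
					also have "... <= (SUM j<n. real (Suc n) / real k)" using ap by (intro sum_mono) (auto simp: abs_le_iff)
					finally show ?thesis by simp
				qed
				moreover have "real n * (real (Suc n) / real k) <= e / 2" using elim(1) by (simp only: times_divide_eq_right)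
				moreover have "0 <= real (lens k u i) / real k" by simp
				ultimately show ?thesis unfolding abs_le_iff using n gs(1)[of i] by linarith
			qed
		qed
	qed
qed

lemma sortd_Delta:
	assumes "!!x. x \<in># A ==> 0 <= x" "sum_mset A = 1"
	shows "sortd A \<in> Delta"
proof -
	define ls where "ls = rev (sorted_list_of_multiset A)"
	have e: "sortd A = (%j. if j < length ls then ls ! j else 0)" by (simp only: sortd_def ls_def Let_def)
	have nn: "0 <= sortd A j" for j by (rule sortd_nonneg) (rule assms)
	have "sum_list ls = 1" using assms(2) by (simp add: ls_def flip: sum_mset_sum_list)
	have "sortd A sums (SUM j<length ls. sortd A j)" by (rule sums_finite) (auto simp: e)
	also have "(SUM j<length ls. sortd A j) = (SUM j<length ls. ls ! j)" by (rule sum.cong) (auto simp: e)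
	also have "... = 1" using \<open>sum_list ls = 1\<close> by (simp add: sum_list_sum_nth atLeast0LessThan)
	finally have "sortd A sums 1" .
	moreover have "decseq (sortd A)"
	proof (rule decseq_SucI, rule ccontr)
		fix j assume "~ sortd A (Suc j) <= sortd A j"
		thus False using sortd_less[OF nn[of j], of A j] sortd_less[OF nn[of j], of A "Suc j"] by auto
	qed
	ultimately show ?thesis using nn by (auto simp: Delta_def)
qed

definition scaled :: "nat => nat multiset => nat => real" where
	"scaled k M = sortd (image_mset (%c. real c / real k) M)"

lemma scaled_mseq:
	assumes "0 < k"
	shows "scaled k (mseq k u) \<in> Delta" "ranks UNIV (%i. real (lens k u i) / real k) (scaled k (mseq k u))"
proof -
	show "scaled k (mseq k u) \<in> Delta"
		unfolding scaled_def
	proof (rule sortd_Delta)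
		have "(SUM c:#M. real c / real k) = real (sum_mset M) / real k" for M
			by (induction M) (auto simp: add_divide_distrib)
		thus "sum_mset (image_mset (%c. real c / real k) (mseq k u)) = 1" using assms by (simp only: sum_mset_mseq) simp
	qed auto
	show "ranks UNIV (%i. real (lens k u i) / real k) (scaled k (mseq k u))"
		unfolding scaled_def
	proof (rule ranks_sortd)
		fix t :: real assume t: "0 < t"
		have e: "t < real c / real k \<longleftrightarrow> t * real k < real c" for c using assms by (simp add: less_divide_eq)
		show "finite {i \<in> UNIV. t < real (lens k u i) / real k} & card {i \<in> UNIV. t < real (lens k u i) / real k}
			= size (filter_mset (%x. t < x) (image_mset (%c. real c / real k) (mseq k u)))"
			using lens_mseq[of "t * real k" k u] t by (simp add: filter_mset_image_mset e)
	qed auto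
qed

lemma scaled_mseq_tendsto:
	assumes "good_stick u"
	shows "(%k. scaled k (mseq k u)) \<longlonglongrightarrow> decreasing_rearrangement (stick_breaking u)"
proof -
	note gs = good_stick_props[OF assms]
	define y where "y = decreasing_rearrangement (stick_breaking u)"
	have y: "ranks UNIV (stick_breaking u) y" unfolding y_def by (rule decreasing_rearrangement_positive(2)[OF gs])
	have "(%k. scaled k (mseq k u) j) \<longlonglongrightarrow> y j" for j
	proof (rule tendstoI)
		fix e :: real assume e: "0 < e"
		have "\<forall>\<^sub>F k in sequentially. 0 < (k::nat)" by (rule eventually_gt_at_top)
		moreover have "\<forall>\<^sub>F k in sequentially. ALL i. \<bar>real (lens k u i) / real k - stick_breaking u i\<bar> <= e / 2"
			by (rule lens_uniform[OF assms]) (use e in simp)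
		ultimately show "\<forall>\<^sub>F k in sequentially. dist (scaled k (mseq k u) j) (y j) < e"
		proof eventually_elim
			case (elim k)
			have "\<bar>scaled k (mseq k u) j - y j\<bar> <= e / 2"
				by (rule ranks_lipschitz[OF scaled_mseq(2)[OF elim(1)] y]) (use elim e in auto)
			thus ?case using e by (simp add: dist_real_def)
		qed
	qed
	hence "limitin (product_topology (%_. euclidean) UNIV) (%k. scaled k (mseq k u)) y sequentially"
		by (subst limitin_componentwise) auto
	thus ?thesis unfolding y_def[symmetric] euclidean_product_topology limitin_canonical_iff .
qed

section \<open>Random sticks and the law \<open>PD1\<close>\<close>

abbreviation unif :: "real measure" where "unif == uniform_measure lborel {0..1}"
abbreviation unifs :: "(nat => real) measure" where "unifs == \<Pi>\<^sub>M i\<in>UNIV. unif"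

lemma prob_space_unif: "prob_space unif"
	by (intro prob_space_uniform_measure) auto

interpretation unif: prob_space unif by (rule prob_space_unif)

interpretation sticks: sequence_space unif
	by unfold_locales

lemma measure_unif: "B \<in> sets borel ==> measure unif B = measure lborel ({0..1} \<inter> B)"
	by (subst measure_uniform_measure) auto

lemma prob_between:
	assumes B: "B \<in> sets borel" "{a<..<b} <= B" "{0..1} \<inter> B <= {a..b}" and ab: "0 <= a" "a <= b" "b <= 1"
	shows "measure unif B = b - a"
proof -
	have "measure lborel ({0..1} \<inter> B) <= measure lborel {a..b}"
		using assms by (intro measure_mono_fmeasurable) (auto simp: fmeasurable_def)
	moreover have "measure lborel {a<..<b} <= measure lborel ({0..1} \<inter> B)"
	proof (rule measure_mono_fmeasurable)
		show "{a<..<b} <= {0..1} \<inter> B" using B(2) ab by auto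
		have "emeasure lborel ({0..1} \<inter> B) <= emeasure lborel {0..1::real}" by (intro emeasure_mono) auto
		also have "... < \<infinity>" by simp
		finally show "{0..1} \<inter> B \<in> fmeasurable lborel" using B by (auto simp: fmeasurable_def)
	qed auto
	ultimately show ?thesis using ab by (simp add: measure_unif[OF B(1)])
qed

lemma cut_measurable [measurable]: "cut k \<in> measurable borel (count_space UNIV)"
	unfolding cut_def by measurable

lemma prob_cut:
	assumes "1 <= l" "l <= k"
	shows "measure unif {a. cut k a = l} = 1 / real k"
proof -
	have k: "0 < real k" using assms by simp
	have "measure unif {a. cut k a = l} = real l / real k - real (l - 1) / real k"
	proof (rule prob_between)
		show "{a. cut k a = l} \<in> sets borel" using measurable_sets[OF cut_measurable, of "{l}" k] by (simp add: vimage_def)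
		show "{real (l - 1) / real k<..<real l / real k} <= {a. cut k a = l}"
		proof
			fix a assume "a \<in> {real (l - 1) / real k<..<real l / real k}"
			hence a: "real (l - 1) < real k * a" "real k * a < real l"
				using k by (auto simp: divide_less_eq less_divide_eq mult.commute)
			hence "\<lfloor>real k * a\<rfloor> = int (l - 1)" using assms by (intro floor_unique) (auto simp: of_nat_diff)
			thus "a \<in> {a. cut k a = l}" using assms by (simp add: cut_def)
		qed
		show "{0..1} \<inter> {a. cut k a = l} <= {real (l - 1) / real k..real l / real k}"
		proof
			fix a assume a: "a \<in> {0..1} \<inter> {a. cut k a = l}"
			hence ka: "0 <= real k * a" "real k * a <= real k" using k mult_left_mono[of a 1 "real k"] by auto
			define j where "j = nat \<lfloor>real k * a\<rfloor>"
			have j: "real j <= real k * a" "real k * a < real j + 1" using ka(1) unfolding j_def by simp_all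
			have "l = min k (Suc j)" using a by (simp add: cut_def j_def)
			hence "real (l - 1) <= real k * a" "real k * a <= real l" using j ka(2) assms by (auto simp: min_def split: if_splits)
			thus "a \<in> {real (l - 1) / real k..real l / real k}" using k by (auto simp: divide_le_eq le_divide_eq mult.commute)
		qed
	qed (use assms in "auto simp: divide_right_mono")
	also have "... = 1 / real k" using assms by (simp add: of_nat_diff diff_divide_distrib)
	finally show ?thesis .
qed

lemma integral_cut:
	fixes ph :: "nat => real"
	assumes "0 < k"
	shows "(\<integral>a. ph (cut k a) \<partial>unif) = (SUM l=1..k. ph l) / real k"
proof -
	have A [measurable]: "{a. cut k a = l} \<in> sets borel" for l
		using measurable_sets[OF cut_measurable, of "{l}" k] by (simp add: vimage_def)
	have "ph (cut k a) = (SUM l=1..k. ph l * indicator {a. cut k a = l} a)" for a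
	proof -
		have "cut k a \<in> {1..k}" using cut_pos[OF assms, of a] cut_le[of k a] by auto
		moreover have "(SUM l=1..k. ph l * indicator {a. cut k a = l} a) = (SUM l=1..k. if cut k a = l then ph l else 0)"
			by (rule sum.cong) (auto simp: indicator_def)
		ultimately show ?thesis by simp
	qed
	hence "(\<integral>a. ph (cut k a) \<partial>unif) = (\<integral>a. (SUM l=1..k. ph l * indicator {a. cut k a = l} a) \<partial>unif)" by simp
	also have "... = (SUM l=1..k. \<integral>a. ph l * indicator {a. cut k a = l} a \<partial>unif)"
		by (intro Bochner_Integration.integral_sum) (auto simp: unif.emeasure_eq_measure)
	also have "... = (SUM l=1..k. ph l * (1 / real k))"
		by (rule sum.cong) (auto simp: prob_cut simp del: measure_uniform_measure)
	finally show ?thesis by (simp add: sum_divide_distrib)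
qed

lemma unifs_coord [measurable]: "(%u. u i) \<in> borel_measurable unifs"
proof -
	have "(%u. u i) \<in> measurable unifs unif" by (rule measurable_component_singleton) simp
	thus ?thesis by simp
qed

lemma unifs_shift [measurable]: "(%u i. u (Suc i)) \<in> measurable unifs unifs"
proof (rule measurable_PiM_single')
	fix i :: nat
	show "(%u. u (Suc i)) \<in> measurable unifs unif" by (rule measurable_component_singleton) simp
qed (auto simp: space_PiM)

lemma mseq_measurable [measurable]: "(%u. mseq k u) \<in> measurable unifs (count_space UNIV)"
proof (induction k rule: less_induct)
	case (less k)
	show ?case
	proof (cases "k = 0")
		case False
		have "(%u. (%l u. add_mset l (mseq (k - l) (%i. u (Suc i)))) (cut k (u 0)) u) \<in> measurable unifs (count_space UNIV)"
		proof (rule measurable_compose_countable'[where I="{1..k}" and f="%l u. add_mset l (mseq (k - l) (%i. u (Suc i)))"])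
			fix l assume l: "l \<in> {1..k}"
			hence [measurable]: "(%u. mseq (k - l) u) \<in> measurable unifs (count_space UNIV)" using less by simp
			show "(%u. add_mset l (mseq (k - l) (%i. u (Suc i)))) \<in> measurable unifs (count_space UNIV)"
				by (rule measurable_compose[OF measurable_compose[OF unifs_shift]]) measurable
		next
			have "(%u. cut k (u 0)) \<in> measurable unifs (count_space UNIV)" by measurable
			moreover have "cut k (u 0) \<in> {1..k}" for u :: "nat => real" using cut_pos[of k "u 0"] cut_le[of k "u 0"] False by auto
			ultimately show "(%u. cut k (u 0)) \<in> measurable unifs (count_space {1..k})"
				by (simp add: measurable_count_space_eq2_countable measurable_count_space_eq2 Pi_def)
		qed simp
		thus ?thesis using False by (simp add: mseq.simps[of k])
	qed simp
qed

text \<open>Splitting off the first coordinate of the product measure and evaluating it with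
  \<open>integral_cut\<close> reproduces the recursion \<open>cyc_avg_stick\<close>.\<close>

lemma integral_mseq:
	fixes h :: "nat multiset => real"
	assumes B: "!!M. \<bar>h M\<bar> <= B"
	shows "(\<integral>u. h (mseq k u) \<partial>unifs) = cyc_avg k h"
	using B
proof (induction k arbitrary: h rule: less_induct)
	case (less k)
	show ?case
	proof (cases "k = 0")
		case True
		thus ?thesis by (simp add: sticks.P.prob_space)
	next
		case False
		have hm: "(%u. h (mseq k u)) \<in> borel_measurable unifs"
			by (rule measurable_compose[OF mseq_measurable]) simp
		have PP: "prob_space (unif \<Otimes>\<^sub>M unifs)" by (intro prob_space_pair prob_space_unif sticks.P.prob_space_axioms)
		interpret PP: pair_prob_space unif unifs ..
		have cm [measurable]: "(%(s, \<omega>). case_nat s \<omega>) \<in> measurable (unif \<Otimes>\<^sub>M unifs) unifs" by measurable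
		have "(\<integral>u. h (mseq k u) \<partial>unifs) = (\<integral>u. h (mseq k u) \<partial>distr (unif \<Otimes>\<^sub>M unifs) unifs (%(s, \<omega>). case_nat s \<omega>))"
			by (simp only: sticks.PiM_iter)
		also have "... = (\<integral>p. h (mseq k (case p of (s, \<omega>) => case_nat s \<omega>)) \<partial>(unif \<Otimes>\<^sub>M unifs))"
			by (rule integral_distr[OF cm hm])
		also have "... = (\<integral>a. (\<integral>\<omega>. h (mseq k (case_nat a \<omega>)) \<partial>unifs) \<partial>unif)"
		proof (subst PP.integral_fst'[symmetric])
			have "(%p. h (mseq k (case p of (s, \<omega>) => case_nat s \<omega>))) \<in> borel_measurable (unif \<Otimes>\<^sub>M unifs)"
				by (rule measurable_compose[OF cm hm])
			thus "integrable (unif \<Otimes>\<^sub>M unifs) (%p. h (mseq k (case p of (s, \<omega>) => case_nat s \<omega>)))"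
				by (rule PP.P.integrable_const_bound[of _ B, rotated]) (use less.prems in auto)
		qed simp
		also have "... = (\<integral>a. (%l. \<integral>\<omega>. h (add_mset l (mseq (k - l) \<omega>)) \<partial>unifs) (cut k a) \<partial>unif)"
			using False by (simp add: mseq.simps[of k])
		also have "... = (SUM l=1..k. \<integral>\<omega>. h (add_mset l (mseq (k - l) \<omega>)) \<partial>unifs) / real k"
			using False by (intro integral_cut) simp
		also have "... = (SUM l=1..k. cyc_avg (k - l) (%M. h (add_mset l M))) / real k"
		proof (intro arg_cong2[where f="(/)"] sum.cong refl)
			fix l assume l: "l \<in> {1..k}"
			show "(\<integral>\<omega>. h (add_mset l (mseq (k - l) \<omega>)) \<partial>unifs) = cyc_avg (k - l) (%M. h (add_mset l M))"
				by (rule less.IH[where h="%M. h (add_mset l M)"]) (use l less.prems in auto)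
		qed
		also have "... = cyc_avg k h" using False by (intro cyc_avg_stick[symmetric]) simp
		finally show ?thesis .
	qed
qed

lemma AE_good_stick: "AE u in unifs. good_stick u"
proof -
	have "AE a in unif. 0 < a & a < (1::real)"
	proof (rule AE_uniform_measureI)
		have "AE a in lborel. a ~= (0::real)" "AE a in lborel. a ~= (1::real)" by (rule AE_lborel_singleton)+
		thus "AE a in lborel. a \<in> {0..1} --> 0 < a & a < (1::real)" by eventually_elim auto
	qed simp
	hence "AE u in unifs. 0 < u i & u i < 1" for i by (intro sticks.AE_component) auto
	hence 1: "AE u in unifs. ALL i. 0 < u i & u i < 1" by (simp add: AE_all_countable)
	have "AE u in unifs. EX i>=N. 1 / 2 < u i" for N
	proof (rule AE_I)
		define A where "A = {u \<in> space unifs. ~ (EX i>=N. 1 / 2 < u i)}"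
		show "{u \<in> space unifs. ~ (EX i>=N. 1 / 2 < u i)} <= A" by (simp add: A_def)
		show A: "A \<in> sets unifs" unfolding A_def by measurable
		have half: "measure unif {..1/2} = 1 / 2"
			using prob_between[of "{..1/2}" 0 "1/2"] by (auto simp: measure_unif)
		\<comment> \<open>\<open>A\<close> forces the \<open>n\<close> coordinates from \<open>N\<close>
		  on to be at most 1/2.\<close>
		have "measure unifs A <= (1 / 2) ^ n" for n
		proof -
			have "emeasure unifs A <= emeasure unifs {u \<in> space unifs. ALL i:{N..<N+n}. u i \<in> {..1/2}}"
				by (rule emeasure_mono) (auto simp: A_def not_less)
			also have "... = (PROD i:{N..<N+n}. emeasure unif {..1/2})"
				by (rule sticks.emeasure_PiM_Collect) auto
			also have "... = ennreal ((1 / 2) ^ n)" unfolding unif.emeasure_eq_measure half prod_constant by (subst ennreal_power) simp_all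
			finally show ?thesis by (simp add: sticks.P.emeasure_eq_measure)
		qed
		moreover have "(%n. (1 / 2 :: real) ^ n) \<longlonglongrightarrow> 0" by (rule LIMSEQ_realpow_zero) auto
		ultimately have "measure unifs A <= 0" by (intro LIMSEQ_le_const[of _ 0]) auto
		thus "emeasure unifs A = 0" by (simp add: sticks.P.emeasure_eq_measure measure_le_0_iff)
	qed
	hence "AE u in unifs. ALL N. EX i>=N. 1 / 2 < u i" by (simp add: AE_all_countable)
	thus ?thesis using 1 unfolding good_stick_def by eventually_elim blast
qed

lemma Delta_borel: "Delta \<in> sets borel"
proof -
	have c: "continuous_on UNIV (%y::nat => real. y i)" for i by (rule continuous_on_product_coordinates)
	\<comment> \<open>Convergence is expressed with countably many tolerances, so that only countable
	  quantifiers remain.\<close>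
	have s: "y sums 1 \<longleftrightarrow> (ALL n. EX N. ALL k>=N. \<bar>(SUM i<k. y i) - 1\<bar> < 1 / real (Suc n))" for y :: "nat => real"
	proof
		assume "y sums 1"
		thus "ALL n. EX N. ALL k>=N. \<bar>(SUM i<k. y i) - 1\<bar> < 1 / real (Suc n)"
			unfolding sums_def LIMSEQ_def dist_real_def by simp
	next
		assume *: "ALL n. EX N. ALL k>=N. \<bar>(SUM i<k. y i) - 1\<bar> < 1 / real (Suc n)"
		show "y sums 1" unfolding sums_def LIMSEQ_def dist_real_def
		proof (intro allI impI)
			fix e :: real assume "0 < e"
			then obtain n where n: "1 / real (Suc n) < e" by (rule nat_approx_posE)
			obtain N where "ALL k>=N. \<bar>(SUM i<k. y i) - 1\<bar> < 1 / real (Suc n)" using * by blast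
			thus "EX N. ALL k>=N. \<bar>(SUM i<k. y i) - 1\<bar> < e" using n by (intro exI[of _ N]) (auto intro: less_trans)
		qed
	qed
	have "Delta = {y \<in> space borel. (ALL i. 0 <= y i) & (ALL n. EX N. ALL k>=N. \<bar>(SUM i<k. y i) - 1\<bar> < 1 / real (Suc n)) & (ALL i. y (Suc i) <= y i)}"
		unfolding Delta_def s decseq_Suc_iff by simp
	also have "... \<in> sets borel"
	proof -
		show ?thesis
			unfolding pred_def[symmetric]
		proof (intro pred_intros_logic pred_intros_countable)
			have "closed {y::nat => real. 0 <= y i}" for i by (intro closed_Collect_le continuous_on_const c)
			from borel_closed[OF this] show "Measurable.pred borel (%y::nat => real. 0 <= y i)" for i by (simp add: pred_def)
			have "closed {y::nat => real. y (Suc i) <= y i}" for i by (intro closed_Collect_le c)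
			from borel_closed[OF this] show "Measurable.pred borel (%y::nat => real. y (Suc i) <= y i)" for i by (simp add: pred_def)
			have "open {y::nat => real. \<bar>sum y {..<k} - 1\<bar> < 1 / real (Suc n)}" for k n
				by (intro open_Collect_less continuous_on_const continuous_on_rabs continuous_on_diff continuous_on_sum c)
			from borel_open[OF this] show "Measurable.pred borel (%y::nat => real. \<bar>sum y {..<k} - 1\<bar> < 1 / real (Suc n))" for k n
				by (simp add: pred_def)
		qed auto
	qed
	finally show ?thesis .
qed

text \<open>The maps behind \<open>PD1\<close> and \<open>cycle_structure_law\<close> take values in
  \<open>Delta\<close> only almost surely, so they are compared with versions that do so everywhere,
  through the preimages of measurable sets.\<close>

lemma distr_AE_cong:
	assumes g: "g \<in> measurable M (restrict_space N A)" and f: "f \<in> measurable M N" and A: "A \<in> sets N"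
		and ae: "AE x in M. f x = g x"
	shows "distr M (restrict_space N A) f = distr M (restrict_space N A) g"
	unfolding distr_def
proof (rule measure_of_eq)
	show "sets (restrict_space N A) <= Pow (space (restrict_space N A))" by (rule sets.space_closed)
	fix X assume "X \<in> sigma_sets (space (restrict_space N A)) (sets (restrict_space N A))"
	hence X: "X \<in> sets (restrict_space N A)" by (simp add: sets.sigma_sets_eq)
	hence XN: "X \<in> sets N" using A by (auto simp: sets_restrict_space)
	show "emeasure M (f -` X \<inter> space M) = emeasure M (g -` X \<inter> space M)"
	proof (rule emeasure_eq_AE)
		show "AE x in M. (x \<in> f -` X \<inter> space M) = (x \<in> g -` X \<inter> space M)" using ae by eventually_elim auto
	qed (use measurable_sets[OF g X] measurable_sets[OF f XN] in auto)
qed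

lemma PD1_distr:
	obtains g where "g \<in> measurable unifs (restrict_space borel Delta)" "!!u. g u \<in> Delta"
		"!!u. good_stick u ==> g u = decreasing_rearrangement (stick_breaking u)"
		"PD1 = distr unifs (restrict_space borel Delta) g"
proof -
	define y0 where "y0 = (%i::nat. if i = 0 then 1 else 0 :: real)"
	have y0: "y0 \<in> Delta"
	proof -
		have "y0 sums 1" unfolding y0_def by (rule sums_single)
		moreover have "decseq y0" by (rule decseq_SucI) (simp add: y0_def)
		moreover have "ALL i. 0 <= y0 i" by (simp add: y0_def)
		ultimately show ?thesis by (simp add: Delta_def)
	qed
	define F where "F = (%u. decreasing_rearrangement (stick_breaking u))"
	define g where "g = (%u. if good_stick u then F u else y0)"
	have sm: "(%u. stick_breaking u i) \<in> borel_measurable unifs" for i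
	proof (induction i rule: less_induct)
		case (less i)
		have "(%u. SUM j<i. stick_breaking u j) \<in> borel_measurable unifs"
		proof (rule borel_measurable_sum)
			fix j assume "j \<in> {..<i}"
			hence "j < i" by simp
			thus "(%u. stick_breaking u j) \<in> borel_measurable unifs" by (rule less)
		qed
		hence "(%u. u i * (1 - (SUM j<i. stick_breaking u j))) \<in> borel_measurable unifs"
			by (intro borel_measurable_times borel_measurable_diff borel_measurable_const unifs_coord)
		thus ?case unfolding stick_breaking.simps[of _ i] .
	qed
	have Fm [measurable]: "F \<in> borel_measurable unifs"
		unfolding F_def by (rule decreasing_rearrangement_measurable) (rule sm)
	have [measurable]: "Measurable.pred unifs good_stick" unfolding good_stick_def by measurable
	have gD: "g u \<in> Delta" for u
		using y0 decreasing_rearrangement_positive(1)[OF good_stick_props] by (auto simp: g_def F_def)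
	have "g \<in> borel_measurable unifs" unfolding g_def by measurable
	hence gm: "g \<in> measurable unifs (restrict_space borel Delta)"
		using gD by (intro measurable_restrict_space2) auto
	have PD1: "PD1 = distr unifs (restrict_space borel Delta) g"
		unfolding PD1_def F_def[symmetric]
		by (rule distr_AE_cong[OF gm Fm Delta_borel]) (use AE_good_stick in eventually_elim, simp add: g_def)
	show ?thesis by (rule that[OF gm gD _ PD1]) (simp add: g_def F_def)
qed

text \<open>Coupling: the same uniform variables \<open>u\<close> drive the discrete sticks for
  every \<open>k\<close>, so the sorted sticks converge almost surely, and dominated convergence
  gives the limit of the means.\<close>

lemma PD1_limit:
	fixes f :: "(nat => real) => real"
	assumes f: "continuous_on Delta f" and B: "!!y. \<bar>f y\<bar> <= B"
	shows "(%k. cyc_avg k (%M. f (scaled k M))) \<longlonglongrightarrow> integral\<^sup>L PD1 f"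
proof -
	obtain g where gm: "g \<in> measurable unifs (restrict_space borel Delta)" and gD: "!!u. g u \<in> Delta"
		and gs: "!!u. good_stick u ==> g u = decreasing_rearrangement (stick_breaking u)"
		and PD1: "PD1 = distr unifs (restrict_space borel Delta) g"
		using PD1_distr by blast
	have fm: "f \<in> borel_measurable (restrict_space borel Delta)" by (rule borel_measurable_continuous_on_restrict[OF f])
	have eq: "integral\<^sup>L PD1 f = (\<integral>u. f (g u) \<partial>unifs)" unfolding PD1 by (rule integral_distr[OF gm fm])
	have "(%k. \<integral>u. f (scaled k (mseq k u)) \<partial>unifs) \<longlonglongrightarrow> (\<integral>u. f (g u) \<partial>unifs)"
	proof (rule integral_dominated_convergence[where w="%_. B"])
		show "(%u. f (g u)) \<in> borel_measurable unifs" by (rule measurable_compose[OF gm fm])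
		show "(%u. f (scaled k (mseq k u))) \<in> borel_measurable unifs" for k
			by (rule measurable_compose[OF mseq_measurable]) simp
		show "AE u in unifs. (%k. f (scaled k (mseq k u))) \<longlonglongrightarrow> f (g u)"
			using AE_good_stick
		proof eventually_elim
			case (elim u)
			have "(%k. scaled k (mseq k u)) \<longlonglongrightarrow> g u" using scaled_mseq_tendsto[OF elim] gs[OF elim] by simp
			moreover have "\<forall>\<^sub>F k in sequentially. scaled k (mseq k u) \<in> Delta"
				using eventually_gt_at_top[of 0] by eventually_elim (rule scaled_mseq)
			ultimately show ?case by (intro continuous_on_tendsto_compose[OF f _ gD])
		qed
	qed (use B in auto)
	moreover have "(\<integral>u. f (scaled k (mseq k u)) \<partial>unifs) = cyc_avg k (%M. f (scaled k M))" for k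
		by (rule integral_mseq) (rule B)
	ultimately show ?thesis unfolding eq by simp
qed

section \<open>Sampling the cycles of a permutation\<close>

lemma induced_return:
	assumes f: "f permutes S" "finite S" and inj: "inj_on xi {..<k}" and i: "i < k"
	obtains t where "0 < t" "xi (induced f k xi i) = (f ^^ t) (xi i)" "induced f k xi i < k"
		"!!s. 0 < s ==> s < t ==> (f ^^ s) (xi i) ~: xi ` {..<k}"
proof -
	have v: "xi i \<in> xi ` {..<k}" using i by simp
	obtain t where t: "0 < t" "(f ^^ t) (xi i) \<in> xi ` {..<k}" "!!s. 0 < s ==> s < t ==> (f ^^ s) (xi i) ~: xi ` {..<k}"
		"first_return f (xi ` {..<k}) (xi i) = (f ^^ t) (xi i)"
		using first_return_obtain[OF f v] by blast
	obtain j where j: "j < k" "(f ^^ t) (xi i) = xi j" using t(2) by auto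
	have "induced f k xi i = j" using i j inj t(4) by (simp add: induced_def inv_into_f_f)
	thus ?thesis using that[of t] t j by auto
qed

lemma induced_permutes:
	assumes f: "f permutes S" "finite S" and inj: "inj_on xi {..<k}"
	shows "induced f k xi permutes {..<k}"
proof -
	have eq: "i = j" if ij: "i < k" "j < k" and e: "induced f k xi i = induced f k xi j" for i j
	proof -
		obtain s where s: "0 < s" "xi (induced f k xi i) = (f ^^ s) (xi i)" "!!r. 0 < r ==> r < s ==> (f ^^ r) (xi i) ~: xi ` {..<k}"
			using induced_return[OF f inj ij(1)] by metis
		obtain t where t: "0 < t" "xi (induced f k xi j) = (f ^^ t) (xi j)" "!!r. 0 < r ==> r < t ==> (f ^^ r) (xi j) ~: xi ` {..<k}"
			using induced_return[OF f inj ij(2)] by metis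
		have fi: "inj f" using f by (simp add: permutes_inj)
		have e2: "(f ^^ s) (xi i) = (f ^^ t) (xi j)" using s(2) t(2) e by simp
		have X: "xi i \<in> xi ` {..<k}" "xi j \<in> xi ` {..<k}" using ij by auto
		have "xi i = xi j"
		proof (cases s t rule: linorder_cases)
			case less
			hence "xi i = (f ^^ (t - s)) (xi j)" using funpow_eq_diff[OF fi e2] by simp
			thus ?thesis using t(3)[of "t - s"] less s(1) X by auto
		next
			case equal
			thus ?thesis using funpow_eq_diff[OF fi e2] by simp
		next
			case greater
			hence "xi j = (f ^^ (s - t)) (xi i)" using funpow_eq_diff[OF fi e2[symmetric]] by simp
			thus ?thesis using s(3)[of "s - t"] greater t(1) X by auto
		qed
		thus ?thesis using inj ij by (auto dest: inj_onD)
	qed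
	have im: "induced f k xi ` {..<k} <= {..<k}" using induced_return[OF f inj] by blast
	have "inj_on (induced f k xi) {..<k}" using eq by (auto intro: inj_onI)
	hence "bij_betw (induced f k xi) {..<k} {..<k}"
		using im by (simp add: bij_betw_def endo_inj_surj)
	thus ?thesis by (rule bij_imp_permutes) (simp add: induced_def)
qed

text \<open>Iterated first returns visit exactly the sampled points of an orbit, so the induced
  permutation neither merges nor splits the cycles of \<open>f\<close>.\<close>

lemma orbit_induced:
	assumes f: "f permutes S" "finite S" and inj: "inj_on xi {..<k}" and ij: "i < k" "j < k"
	shows "j \<in> orbit (induced f k xi) i \<longleftrightarrow> xi j \<in> orbit f (xi i)"
proof
	have ret: "xi (induced f k xi l) \<in> orbit f (xi l) & induced f k xi l < k" if l: "l < k" for l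
	proof -
		obtain t where "0 < t" "xi (induced f k xi l) = (f ^^ t) (xi l)" "induced f k xi l < k"
			by (rule induced_return[OF f inj l])
		thus ?thesis by (auto simp: orbit_altdef)
	qed
	assume "j \<in> orbit (induced f k xi) i"
	hence "xi j \<in> orbit f (xi i) & j < k"
	proof induction
		case base thus ?case using ret[OF ij(1)] .
	next
		case (step l)
		hence "xi (induced f k xi l) \<in> orbit f (xi l)" "induced f k xi l < k" using ret by blast+
		thus ?case using orbit_trans[of "xi (induced f k xi l)" f "xi l" "xi i"] step by blast
	qed
	thus "xi j \<in> orbit f (xi i)" by simp
next
	have *: "0 < t ==> i < k ==> (f ^^ t) (xi i) = xi j ==> j \<in> orbit (induced f k xi) i" for t i
	proof (induction t arbitrary: i rule: less_induct)
		case (less t)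
		obtain s where s: "0 < s" "xi (induced f k xi i) = (f ^^ s) (xi i)" "induced f k xi i < k" "!!r. 0 < r ==> r < s ==> (f ^^ r) (xi i) ~: xi ` {..<k}"
			using induced_return[OF f inj less.prems(2)] by metis
		have st: "s <= t" using s(4)[of t] less.prems ij by (cases "s <= t") (auto simp: not_le)
		show ?case
		proof (cases "s = t")
			case True
			hence "xi (induced f k xi i) = xi j" using s less.prems by simp
			hence "induced f k xi i = j" using inj s(3) ij by (auto dest: inj_onD)
			thus ?thesis using orbit.base[of "induced f k xi" i] by simp
		next
			case False
			have "(f ^^ (t - s)) (xi (induced f k xi i)) = (f ^^ (t - s + s)) (xi i)" unfolding s(2) funpow_add by simp
			hence "(f ^^ (t - s)) (xi (induced f k xi i)) = xi j" using st less.prems by simp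
			hence "j \<in> orbit (induced f k xi) (induced f k xi i)" using False st s(1,3) by (intro less.IH[of "t - s"]) auto
			thus ?thesis by (rule orbit_trans) (rule orbit.base)
		qed
	qed
	assume "xi j \<in> orbit f (xi i)"
	then obtain t where "0 < t" "(f ^^ t) (xi i) = xi j" by (auto simp: orbit_altdef)
	thus "j \<in> orbit (induced f k xi) i" using * ij by blast
qed

text \<open>A bijection is asked for above positive levels only, so that cycles without a sampled
  point may be ignored.\<close>

lemma ranks_bij:
	assumes "ranks I v y" "!!t. 0 < t ==> bij_betw h {i\<in>J. t < w i} {i\<in>I. t < v i}"
	shows "ranks J w y"
	using assms(1) bij_betw_same_card[OF assms(2)] bij_betw_finite[OF assms(2)] unfolding ranks_def by auto

lemma cycle_structure_scaled: "cycle_structure {..<k} s = scaled k (cyc_type k s)"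
	by (simp add: cycle_structure_sortd scaled_def cyc_type_def image_mset.compositionality comp_def)

text \<open>The cycles of the induced permutation are the traces of the sampled cycles of
  \<open>f\<close>, so their lengths are sample counts. Both cycle structures are thereby indexed by
  the same family, the cycles of \<open>f\<close>.\<close>

lemma ranks_induced:
	assumes f: "f permutes S" "finite S" and xi: "xi ` {..<k} <= S" and inj: "inj_on xi {..<k}"
	shows "ranks (orbit f ` S) (%C. real (card {i\<in>{..<k}. xi i \<in> C}) / real k) (scaled k (cyc_type k (induced f k xi)))"
proof (rule ranks_bij)
	define s where "s = induced f k xi"
	define g where "g = (%C. {i\<in>{..<k}. xi i \<in> C})"
	have gC: "{i\<in>{..<k}. xi i \<in> C} = g C" for C by (simp add: g_def)
	have s: "s permutes {..<k}" unfolding s_def by (rule induced_permutes[OF f inj])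
	show "ranks (orbit s ` {..<k}) (%C. real (card C) / real (card {..<k})) (scaled k (cyc_type k (induced f k xi)))"
		unfolding s_def[symmetric] cycle_structure_scaled[symmetric] by (rule ranks_cycle_structure) simp
	have os: "orbit s i = g (orbit f (xi i))" if "i < k" for i
		using orbit_induced[OF f inj that] permutes_orbit_subset[OF s, of i] that unfolding g_def s_def by auto
	have self: "x \<in> orbit f x" for x by (rule self_in_orbit_permutes[OF f])
	fix t :: real assume t: "0 < t"
	have ne: "EX i<k. C = orbit f (xi i)" if C: "C \<in> orbit f ` S" "t < real (card (g C)) / real k" for C
	proof -
		have "g C ~= {}" using C(2) t by auto
		then obtain i where i: "i < k" "xi i \<in> C" by (auto simp: g_def)
		obtain x where x: "C = orbit f x" using C(1) by auto
		hence "C = orbit f (xi i)" using orbit_permutes_eq[OF f, of "xi i" x] i by simp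
		thus ?thesis using i by blast
	qed
	show "bij_betw g {C\<in>orbit f ` S. t < real (card {i\<in>{..<k}. xi i \<in> C}) / real k} {C\<in>orbit s ` {..<k}. t < real (card C) / real (card {..<k})}"
		unfolding gC
	proof (rule bij_betw_imageI)
		show "inj_on g {C\<in>orbit f ` S. t < real (card (g C)) / real k}"
		proof (rule inj_onI)
			fix C C' assume C: "C \<in> {C\<in>orbit f ` S. t < real (card (g C)) / real k}" "C' \<in> {C\<in>orbit f ` S. t < real (card (g C)) / real k}" "g C = g C'"
			obtain i where i: "i < k" "C = orbit f (xi i)" using ne C by blast
			obtain x where x: "C' = orbit f x" using C(2) by auto
			have "i \<in> g C'" using C(3) i self by (auto simp: g_def)
			hence "xi i \<in> orbit f x" using x by (simp add: g_def)
			thus "C = C'" using orbit_permutes_eq[OF f, of "xi i" x] i x by simp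
		qed
		show "g ` {C\<in>orbit f ` S. t < real (card (g C)) / real k} = {C\<in>orbit s ` {..<k}. t < real (card C) / real (card {..<k})}"
		proof (intro equalityI subsetI)
			fix D assume "D \<in> g ` {C\<in>orbit f ` S. t < real (card (g C)) / real k}"
			then obtain C where C: "C \<in> orbit f ` S" "t < real (card (g C)) / real k" "D = g C" by blast
			then obtain i where i: "i < k" "C = orbit f (xi i)" using ne by blast
			hence "D = orbit s i" using os C by simp
			thus "D \<in> {C\<in>orbit s ` {..<k}. t < real (card C) / real (card {..<k})}" using C i by auto
		next
			fix D assume "D \<in> {C\<in>orbit s ` {..<k}. t < real (card C) / real (card {..<k})}"
			then obtain i where i: "i < k" "D = orbit s i" "t < real (card D) / real k" by auto
			have "xi i \<in> S" using xi i(1) by auto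
			thus "D \<in> g ` {C\<in>orbit f ` S. t < real (card (g C)) / real k}"
				using i os[OF i(1)] by (intro image_eqI[of _ _ "orbit f (xi i)"]) auto
		qed
	qed
qed

lemma sum_PiE_square:
	fixes a :: "'a => real"
	assumes S: "finite S" and z: "(SUM v:S. a v) = 0"
	shows "(SUM xi:PiE {..<k} (%_. S). (SUM i<k. a (xi i))\<^sup>2) = real k * real (card S) ^ (k - 1) * (SUM v:S. (a v)\<^sup>2)"
proof -
	have diag: "(SUM xi:PiE {..<k} (%_. S). a (xi i) * a (xi j)) = (if i = j then real (card S) ^ (k - 1) * (SUM v:S. (a v)\<^sup>2) else 0)"
		if ij: "i < k" "j < k" for i j
	proof -
		have "(SUM xi:PiE {..<k} (%_. S). a (xi i) * a (xi j)) = (SUM xi:PiE ({..<k} - {i}) (%_. S). SUM v:S. a v * a ((xi(i := v)) j))"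
			using ij S by (subst sum_PiE_split[of _ i]) auto
		also have "... = (SUM xi:PiE ({..<k} - {i}) (%_. S). if i = j then (SUM v:S. (a v)\<^sup>2) else 0)"
		proof (rule sum.cong)
			fix xi
			have "(SUM v:S. a v * a (xi j)) = 0" unfolding sum_distrib_right[symmetric] z by simp
			thus "(SUM v:S. a v * a ((xi(i := v)) j)) = (if i = j then (SUM v:S. (a v)\<^sup>2) else 0)"
				by (auto simp: power2_eq_square)
		qed simp
		also have "... = (if i = j then real (card S) ^ (k - 1) * (SUM v:S. (a v)\<^sup>2) else 0)"
			using ij by (simp add: card_PiE)
		finally show ?thesis .
	qed
	have "(SUM xi:PiE {..<k} (%_. S). (SUM i<k. a (xi i))\<^sup>2) = (SUM xi:PiE {..<k} (%_. S). SUM i<k. SUM j<k. a (xi i) * a (xi j))"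
		by (simp add: power2_eq_square sum_product)
	also have "... = (SUM i<k. SUM j<k. SUM xi:PiE {..<k} (%_. S). a (xi i) * a (xi j))"
		by (subst sum.swap, rule sum.cong[OF refl], rule sum.swap)
	also have "... = (SUM i<k. SUM j<k. if i = j then real (card S) ^ (k - 1) * (SUM v:S. (a v)\<^sup>2) else 0)"
		by (intro sum.cong refl) (use diag in auto)
	also have "... = real k * real (card S) ^ (k - 1) * (SUM v:S. (a v)\<^sup>2)" by simp
	finally show ?thesis .
qed

text \<open>The count in a cycle of relative size \<open>p\<close> is binomial with variance at most
  \<open>k * p\<close>, and the relative sizes sum to 1.\<close>

lemma sampling_variance:
	fixes P :: "'a set set"
	assumes S: "finite S" "S ~= {}" and P: "partition_on S P" and k: "0 < k"
	shows "(SUM xi:PiE {..<k} (%_. S). SUM C:P. (real (card {i\<in>{..<k}. xi i \<in> C}) / real k - real (card C) / real (card S))\<^sup>2)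
		<= real (card S) ^ k / real k"
proof -
	define N where "N = real (card S)"
	have N: "N > 0" using S by (simp add: N_def card_gt_0_iff)
	have fP: "finite P" using P S(1) by (rule finite_elements[rotated])
	define a :: "'a set => 'a => real" where "a = (%C v. of_bool (v \<in> C) - real (card C) / N)"
	have CS: "C <= S" if "C \<in> P" for C using P that by (auto simp: partition_on_def)
	have cnt: "(SUM v:S. of_bool (v \<in> C)) = real (card C)" if "C \<in> P" for C
	proof -
		have "(SUM v:S. of_bool (v \<in> C)) = (SUM v:C. (1::real))"
			using CS[OF that] S by (intro sum.mono_neutral_cong_right) auto
		thus ?thesis by simp
	qed
	have a0: "(SUM v:S. a C v) = 0" if "C \<in> P" for C
		using cnt[OF that] N by (simp add: a_def sum_subtractf N_def)
	have a2: "(SUM v:S. (a C v)\<^sup>2) <= real (card C)" if "C \<in> P" for C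
	proof -
		have "(SUM v:S. (a C v)\<^sup>2) = (SUM v:S. of_bool (v \<in> C) - real (card C) / N * of_bool (v \<in> C) - real (card C) / N * a C v)"
			by (rule sum.cong) (auto simp: a_def power2_eq_square algebra_simps)
		also have "... = real (card C) - real (card C) / N * real (card C)"
			by (simp only: sum_subtractf sum_distrib_left[symmetric] cnt[OF that] a0[OF that] mult_zero_right diff_0_right)
		also have "... <= real (card C)" using N by simp
		finally show ?thesis .
	qed
	have e: "real (card {i\<in>{..<k}. xi i \<in> C}) / real k - real (card C) / N = (SUM i<k. a C (xi i)) / real k" for xi C
	proof -
		have "(SUM i<k. of_bool (xi i \<in> C)) = real (card {i\<in>{..<k}. xi i \<in> C})" by (simp add: sum_of_bool_eq Int_def)
		hence "(SUM i<k. a C (xi i)) = real (card {i\<in>{..<k}. xi i \<in> C}) - real k * (real (card C) / N)"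
			by (simp add: a_def sum_subtractf)
		thus ?thesis using k by (simp add: diff_divide_distrib)
	qed
	have "(SUM xi:PiE {..<k} (%_. S). SUM C:P. (real (card {i\<in>{..<k}. xi i \<in> C}) / real k - real (card C) / N)\<^sup>2)
		= (SUM C:P. (SUM xi:PiE {..<k} (%_. S). (SUM i<k. a C (xi i))\<^sup>2) / (real k)\<^sup>2)"
		unfolding e power_divide by (subst sum.swap) (simp add: sum_divide_distrib)
	also have "... <= (SUM C:P. real k * N ^ (k - 1) * real (card C) / (real k)\<^sup>2)"
	proof (intro sum_mono divide_right_mono)
		fix C assume C: "C \<in> P"
		show "(SUM xi:PiE {..<k} (%_. S). (SUM i<k. a C (xi i))\<^sup>2) <= real k * N ^ (k - 1) * real (card C)"
			unfolding sum_PiE_square[OF S(1) a0[OF C]] N_def[symmetric] using N a2[OF C] by (intro mult_left_mono) auto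
	qed simp
	also have "... = real k * N ^ (k - 1) * (SUM C:P. real (card C)) / (real k)\<^sup>2"
		by (simp add: sum_distrib_left sum_divide_distrib)
	also have "(SUM C:P. real (card C)) = N"
	proof -
		have "card (\<Union>P) = (SUM C:P. card C)"
		proof (rule card_Union_disjoint)
			show "finite C" if "C \<in> P" for C using CS[OF that] S(1) by (rule finite_subset)
		qed (use partition_onD2[OF P] in "auto simp: disjoint_def pairwise_def disjnt_def")
		hence "card S = (SUM C:P. card C)" using partition_onD1[OF P] by simp
		thus ?thesis by (simp add: N_def)
	qed
	also have "real k * N ^ (k - 1) * N / (real k)\<^sup>2 = N ^ k / real k"
	proof -
		have "N ^ k = N ^ (k - 1) * N" using k by (cases k) auto
		thus ?thesis using k by (simp add: power2_eq_square)
	qed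
	finally show ?thesis unfolding N_def .
qed

lemma orbits_partition:
	assumes "f permutes S" "finite S" shows "partition_on S (orbit f ` S)"
proof (rule partition_onI)
	have self: "x \<in> orbit f x" for x by (rule self_in_orbit_permutes[OF assms])
	show "\<Union> (orbit f ` S) = S" using permutes_orbit_subset[OF assms(1)] self by blast
	show "{} ~: orbit f ` S" using self by blast
	show "disjnt p q" if pq: "p \<in> orbit f ` S" "q \<in> orbit f ` S" "p ~= q" for p q
	proof (rule ccontr)
		assume "~ disjnt p q"
		then obtain z where z: "z \<in> p" "z \<in> q" by (auto simp: disjnt_def)
		obtain x y where xy: "p = orbit f x" "q = orbit f y" using pq by auto
		have "orbit f z = p" "orbit f z = q" using z xy orbit_permutes_eq[OF assms, of z x] orbit_permutes_eq[OF assms, of z y] by simp_all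
		thus False using pq by simp
	qed
qed

text \<open>By \<open>ranks_lipschitz\<close> the sup distance between the two cycle structures is
  at most the square root of the sum \<open>V xi\<close> of squared deviations, whose mean over all
  samples is at most \<open>1 / k\<close>.\<close>

lemma sampling_error:
	fixes g :: "(nat => real) => real"
	assumes f: "f permutes S" "finite S" "S ~= {}" and k: "0 < k"
		and B: "!!y. \<bar>g y\<bar> <= B" and L: "0 <= L"
		and lip: "!!y y' d. y \<in> Delta ==> y' \<in> Delta ==> (!!j. \<bar>y j - y' j\<bar> <= d) ==> \<bar>g y - g y'\<bar> <= L * d"
	shows "\<bar>real (card S) ^ k * g (cycle_structure S f) - (SUM xi:PiE {..<k} (%_. S). if inj_on xi {..<k} then g (scaled k (cyc_type k (induced f k xi))) else 0)\<bar>
		<= real (card S) ^ k * (L / sqrt k) + B * real (card {xi\<in>PiE {..<k} (%_. S). ~ inj_on xi {..<k}})"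
proof -
	define Xi where "Xi = PiE {..<k} (%_. S)"
	have fXi: "finite Xi" unfolding Xi_def using f by (intro finite_PiE) auto
	have cXi: "real (card Xi) = real (card S) ^ k" by (simp add: Xi_def card_PiE)
	define V where "V = (%xi. SUM C:orbit f ` S. (real (card {i\<in>{..<k}. xi i \<in> C}) / real k - real (card C) / real (card S))\<^sup>2)"
	define h where "h = (%xi. if inj_on xi {..<k} then g (scaled k (cyc_type k (induced f k xi))) else 0)"
	define e where "e = 1 / sqrt (real k)"
	have e: "e > 0" "e * e = 1 / real k" using k by (auto simp: e_def)
	have bnd: "\<bar>g (cycle_structure S f) - h xi\<bar> <= L * (e / 2 + V xi / (2 * e)) + B * of_bool (~ inj_on xi {..<k})" if xi: "xi \<in> Xi" for xi
	proof -
		have V0: "0 <= V xi" unfolding V_def by (intro sum_nonneg) auto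
		\<comment> \<open>Bounding the root by a linear function with the scale
		  \<open>e = 1 / sqrt k\<close> allows averaging \<open>V\<close> itself.\<close>
		have amgm: "sqrt (V xi) <= e / 2 + V xi / (2 * e)"
		proof -
			have "(sqrt (V xi) - e)\<^sup>2 = e * e + V xi - 2 * e * sqrt (V xi)"
				using V0 by (simp add: power2_diff power2_eq_square algebra_simps)
			hence "2 * e * sqrt (V xi) <= e * e + V xi" using zero_le_power2[of "sqrt (V xi) - e"] by linarith
			thus ?thesis using e by (simp add: field_simps)
		qed
		show ?thesis
		proof (cases "inj_on xi {..<k}")
			case True
			have im: "xi ` {..<k} <= S" using xi by (auto simp: Xi_def)
			have s: "induced f k xi permutes {..<k}" by (rule induced_permutes[OF f(1,2) True])
			have "\<bar>g (cycle_structure S f) - g (scaled k (cyc_type k (induced f k xi)))\<bar> <= L * sqrt (V xi)"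
			proof (rule lip)
				show "cycle_structure S f \<in> Delta" using f
					by (intro cycle_structure_in_Delta) (auto simp: permutes_imp_bij permutes_not_in)
				have "cycle_structure {..<k} (induced f k xi) \<in> Delta" using s k
					by (intro cycle_structure_in_Delta) (auto simp: permutes_imp_bij permutes_not_in)
				thus "scaled k (cyc_type k (induced f k xi)) \<in> Delta" by (simp add: cycle_structure_scaled)
				show "\<bar>cycle_structure S f j - scaled k (cyc_type k (induced f k xi)) j\<bar> <= sqrt (V xi)" for j
				proof (rule ranks_lipschitz[OF ranks_cycle_structure[OF f(2), of f] ranks_induced[OF f(1,2) im True]])
					fix C assume C: "C \<in> orbit f ` S"
					have "(real (card {i\<in>{..<k}. xi i \<in> C}) / real k - real (card C) / real (card S))\<^sup>2 <= V xi"
						unfolding V_def using C f(2) by (intro member_le_sum) auto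
					thus "\<bar>real (card C) / real (card S) - real (card {i\<in>{..<k}. xi i \<in> C}) / real k\<bar> <= sqrt (V xi)"
						by (subst abs_minus_commute) (rule real_le_rsqrt, simp)
				qed (use V0 in simp)
			qed
			also have "... <= L * (e / 2 + V xi / (2 * e))" using amgm L by (rule mult_left_mono)
			finally show ?thesis using True by (simp add: h_def)
		next
			case False
			have "0 <= L * (e / 2 + V xi / (2 * e))" using L V0 e by (intro mult_nonneg_nonneg add_nonneg_nonneg) auto
			thus ?thesis using False B[of "cycle_structure S f"] by (simp add: h_def)
		qed
	qed
	have "real (card S) ^ k * g (cycle_structure S f) - (SUM xi:Xi. h xi) = (SUM xi:Xi. g (cycle_structure S f) - h xi)"
		by (simp add: sum_subtractf cXi)
	hence "\<bar>real (card S) ^ k * g (cycle_structure S f) - (SUM xi:Xi. h xi)\<bar> <= (SUM xi:Xi. \<bar>g (cycle_structure S f) - h xi\<bar>)" by simp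
	also have "... <= (SUM xi:Xi. L * (e / 2 + V xi / (2 * e)) + B * of_bool (~ inj_on xi {..<k}))" by (rule sum_mono) (rule bnd)
	also have "... = L * (real (card S) ^ k * (e / 2) + (SUM xi:Xi. V xi) / (2 * e)) + B * (SUM xi:Xi. of_bool (~ inj_on xi {..<k}))"
		by (simp add: sum.distrib sum_distrib_left sum_divide_distrib cXi distrib_left)
	also have "... <= L * (real (card S) ^ k * (e / 2) + (real (card S) ^ k / real k) / (2 * e)) + B * (SUM xi:Xi. of_bool (~ inj_on xi {..<k}))"
		using sampling_variance[OF f(2,3) orbits_partition[OF f(1,2)] k] e L
		unfolding V_def Xi_def by (intro add_right_mono mult_left_mono add_left_mono divide_right_mono) auto
	also have "L * (real (card S) ^ k * (e / 2) + (real (card S) ^ k / real k) / (2 * e)) = real (card S) ^ k * (L / sqrt k)"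
	proof -
		have "1 / real k / (2 * e) = e / 2" using e(1) unfolding e(2)[symmetric] by simp
		hence "real (card S) ^ k / real k / (2 * e) = real (card S) ^ k * (e / 2)" by (metis (no_types, lifting) mult.right_neutral times_divide_eq_right)
		thus ?thesis by (simp add: e_def)
	qed
	also have "(SUM xi:Xi. of_bool (~ inj_on xi {..<k})) = real (card {xi\<in>Xi. ~ inj_on xi {..<k}})"
		using fXi by (simp add: sum_of_bool_eq Int_def)
	finally show ?thesis unfolding Xi_def h_def .
qed

lemma card_not_inj:
	assumes "finite S"
	shows "real (card {xi\<in>PiE {..<k} (%_. S). ~ inj_on xi {..<k}}) <= (real k)\<^sup>2 * real (card S) ^ (k - 1)"
proof -
	define Xi where "Xi = PiE {..<k} (%_. S)"
	have fXi: "finite Xi" unfolding Xi_def using assms by (intro finite_PiE) auto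
	have pair: "(SUM xi:Xi. of_bool (i ~= j & xi i = xi j)) <= real (card S) ^ (k - 1)" if ij: "i < k" "j < k" for i j
	proof (cases "i = j")
		case False
		have "(SUM xi:Xi. of_bool (i ~= j & xi i = xi j)) = (SUM xi:PiE ({..<k} - {i}) (%_. S). SUM v:S. (of_bool (v = xi j) :: real))"
			unfolding Xi_def using ij assms False by (subst sum_PiE_split[of _ i]) auto
		also have "... <= (SUM xi:PiE ({..<k} - {i}) (%_. S). 1)"
		proof (rule sum_mono)
			fix xi
			have "(SUM v:S. (of_bool (v = xi j) :: real)) = real (card (S \<inter> {xi j}))" using assms by (simp add: sum_of_bool_eq Int_def)
			also have "... <= real (card {xi j})" by (intro of_nat_mono card_mono) auto
			finally show "(SUM v:S. (of_bool (v = xi j) :: real)) <= 1" by simp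
		qed
		also have "... = real (card S) ^ (k - 1)" using ij by (simp add: card_PiE)
		finally show ?thesis .
	qed simp
	have "real (card {xi\<in>Xi. ~ inj_on xi {..<k}}) = (SUM xi:Xi. of_bool (~ inj_on xi {..<k}))"
		using fXi by (simp add: sum_of_bool_eq Int_def)
	also have "... <= (SUM xi:Xi. SUM i<k. SUM j<k. of_bool (i ~= j & xi i = xi j))"
	proof (rule sum_mono)
		fix xi
		have nn: "0 <= (SUM i<k. SUM j<k. (of_bool (i ~= j & xi i = xi j) :: real))" by (intro sum_nonneg) auto
		show "of_bool (~ inj_on xi {..<k}) <= (SUM i<k. SUM j<k. (of_bool (i ~= j & xi i = xi j) :: real))"
		proof (cases "inj_on xi {..<k}")
			case False
			then obtain i j where ij: "i < k" "j < k" "i ~= j" "xi i = xi j" by (auto simp: inj_on_def)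
			have "(1::real) = of_bool (i ~= j & xi i = xi j)" using ij by simp
			also have "... <= (SUM j<k. of_bool (i ~= j & xi i = xi j))" using ij by (intro member_le_sum) auto
			also have "... <= (SUM i<k. SUM j<k. of_bool (i ~= j & xi i = xi j))"
				using ij by (intro member_le_sum[of i "{..<k}" "%i. SUM j<k. of_bool (i ~= j & xi i = xi j)"]) (auto intro!: sum_nonneg)
			finally show ?thesis using False by simp
		qed (use nn in simp)
	qed
	also have "... = (SUM i<k. SUM j<k. SUM xi:Xi. of_bool (i ~= j & xi i = xi j))"
		by (subst sum.swap, rule sum.cong[OF refl], rule sum.swap)
	also have "... <= (SUM i<k. SUM j<k. real (card S) ^ (k - 1))" by (intro sum_mono) (use pair in auto)
	also have "... = (real k)\<^sup>2 * real (card S) ^ (k - 1)" by (simp add: power2_eq_square)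
	finally show ?thesis unfolding Xi_def .
qed

section \<open>The law of the induced permutation\<close>

context hc begin

text \<open>The points are sampled with replacement, which keeps them independent for the variance
  bound; the mass lost by repetitions is \<open>notinj\<close>.\<close>

definition indP :: "nat => (nat => nat) => real" where
	"indP k s = (SUM xi:PiE {..<k} (%_. Tor). Pr (%D. inj_on xi {..<k} & induced (Phi D) k xi = s)) / real (n * m) ^ k"

definition notinj :: "nat => real" where
	"notinj k = real (card {xi\<in>PiE {..<k} (%_. Tor). ~ inj_on xi {..<k}}) / real (n * m) ^ k"

lemma notinj_le: "0 < k ==> notinj k <= (real k)\<^sup>2 / real (n * m)" "0 <= notinj k"
proof -
	assume k: "0 < k"
	have nm: "real (n * m) > 0" using n_pos m_ge by simp
	have "notinj k <= (real k)\<^sup>2 * real (n * m) ^ (k - 1) / real (n * m) ^ k"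
		unfolding notinj_def using card_not_inj[of "Tor" k] by (intro divide_right_mono) (auto simp: card_torus)
	also have "... = (real k)\<^sup>2 / real (n * m)"
	proof -
		have "P > 0 ==> A * P ^ (k - 1) / P ^ k = A / P" for A P :: real using k by (cases k) auto
		thus ?thesis using nm by blast
	qed
	finally show "notinj k <= (real k)\<^sup>2 / real (n * m)" .
qed (simp add: notinj_def)

lemma sum_indP:
	fixes h :: "(nat => nat) => real"
	shows "(SUM s | s permutes {..<k}. indP k s * h s) = (SUM xi:PiE {..<k} (%_. Tor). Ex (%D. if inj_on xi {..<k} then h (induced (Phi D) k xi) else 0)) / real (n * m) ^ k"
proof -
	have fp: "finite {s. s permutes {..<k}}" by (rule finite_permutations) simp
	have e: "(SUM s | s permutes {..<k}. Pr (%D. inj_on xi {..<k} & induced (Phi D) k xi = s) * h s) = Ex (%D. if inj_on xi {..<k} then h (induced (Phi D) k xi) else 0)" for xi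
	proof -
		have "(SUM s | s permutes {..<k}. Pr (%D. inj_on xi {..<k} & induced (Phi D) k xi = s) * h s) = Ex (%D. SUM s | s permutes {..<k}. of_bool (inj_on xi {..<k} & induced (Phi D) k xi = s) * h s)"
			unfolding Pr_def by (simp only: Ex_sum Ex_multc)
		also have "... = Ex (%D. if inj_on xi {..<k} then h (induced (Phi D) k xi) else 0)"
		proof (rule Ex_cong)
			fix D assume D: "D \<in> Om"
			show "(SUM s | s permutes {..<k}. of_bool (inj_on xi {..<k} & induced (Phi D) k xi = s) * h s) = (if inj_on xi {..<k} then h (induced (Phi D) k xi) else 0)"
			proof (cases "inj_on xi {..<k}")
				case True
				have "induced (Phi D) k xi permutes {..<k}" by (rule induced_permutes[OF Phi_permutes[OF D] _ True]) simp
				moreover have "(SUM s | s permutes {..<k}. of_bool (inj_on xi {..<k} & induced (Phi D) k xi = s) * h s) = (SUM s | s permutes {..<k}. if induced (Phi D) k xi = s then h s else 0)"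
					by (rule sum.cong) (use True in auto)
				ultimately show ?thesis using fp True by (simp add: sum.delta)
			qed simp
		qed
		finally show ?thesis .
	qed
	have "(SUM s | s permutes {..<k}. indP k s * h s) = (SUM xi:PiE {..<k} (%_. Tor). SUM s | s permutes {..<k}. Pr (%D. inj_on xi {..<k} & induced (Phi D) k xi = s) * h s) / real (n * m) ^ k"
		unfolding indP_def by (subst sum.swap) (simp add: sum_divide_distrib sum_distrib_right)
	thus ?thesis unfolding e .
qed

lemma sum_indP_1: "(SUM s | s permutes {..<k}. indP k s) = 1 - notinj k"
proof -
	define Xi where "Xi = PiE {..<k} (%_. Tor)"
	have fXi: "finite Xi" unfolding Xi_def by (intro finite_PiE) auto
	have cXi: "real (card Xi) = real (n * m) ^ k" by (simp add: Xi_def card_PiE card_torus)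
	have nm: "real (n * m) ^ k > 0" using n_pos m_ge by simp
	have "(SUM s | s permutes {..<k}. indP k s) = (SUM xi:Xi. Ex (%D. if inj_on xi {..<k} then 1 else 0)) / real (n * m) ^ k"
		using sum_indP[of k "%_. 1"] by (simp add: Xi_def)
	also have "(SUM xi:Xi. Ex (%D. if inj_on xi {..<k} then 1 else 0)) = (SUM xi:Xi. 1 - of_bool (~ inj_on xi {..<k}))"
		by (rule sum.cong) auto
	also have "... = real (n * m) ^ k - real (card {xi\<in>Xi. ~ inj_on xi {..<k}})"
		using fXi by (simp add: sum_subtractf cXi sum_of_bool_eq Int_def)
	finally show ?thesis using n_pos m_ge by (simp add: diff_divide_distrib notinj_def Xi_def)
qed

lemma Ex_sampling:
	fixes g :: "(nat => real) => real"
	assumes k: "0 < k" and B: "!!y. \<bar>g y\<bar> <= B" and L: "0 <= L"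
		and lip: "!!y y' d. y \<in> Delta ==> y' \<in> Delta ==> (!!j. \<bar>y j - y' j\<bar> <= d) ==> \<bar>g y - g y'\<bar> <= L * d"
	shows "\<bar>Ex (%D. g (cycle_structure Tor (Phi D))) - (SUM s | s permutes {..<k}. indP k s * g (scaled k (cyc_type k s)))\<bar> <= L / sqrt k + B * notinj k"
proof -
	define Xi where "Xi = PiE {..<k} (%_. Tor)"
	define h where "h = (%D xi. if inj_on xi {..<k} then g (scaled k (cyc_type k (induced (Phi D) k xi))) else 0)"
	define P where "P = real (n * m) ^ k"
	have P: "P > 0" using n_pos m_ge by (simp add: P_def)
	have ne: "Tor ~= {}" using n_pos m_ge by (auto simp: torus_def)
	have "(SUM s | s permutes {..<k}. indP k s * g (scaled k (cyc_type k s))) = (SUM xi:Xi. Ex (%D. h D xi)) / P"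
		unfolding sum_indP Xi_def h_def P_def ..
	also have "(SUM xi:Xi. Ex (%D. h D xi)) = Ex (%D. SUM xi:Xi. h D xi)" by (rule Ex_sum[symmetric])
	finally have e: "P * (Ex (%D. g (cycle_structure Tor (Phi D))) - (SUM s | s permutes {..<k}. indP k s * g (scaled k (cyc_type k s))))
		= Ex (%D. P * g (cycle_structure Tor (Phi D)) - (SUM xi:Xi. h D xi))"
		using P by (simp only: Ex_diff Ex_cmult right_diff_distrib) simp
	have "\<bar>Ex (%D. P * g (cycle_structure Tor (Phi D)) - (SUM xi:Xi. h D xi))\<bar> <= Ex (%D. \<bar>P * g (cycle_structure Tor (Phi D)) - (SUM xi:Xi. h D xi)\<bar>)"
		by (rule Ex_abs)
	also have "... <= Ex (%D. P * (L / sqrt k) + B * real (card {xi\<in>Xi. ~ inj_on xi {..<k}}))"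
	proof (rule Ex_mono)
		fix D assume D: "D \<in> Om"
		show "\<bar>P * g (cycle_structure Tor (Phi D)) - (SUM xi:Xi. h D xi)\<bar> <= P * (L / sqrt k) + B * real (card {xi\<in>Xi. ~ inj_on xi {..<k}})"
			unfolding P_def Xi_def h_def card_torus[symmetric]
			by (rule sampling_error[OF Phi_permutes[OF D] finite_torus ne k B L]) (rule lip)
	qed
	also have "... = P * (L / sqrt k + B * notinj k)" using P n_pos m_ge by (simp add: notinj_def P_def Xi_def distrib_left)
	finally show ?thesis unfolding e[symmetric] using P by (simp add: abs_mult)
qed

end

context hcw begin

lemma indP_diff:
	"indP k s - indP k (s \<circ> swp i j) = (SUM xi:PiE {..<k} (%_. Tor). Ex (%D. swapF k s i j D xi)) / real (n * m) ^ k"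
proof -
	have "Pr (%D. inj_on xi {..<k} & induced (Phi D) k xi = s) - Pr (%D. inj_on xi {..<k} & induced (Phi D) k xi = s \<circ> swp i j)
		= Ex (%D. swapF k s i j D xi)" for xi
		unfolding Pr_def Ex_diff[symmetric] by (rule Ex_cong) (simp add: swapF_def)
	thus ?thesis by (simp add: indP_def diff_divide_distrib[symmetric] sum_subtractf[symmetric])
qed

end

text \<open>Transpositions connect every permutation with the identity, so the differences between
  all values tend to 0, and the total mass \<open>1 - notinj\<close> forces the common
  limit.\<close>

lemma indP_limit:
	assumes z: "z > 0" and c: "c >= 200" and k: "0 < k" and s: "s permutes {..<k}"
	shows "(%m. hc.indP (m + excess c m) m z k s) \<longlonglongrightarrow> 1 / fact k"
		and "(%m. hc.notinj (m + excess c m) m k) \<longlonglongrightarrow> 0"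
proof -
	define n where "n = (%m. m + excess c m)"
	have c0: "c > 0" using c by simp
	have "\<forall>\<^sub>F m in sequentially. 1 <= real (excess c m)" unfolding excess_def using c0 by real_asymp
	hence side: "\<forall>\<^sub>F m in sequentially. 3 <= m & 0 < excess c m"
		using eventually_ge_at_top[of 3] by eventually_elim auto
	have loc: "hcw (n m) m z (excess c m)" if "3 <= m & 0 < excess c m" for m
		using that z by unfold_locales (auto simp: n_def)
	show ni: "(%m. hc.notinj (m + excess c m) m k) \<longlonglongrightarrow> 0"
		unfolding n_def[THEN fun_cong, symmetric]
	proof (rule tendsto_sandwich[OF _ _ tendsto_const])
		show "\<forall>\<^sub>F m in sequentially. 0 <= hc.notinj (n m) m k" using side
		proof eventually_elim
			case (elim m)
			interpret hcw "n m" m z "excess c m" using elim by (rule loc)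
			show ?case by (rule notinj_le(2))
		qed
		show "\<forall>\<^sub>F m in sequentially. hc.notinj (n m) m k <= (real k)\<^sup>2 * (1 / real m)" using side
		proof eventually_elim
			case (elim m)
			interpret hcw "n m" m z "excess c m" using elim by (rule loc)
			have "notinj k <= (real k)\<^sup>2 / real (n m * m)" by (rule notinj_le(1)[OF k])
			also have "... <= (real k)\<^sup>2 / real m"
				using elim by (intro divide_left_mono) (auto simp: n_def)
			finally show ?case by simp
		qed
		have "(%m. 1 / real m) \<longlonglongrightarrow> 0" by real_asymp
		from tendsto_mult_left[OF this] show "(%m. (real k)\<^sup>2 * (1 / real m)) \<longlonglongrightarrow> 0" by simp
	qed
	define p where "p = (%s m. hc.indP (n m) m z k s)"
	have diff: "(%m. p s m - p (s \<circ> swp i j) m) \<longlonglongrightarrow> 0" if ij: "i < k" "j < k" "i ~= j" for s i j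
	proof -
		have "(%m. \<bar>SUM xi:PiE {..<k} (%_. torus (n m) m). hc.Ex (n m) m z (%D. hcw.swapF (n m) m k s i j D xi)\<bar> / real (n m * m) ^ k) \<longlonglongrightarrow> 0"
			using swap_limit[OF z c ij, of s] by (simp add: n_def)
		moreover have "\<forall>\<^sub>F m in sequentially. \<bar>SUM xi:PiE {..<k} (%_. torus (n m) m). hc.Ex (n m) m z (%D. hcw.swapF (n m) m k s i j D xi)\<bar> / real (n m * m) ^ k = \<bar>p s m - p (s \<circ> swp i j) m\<bar>"
			using side
		proof eventually_elim
			case (elim m)
			interpret hcw "n m" m z "excess c m" using elim by (rule loc)
			show ?case unfolding p_def indP_diff by (simp add: abs_divide)
		qed
		ultimately have "(%m. \<bar>p s m - p (s \<circ> swp i j) m\<bar>) \<longlonglongrightarrow> 0"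
			by (rule Lim_transform_eventually)
		thus ?thesis by (rule tendsto_rabs_zero_cancel)
	qed
	have "(%m. p s m - p id m) \<longlonglongrightarrow> 0" if s: "s permutes {..<k}" for s
		using finite_lessThan s
	proof (induction rule: permutes_rev_induct)
		case id
		show ?case by simp
	next
		case (swap a b s)
		have "(%m. (p s m - p id m) - (p s m - p (s \<circ> swp a b) m)) \<longlonglongrightarrow> 0 - 0"
			by (intro tendsto_diff swap diff) (use swap in auto)
		thus ?case by (simp add: o_def id_def)
	qed
	hence pid: "(%m. p s m - p id m) \<longlonglongrightarrow> 0" if "s permutes {..<k}" for s using that by blast
	have "(%m. (1 - hc.notinj (n m) m k - (SUM s | s permutes {..<k}. p s m - p id m)) / fact k) \<longlonglongrightarrow> (1 - 0 - (SUM s | s permutes {..<k}. 0)) / fact k"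
		using ni by (intro tendsto_intros pid) (auto simp: n_def)
	moreover have "\<forall>\<^sub>F m in sequentially. (1 - hc.notinj (n m) m k - (SUM s | s permutes {..<k}. p s m - p id m)) / fact k = p id m"
		using side
	proof eventually_elim
		case (elim m)
		interpret hcw "n m" m z "excess c m" using elim by (rule loc)
		have "(SUM s | s permutes {..<k}. p s m) = 1 - notinj k" unfolding p_def by (rule sum_indP_1)
		moreover have "real (card {s. s permutes {..<k}}) = fact k" by (simp add: card_permutations[of _ k])
		ultimately have "1 - notinj k - (SUM s | s permutes {..<k}. p s m - p id m) = fact k * p id m" by (simp add: sum_subtractf)
		thus ?case by simp
	qed
	ultimately have "(%m. p id m) \<longlonglongrightarrow> 1 / fact k"
		using Lim_transform_eventually by fastforce
	from tendsto_add[OF pid[OF s] this] show "(%m. hc.indP (m + excess c m) m z k s) \<longlonglongrightarrow> 1 / fact k"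
		by (simp add: p_def n_def)
qed

text \<open>Two limits in succession: \<open>k\<close> is fixed so large that the sampling error and
  the distance to \<open>PD1\<close> are small, and then \<open>m\<close> grows. The Lipschitz
  condition makes the main part \<open>L / sqrt k\<close> of the sampling error uniform in
  \<open>m\<close>.\<close>

lemma hard_core_limit:
	fixes g :: "(nat => real) => real"
	assumes z: "z > 0" and c: "c >= 200" and g: "continuous_on Delta g" and B: "!!y. \<bar>g y\<bar> <= B" and L: "0 <= L"
		and lip: "!!y y' d. y \<in> Delta ==> y' \<in> Delta ==> (!!j. \<bar>y j - y' j\<bar> <= d) ==> \<bar>g y - g y'\<bar> <= L * d"
	shows "(%m. hc.Ex (m + excess c m) m z (%D. g (cycle_structure (torus (m + excess c m) m) (hc.Phi (m + excess c m) m D)))) \<longlonglongrightarrow> integral\<^sup>L PD1 g"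
proof -
	define n where "n = (%m. m + excess c m)"
	define E where "E = (%m. hc.Ex (n m) m z (%D. g (cycle_structure (torus (n m) m) (hc.Phi (n m) m D))))"
	define A where "A = (%k m. SUM s | s permutes {..<k}. hc.indP (n m) m z k s * g (scaled k (cyc_type k s)))"
	have bound: "\<forall>\<^sub>F m in sequentially. \<bar>E m - A k m\<bar> <= L / sqrt k + B * hc.notinj (n m) m k" if k: "0 < k" for k
		using eventually_ge_at_top[of 3]
	proof eventually_elim
		case (elim m)
		interpret hc "n m" m z by unfold_locales (use elim z in "auto simp: n_def")
		show ?case unfolding E_def A_def by (rule Ex_sampling[OF k B L]) (rule lip)
	qed
	have Al: "A k \<longlonglongrightarrow> cyc_avg k (%M. g (scaled k M))" if k: "0 < k" for k
	proof -
		have "A k \<longlonglongrightarrow> (SUM s | s permutes {..<k}. 1 / fact k * g (scaled k (cyc_type k s)))"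
			unfolding A_def n_def by (intro tendsto_sum tendsto_mult_right indP_limit[OF z c k]) simp
		also have "(SUM s | s permutes {..<k}. 1 / fact k * g (scaled k (cyc_type k s))) = 1 / fact k * (SUM s | s permutes {..<k}. g (scaled k (cyc_type k s)))"
			by (rule sum_distrib_left[symmetric])
		also have "... = cyc_avg k (%M. g (scaled k M))" using cyc_avg_permutations[where k=k and h="%M. g (scaled k M)"] by simp
		finally show ?thesis .
	qed
	have "E \<longlonglongrightarrow> integral\<^sup>L PD1 g"
	proof (rule tendstoI)
		fix e :: real assume e: "0 < e"
		have "(%k. L * (1 / sqrt (real k))) \<longlonglongrightarrow> L * 0" by (intro tendsto_mult_left) real_asymp
		hence "\<forall>\<^sub>F k in sequentially. L * (1 / sqrt (real k)) < e / 4" using e by (intro order_tendstoD(2)) auto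
		moreover have "\<forall>\<^sub>F k in sequentially. dist (cyc_avg k (%M. g (scaled k M))) (integral\<^sup>L PD1 g) < e / 4"
			using e by (intro tendstoD[OF PD1_limit[OF g B]]) simp
		ultimately have "\<forall>\<^sub>F k in sequentially. L / sqrt k < e / 4 & \<bar>cyc_avg k (%M. g (scaled k M)) - integral\<^sup>L PD1 g\<bar> < e / 4 & 0 < k"
			using eventually_gt_at_top[of "0::nat"] by eventually_elim (simp add: dist_real_def)
		then obtain k where k: "L / sqrt k < e / 4" "\<bar>cyc_avg k (%M. g (scaled k M)) - integral\<^sup>L PD1 g\<bar> < e / 4" "0 < k"
			by (auto simp: eventually_sequentially)
		have "(%m. B * hc.notinj (n m) m k) \<longlonglongrightarrow> B * 0" unfolding n_def
			by (intro tendsto_mult_left indP_limit(2)[OF z c k(3) permutes_id])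
		hence "\<forall>\<^sub>F m in sequentially. B * hc.notinj (n m) m k < e / 4" using e by (intro order_tendstoD(2)) auto
		moreover have "\<forall>\<^sub>F m in sequentially. dist (A k m) (cyc_avg k (%M. g (scaled k M))) < e / 4"
			using e by (intro tendstoD[OF Al[OF k(3)]]) simp
		ultimately show "\<forall>\<^sub>F m in sequentially. dist (E m) (integral\<^sup>L PD1 g) < e"
			using bound[OF k(3)]
		proof eventually_elim
			case (elim m)
			thus ?case using k unfolding dist_real_def by linarith
		qed
	qed
	thus ?thesis by (simp add: E_def n_def)
qed

section \<open>From directed permutations to hard-core configurations\<close>

context hc begin

definition Cfg :: "(int \<times> int => int) set" where
	"Cfg = {ph \<in> PiE_dflt Tor 0 (%_. {-1, 0, 1}). bij_betw (shift_map n m ph) Tor Tor}"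

definition RotC :: "int => int => (int \<times> int => int) set" where
	"RotC c sgm = {ph \<in> Cfg. ALL x:Tor. fst x = c --> ph x = sgm}"

definition Rot :: "(int \<times> int => int) set" where
	"Rot = (UN c:{0..<int n}. RotC c 1 \<union> RotC c (-1))"

text \<open>Relative to the step 0, every nonzero step has weight \<open>q = a / (1 - 2 * a)\<close>
  in the intended use. An exchanged pair consists of two such steps, so its weight is
  \<open>q\<^sup>2 = z\<close>.\<close>

definition wt :: "real => (int \<times> int => int) => real" where
	"wt q ph = q ^ card {x \<in> Tor. ph x ~= 0}"

lemma finite_Cfg [simp]: "finite Cfg"
	unfolding Cfg_def by (rule finite_subset[of _ "PiE_dflt Tor 0 (%_. {-1, 0, 1})"]) auto

lemma shift_map_rt: "x \<in> Tor ==> shift_map n m ph x = rt (sh x (ph x))"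
	by (simp add: shift_map_def rt_def sh_def mod_simps algebra_simps)

lemma Cfg_iff:
	"ph \<in> Cfg \<longleftrightarrow> (ALL x. x ~: Tor --> ph x = 0) & (ALL x:Tor. ph x \<in> {-1, 0, 1}) &
			(ALL x:Tor. ALL y:Tor. sh x (ph x) = sh y (ph y) --> x = y)"
proof -
	have "bij_betw (shift_map n m ph) Tor Tor \<longleftrightarrow> inj_on (shift_map n m ph) Tor"
	proof
		assume i: "inj_on (shift_map n m ph) Tor"
		have "shift_map n m ph ` Tor <= Tor" by (rule image_subsetI) (simp add: shift_map_rt rt_torus)
		thus "bij_betw (shift_map n m ph) Tor Tor"
			using i by (simp add: bij_betw_def endo_inj_surj)
	qed (rule bij_betw_imp_inj_on)
	also have "... \<longleftrightarrow> (ALL x:Tor. ALL y:Tor. sh x (ph x) = sh y (ph y) --> x = y)"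
	proof -
		have "shift_map n m ph x = shift_map n m ph y \<longleftrightarrow> sh x (ph x) = sh y (ph y)" if "x \<in> Tor" "y \<in> Tor" for x y
			using inj_on_eq_iff[OF rt_inj sh_torus[OF that(1)] sh_torus[OF that(2)]] that by (simp only: shift_map_rt)
		thus ?thesis unfolding inj_on_def by blast
	qed
	finally show ?thesis unfolding Cfg_def PiE_dflt_def by blast
qed

lemma sh_ne:
	assumes "x \<in> Tor" "~ int m dvd a - b" shows "sh x a ~= sh x b"
	using assms by (simp add: sh_eq_iff)

lemma not_dvd_m: "~ int m dvd 1" "~ int m dvd 2" "~ int m dvd -1" "~ int m dvd -2"
	using m_ge by (auto dest!: zdvd_imp_le)

text \<open>The neighbour onto which \<open>x\<close> moves can neither stay nor move back, so it
  moves on in the same direction. The next site then cannot stay, because the neighbour moves onto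
  it, nor move back, because \<open>x\<close> has taken that place; so the hypothesis is reproduced
  one site further.\<close>

lemma Cfg_propagate:
	assumes ph: "ph \<in> Cfg" and x: "x \<in> Tor" and sgm: "sgm = 1 | sgm = -1" and e: "ph x = sgm" "ph (sh x sgm) ~= - sgm"
	shows "ph (sh x sgm) = sgm" "ph (sh x (2 * sgm)) = sgm"
proof -
	have val: "ph y \<in> {-1, 0, 1}" if "y \<in> Tor" for y using ph that by (simp add: Cfg_iff)
	have inj: "p = q" if "p \<in> Tor" "q \<in> Tor" "sh p (ph p) = sh q (ph q)" for p q
		using ph that unfolding Cfg_iff by blast
	have ne: "sh x sgm ~= x" "sh x (2 * sgm) ~= x" "sh x (2 * sgm) ~= sh x sgm"
		using sh_ne[OF x, of sgm 0] sh_ne[OF x, of "2 * sgm" 0] sh_ne[OF x, of "2 * sgm" sgm] sgm not_dvd_m x by auto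
	have t: "sh x sgm \<in> Tor" "sh x (2 * sgm) \<in> Tor" using x by auto
	have n0: "ph (sh x sgm) ~= 0"
	proof
		assume "ph (sh x sgm) = 0"
		hence "sh (sh x sgm) (ph (sh x sgm)) = sh x (ph x)" using x e by simp
		thus False using inj[OF t(1) x] ne by simp
	qed
	show 1: "ph (sh x sgm) = sgm" using val[OF t(1)] n0 e sgm by auto
	have "ph (sh x (2 * sgm)) ~= 0"
	proof
		assume "ph (sh x (2 * sgm)) = 0"
		hence "sh (sh x (2 * sgm)) (ph (sh x (2 * sgm))) = sh (sh x sgm) (ph (sh x sgm))" using x 1 by simp
		thus False using inj[OF t(2,1)] ne by simp
	qed
	moreover have "ph (sh x (2 * sgm)) ~= - sgm"
	proof
		assume "ph (sh x (2 * sgm)) = - sgm"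
		hence "sh (sh x (2 * sgm)) (ph (sh x (2 * sgm))) = sh x (ph x)" using x e by simp
		thus False using inj[OF t(2) x] ne by simp
	qed
	ultimately show "ph (sh x (2 * sgm)) = sgm" using val[OF t(2)] sgm by auto
qed

text \<open>A move that is not answered by the opposite move forces the next site to make an
  unanswered move as well, and this runs once around the column.\<close>

lemma Cfg_rotation:
	assumes ph: "ph \<in> Cfg" and x: "x \<in> Tor" and sgm: "sgm = 1 | sgm = -1" and e: "ph x = sgm" "ph (sh x sgm) ~= - sgm"
	shows "ph \<in> Rot"
proof -
	have step: "ph (sh x (int j * sgm)) = sgm & ph (sh x (int (Suc j) * sgm)) = sgm" for j
	proof (induction j)
		case 0
		thus ?case using Cfg_propagate(1)[OF assms] e x by simp
	next
		case (Suc j)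
		define y where "y = sh x (int j * sgm)"
		have y: "y \<in> Tor" using x by (simp add: y_def)
		have sy: "sh y sgm = sh x (int (Suc j) * sgm)" "sh y (2 * sgm) = sh x (int (Suc (Suc j)) * sgm)"
			by (simp_all add: y_def algebra_simps)
		have "ph y = sgm" "ph (sh y sgm) ~= - sgm" using Suc sgm unfolding sy by (auto simp: y_def)
		thus ?case using Cfg_propagate(2)[OF ph y sgm] Suc unfolding sy by simp
	qed
	have "ph v = sgm" if v: "v \<in> Tor" "fst v = fst x" for v
	proof -
		define j where "j = nat ((sgm * (snd v - snd x)) mod int m)"
		have m0: "0 < int m" using m_ge by simp
		have "int j = (sgm * (snd v - snd x)) mod int m" using m0 by (simp add: j_def)
		hence "(int j * sgm) mod int m = (sgm * sgm * (snd v - snd x)) mod int m"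
			by (metis mod_mult_left_eq mult.commute mult.assoc)
		moreover have "sgm * sgm = 1" using sgm by auto
		ultimately have "(snd x + int j * sgm) mod int m = (snd x + (snd v - snd x)) mod int m"
			by (metis mod_add_right_eq mult_1)
		hence "sh x (int j * sgm) = v" using v by (cases v) (auto simp: sh_def torus_def)
		thus ?thesis using step[of j] by simp
	qed
	hence "ph \<in> RotC (fst x) sgm" using ph by (simp add: RotC_def)
	moreover have "fst x \<in> {0..<int n}" using x by (auto simp: torus_def)
	ultimately show ?thesis using sgm unfolding Rot_def by blast
qed

lemma phi_Cfg: "D \<in> Om ==> phi D \<in> Cfg"
proof -
	assume D: "D \<in> Om"
	have "inj_on (Phi D) Tor" using Phi_permutes[OF D] by (meson permutes_inj inj_on_subset subset_UNIV)
	have "x = y" if "x \<in> Tor" "y \<in> Tor" "sh x (phi D x) = sh y (phi D y)" for x y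
	proof -
		have "Phi D x = Phi D y" using that by (simp add: Phi_eq mv_def)
		with \<open>inj_on (Phi D) Tor\<close> show ?thesis using that(1,2) by (rule inj_onD)
	qed
	moreover have "phi D x = 0" if "x ~: Tor" for x using that by (simp add: phi_def)
	moreover have "phi D x \<in> {-1, 0, 1}" for x using phi_cases[of D x] by blast
	ultimately show ?thesis unfolding Cfg_iff by blast
qed

lemma Cfg_not_Rot: "Cfg - Rot = phi ` Om" "inj_on phi Om"
proof -
	show "inj_on phi Om"
	proof (rule inj_onI)
		fix D D' assume D: "D \<in> Om" "D' \<in> Om" "phi D = phi D'"
		have "x \<in> D \<longleftrightarrow> x \<in> D'" for x using phi_1[OF D(1), of x] phi_1[OF D(2), of x] D(3) by simp
		thus "D = D'" by blast
	qed
	show "Cfg - Rot = phi ` Om"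
	proof (intro equalityI subsetI)
		fix ph assume "ph \<in> Cfg - Rot"
		hence ph: "ph \<in> Cfg" and nr: "ph ~: Rot" by auto
		have up: "ph (sh x 1) = -1" if "x \<in> Tor" "ph x = 1" for x
			using Cfg_rotation[OF ph that(1), of 1] that nr by auto
		have dn: "ph (sh x (-1)) = 1" if "x \<in> Tor" "ph x = -1" for x
			using Cfg_rotation[OF ph that(1), of "-1"] that nr by auto
		define D where "D = {x \<in> Tor. ph x = 1}"
		have D: "D \<in> Om" using up by (auto simp: Om_def D_def)
		have "ph x = phi D x" for x
		proof (cases "x \<in> Tor")
			case True
			hence "ph x \<in> {-1, 0, 1}" using ph by (simp add: Cfg_iff)
			then consider "ph x = 1" | "ph x = -1" | "ph x = 0" by auto
			thus ?thesis
			proof cases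
				case 1 thus ?thesis using True by (simp add: phi_def D_def)
			next
				case 2 thus ?thesis using True dn[OF True 2] by (simp add: phi_def D_def)
			next
				case 3
				have "ph (sh x (-1)) ~= 1" using up[of "sh x (-1)"] True 3 by auto
				thus ?thesis using True 3 by (simp add: phi_def D_def)
			qed
		next
			case False
			hence "ph x = 0" using ph unfolding Cfg_iff by blast
			thus ?thesis using False by (simp add: phi_def)
		qed
		hence "ph = phi D" by blast
		thus "ph \<in> phi ` Om" using D by blast
	next
		fix ph assume "ph \<in> phi ` Om"
		then obtain D where D: "D \<in> Om" "ph = phi D" by blast
		have "phi D ~: RotC c sgm" if c: "c \<in> {0..<int n}" and sgm: "sgm = 1 | sgm = -1" for c sgm
		proof
			assume "phi D \<in> RotC c sgm"
			hence r: "phi D x = sgm" if "x \<in> Tor" "fst x = c" for x using that by (simp add: RotC_def)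
			have x: "(c, 0) \<in> Tor" using c m_ge by (auto simp: torus_def)
			have "phi D (mv D (c, 0)) = - phi D (c, 0)" by (rule phi_mv[OF D(1) x])
			moreover have "mv D (c, 0) \<in> Tor" "fst (mv D (c, 0)) = c" using x by (auto simp: mv_def)
			ultimately show False using r[OF x] r[of "mv D (c, 0)"] sgm by auto
		qed
		hence "phi D ~: Rot" unfolding Rot_def by blast
		thus "ph \<in> Cfg - Rot" using phi_Cfg[OF D(1)] D(2) by blast
	qed
qed

lemma card_phi_nonzero:
	assumes D: "D \<in> Om" shows "card {x \<in> Tor. phi D x ~= 0} = 2 * card D"
proof -
	have DT: "D <= Tor" using D by (simp add: Om_def)
	have fD: "finite D" using DT finite_subset finite_torus by blast
	have "{x \<in> Tor. phi D x ~= 0} = D \<union> (%x. sh x 1) ` D"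
	proof (intro equalityI subsetI)
		fix x assume x: "x \<in> {x \<in> Tor. phi D x ~= 0}"
		hence "x \<in> D | sh x (-1) \<in> D" by (auto simp: phi_def split: if_splits)
		moreover have "x = sh (sh x (-1)) 1" using x by simp
		ultimately show "x \<in> D \<union> (%x. sh x 1) ` D" by blast
	next
		fix x assume x: "x \<in> D \<union> (%x. sh x 1) ` D"
		then consider "x \<in> D" | y where "y \<in> D" "x = sh y 1" by blast
		thus "x \<in> {x \<in> Tor. phi D x ~= 0}"
		proof cases
			case 1 thus ?thesis using DT by (auto simp: phi_def)
		next
			case 2
			hence "y \<in> Tor" using DT by blast
			hence "x \<in> Tor" "sh x (-1) \<in> D" using 2 by auto
			thus ?thesis by (auto simp: phi_def)
		qed
	qed
	moreover have "D \<inter> (%x. sh x 1) ` D = {}" using D by (auto simp: Om_def)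
	moreover have "card ((%x. sh x 1) ` D) = card D"
	proof (rule card_image, rule inj_onI)
		fix x y assume xy: "x \<in> D" "y \<in> D" "sh x 1 = sh y 1"
		hence "sh (sh x 1) (-1) = sh (sh y 1) (-1)" by simp
		moreover have "x \<in> Tor" "y \<in> Tor" using xy DT by auto
		ultimately show "x = y" by simp
	qed
	ultimately show ?thesis using fD by (simp add: card_Un_disjoint)
qed

lemma sum_wt_not_Rot:
	assumes z: "z = q\<^sup>2"
	shows "(SUM ph:Cfg - Rot. wt q ph * h ph) = Zt * Ex (%D. h (phi D))"
proof -
	have "(SUM ph:Cfg - Rot. wt q ph * h ph) = (SUM D:Om. wt q (phi D) * h (phi D))"
		unfolding Cfg_not_Rot(1) by (subst sum.reindex[OF Cfg_not_Rot(2)]) simp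
	also have "... = (SUM D:Om. z ^ card D * h (phi D))"
		by (rule sum.cong) (auto simp: wt_def card_phi_nonzero z power_mult)
	finally show ?thesis using Zt_pos by (simp add: Ex_def)
qed

end

section \<open>Rotated columns are negligible\<close>

lemma sum_Pow_power:
	fixes z :: real
	assumes "finite A" shows "(SUM S:Pow A. z ^ card S) = (1 + z) ^ card A"
	using prod_add[OF assms, of "%_. z" "%_. 1"] by (simp add: add.commute)

lemma sum_UN_le:
	fixes f :: "'b => real"
	assumes "finite I" "!!i. finite (A i)" "!!x. 0 <= f x"
	shows "(SUM x:(UN i:I. A i). f x) <= (SUM i:I. SUM x:A i. f x)"
	using assms(1)
proof induction
	case (insert i I)
	have "(SUM x:(UN i:insert i I. A i). f x) = (SUM x:A i \<union> (UN i:I. A i). f x)" by simp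
	also have "... <= (SUM x:A i. f x) + (SUM x:(UN i:I. A i). f x)"
		using insert assms by (simp add: sum_Un sum_nonneg)
	finally show ?case using insert by simp
qed simp

context hc begin

lemma Cfg_out: "ph \<in> Cfg ==> x ~: Tor ==> ph x = 0"
	unfolding Cfg_iff by blast

lemma Cfg_val: "ph \<in> Cfg ==> ph x \<in> {-1, 0, 1}"
	unfolding Cfg_iff by blast

text \<open>The exchanges of the sites \<open>2 * i\<close> and \<open>2 * i + 1\<close> do not
  overlap, so for indices below \<open>m div 2\<close> every set of them is admissible in one
  column.\<close>

definition evens :: "int => nat set => (int \<times> int) set" where
	"evens c S = (%i. (c, 2 * int i)) ` S"

definition glue :: "int => (int \<times> int => int) => nat set => int \<times> int => int" where
	"glue c ph S x = (if x \<in> Tor & fst x = c then phi (evens c S) x else ph x)"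

lemma evens_Om:
	assumes c: "c \<in> {0..<int n}" and S: "S <= {..<m div 2}"
	shows "evens c S \<in> Om"
proof -
	have lt: "2 * int i + 1 < int m" if "i \<in> S" for i
	proof -
		have "i < m div 2" using S that by auto
		hence "2 * i + 1 < m" by linarith
		thus ?thesis by linarith
	qed
	have "sh (c, 2 * int i) 1 = (c, 2 * int i + 1)" if "i \<in> S" for i
		using lt[OF that] by (simp add: sh_def)
	moreover have "(c, 2 * int i + 1) ~: evens c S" for i
		unfolding evens_def by (auto, presburger)
	moreover have "(c, 2 * int i) \<in> Tor" if "i \<in> S" for i using lt[OF that] c by (simp add: torus_def)
	ultimately show ?thesis unfolding Om_def evens_def by auto
qed

lemma fst_evens: "y \<in> evens c S ==> fst y = c"
	by (auto simp: evens_def)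

lemma phi_evens_0: "fst x ~= c ==> phi (evens c S) x = 0"
	using fst_evens[of x c S] fst_evens[of "sh x (-1)" c S] by (auto simp: phi_def)

lemma glue_Cfg:
	assumes c: "c \<in> {0..<int n}" and S: "S <= {..<m div 2}" and ph: "ph \<in> Cfg"
	shows "glue c ph S \<in> Cfg"
proof -
	note E = phi_Cfg[OF evens_Om[OF c S]]
	have inj: "x = y" if x: "x \<in> Tor" "y \<in> Tor" and e: "sh x (glue c ph S x) = sh y (glue c ph S y)" for x y
	proof -
		have f: "fst x = fst y" using arg_cong[OF e, of fst] by simp
		show ?thesis
		proof (cases "fst x = c")
			case True
			hence "sh x (phi (evens c S) x) = sh y (phi (evens c S) y)" using e f x by (simp add: glue_def)
			thus ?thesis using E x unfolding Cfg_iff by blast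
		next
			case False
			hence "sh x (ph x) = sh y (ph y)" using e f x by (simp add: glue_def)
			thus ?thesis using ph x unfolding Cfg_iff by blast
		qed
	qed
	have "glue c ph S x = 0" if "x ~: Tor" for x using Cfg_out[OF ph that] that by (simp add: glue_def)
	moreover have "glue c ph S x \<in> {-1, 0, 1}" if "x \<in> Tor" for x
		using Cfg_val[OF E, of x] Cfg_val[OF ph, of x] by (simp add: glue_def)
	ultimately show ?thesis using inj unfolding Cfg_iff by blast
qed

lemma wt_glue:
	assumes c: "c \<in> {0..<int n}" and S: "S <= {..<m div 2}" and ph: "ph \<in> RotC c sgm" and sgm: "sgm ~= 0" and z: "z = q\<^sup>2"
	shows "wt q ph * z ^ card S = q ^ m * wt q (glue c ph S)"
proof -
	define R where "R = {x \<in> Tor. fst x ~= c & ph x ~= 0}"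
	define Col where "Col = {x \<in> Tor. fst x = c}"
	define E where "E = {x \<in> Tor. phi (evens c S) x ~= 0}"
	have fin: "finite R" "finite Col" "finite E" by (auto simp: R_def Col_def E_def)
	have EC: "E <= Col" using phi_evens_0 by (auto simp: E_def Col_def)
	have dis: "R \<inter> Col = {}" "R \<inter> E = {}" using EC by (auto simp: R_def Col_def)
	have cC: "card Col = m"
	proof -
		have "Col = {c} \<times> {0..<int m}" using c by (auto simp: Col_def torus_def)
		thus ?thesis by (simp add: card_cartesian_product)
	qed
	have cE: "card E = 2 * card S"
	proof -
		have "card (evens c S) = card S" unfolding evens_def by (rule card_image) (auto simp: inj_on_def)
		thus ?thesis unfolding E_def using card_phi_nonzero[OF evens_Om[OF c S]] by simp
	qed
	have "{x \<in> Tor. ph x ~= 0} = R \<union> Col"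
	proof (rule set_eqI)
		fix x
		have "x \<in> Tor ==> fst x = c ==> ph x = sgm" using ph unfolding RotC_def by blast
		thus "x \<in> {x \<in> Tor. ph x ~= 0} \<longleftrightarrow> x \<in> R \<union> Col" using sgm unfolding R_def Col_def by blast
	qed
	hence 1: "card {x \<in> Tor. ph x ~= 0} = card R + m" using fin dis cC by (simp add: card_Un_disjoint)
	have "{x \<in> Tor. glue c ph S x ~= 0} = R \<union> E"
	proof (rule set_eqI)
		fix x
		show "x \<in> {x \<in> Tor. glue c ph S x ~= 0} \<longleftrightarrow> x \<in> R \<union> E"
			using phi_evens_0[of x c S] by (cases "fst x = c") (simp_all add: R_def E_def glue_def)
	qed
	hence 2: "card {x \<in> Tor. glue c ph S x ~= 0} = card R + 2 * card S" using fin dis cE by (simp add: card_Un_disjoint)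
	show ?thesis unfolding wt_def 1 2 z by (simp add: power_add power_mult[symmetric] mult_ac)
qed

lemma glue_inj:
	assumes c: "c \<in> {0..<int n}"
	shows "inj_on (%(ph, S). glue c ph S) (RotC c sgm \<times> Pow {..<m div 2})"
proof (rule inj_onI)
	fix p p' assume p: "p \<in> RotC c sgm \<times> Pow {..<m div 2}" "p' \<in> RotC c sgm \<times> Pow {..<m div 2}"
		and e: "(case p of (ph, S) => glue c ph S) = (case p' of (ph, S) => glue c ph S)"
	obtain ph S ph' S' where pp: "p = (ph, S)" "p' = (ph', S')" by (cases p, cases p')
	have S: "S <= {..<m div 2}" "S' <= {..<m div 2}" and ph: "ph \<in> RotC c sgm" "ph' \<in> RotC c sgm" using p pp by auto
	have g: "glue c ph S x = glue c ph' S' x" for x using e pp by simp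
	note O = evens_Om[OF c S(1)] evens_Om[OF c S(2)]
	have "ph x = ph' x" for x
	proof (cases "x \<in> Tor")
		case True
		show ?thesis
		proof (cases "fst x = c")
			case f: True
			have "ph x = sgm" "ph' x = sgm" using ph True f unfolding RotC_def by blast+
			thus ?thesis by simp
		next
			case False
			thus ?thesis using g[of x] by (simp add: glue_def)
		qed
	next
		case False
		thus ?thesis using g[of x] by (simp add: glue_def)
	qed
	moreover have "i \<in> S \<longleftrightarrow> i \<in> S'" if i: "i < m div 2" for i
	proof -
		have "2 * i < m" using i by linarith
		hence x: "(c, 2 * int i) \<in> Tor" using c by (simp add: torus_def)
		have "phi (evens c S) (c, 2 * int i) = phi (evens c S') (c, 2 * int i)" using g[of "(c, 2 * int i)"] x by (simp add: glue_def)
		hence "(c, 2 * int i) \<in> evens c S \<longleftrightarrow> (c, 2 * int i) \<in> evens c S'" using phi_1[OF O(1)] phi_1[OF O(2)] by metis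
		thus ?thesis by (auto simp: evens_def)
	qed
	ultimately show "p = p'" using S pp by auto
qed

text \<open>Replacing a rotated column of weight \<open>q ^ m\<close> by an arbitrary set of the
  \<open>m div 2\<close> disjoint exchanges is injective, and these sets have total weight
  \<open>(1 + z) ^ (m div 2)\<close>. As \<open>z = q\<^sup>2\<close>, the quotient is exponentially
  small in \<open>m\<close>.\<close>

lemma sum_wt_RotC:
	assumes c: "c \<in> {0..<int n}" and sgm: "sgm ~= 0" and z: "z = q\<^sup>2" and q: "q > 0"
	shows "(SUM ph:RotC c sgm. wt q ph) <= q ^ m / (1 + z) ^ (m div 2) * (SUM ph:Cfg. wt q ph)"
proof -
	have w0: "0 <= wt q ph" for ph using q by (simp add: wt_def)
	have fR: "finite (RotC c sgm)" unfolding RotC_def by (rule finite_subset[of _ Cfg]) auto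
	have "(SUM ph:RotC c sgm. wt q ph) * (1 + z) ^ (m div 2) = (SUM ph:RotC c sgm. SUM S:Pow {..<m div 2}. wt q ph * z ^ card S)"
		using sum_Pow_power[of "{..<m div 2}" z] by (simp add: sum_distrib_left[symmetric] sum_distrib_right)
	also have "... = (SUM ph:RotC c sgm. SUM S:Pow {..<m div 2}. q ^ m * wt q (glue c ph S))"
		by (intro sum.cong refl) (rule wt_glue[OF c _ _ sgm z], auto)
	also have "... = q ^ m * (SUM psi0:(%(ph, S). glue c ph S) ` (RotC c sgm \<times> Pow {..<m div 2}). wt q psi0)"
		by (subst sum.reindex[OF glue_inj[OF c]]) (simp add: sum.cartesian_product case_prod_beta sum_distrib_left)
	also have "... <= q ^ m * (SUM psi0:Cfg. wt q psi0)"
	proof (intro mult_left_mono sum_mono2)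
		show "(%(ph, S). glue c ph S) ` (RotC c sgm \<times> Pow {..<m div 2}) <= Cfg"
			using glue_Cfg[OF c] by (auto simp: RotC_def)
	qed (use q w0 in auto)
	finally show ?thesis using z_pos by (simp add: le_divide_eq)
qed

lemma sum_wt_Rot:
	assumes z: "z = q\<^sup>2" and q: "q > 0"
	shows "(SUM ph:Rot. wt q ph) <= 2 * real n * (q ^ m / (1 + z) ^ (m div 2)) * (SUM ph:Cfg. wt q ph)"
proof -
	have w0: "0 <= wt q ph" for ph using q by (simp add: wt_def)
	have fR: "finite (RotC c sgm)" for c sgm unfolding RotC_def by (rule finite_subset[of _ Cfg]) auto
	have "(SUM ph:Rot. wt q ph) <= (SUM c:{0..<int n}. SUM ph:RotC c 1 \<union> RotC c (-1). wt q ph)"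
		unfolding Rot_def by (rule sum_UN_le) (use fR w0 in auto)
	also have "... <= (SUM c:{0..<int n}. (SUM ph:RotC c 1. wt q ph) + (SUM ph:RotC c (-1). wt q ph))"
	proof (rule sum_mono)
		fix c
		show "(SUM ph:RotC c 1 \<union> RotC c (-1). wt q ph) <= (SUM ph:RotC c 1. wt q ph) + (SUM ph:RotC c (-1). wt q ph)"
			using sum.union_inter[OF fR[of c 1] fR[of c "-1"], of "wt q"] sum_nonneg[of "RotC c 1 \<inter> RotC c (-1)" "wt q"] w0 by simp
	qed
	also have "... <= (SUM c:{0..<int n}. q ^ m / (1 + z) ^ (m div 2) * (SUM ph:Cfg. wt q ph) + q ^ m / (1 + z) ^ (m div 2) * (SUM ph:Cfg. wt q ph))"
		by (intro sum_mono add_mono sum_wt_RotC[OF _ _ z q]) auto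
	also have "... = 2 * real n * (q ^ m / (1 + z) ^ (m div 2)) * (SUM ph:Cfg. wt q ph)" by simp
	finally show ?thesis .
qed

text \<open>The factor \<open>1 - 2 * a\<close> of every site and the probability of the
  conditioning event cancel between numerator and denominator.\<close>

lemma expectation_directed_permutation:
	assumes a: "0 < a" "a < 1 / 2"
	defines "q == a / (1 - 2 * a)"
	shows "measure_pmf.expectation (directed_permutation_pmf a n m) F = (SUM ph:Cfg. wt q ph * F (shift_map n m ph)) / (SUM ph:Cfg. wt q ph)"
proof -
	define Q where "Q = Pi_pmf Tor 0 (%_. step_pmf a)"
	define BB where "BB = {ph. bij_betw (shift_map n m ph) Tor Tor}"
	define b where "b = 1 - 2 * a"
	have b: "b > 0" using a by (simp add: b_def)
	have pre: "shift_map n m -` {\<pi>. bij_betw \<pi> Tor Tor} = BB" by (auto simp: BB_def)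
	have ne: "set_pmf Q \<inter> BB ~= {}"
		using bijection_possible[OF a, of n m] unfolding random_map_pmf_def Q_def[symmetric] pre[symmetric] by auto
	have dp: "directed_permutation_pmf a n m = map_pmf (shift_map n m) (cond_pmf Q BB)"
		unfolding directed_permutation_pmf_def random_map_pmf_def Q_def[symmetric]
		by (subst cond_map_pmf) (use ne in "simp_all only: pre not_False_eq_True")
	have "pmf_of_list_wf [(-1 :: int, a), (0, 1 - 2 * a), (1, a)]" using a by (intro pmf_of_list_wfI) auto
	from set_pmf_of_list[OF this] have st: "set_pmf (step_pmf a) <= {-1, 0, 1}" by (simp add: step_pmf_def)
	have sub: "set_pmf (cond_pmf Q BB) <= Cfg"
	proof
		fix ph assume "ph \<in> set_pmf (cond_pmf Q BB)"
		hence ph: "ph \<in> set_pmf Q" "ph \<in> BB" using set_cond_pmf[OF ne] by auto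
		hence "ph \<in> PiE_dflt Tor 0 (set_pmf \<circ> (%_. step_pmf a))"
			unfolding Q_def by (subst (asm) set_Pi_pmf) auto
		hence "ph \<in> PiE_dflt Tor 0 (%_. {-1, 0, 1})" using st unfolding PiE_dflt_def by auto
		thus "ph \<in> Cfg" using ph(2) unfolding Cfg_def BB_def by blast
	qed
	have pmfQ: "pmf (cond_pmf Q BB) ph = b ^ (n * m) * wt q ph / measure Q BB" if ph: "ph \<in> Cfg" for ph
	proof -
		have "ph \<in> BB" using ph unfolding Cfg_def BB_def by blast
		hence "pmf (cond_pmf Q BB) ph = pmf Q ph / measure Q BB" by (simp add: pmf_cond[OF ne])
		also have "pmf Q ph = (PROD x:Tor. pmf (step_pmf a) (ph x))"
			unfolding Q_def using Cfg_out[OF ph] by (intro pmf_Pi') auto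
		also have "... = (PROD x:Tor. b * (if ph x ~= 0 then q else 1))"
		proof (rule prod.cong)
			fix x assume "x \<in> Tor"
			hence "ph x \<in> {-1, 0, 1}" using ph unfolding Cfg_iff by blast
			thus "pmf (step_pmf a) (ph x) = b * (if ph x ~= 0 then q else 1)"
				using pmf_step_pmf[OF a] b by (auto simp: b_def q_def)
		qed simp
		also have "... = b ^ (n * m) * wt q ph"
			unfolding wt_def by (simp add: prod.distrib card_torus prod.inter_filter[symmetric])
		finally show ?thesis .
	qed
	define W where "W = (SUM ph:Cfg. wt q ph)"
	have "(SUM ph:Cfg. pmf (cond_pmf Q BB) ph) = 1" by (rule sum_pmf_eq_1[OF _ sub]) simp
	hence "b ^ (n * m) * W / measure Q BB = 1" unfolding W_def by (simp add: pmfQ sum_distrib_left sum_divide_distrib)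
	hence M: "measure Q BB = b ^ (n * m) * W" "measure Q BB ~= 0" by (auto simp: divide_eq_1_iff)
	have "measure_pmf.expectation (directed_permutation_pmf a n m) F = measure_pmf.expectation (cond_pmf Q BB) (%ph. F (shift_map n m ph))"
		unfolding dp by simp
	also have "... = (SUM ph:Cfg. F (shift_map n m ph) * pmf (cond_pmf Q BB) ph)"
		by (rule integral_measure_pmf_real) (use sub in auto)
	also have "... = (SUM ph:Cfg. F (shift_map n m ph) * (wt q ph / W))"
		by (rule sum.cong) (use M b in "auto simp: pmfQ")
	finally show ?thesis by (simp add: W_def sum_divide_distrib mult.commute)
qed

text \<open>Dropping a set of relative weight \<open>r\<close> changes the mean of a function
  bounded by \<open>B\<close> by at most \<open>2 * B * r\<close>.\<close>

lemma directed_permutation_hard_core: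
	assumes a: "0 < a" "a < 1 / 2" and z: "z = (a / (1 - 2 * a))\<^sup>2" and B: "!!\<pi>. \<bar>F \<pi>\<bar> <= B"
	shows "\<bar>measure_pmf.expectation (directed_permutation_pmf a n m) F - Ex (%D. F (Phi D))\<bar>
		<= 2 * B * (2 * real n * ((a / (1 - 2 * a)) ^ m / (1 + z) ^ (m div 2)))"
proof -
	define q where "q = a / (1 - 2 * a)"
	have q: "q > 0" using a by (simp add: q_def)
	have zq: "z = q\<^sup>2" by (simp add: z q_def)
	define W where "W = (SUM ph:Cfg. wt q ph)"
	define R where "R = (SUM ph:Rot. wt q ph)"
	define r where "r = 2 * real n * (q ^ m / (1 + z) ^ (m div 2))"
	define e where "e = Ex (%D. F (Phi D))"
	have w0: "0 <= wt q ph" for ph using q by (simp add: wt_def)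
	have RC: "Rot <= Cfg" by (auto simp: Rot_def RotC_def)
	have fR: "finite Rot" by (rule finite_subset[OF RC]) simp
	have R0: "0 <= R" unfolding R_def using w0 by (intro sum_nonneg) auto
	have Rr: "R <= r * W" unfolding R_def r_def W_def by (rule sum_wt_Rot[OF zq q])
	have WZ: "W - R = Zt"
		using sum_wt_not_Rot[OF zq, of "%_. 1"] sum_diff[OF finite_Cfg RC, of "wt q"] by (simp add: W_def R_def)
	hence Wp: "W > 0" using R0 Zt_pos by linarith
	have "\<bar>e\<bar> <= Ex (%D. \<bar>F (Phi D)\<bar>)" unfolding e_def by (rule Ex_abs)
	also have "... <= Ex (%_. B)" by (rule Ex_mono) (rule B)
	finally have eB: "\<bar>e\<bar> <= B" by simp
	define FR where "FR = (SUM ph:Rot. wt q ph * F (shift_map n m ph))"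
	have "(SUM ph:Cfg - Rot. wt q ph * F (shift_map n m ph)) = (W - R) * e"
		unfolding WZ e_def using sum_wt_not_Rot[OF zq, of "%ph. F (shift_map n m ph)"] by (simp add: Phi_def)
	hence split: "(SUM ph:Cfg. wt q ph * F (shift_map n m ph)) = (W - R) * e + FR"
		using sum.subset_diff[OF RC finite_Cfg, of "%ph. wt q ph * F (shift_map n m ph)"] by (simp add: FR_def)
	have "\<bar>FR\<bar> <= (SUM ph:Rot. wt q ph * B)" unfolding FR_def
		by (rule order_trans[OF sum_abs], rule sum_mono) (use w0 B in "auto simp: abs_mult intro: mult_left_mono")
	hence FRB: "\<bar>FR\<bar> <= R * B" by (simp add: R_def sum_distrib_right)
	have "measure_pmf.expectation (directed_permutation_pmf a n m) F - e = ((W - R) * e + FR) / W - e"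
		unfolding expectation_directed_permutation[OF a] q_def[symmetric] W_def[symmetric] split ..
	also have "... = (FR - R * e) / W" using Wp by (simp add: field_simps)
	finally have "\<bar>measure_pmf.expectation (directed_permutation_pmf a n m) F - e\<bar> = \<bar>FR - R * e\<bar> / W" using Wp by simp
	also have "... <= (2 * B * R) / W"
	proof (rule divide_right_mono)
		have "\<bar>R * e\<bar> <= R * B" unfolding abs_mult using R0 eB by (simp add: mult_left_mono)
		thus "\<bar>FR - R * e\<bar> <= 2 * B * R" using FRB abs_triangle_ineq4[of FR "R * e"] by (simp add: algebra_simps)
	qed (use Wp in simp)
	also have "... <= (2 * B * (r * W)) / W"
		using Rr eB Wp by (intro divide_right_mono mult_left_mono) auto
	also have "... = 2 * B * r" using Wp by simp
	finally show ?thesis by (simp add: e_def r_def q_def)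
qed

end

section \<open>Weak convergence\<close>

lemma rotation_limit:
	fixes q c :: real
	assumes q: "q > 0" and c: "c > 0"
	shows "(%m. 2 * real (m + excess c m) * (q ^ m / (1 + q\<^sup>2) ^ (m div 2))) \<longlonglongrightarrow> 0"
proof -
	define rh where "rh = q\<^sup>2 / (1 + q\<^sup>2)"
	have rh: "0 < rh" "rh < 1" using q by (auto simp: rh_def add_pos_pos)
	have "(%h. 4 * (2 * real h + 1) * (1 + q) * rh ^ h) \<longlonglongrightarrow> 0" using rh q by real_asymp
	moreover have "filterlim (%m::nat. m div 2) at_top at_top"
		by (rule filterlim_at_top_div_const_nat) simp
	ultimately have lim: "(%m. 4 * (2 * real (m div 2) + 1) * (1 + q) * rh ^ (m div 2)) \<longlonglongrightarrow> 0"
		by (rule filterlim_compose)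
	have le: "\<forall>\<^sub>F m in sequentially. real (excess c m) <= real m" unfolding excess_def using c by real_asymp
	show ?thesis
	proof (rule tendsto_sandwich[OF _ _ tendsto_const lim])
		show "\<forall>\<^sub>F m in sequentially. 0 <= 2 * real (m + excess c m) * (q ^ m / (1 + q\<^sup>2) ^ (m div 2))"
			using q by (intro always_eventually allI mult_nonneg_nonneg divide_nonneg_nonneg) auto
		show "\<forall>\<^sub>F m in sequentially. 2 * real (m + excess c m) * (q ^ m / (1 + q\<^sup>2) ^ (m div 2)) <= 4 * (2 * real (m div 2) + 1) * (1 + q) * rh ^ (m div 2)"
			using le
		proof eventually_elim
			case (elim m)
			have m: "m = 2 * (m div 2) + m mod 2" by simp
			have mm: "real m <= 2 * real (m div 2) + 1" by linarith
			have "q ^ m = (q\<^sup>2) ^ (m div 2) * q ^ (m mod 2)"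
				by (subst m) (simp only: power_add power_mult)
			\<comment> \<open>An odd \<open>m\<close> leaves one unpaired factor \<open>q\<close>.\<close>
			also have "q ^ (m mod 2) <= 1 + q" using q by (cases "m mod 2 = 0") (auto simp: not_mod_2_eq_0_eq_1)
			finally have "q ^ m <= (q\<^sup>2) ^ (m div 2) * (1 + q)" using q by (simp add: mult_left_mono)
			hence "q ^ m / (1 + q\<^sup>2) ^ (m div 2) <= (q\<^sup>2) ^ (m div 2) * (1 + q) / (1 + q\<^sup>2) ^ (m div 2)"
				using q by (intro divide_right_mono) auto
			also have "... = (1 + q) * rh ^ (m div 2)" by (simp add: rh_def power_divide)
			finally have 1: "q ^ m / (1 + q\<^sup>2) ^ (m div 2) <= (1 + q) * rh ^ (m div 2)" .
			have 2: "2 * real (m + excess c m) <= 4 * (2 * real (m div 2) + 1)" using elim mm by simp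
			have "2 * real (m + excess c m) * (q ^ m / (1 + q\<^sup>2) ^ (m div 2)) <= 4 * (2 * real (m div 2) + 1) * ((1 + q) * rh ^ (m div 2))"
				by (rule mult_mono[OF 2 1]) (use q in auto)
			thus ?case by (simp add: mult.assoc)
		qed
	qed
qed

abbreviation cs_mean :: "real => real => nat => ((nat => real) => real) => real" where
	"cs_mean a c m g == measure_pmf.expectation (directed_permutation_pmf a (m + excess c m) m) (%\<pi>. g (cycle_structure (torus (m + excess c m) m) \<pi>))"

lemma directed_permutation_limit:
	fixes g :: "(nat => real) => real"
	assumes a: "0 < a" "a < 1 / 2" and c: "c >= 200" and g: "continuous_on Delta g" and B: "!!y. \<bar>g y\<bar> <= B" and L: "0 <= L"
		and lip: "!!y y' d. y \<in> Delta ==> y' \<in> Delta ==> (!!j. \<bar>y j - y' j\<bar> <= d) ==> \<bar>g y - g y'\<bar> <= L * d"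
	shows "(%m. cs_mean a c m g) \<longlonglongrightarrow> integral\<^sup>L PD1 g"
proof -
	define n where "n = (%m. m + excess c m)"
	define q where "q = a / (1 - 2 * a)"
	have q: "q > 0" using a by (simp add: q_def)
	have z: "q\<^sup>2 > 0" using q by simp
	define E where "E = (%m. measure_pmf.expectation (directed_permutation_pmf a (n m) m) (%\<pi>. g (cycle_structure (torus (n m) m) \<pi>)))"
	define X where "X = (%m. hc.Ex (n m) m (q\<^sup>2) (%D. g (cycle_structure (torus (n m) m) (hc.Phi (n m) m D))))"
	have X: "X \<longlonglongrightarrow> integral\<^sup>L PD1 g" unfolding X_def n_def by (rule hard_core_limit[OF z c g B L]) (rule lip)
	have "(%m. 2 * B * (2 * real (n m) * (q ^ m / (1 + q\<^sup>2) ^ (m div 2)))) \<longlonglongrightarrow> 2 * B * 0"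
		unfolding n_def by (intro tendsto_mult_left rotation_limit q) (use c in simp)
	hence "(%m. 2 * B * (2 * real (n m) * (q ^ m / (1 + q\<^sup>2) ^ (m div 2)))) \<longlonglongrightarrow> 0" by simp
	moreover have "\<forall>\<^sub>F m in sequentially. norm (E m - X m) <= 2 * B * (2 * real (n m) * (q ^ m / (1 + q\<^sup>2) ^ (m div 2)))"
		using eventually_ge_at_top[of 3]
	proof eventually_elim
		case (elim m)
		interpret hc "n m" m "q\<^sup>2" by unfold_locales (use elim z in "auto simp: n_def")
		have "q\<^sup>2 = (a / (1 - 2 * a))\<^sup>2" by (simp add: q_def)
		from directed_permutation_hard_core[OF a this, where B=B and F="%\<pi>. g (cycle_structure (torus (n m) m) \<pi>)"]
		show ?case unfolding E_def X_def real_norm_def q_def[symmetric] using B by simp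
	qed
	ultimately have "(%m. E m - X m) \<longlonglongrightarrow> 0" by (rule Lim_null_comparison[rotated])
	from tendsto_add[OF this X] show ?thesis by (simp add: E_def n_def)
qed

section \<open>Lipschitz approximation from below\<close>

definition supd :: "(nat => real) => (nat => real) => real" where
	"supd x y = (SUP i. \<bar>x i - y i\<bar>)"

lemma supd_nonneg: "x \<in> Delta ==> y \<in> Delta ==> 0 <= supd x y"
	unfolding supd_def by (rule cSUP_upper2[OF bdd_above_Delta_diff, of _ _ 0]) auto

lemma supd_self [simp]: "supd x x = 0"
	by (simp add: supd_def)

lemma le_supd: "x \<in> Delta ==> y \<in> Delta ==> \<bar>x i - y i\<bar> <= supd x y"
	unfolding supd_def by (rule cSUP_upper[OF _ bdd_above_Delta_diff]) auto

lemma supd_triangle: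
	assumes "x \<in> Delta" "x' \<in> Delta" "y \<in> Delta" "!!j. \<bar>x j - x' j\<bar> <= d"
	shows "supd x' y <= supd x y + d"
	unfolding supd_def[of x']
proof (rule cSUP_least)
	fix i
	show "\<bar>x' i - y i\<bar> <= supd x y + d" using le_supd[OF assms(1,3), of i] assms(4)[of i] by linarith
qed simp

text \<open>For bounded \<open>f\<close> this is on \<open>Delta\<close> the largest minorant of
  \<open>f\<close> that is Lipschitz with constant \<open>N\<close> in the sup norm.
  \<open>Delta\<close> is not compact, so a bounded continuous function need not be uniformly
  continuous, while the sampling argument requires a Lipschitz function. The value 0 elsewhere keeps
  the bound global.\<close>

definition infconv :: "nat => ((nat => real) => real) => (nat => real) => real" where
	"infconv N f x = (if x \<in> Delta then INF y\<in>Delta. f y + real N * supd x y else 0)"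

lemma infconv_bdd:
	assumes B: "!!y. \<bar>f y\<bar> <= B" and x: "x \<in> Delta"
	shows "bdd_below ((%y. f y + real N * supd x y) ` Delta)"
proof (rule bdd_belowI2)
	fix y assume "y \<in> Delta"
	hence "0 <= real N * supd x y" using supd_nonneg[OF x] by simp
	thus "- B <= f y + real N * supd x y" using B[of y] by linarith
qed

lemma infconv_bounds:
	assumes B: "!!y. \<bar>f y\<bar> <= B" and f0: "!!y. y ~: Delta ==> f y = 0"
	shows "infconv N f x <= f x" "\<bar>infconv N f x\<bar> <= B"
proof -
	show le: "infconv N f x <= f x"
	proof (cases "x \<in> Delta")
		case True
		thus ?thesis unfolding infconv_def using cINF_lower[OF infconv_bdd[where f=f and N=N, OF B True] True] by simp
	qed (simp add: infconv_def f0)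
	show "\<bar>infconv N f x\<bar> <= B"
	proof (cases "x \<in> Delta")
		case True
		have "- B <= (INF y\<in>Delta. f y + real N * supd x y)"
		proof (rule cINF_greatest)
			fix y assume "y \<in> Delta"
			hence "0 <= real N * supd x y" using supd_nonneg[OF True] by simp
			thus "- B <= f y + real N * supd x y" using B[of y] by linarith
		qed (use True in auto)
		thus ?thesis using le B[of x] True by (simp add: infconv_def abs_le_iff)
	next
		case False
		thus ?thesis using B[of x] by (simp add: infconv_def)
	qed
qed

lemma infconv_le:
	assumes B: "!!y. \<bar>f y\<bar> <= B" and x: "x \<in> Delta" "x' \<in> Delta" "!!j. \<bar>x j - x' j\<bar> <= d"
	shows "infconv N f x' <= infconv N f x + real N * d"
proof -
	have "infconv N f x' - real N * d <= (INF y\<in>Delta. f y + real N * supd x y)"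
	proof (rule cINF_greatest)
		fix y assume y: "y \<in> Delta"
		have "infconv N f x' <= f y + real N * supd x' y"
			unfolding infconv_def using x cINF_lower[OF infconv_bdd[where f=f and N=N, OF B x(2)] y] by simp
		also have "... <= f y + real N * (supd x y + d)"
			by (intro add_left_mono mult_left_mono supd_triangle[OF x(1,2) y x(3)]) simp
		finally show "infconv N f x' - real N * d <= f y + real N * supd x y" by (simp add: algebra_simps)
	qed (use x in auto)
	thus ?thesis using x by (simp add: infconv_def)
qed

lemma infconv_lipschitz:
	assumes B: "!!y. \<bar>f y\<bar> <= B" and x: "x \<in> Delta" "x' \<in> Delta" "!!j. \<bar>x j - x' j\<bar> <= d"
	shows "\<bar>infconv N f x - infconv N f x'\<bar> <= real N * d"
proof -
	have "infconv N f x' <= infconv N f x + real N * d" by (rule infconv_le[where f=f and N=N, OF B x])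
	moreover have "infconv N f x <= infconv N f x' + real N * d"
		by (rule infconv_le[where f=f and N=N, OF B x(2,1)]) (subst abs_minus_commute, rule x(3))
	ultimately show ?thesis by (simp add: abs_le_iff)
qed

lemma lipschitz_continuous_Delta:
	fixes g :: "(nat => real) => real"
	assumes L: "0 <= L" and lip: "!!y y' d. y \<in> Delta ==> y' \<in> Delta ==> (!!j. \<bar>y j - y' j\<bar> <= d) ==> \<bar>g y - g y'\<bar> <= L * d"
	shows "continuous_on Delta g"
proof -
	have "openin (top_of_set Delta) (Delta \<inter> g -` U)" if U: "open U" for U
		unfolding openin_Delta_iff_sup_norm
	proof (intro conjI ballI)
		fix x assume x: "x \<in> Delta \<inter> g -` U"
		then obtain e where e: "e > 0" "!!t. \<bar>t - g x\<bar> < e ==> t \<in> U" using U unfolding open_real by auto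
		show "EX r>0. ALL y:Delta. (SUP i. \<bar>x i - y i\<bar>) < r --> y \<in> Delta \<inter> g -` U"
		proof (intro exI[of _ "e / (L + 1)"] conjI ballI impI)
			show "0 < e / (L + 1)" using e L by simp
			fix y assume y: "y \<in> Delta" and lt: "(SUP i. \<bar>x i - y i\<bar>) < e / (L + 1)"
			have xD: "x \<in> Delta" using x by simp
			have "\<bar>g x - g y\<bar> <= L * supd x y" by (rule lip[OF xD y]) (rule le_supd[OF xD y])
			also have "... <= L * (e / (L + 1))" using lt L by (intro mult_left_mono) (auto simp: supd_def)
			also have "... < e" using e L by (simp add: field_simps)
			finally have "\<bar>g y - g x\<bar> < e" by (simp add: abs_minus_commute)
			thus "y \<in> Delta \<inter> g -` U" using e(2) y by simp
		qed
	qed auto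
	thus ?thesis unfolding continuous_on_open_invariant openin_open by (metis inf_commute)
qed

lemma infconv_tendsto:
	assumes f: "continuous_on Delta f" and B: "!!y. \<bar>f y\<bar> <= B" and x: "x \<in> Delta"
	shows "(%N. infconv N f x) \<longlonglongrightarrow> f x"
proof (rule LIMSEQ_I)
	fix e :: real assume e: "0 < e"
	have "openin (top_of_set Delta) (Delta \<inter> f -` {f x - e / 2<..})"
		by (rule continuous_openin_preimage_gen[OF f]) simp
	moreover have "x \<in> Delta \<inter> f -` {f x - e / 2<..}" using x e by simp
	ultimately obtain r where r: "r > 0" "!!y. y \<in> Delta ==> supd x y < r ==> f x - e / 2 < f y"
		unfolding openin_Delta_iff_sup_norm supd_def[symmetric] by fastforce
	\<comment> \<open>Beyond distance \<open>r\<close> the penalty is then at least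
	  \<open>2 * B\<close>, the largest possible variation of \<open>f\<close>.\<close>
	obtain N0 :: nat where N0: "2 * B / r < real N0" using reals_Archimedean2 by blast
	show "EX N0. ALL N>=N0. norm (infconv N f x - f x) < e"
	proof (intro exI[of _ N0] allI impI)
		fix N assume N: "N0 <= N"
		have "f x - e / 2 <= (INF y\<in>Delta. f y + real N * supd x y)"
		proof (rule cINF_greatest)
			fix y assume y: "y \<in> Delta"
			have d0: "0 <= supd x y" by (rule supd_nonneg[OF x y])
			show "f x - e / 2 <= f y + real N * supd x y"
			proof (cases "supd x y < r")
				case True
				have "0 <= real N * supd x y" using d0 by simp
				thus ?thesis using r(2)[OF y True] by linarith
			next
				case False
				have "2 * B <= real N0 * r" using N0 r by (simp add: divide_less_eq)
				also have "... <= real N * supd x y" using N False r by (intro mult_mono) auto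
				finally show ?thesis using B[of x] B[of y] e by linarith
			qed
		qed (use x in auto)
		moreover have "infconv N f x <= f x"
			unfolding infconv_def using x cINF_lower[OF infconv_bdd[where f=f and N=N, OF B x] x] by simp
		ultimately show "norm (infconv N f x - f x) < e" using x e by (simp add: infconv_def)
	qed
qed

text \<open>Since \<open>infconv N f <= f\<close>, convergence for the Lipschitz minorants yields a
  lower bound for the means of \<open>f\<close>. Applied to \<open>f\<close> and to its negative it
  gives the limit.\<close>

lemma expectation_lower:
	fixes f :: "(nat => real) => real"
	assumes a: "0 < a" "a < 1 / 2" and c: "c >= 200" and f: "continuous_on Delta f" and B: "!!y. \<bar>f y\<bar> <= B"
		and f0: "!!y. y ~: Delta ==> f y = 0" and e: "0 < e"
	shows "\<forall>\<^sub>F m in sequentially. integral\<^sup>L PD1 f - e <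
		cs_mean a c m f"
proof -
	obtain g where gm: "g \<in> measurable unifs (restrict_space borel Delta)" and gD: "!!u. g u \<in> Delta"
		and "!!u. good_stick u ==> g u = decreasing_rearrangement (stick_breaking u)"
		and PD1: "PD1 = distr unifs (restrict_space borel Delta) g"
		using PD1_distr by blast
	have lipN: "\<bar>infconv N f y - infconv N f y'\<bar> <= real N * d"
		if "y \<in> Delta" "y' \<in> Delta" "!!j. \<bar>y j - y' j\<bar> <= d" for N y y' d
		by (rule infconv_lipschitz[where f=f, OF B that(1,2)]) (rule that(3))
	have cN: "continuous_on Delta (infconv N f)" for N
		by (rule lipschitz_continuous_Delta[of "real N"]) (simp, rule lipN)
	have PDi: "integral\<^sup>L PD1 h = (\<integral>u. h (g u) \<partial>unifs)" "(%u. h (g u)) \<in> borel_measurable unifs" if "continuous_on Delta h" for h :: "(nat => real) => real"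
	proof -
		have hm: "h \<in> borel_measurable (restrict_space borel Delta)" by (rule borel_measurable_continuous_on_restrict[OF that])
		show "integral\<^sup>L PD1 h = (\<integral>u. h (g u) \<partial>unifs)" unfolding PD1 by (rule integral_distr[OF gm hm])
		show "(%u. h (g u)) \<in> borel_measurable unifs" by (rule measurable_compose[OF gm hm])
	qed
	have "(%N. integral\<^sup>L PD1 (infconv N f)) \<longlonglongrightarrow> integral\<^sup>L PD1 f"
		unfolding PDi(1)[OF cN] PDi(1)[OF f]
	proof (rule integral_dominated_convergence[where w="%_. B"])
		show "AE u in unifs. (%N. infconv N f (g u)) \<longlonglongrightarrow> f (g u)"
			by (intro AE_I2 infconv_tendsto[where f=f, OF f B gD])
		show "AE u in unifs. norm (infconv N f (g u)) <= B" for N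
			unfolding real_norm_def by (intro AE_I2 infconv_bounds(2)[where f=f, OF B f0])
		show "integrable unifs (%_. B)" by simp
	qed (rule PDi(2)[OF f] PDi(2)[OF cN])+
	hence "\<forall>\<^sub>F N in sequentially. integral\<^sup>L PD1 f - e / 2 < integral\<^sup>L PD1 (infconv N f)"
		using e by (intro order_tendstoD(1)) auto
	then obtain N where N: "integral\<^sup>L PD1 f - e / 2 < integral\<^sup>L PD1 (infconv N f)" by (auto simp: eventually_sequentially)
	have "(%m. cs_mean a c m (infconv N f)) \<longlonglongrightarrow> integral\<^sup>L PD1 (infconv N f)"
		by (rule directed_permutation_limit[OF a c, where B=B and L="real N"])
			(rule cN infconv_bounds(2)[where f=f, OF B f0] of_nat_0_le_iff lipN | assumption)+
	hence "\<forall>\<^sub>F m in sequentially. integral\<^sup>L PD1 (infconv N f) - e / 2 < cs_mean a c m (infconv N f)"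
		using e by (intro order_tendstoD(1)) auto
	thus ?thesis
	proof eventually_elim
		case (elim m)
		have "cs_mean a c m (infconv N f)
			<= cs_mean a c m f"
		proof (rule integral_mono)
			show "integrable (measure_pmf (directed_permutation_pmf a (m + excess c m) m)) (%\<pi>. infconv N f (cycle_structure (torus (m + excess c m) m) \<pi>))"
				by (rule measure_pmf.integrable_const_bound[where B=B]) (simp_all add: infconv_bounds(2)[where f=f, OF B f0])
			show "integrable (measure_pmf (directed_permutation_pmf a (m + excess c m) m)) (%\<pi>. f (cycle_structure (torus (m + excess c m) m) \<pi>))"
				by (rule measure_pmf.integrable_const_bound[where B=B]) (simp_all add: B)
		qed (rule infconv_bounds(1)[where f=f, OF B f0])
		thus ?case using elim N by linarith
	qed
qed

text \<open>Off the bijections \<open>cycle_structure\<close> may leave \<open>Delta\<close>;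
  replacing its value there by that at \<open>id\<close> changes nothing almost surely and provides
  a measurable map into the restricted space.\<close>

lemma integral_cycle_structure_law:
	fixes f :: "(nat => real) => real"
	assumes a: "0 < a" "a < 1 / 2" and nm: "0 < n" "0 < m" and f: "continuous_on Delta f"
	shows "integral\<^sup>L (cycle_structure_law a n m) f = measure_pmf.expectation (directed_permutation_pmf a n m) (%\<pi>. f (cycle_structure (torus n m) \<pi>))"
proof -
	define S where "S = torus n m"
	have S: "finite S" "S ~= {}" using nm by (auto simp: S_def torus_def)
	define M where "M = measure_pmf (directed_permutation_pmf a n m)"
	define ok where "ok = (%\<pi>. bij_betw \<pi> S S & (ALL x. x ~: S --> \<pi> x = x))"
	define h where "h = (%\<pi>. if ok \<pi> then cycle_structure S \<pi> else cycle_structure S id)"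
	have hD: "h \<pi> \<in> Delta" for \<pi>
		using cycle_structure_in_Delta[OF S, of \<pi>] cycle_structure_in_Delta[OF S, of id] by (auto simp: h_def ok_def)
	have hm: "h \<in> measurable M (restrict_space borel Delta)"
		using hD by (auto simp: M_def measurable_def space_restrict_space)
	have sub: "set_pmf (directed_permutation_pmf a n m) <= {\<pi>. ok \<pi>}"
	proof
		fix \<pi> assume "\<pi> \<in> set_pmf (directed_permutation_pmf a n m)"
		hence "\<pi> \<in> set_pmf (random_map_pmf a n m)" "bij_betw \<pi> S S"
			unfolding directed_permutation_pmf_def set_cond_pmf[OF bijection_possible[OF a]] S_def by auto
		thus "\<pi> \<in> {\<pi>. ok \<pi>}" by (auto simp: ok_def random_map_pmf_def shift_map_def S_def)
	qed
	have ae: "AE \<pi> in M. cycle_structure S \<pi> = h \<pi>"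
		unfolding M_def using sub by (auto simp: AE_measure_pmf_iff h_def)
	have "cycle_structure_law a n m = distr M (restrict_space borel Delta) h"
		unfolding cycle_structure_law_def M_def[symmetric] S_def[symmetric]
		by (rule distr_AE_cong[OF hm _ Delta_borel ae]) (simp add: M_def)
	hence "integral\<^sup>L (cycle_structure_law a n m) f = (\<integral>\<pi>. f (h \<pi>) \<partial>M)"
		using integral_distr[OF hm borel_measurable_continuous_on_restrict[OF f]] by simp
	also have "... = (\<integral>\<pi>. f (cycle_structure S \<pi>) \<partial>M)"
		by (rule integral_cong_AE) (use ae in "auto simp: M_def")
	finally show ?thesis by (simp add: M_def S_def)
qed

theorem theorem1p2:
	shows "\<exists>C0::real. C0 > 0 \<and> (\<forall>C'\<ge>C0. \<forall>a::real. 0 < a \<and> a < 1/2 \<longrightarrow>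
						weak_conv_on Delta (\<lambda>m. cycle_structure_law a (m + excess C' m) m) PD1)"
\<comment> \<open>The constant is the one that the union bound for \<open>Good\<close> in
  \<open>swap_limit\<close> requires.\<close>
proof (intro exI[of _ 200] conjI allI impI)
	show "(200::real) > 0" by simp
	fix c a :: real
	assume c: "c >= 200" and "0 < a & a < 1/2"
	hence a: "0 < a" "a < 1 / 2" by auto
	show "weak_conv_on Delta (%m. cycle_structure_law a (m + excess c m) m) PD1"
		unfolding weak_conv_on_def
	proof (intro allI impI)
		fix f :: "(nat => real) => real"
		assume fb: "continuous_on Delta f & bounded (f ` Delta)"
		\<comment> \<open>The values of \<open>f\<close> outside \<open>Delta\<close> are arbitrary;
		  cutting them off gives a bound on the whole space and leaves the integrals unchanged.\<close>
		define f1 where "f1 = (%y. if y \<in> Delta then f y else 0)"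
		have f1: "continuous_on Delta f1" using fb by (subst continuous_on_cong[where g=f]) (auto simp: f1_def)
		obtain B where B: "!!y. y \<in> Delta ==> \<bar>f y\<bar> <= B" using fb by (auto simp: bounded_iff)
		have B1: "\<bar>f1 y\<bar> <= \<bar>B\<bar>" for y using B[of y] by (auto simp: f1_def)
		define E where "E = (%m. cs_mean a c m f1)"
		have "E \<longlonglongrightarrow> integral\<^sup>L PD1 f1"
		proof (rule tendstoI)
			fix e :: real assume e: "0 < e"
			have "\<forall>\<^sub>F m in sequentially. integral\<^sup>L PD1 f1 - e < E m"
				unfolding E_def by (rule expectation_lower[OF a c f1 B1 _ e]) (simp add: f1_def)
			moreover have "\<forall>\<^sub>F m in sequentially. integral\<^sup>L PD1 (%y. - f1 y) - e < cs_mean a c m (%y. - f1 y)"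
				by (rule expectation_lower[OF a c continuous_on_minus[OF f1] _ _ e, where B="\<bar>B\<bar>"]) (use B1 in "auto simp: f1_def")
			ultimately show "\<forall>\<^sub>F m in sequentially. dist (E m) (integral\<^sup>L PD1 f1) < e"
				by eventually_elim (simp add: E_def dist_real_def abs_less_iff)
		qed
		moreover have "\<forall>\<^sub>F m in sequentially. E m = integral\<^sup>L (cycle_structure_law a (m + excess c m) m) f"
			using eventually_gt_at_top[of 0]
		proof eventually_elim
			case (elim m)
			have "integral\<^sup>L (cycle_structure_law a (m + excess c m) m) f = integral\<^sup>L (cycle_structure_law a (m + excess c m) m) f1"
				by (rule Bochner_Integration.integral_cong) (auto simp: cycle_structure_law_def f1_def space_restrict_space)
			also have "... = E m" unfolding E_def by (rule integral_cycle_structure_law[OF a _ elim f1]) (use elim in simp)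
			finally show ?case by simp
		qed
		ultimately have "(%m. integral\<^sup>L (cycle_structure_law a (m + excess c m) m) f) \<longlonglongrightarrow> integral\<^sup>L PD1 f1"
			by (rule Lim_transform_eventually)
		moreover have "integral\<^sup>L PD1 f1 = integral\<^sup>L PD1 f"
			by (rule Bochner_Integration.integral_cong) (auto simp: PD1_def f1_def space_restrict_space)
		ultimately show "(%m. integral\<^sup>L (cycle_structure_law a (m + excess c m) m) f) \<longlonglongrightarrow> integral\<^sup>L PD1 f" by simp
	qed
qed

end
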